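(* Let $\alpha=(\alpha_{r,m}:C([-r,r]^m)\to[0,\infty])_{r>0,\,m\in\mathbb N}$ be a family of possibly infinite norms. Suppose $u\le\alpha\le\beta$ (where $u$ is the uniform family and $\beta$ the Varopoulos family) and $\alpha$ is increasing, complete, and translation invariant. Let $k\in\mathbb N_0\cup\{\infty\}$. (i) $\mathbf C_\alpha^k(\mathbb R)=C_\alpha^k(\mathbb R)$, i.e., polynomials are dense in $\mathbf C_\alpha^k(\mathbb R)$; actually (for $k<\infty$), $C_\alpha^k(\mathbb R)=\{f\in C^k(\mathbb R):f^{[k]}\in C_\alpha(\mathbb R^{k+1})\}$. In particular, if, in addition, $\mathcal C_\alpha(\mathbb R^m)=C_\alpha(\mathbb R^m)$ for all $m\in\mathbb N$, then $\mathcal C_\alpha^k(\mathbb R)=C_\alpha^k(\mathbb R)$, i.e., polynomials are dense in $\mathcal C_\alpha^k(\mathbb R)$. (ii) $W_k(\mathbb R)\subseteq\mathbf C_\alpha^k(\mathbb R)$, and $W_k(\mathbb R)$ is dense in $\mathbf C_\alpha^k(\mathbb R)$.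
   Context: A possibly infinite norm on a complex vector space $V$ is a function $\eta:V\to[0,\infty]$ with $\eta(cv)=|c|\eta(v)$ ($0\cdot\infty=0$), $\eta(v+w)\le\eta(v)+\eta(w)$, $\eta(v)=0$ iff $v=0$; $V_\eta:=\{\eta<\infty\}$. $C(X)$ denotes complex-valued continuous functions. Write $\alpha_{r,m}(\varphi):=\alpha_{r,m}(\varphi|_{[-r,r]^m})$ when the domain of $\varphi$ contains $[-r,r]^m$. For families, $\alpha^1\le\alpha^2$ means $\alpha^1_{r,m}\le\alpha^2_{r,m}$ for all $r,m$. $u_{r,m}(\varphi):=\sup_{[-r,r]^m}|\varphi|$. $\beta_{r,m}(\varphi)$ is the infimum of $\sum_{n=1}^\infty\prod_{i=1}^m\|\varphi_{i,n}\|_{\ell^\infty([-r,r])}$ over sequences $(\varphi_{i,n})_n$ in $C([-r,r])$, $i=1,\ldots,m$, for which this sum is finite and $\varphi(\boldsymbol\lambda)=\sum_n\varphi_{1,n}(\lambda_1)\cdots\varphi_{m,n}(\lambda_m)$ on $[-r,r]^m$ ($\infty$ if none exist). $\alpha$ is: complete if each $(C([-r,r]^m)_{\alpha_{r,m}},\alpha_{r,m})$ is a Banach space; increasing if $\alpha_{s,m}(\varphi|_{[-s,s]^m})\le\alpha_{r,m}(\varphi)$ for $0<s\le r$, $\varphi\in C([-r,r]^m)$; translation invariant if $\alpha_{r,m}(\varphi(\cdot+\boldsymbol\mu)|_{[-r,r]^m})\le\alpha_{r+|\boldsymbol\mu|_\infty,m}(\varphi)$ for all $r>0$, $m\in\mathbb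 N$, $\boldsymbol\mu\in\mathbb R^m$, $\varphi\in C([-|\boldsymbol\mu|_\infty-r,r+|\boldsymbol\mu|_\infty]^m)$, where $|\boldsymbol\mu|_\infty=\max_i|\mu_i|$. $\mathcal C_\alpha(\mathbb R^m):=\{\varphi\in C(\mathbb R^m):\alpha_{r,m}(\varphi)<\infty\ \forall r>0\}$ with the topology generated by the seminorms $\alpha_{r,m}$, $r>0$; it contains the $m$-variate complex polynomials (since $\alpha\le\beta$), and $C_\alpha(\mathbb R^m)$ is the closure of the polynomials in it. Divided differences: $f^{[0]}:=f$ and, for distinct reals, $f^{[i]}(s_1,\ldots,s_{i+1}):=\frac{f^{[i-1]}(s_1,\ldots,s_i)-f^{[i-1]}(s_1,\ldots,s_{i-1},s_{i+1})}{s_i-s_{i+1}}$, extended continuously to $\mathbb R^{i+1}$ when $f\in C^i(\mathbb R)$. $\mathcal C_\alpha^k(\mathbb R):=\{f\in C^k(\mathbb R):f^{[i]}\in\mathcal C_\alpha(\mathbb R^{i+1})\text{ whenever }0\le i<k+1\}$ with the topology generated by the seminorms $f\mapsto\alpha_{r,i+1}(f^{[i]})$ ($r>0$, $0\le i<k+1$). $C_\alpha^k(\mathbb R)$ is the closure of $\mathbb C[\lambda]$ in $\mathcal C_\alpha^k(\mathbb R)$. $\mathbf C_\alpha^k(\mathbb R):=\{f\in C^k(\mathbb R):f^{[i]}\in C_\alpha(\mathbb R^{i+1})\text{ whenever }0\le i<k+1\}$, with the subspace topology from $\mathcal C_\alpha^k(\mathbb R)$. Wiener space: for $k\in\mathbb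 N_0$, $W_k(\mathbb R)$ is the set of $f:\mathbb R\to\mathbb C$ for which there is a Borel complex measure $\mu$ on $\mathbb R$ with $\int_{\mathbb R}|\xi|^k\,|\mu|(d\xi)<\infty$ and $f(\lambda)=\int_{\mathbb R}e^{i\lambda\xi}\,\mu(d\xi)$ for all $\lambda\in\mathbb R$; $W_\infty(\mathbb R):=\bigcap_{k\in\mathbb N}W_k(\mathbb R)$. *)

theory Defs
  imports "HOL-Analysis.Analysis" "HOL-Library.Extended_Nat"
begin

section \<open>Function spaces over subsets of \<open>\<real>\<^sup>m\<close>\<close>

text \<open>
  Since the dimension \<open>m\<close> varies inside the statement, \<open>\<real>\<^sup>m\<close> is the library's
  \<^const>\<open>Euclidean_space\<close> \<open>m\<close>: the sequences \<open>x :: nat \<Rightarrow> real\<close> with \<open>x i = 0\<close> for \<open>i \<ge> m\<close>,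
  with the topology induced by the product topology. Coordinates are numbered from \<open>0\<close>.
\<close>

abbreviation Rn :: "nat \<Rightarrow> (nat \<Rightarrow> real) set" where
  "Rn m \<equiv> topspace (Euclidean_space m)"

definition cube :: "real \<Rightarrow> nat \<Rightarrow> (nat \<Rightarrow> real) set" where
  "cube r m = {x \<in> Rn m. \<forall>i<m. x i \<in> {-r..r}}"

text \<open>
  A function on \<open>K\<close> is represented by its extension by zero. Hence equality of elements of \<open>C(K)\<close> is
  equality of HOL functions, and the vector space operations are the pointwise ones.
\<close>

definition C_on :: "(nat \<Rightarrow> real) set \<Rightarrow> ((nat \<Rightarrow> real) \<Rightarrow> complex) set" where
  "C_on K = {\<phi>. continuous_on K \<phi> \<and> (\<forall>x. x \<notin> K \<longrightarrow> \<phi> x = 0)}"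

definition restr :: "(nat \<Rightarrow> real) set \<Rightarrow> ((nat \<Rightarrow> real) \<Rightarrow> complex) \<Rightarrow> (nat \<Rightarrow> real) \<Rightarrow> complex" where
  "restr K \<phi> = (\<lambda>x. if x \<in> K then \<phi> x else 0)"

section \<open>Families of possibly infinite norms\<close>

definition ext_norm :: "('a \<Rightarrow> complex) set \<Rightarrow> (('a \<Rightarrow> complex) \<Rightarrow> ennreal) \<Rightarrow> bool" where
  "ext_norm V \<eta> \<longleftrightarrow>
     (\<forall>c. \<forall>v\<in>V. \<eta> (\<lambda>x. c * v x) = ennreal (cmod c) * \<eta> v) \<and>
     (\<forall>v\<in>V. \<forall>w\<in>V. \<eta> (\<lambda>x. v x + w x) \<le> \<eta> v + \<eta> w) \<and>
     (\<forall>v\<in>V. \<eta> v = 0 \<longleftrightarrow> v = (\<lambda>x. 0))"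

text \<open>
  The completeness half of \<open>(V\<^sub>\<eta>, \<eta>)\<close> being a Banach space; that \<open>\<eta>\<close> is a norm on
  \<open>V\<^sub>\<eta> = {\<eta> < \<infinity>}\<close> is part of \<^const>\<open>ext_norm\<close>.
\<close>

definition ext_complete :: "('a \<Rightarrow> complex) set \<Rightarrow> (('a \<Rightarrow> complex) \<Rightarrow> ennreal) \<Rightarrow> bool" where
  "ext_complete V \<eta> \<longleftrightarrow>
     (\<forall>\<sigma> :: nat \<Rightarrow> 'a \<Rightarrow> complex.
        (\<forall>n. \<sigma> n \<in> V \<and> \<eta> (\<sigma> n) < \<infinity>) \<and>
        (\<forall>e>0. \<exists>N. \<forall>p\<ge>N. \<forall>q\<ge>N. \<eta> (\<lambda>x. \<sigma> p x - \<sigma> q x) < ennreal e) \<longrightarrow>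
        (\<exists>l\<in>V. \<eta> l < \<infinity> \<and> (\<lambda>n. \<eta> (\<lambda>x. \<sigma> n x - l x)) \<longlonglongrightarrow> 0))"

text \<open>
  Only the values \<open>\<alpha> r m \<phi>\<close> with \<open>r > 0\<close>, \<open>m \<ge> 1\<close> and \<open>\<phi> \<in> C([-r,r]\<^sup>m)\<close> are meaningful.
\<close>

type_synonym family = "real \<Rightarrow> nat \<Rightarrow> ((nat \<Rightarrow> real) \<Rightarrow> complex) \<Rightarrow> ennreal"

definition norm_family :: "family \<Rightarrow> bool" where
  "norm_family \<alpha> \<longleftrightarrow> (\<forall>r>0. \<forall>m\<ge>1. ext_norm (C_on (cube r m)) (\<alpha> r m))"

definition family_le :: "family \<Rightarrow> family \<Rightarrow> bool" where
  "family_le \<alpha> \<beta> \<longleftrightarrow> (\<forall>r>0. \<forall>m\<ge>1. \<forall>\<phi>\<in>C_on (cube r m). \<alpha> r m \<phi> \<le> \<beta> r m \<phi>)"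

definition complete_family :: "family \<Rightarrow> bool" where
  "complete_family \<alpha> \<longleftrightarrow> (\<forall>r>0. \<forall>m\<ge>1. ext_complete (C_on (cube r m)) (\<alpha> r m))"

definition increasing_family :: "family \<Rightarrow> bool" where
  "increasing_family \<alpha> \<longleftrightarrow>
     (\<forall>s r. 0 < s \<and> s \<le> r \<longrightarrow>
        (\<forall>m\<ge>1. \<forall>\<phi>\<in>C_on (cube r m). \<alpha> s m (restr (cube s m) \<phi>) \<le> \<alpha> r m \<phi>))"

definition max_abs :: "nat \<Rightarrow> (nat \<Rightarrow> real) \<Rightarrow> real" where
  "max_abs m \<mu> = Max ((\<lambda>i. \<bar>\<mu> i\<bar>) ` {..<m})"

definition translation_invariant_family :: "family \<Rightarrow> bool" where
  "translation_invariant_family \<alpha> \<longleftrightarrow>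
     (\<forall>r>0. \<forall>m\<ge>1. \<forall>\<mu>\<in>Rn m. \<forall>\<phi>\<in>C_on (cube (r + max_abs m \<mu>) m).
        \<alpha> r m (restr (cube r m) (\<lambda>x. \<phi> (\<lambda>i. x i + \<mu> i))) \<le> \<alpha> (r + max_abs m \<mu>) m \<phi>)"

definition uniform_family :: family where
  "uniform_family r m \<phi> = (SUP x\<in>cube r m. ennreal (cmod (\<phi> x)))"

definition varopoulos_family :: family where
  "varopoulos_family r m \<phi> =
     Inf {S. \<exists>f :: nat \<Rightarrow> nat \<Rightarrow> real \<Rightarrow> complex.
            (\<forall>i<m. \<forall>n. continuous_on {-r..r} (f i n)) \<and>
            S = (\<Sum>n. \<Prod>i<m. SUP t\<in>{-r..r}. ennreal (cmod (f i n t))) \<and>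
            S < \<infinity> \<and>
            (\<forall>x\<in>cube r m. (\<lambda>n. \<Prod>i<m. f i n (x i)) sums \<phi> x)}"

section \<open>Topologies and the spaces over \<open>\<real>\<^sup>m\<close>\<close>

definition seminorm_topology ::
    "('a \<Rightarrow> complex) set \<Rightarrow> (('a \<Rightarrow> complex) \<Rightarrow> ennreal) set \<Rightarrow> ('a \<Rightarrow> complex) topology" where
  "seminorm_topology V P =
     topology_generated_by {{g \<in> V. p (\<lambda>x. g x - f x) < ennreal e} | f p e. f \<in> V \<and> p \<in> P \<and> e > 0}"

text \<open>
  \<open>calC\<close>, \<open>calCk\<close> are the script spaces (finite seminorms), \<open>C_alpha\<close>, \<open>Ck_alpha\<close> the closures
  of the polynomials in them, and \<open>boldCk\<close> the bold space, defined through \<open>C_alpha\<close>.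
\<close>

definition calC :: "family \<Rightarrow> nat \<Rightarrow> ((nat \<Rightarrow> real) \<Rightarrow> complex) set" where
  "calC \<alpha> m = {\<phi> \<in> C_on (Rn m). \<forall>r>0. \<alpha> r m (restr (cube r m) \<phi>) < \<infinity>}"

definition calC_top :: "family \<Rightarrow> nat \<Rightarrow> ((nat \<Rightarrow> real) \<Rightarrow> complex) topology" where
  "calC_top \<alpha> m = seminorm_topology (calC \<alpha> m) {\<lambda>\<phi>. \<alpha> r m (restr (cube r m) \<phi>) | r. r > 0}"

definition mpolys :: "nat \<Rightarrow> ((nat \<Rightarrow> real) \<Rightarrow> complex) set" where
  "mpolys m = {restr (Rn m) (\<lambda>x. \<Sum>e\<in>E. c e * (\<Prod>i<m. complex_of_real (x i) ^ e i)) | E c.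
                 finite (E :: (nat \<Rightarrow> nat) set)}"

definition C_alpha :: "family \<Rightarrow> nat \<Rightarrow> ((nat \<Rightarrow> real) \<Rightarrow> complex) set" where
  "C_alpha \<alpha> m = calC_top \<alpha> m closure_of mpolys m"

section \<open>Divided differences and the spaces over \<open>\<real>\<close>\<close>

definition vderiv :: "nat \<Rightarrow> (real \<Rightarrow> complex) \<Rightarrow> real \<Rightarrow> complex" where
  "vderiv i f = ((\<lambda>g x. vector_derivative g (at x)) ^^ i) f"

definition Ck :: "enat \<Rightarrow> (real \<Rightarrow> complex) set" where
  "Ck k = {f. (\<forall>i. enat i < k \<longrightarrow> (\<forall>x. vderiv i f differentiable (at x))) \<and>
              (\<forall>i. enat i \<le> k \<longrightarrow> continuous_on UNIV (vderiv i f))}"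

text \<open>The recursive formula; meaningful only if \<open>s 0, \<dots>, s i\<close> are distinct.\<close>

fun dd :: "nat \<Rightarrow> (real \<Rightarrow> complex) \<Rightarrow> (nat \<Rightarrow> real) \<Rightarrow> complex" where
  "dd 0 f s = f (s 0)"
| "dd (Suc i) f s = (dd i f s - dd i f (s(i := s (Suc i)))) / complex_of_real (s i - s (Suc i))"

text \<open>
  The continuous extension to \<open>\<real>\<^sup>i\<^sup>+\<^sup>1\<close>. It is unique because points with distinct coordinates
  are dense, and it exists for \<open>f \<in> C\<^sup>i(\<real>)\<close>, the only case in which the operator is used.
\<close>

definition divdiff :: "nat \<Rightarrow> (real \<Rightarrow> complex) \<Rightarrow> (nat \<Rightarrow> real) \<Rightarrow> complex" where
  "divdiff i f = (THE g. g \<in> C_on (Rn (Suc i)) \<and>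
                         (\<forall>s\<in>Rn (Suc i). inj_on s {..i} \<longrightarrow> g s = dd i f s))"

definition calCk :: "family \<Rightarrow> enat \<Rightarrow> (real \<Rightarrow> complex) set" where
  "calCk \<alpha> k = {f \<in> Ck k. \<forall>i. enat i < k + 1 \<longrightarrow> divdiff i f \<in> calC \<alpha> (i + 1)}"

definition calCk_top :: "family \<Rightarrow> enat \<Rightarrow> (real \<Rightarrow> complex) topology" where
  "calCk_top \<alpha> k = seminorm_topology (calCk \<alpha> k)
     {\<lambda>f. \<alpha> r (i + 1) (restr (cube r (i + 1)) (divdiff i f)) | r i. r > 0 \<and> enat i < k + 1}"

definition polys :: "(real \<Rightarrow> complex) set" where
  "polys = {\<lambda>x. poly p (complex_of_real x) | p. True}"

definition Ck_alpha :: "family \<Rightarrow> enat \<Rightarrow> (real \<Rightarrow> complex) set" where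
  "Ck_alpha \<alpha> k = calCk_top \<alpha> k closure_of polys"

definition boldCk :: "family \<Rightarrow> enat \<Rightarrow> (real \<Rightarrow> complex) set" where
  "boldCk \<alpha> k = {f \<in> Ck k. \<forall>i. enat i < k + 1 \<longrightarrow> divdiff i f \<in> C_alpha \<alpha> (i + 1)}"

definition boldCk_top :: "family \<Rightarrow> enat \<Rightarrow> (real \<Rightarrow> complex) topology" where
  "boldCk_top \<alpha> k = subtopology (calCk_top \<alpha> k) (boldCk \<alpha> k)"

section \<open>Complex Borel measures and Wiener spaces\<close>

definition complex_borel_measure :: "(real set \<Rightarrow> complex) \<Rightarrow> bool" where
  "complex_borel_measure \<mu> \<longleftrightarrow>
     (\<forall>A :: nat \<Rightarrow> real set. range A \<subseteq> sets borel \<and> disjoint_family A \<longrightarrow>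
        (\<lambda>n. \<mu> (A n)) sums \<mu> (\<Union>n. A n))"

text \<open>
  \<^const>\<open>measure_of\<close> yields the null measure unless the given set function is countably additive;
  for \<open>total_variation\<close> and \<open>jordan_pos\<close> this holds by the classical theorems on complex
  and signed measures.
\<close>

definition total_variation :: "(real set \<Rightarrow> complex) \<Rightarrow> real measure" where
  "total_variation \<mu> = measure_of UNIV (sets borel)
     (\<lambda>E. SUP A\<in>{A :: nat \<Rightarrow> real set. range A \<subseteq> sets borel \<and> disjoint_family A \<and> (\<Union>n. A n) = E}.
        \<Sum>n. ennreal (cmod (\<mu> (A n))))"

text \<open>
  The positive part \<open>\<nu>\<^sup>+\<close> of the Jordan decomposition of a signed measure, \<open>\<nu>\<^sup>-\<close> being the positive
  part of \<open>-\<nu>\<close>. As \<^const>\<open>ennreal\<close> maps negative numbers to \<open>0\<close>, these contribute nothing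
  to the supremum.
\<close>

definition jordan_pos :: "(real set \<Rightarrow> real) \<Rightarrow> real measure" where
  "jordan_pos \<nu> = measure_of UNIV (sets borel) (\<lambda>E. SUP B\<in>{B \<in> sets borel. B \<subseteq> E}. ennreal (\<nu> B))"

definition signed_integral :: "(real set \<Rightarrow> real) \<Rightarrow> (real \<Rightarrow> complex) \<Rightarrow> complex" where
  "signed_integral \<nu> f =
     (LINT \<xi>|jordan_pos \<nu>. f \<xi>) - (LINT \<xi>|jordan_pos (\<lambda>E. - \<nu> E). f \<xi>)"

definition complex_integral :: "(real set \<Rightarrow> complex) \<Rightarrow> (real \<Rightarrow> complex) \<Rightarrow> complex" where
  "complex_integral \<mu> f =
     signed_integral (\<lambda>E. Re (\<mu> E)) f + \<i> * signed_integral (\<lambda>E. Im (\<mu> E)) f"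

definition wiener_fin :: "nat \<Rightarrow> (real \<Rightarrow> complex) set" where
  "wiener_fin k = {f. \<exists>\<mu>. complex_borel_measure \<mu> \<and>
     (\<integral>\<^sup>+ \<xi>. ennreal (\<bar>\<xi>\<bar> ^ k) \<partial>total_variation \<mu>) < \<infinity> \<and>
     (\<forall>x. f x = complex_integral \<mu> (\<lambda>\<xi>. exp (\<i> * complex_of_real (x * \<xi>))))}"

definition wiener :: "enat \<Rightarrow> (real \<Rightarrow> complex) set" where
  "wiener k = (case k of enat n \<Rightarrow> wiener_fin n | \<infinity> \<Rightarrow> (\<Inter>n\<in>{1..}. wiener_fin n))"

end

theory Submission
  imports Defs
begin

text \<open>
  The two sides of \<open>u \<le> \<alpha> \<le> \<beta>\<close> play opposite parts. Because of \<open>\<alpha> \<le> \<beta>\<close>, approximations may be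
  constructed from explicit expansions of divided differences into elementary tensors. Because of
  \<open>u \<le> \<alpha>\<close> and completeness, limits in \<open>\<alpha>\<close> can be recognized by their pointwise values
  (\<open>cube_norm_isdd_limit\<close>).

  On the side of \<open>\<beta>\<close>, the Leibniz rule makes the sum of the norms of the divided differences of
  orders \<open>0, \<dots>, n\<close> submultiplicative, so the limits of polynomials in this norm form an algebra. It
  contains the exponentials \<open>e\<^bsup>ix\<xi>\<^esup>\<close>, whose divided difference of order \<open>i\<close> has norm
  \<open>O(\<bar>\<xi>\<bar>\<^sup>i)\<close> (\<open>dd_le_expi\<close>). This has two consequences.

  First, functions of class \<open>C\<^sup>n\<^sup>+\<^sup>1\<close> are limits of polynomials in the norms of orders up to \<open>n\<close>
  (\<open>Ck_Suc_smooth_closure\<close>): expand the derivative of order \<open>n + 1\<close> into exponentials with coefficients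
  \<open>c\<^sub>\<xi>\<close>. Integrating \<open>n + 1\<close> times gains \<open>\<bar>\<xi>\<bar>\<^sup>n\<^sup>+\<^sup>1\<close>, the norm costs \<open>\<bar>\<xi>\<bar>\<^sup>n\<close>, and \<open>\<Sum> \<bar>c\<^sub>\<xi>\<bar> / \<bar>\<xi>\<bar>\<close> is finite by
  the inequalities of Bessel and Cauchy--Schwarz. Second, the Fourier transform of a measure with a finite
  moment of order \<open>n\<close> is a limit of polynomials in the same norms (\<open>fourier_smooth_closure\<close>), which gives
  \<open>W\<^sub>k \<subseteq> \<^bold>C\<^sup>k\<close>. Its density follows from that of the polynomials, since
  \<open>(e\<^bsup>ihx\<^esup> - 1) / (ih)\<close> tends to \<open>x\<close>.

  The first consequence loses one derivative. For a function \<open>f\<close> of class \<open>C\<^sup>k\<close> whose divided difference of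
  order \<open>k\<close> is an \<open>\<alpha>\<close>-limit of polynomials, the lost derivative is recovered by averaging \<open>f\<close> over
  \<open>[x, x + \<epsilon>]\<close>. The average is of class \<open>C\<^sup>k\<^sup>+\<^sup>1\<close>, and its divided differences are averages of
  translates of those of \<open>f\<close>; by translation invariance, translation is continuous on \<open>\<alpha>\<close>-limits of
  polynomials, so they are \<open>\<alpha>\<close>-close to those of \<open>f\<close> (\<open>shift_continuous\<close>, \<open>average_close\<close>). The lower orders
  are covered by the first consequence applied to \<open>f\<close> itself. Together this yields a polynomial close to
  \<open>f\<close> in all orders at once (\<open>simultaneous_polynomial_approximation\<close>), which is the density of the polynomials,
  and shows that the condition on the order \<open>k\<close> implies those on the lower orders.
\<close>


section \<open>Continuously differentiable functions\<close>

lemma Ck_0: "f \<in> Ck (enat 0) \<longleftrightarrow> continuous_on UNIV f"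
  by (auto simp: Ck_def vderiv_def)

lemma vderiv_0 [simp]: "vderiv 0 f = f"
  by (simp add: vderiv_def)

lemma vderiv_Suc: "vderiv (Suc i) f = vderiv i (\<lambda>x. vector_derivative f (at x))"
  unfolding vderiv_def by (simp only: funpow_Suc_right comp_apply)

lemma Ck_SucD:
  assumes "f \<in> Ck (enat (Suc n))"
  shows "(f has_vector_derivative vector_derivative f (at x)) (at x)"
    and "(\<lambda>x. vector_derivative f (at x)) \<in> Ck (enat n)"
proof -
  have "vderiv 0 f differentiable at x"
    using assms unfolding Ck_def by (auto simp del: vderiv_0)
  then show "(f has_vector_derivative vector_derivative f (at x)) (at x)"
    by (simp add: vector_derivative_works)
  show "(\<lambda>x. vector_derivative f (at x)) \<in> Ck (enat n)"
    unfolding Ck_def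
  proof (intro CollectI conjI allI impI)
    fix i x assume "enat i < enat n"
    then show "vderiv i (\<lambda>x. vector_derivative f (at x)) differentiable at x"
      using assms vderiv_Suc[of i f] unfolding Ck_def by (auto dest!: spec[where x="Suc i"])
  next
    fix i assume "enat i \<le> enat n"
    then show "continuous_on UNIV (vderiv i (\<lambda>x. vector_derivative f (at x)))"
      using assms vderiv_Suc[of i f] unfolding Ck_def by (auto dest!: spec[where x="Suc i"])
  qed
qed

lemma Ck_SucI:
  assumes f': "\<And>x. (f has_vector_derivative f' x) (at x)" and "f' \<in> Ck (enat n)"
  shows "f \<in> Ck (enat (Suc n))"
proof -
  have eq: "(\<lambda>x. vector_derivative f (at x)) = f'"
    using f' by (auto intro: vector_derivative_at)
  have "vderiv i f differentiable at x" if "enat i < enat (Suc n)" for i x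
    using that assms(2) f'[of x] unfolding Ck_def
    by (cases i) (auto simp: vderiv_Suc eq differentiableI_vector)
  moreover have "continuous_on UNIV (vderiv i f)" if "enat i \<le> enat (Suc n)" for i
  proof (cases i)
    case 0
    then show ?thesis
      using f' by (auto intro!: continuous_at_imp_continuous_on has_vector_derivative_continuous)
  next
    case (Suc j)
    then show ?thesis using that assms(2) unfolding Ck_def by (auto simp: vderiv_Suc eq)
  qed
  ultimately show ?thesis unfolding Ck_def by blast
qed

lemma Ck_mono: "f \<in> Ck k \<Longrightarrow> l \<le> k \<Longrightarrow> f \<in> Ck l"
  unfolding Ck_def by (auto intro: order_trans order_less_le_trans)

lemma Ck_iff_finite: "f \<in> Ck k \<longleftrightarrow> (\<forall>n. enat n \<le> k \<longrightarrow> f \<in> Ck (enat n))"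
proof (intro iffI allI impI)
  assume *: "\<forall>n. enat n \<le> k \<longrightarrow> f \<in> Ck (enat n)"
  show "f \<in> Ck k" unfolding Ck_def
  proof (intro CollectI conjI allI impI)
    fix i x assume "enat i < k"
    then have "enat (Suc i) \<le> k" by (simp add: Suc_ile_eq)
    with * have "f \<in> Ck (enat (Suc i))" by blast
    then show "vderiv i f differentiable at x" unfolding Ck_def by simp
  next
    fix i assume "enat i \<le> k"
    with * have "f \<in> Ck (enat i)" by blast
    then show "continuous_on UNIV (vderiv i f)" unfolding Ck_def by simp
  qed
qed (auto intro: Ck_mono)

lemma Ck_continuous: "f \<in> Ck k \<Longrightarrow> continuous_on UNIV f"
  using Ck_mono[of f k "enat 0"] by (simp add: Ck_0 zero_enat_def[symmetric]) (simp add: zero_enat_def Ck_0)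

lemma Ck_const: "(\<lambda>x. c) \<in> Ck (enat n)"
proof (induction n arbitrary: c)
  case 0 show ?case by (simp add: Ck_0)
next
  case (Suc n) then show ?case by (auto intro!: Ck_SucI[where f'="\<lambda>x. 0"])
qed

lemma Ck_add: "f \<in> Ck (enat n) \<Longrightarrow> g \<in> Ck (enat n) \<Longrightarrow> (\<lambda>x. f x + g x) \<in> Ck (enat n)"
proof (induction n arbitrary: f g)
  case 0 then show ?case by (auto simp: Ck_0 intro: continuous_intros)
next
  case (Suc n)
  show ?case
    by (rule Ck_SucI[OF _ Suc.IH[OF Ck_SucD(2)[OF Suc.prems(1)] Ck_SucD(2)[OF Suc.prems(2)]]])
       (intro has_vector_derivative_add Ck_SucD(1)[OF Suc.prems(1)] Ck_SucD(1)[OF Suc.prems(2)])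
qed

lemma Ck_mult: "f \<in> Ck (enat n) \<Longrightarrow> g \<in> Ck (enat n) \<Longrightarrow> (\<lambda>x. f x * g x) \<in> Ck (enat n)"
proof (induction n arbitrary: f g)
  case 0 then show ?case by (auto simp: Ck_0 intro: continuous_intros)
next
  case (Suc n)
  have n: "f \<in> Ck (enat n)" "g \<in> Ck (enat n)" using Suc.prems by (auto intro: Ck_mono)
  show ?case
    by (rule Ck_SucI[OF _ Ck_add[OF Suc.IH[OF n(1) Ck_SucD(2)[OF Suc.prems(2)]]
            Suc.IH[OF Ck_SucD(2)[OF Suc.prems(1)] n(2)]]])
       (intro has_vector_derivative_mult Ck_SucD(1)[OF Suc.prems(1)] Ck_SucD(1)[OF Suc.prems(2)])
qed

lemma Ck_cmult: "f \<in> Ck (enat n) \<Longrightarrow> (\<lambda>x. c * f x) \<in> Ck (enat n)"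
  by (intro Ck_mult Ck_const)

lemma Ck_diff: "f \<in> Ck (enat n) \<Longrightarrow> g \<in> Ck (enat n) \<Longrightarrow> (\<lambda>x. f x - g x) \<in> Ck (enat n)"
  using Ck_add[OF _ Ck_cmult[of g n "-1"]] by simp

lemma Ck_sum: "(\<And>a. a \<in> A \<Longrightarrow> f a \<in> Ck (enat n)) \<Longrightarrow> (\<lambda>x. \<Sum>a\<in>A. f a x) \<in> Ck (enat n)"
  by (induction A rule: infinite_finite_induct) (auto intro: Ck_const Ck_add)

lemma Ck_shift: "f \<in> Ck (enat n) \<Longrightarrow> (\<lambda>x. f (x + t)) \<in> Ck (enat n)"
proof (induction n arbitrary: f)
  case 0 then show ?case
    by (auto simp: Ck_0 intro!: continuous_on_compose2[of UNIV f] continuous_intros)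
next
  case (Suc n)
  have "((\<lambda>x. f (x + t)) has_vector_derivative vector_derivative f (at (x + t))) (at x)" for x
  proof -
    have "((\<lambda>x. x + t) has_vector_derivative 1) (at x)"
      by (auto intro!: derivative_eq_intros)
    from vector_diff_chain_at[OF this Ck_SucD(1)[OF Suc.prems]] show ?thesis
      by (simp add: o_def)
  qed
  then show ?case
    by (rule Ck_SucI) (rule Suc.IH[OF Ck_SucD(2)[OF Suc.prems]])
qed

lemma Ck_of_real: "complex_of_real \<in> Ck (enat n)"
proof (cases n)
  case 0 then show ?thesis by (simp add: Ck_0 continuous_on_of_real_id)
next
  case (Suc m)
  have "(complex_of_real has_vector_derivative 1) (at x)" for x
    using has_vector_derivative_of_real[OF DERIV_ident] by (simp add: o_def)
  then show ?thesis unfolding Suc by (rule Ck_SucI) (rule Ck_const)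
qed

lemma Ck_power: "(\<lambda>x. complex_of_real x ^ j) \<in> Ck (enat n)"
  by (induction j) (auto intro: Ck_const Ck_mult Ck_of_real)

section \<open>Divided differences\<close>

lemma dd_cong: "(\<And>j. j \<le> i \<Longrightarrow> f (s j) = g (t j) \<and> s j = t j) \<Longrightarrow> dd i f s = dd i g t"
proof (induction i arbitrary: s t)
  case (Suc i)
  have *: "f (s j) = g (t j)" "s j = t j" if "j \<le> Suc i" for j
    using Suc.prems[OF that] by blast+
  have "dd i f s = dd i g t" by (rule Suc.IH) (simp add: *(1), simp add: *(2))
  moreover have "dd i f (s(i := s (Suc i))) = dd i g (t(i := t (Suc i)))"
    by (rule Suc.IH) (simp add: *(1) fun_upd_def, simp add: *(2))
  ultimately show ?case using *(2) by simp
next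
  case 0
  then show ?case by force
qed

lemma dd_add: "dd i (\<lambda>x. f x + g x) s = dd i f s + dd i g s"
  by (induction i arbitrary: s) (auto simp: add_divide_distrib diff_divide_distrib)

lemma dd_cmult: "dd i (\<lambda>x. c * f x) s = c * dd i f s"
  by (induction i arbitrary: s) (auto simp: algebra_simps diff_divide_distrib)

lemma dd_diff: "dd i (\<lambda>x. f x - g x) s = dd i f s - dd i g s"
  using dd_add[of i f "\<lambda>x. -1 * g x" s] dd_cmult[of i "-1" g s] by simp

lemma dd_sum: "dd i (\<lambda>x. \<Sum>a\<in>A. f a x) s = (\<Sum>a\<in>A. dd i (f a) s)"
  using dd_cmult[of i 0 "\<lambda>_. 0"]
  by (induction A rule: infinite_finite_induct) (auto simp: dd_add)

lemma dd_affine: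
  assumes "u \<noteq> 0"
  shows "dd i (\<lambda>x. g (a + u * x)) s = complex_of_real u ^ i * dd i g (\<lambda>j. a + u * s j)"
proof (induction i arbitrary: s)
  case (Suc i)
  have *: "(\<lambda>j. a + u * (s(i := s (Suc i))) j) = (\<lambda>j. a + u * s j)(i := a + u * s (Suc i))"
    by auto
  have **: "(a + u * s i) - (a + u * s (Suc i)) = u * (s i - s (Suc i))"
    by (simp add: algebra_simps)
  show ?case using assms
    unfolding dd.simps Suc.IH * fun_upd_same ** of_real_mult right_diff_distrib[symmetric]
    by simp
qed simp

lemma dd_tendsto:
  assumes "\<And>j. j \<le> i \<Longrightarrow> ((\<lambda>n. f n (s j)) \<longlongrightarrow> g (s j)) F"
  shows "((\<lambda>n. dd i (f n) s) \<longlongrightarrow> dd i g s) F"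
  using assms
proof (induction i arbitrary: s)
  case (Suc i)
  have "((\<lambda>n. dd i (f n) s) \<longlongrightarrow> dd i g s) F" by (rule Suc.IH) (use Suc.prems in auto)
  moreover have "((\<lambda>n. dd i (f n) (s(i := s (Suc i)))) \<longlongrightarrow> dd i g (s(i := s (Suc i)))) F"
    by (rule Suc.IH) (use Suc.prems in auto)
  ultimately show ?case unfolding dd.simps divide_inverse by (intro tendsto_intros)
qed auto

text \<open>Taking the difference quotient against the first node first: the recursion of \<^const>\<open>dd\<close>
  splits off the last two nodes, so both recursions commute.\<close>

lemma dd_Suc_first:
  "dd (Suc i) f s = dd i (\<lambda>x. (f (s 0) - f x) / complex_of_real (s 0 - x)) (\<lambda>j. s (Suc j))"
proof (induction i arbitrary: s)
  case (Suc i)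
  have "(\<lambda>j. (s(Suc i := s (Suc (Suc i)))) (Suc j)) = (\<lambda>j. s (Suc j))(i := s (Suc (Suc i)))"
    by auto
  then show ?case
    using Suc.IH[of s] Suc.IH[of "s(Suc i := s (Suc (Suc i)))"]
    unfolding dd.simps(2)[of "Suc i" f s] dd.simps(2)[of i _ "\<lambda>j. s (Suc j)"]
    by (simp del: dd.simps add: fun_upd_def)
qed simp

lemma inj_on_drop_node:
  assumes "inj_on s {..Suc i}" shows "inj_on (s(i := s (Suc i))) {..i}"
proof (rule inj_onI)
  fix x y assume *: "x \<in> {..i}" "y \<in> {..i}" "(s(i := s (Suc i))) x = (s(i := s (Suc i))) y"
  let ?c = "\<lambda>l. if l = i then Suc i else l"
  have "s (?c x) = s (?c y)" using *(3) by (auto split: if_splits)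
  then have "?c x = ?c y" using inj_onD[OF assms, of "?c x" "?c y"] *(1,2) by auto
  then show "x = y" using *(1,2) by (auto split: if_splits)
qed

text \<open>The Leibniz rule. In each term the two factors share exactly one node, \<open>s j\<close>.\<close>

lemma dd_mult:
  assumes "inj_on s {..i}"
  shows "dd i (\<lambda>x. f x * g x) s = (\<Sum>j\<le>i. dd j f s * dd (i - j) g (\<lambda>l. s (l + j)))"
  using assms
proof (induction i arbitrary: s)
  case (Suc i)
  let ?t = "s(i := s (Suc i))"
  have ne: "s i \<noteq> s (Suc i)" using Suc.prems by (auto dest: inj_onD)
  have inj: "inj_on s {..i}" using Suc.prems by (rule inj_on_subset) auto
  have injt: "inj_on ?t {..i}" using Suc.prems by (rule inj_on_drop_node)
  have d: "dd j f ?t = dd j f s" if "j < i" for j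
    by (rule dd_cong) (use that in auto)
  have g: "(dd (i - j) g (\<lambda>l. s (l + j)) - dd (i - j) g (\<lambda>l. ?t (l + j))) / of_real (s i - s (Suc i))
      = dd (Suc i - j) g (\<lambda>l. s (l + j))" if "j < i" for j
  proof -
    have "(\<lambda>l. ?t (l + j)) = (\<lambda>l. s (l + j))(i - j := s (Suc i - j + j))"
      using that by (auto simp: fun_eq_iff)
    then show ?thesis using that by (simp add: Suc_diff_le)
  qed
  have "dd (Suc i) (\<lambda>x. f x * g x) s =
     ((\<Sum>j<i. dd j f s * (dd (i - j) g (\<lambda>l. s (l + j)) - dd (i - j) g (\<lambda>l. ?t (l + j)))) +
       (dd i f s * g (s i) - dd i f ?t * g (s (Suc i)))) / of_real (s i - s (Suc i))"
    using d by (simp add: Suc.IH[OF inj] Suc.IH[OF injt] lessThan_Suc_atMost[symmetric]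
        sum_subtractf right_diff_distrib del: fun_upd_apply) simp
  also have "\<dots> = (\<Sum>j<i. dd j f s * dd (Suc i - j) g (\<lambda>l. s (l + j))) +
       (dd i f s * g (s i) - dd i f ?t * g (s (Suc i))) / of_real (s i - s (Suc i))"
    unfolding add_divide_distrib sum_divide_distrib
  proof (intro arg_cong2[where f="(+)"] sum.cong refl)
    fix j assume "j \<in> {..<i}"
    then show "dd j f s * (dd (i - j) g (\<lambda>l. s (l + j)) - dd (i - j) g (\<lambda>l. ?t (l + j))) /
        of_real (s i - s (Suc i)) = dd j f s * dd (Suc i - j) g (\<lambda>l. s (l + j))"
      using g[of j] by (metis lessThan_iff times_divide_eq_right)
  qed
  also have "(dd i f s * g (s i) - dd i f ?t * g (s (Suc i))) / of_real (s i - s (Suc i)) =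
     dd i f s * ((g (s i) - g (s (Suc i))) / of_real (s i - s (Suc i))) +
     (dd i f s - dd i f ?t) / of_real (s i - s (Suc i)) * g (s (Suc i))"
    by (simp add: diff_divide_distrib left_diff_distrib right_diff_distrib add_divide_distrib)
  also have "(dd i f s - dd i f ?t) / of_real (s i - s (Suc i)) = dd (Suc i) f s" by simp
  also have "(g (s i) - g (s (Suc i))) / of_real (s i - s (Suc i)) = dd (Suc i - i) g (\<lambda>l. s (l + i))"
    by simp
  finally show ?case
    by (simp add: lessThan_Suc_atMost[symmetric] add.assoc del: dd.simps(2))
qed simp

lemma dd_integral:
  fixes h :: "real \<Rightarrow> real \<Rightarrow> complex"
  assumes "\<And>j. j \<le> i \<Longrightarrow> (\<lambda>u. h u (s j)) integrable_on A"
  shows "(\<lambda>u. dd i (h u) s) integrable_on A \<and>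
         dd i (\<lambda>x. integral A (\<lambda>u. h u x)) s = integral A (\<lambda>u. dd i (h u) s)"
  using assms
proof (induction i arbitrary: s)
  case (Suc i)
  let ?t = "s(i := s (Suc i))"
  have 1: "(\<lambda>u. dd i (h u) s) integrable_on A \<and>
         dd i (\<lambda>x. integral A (\<lambda>u. h u x)) s = integral A (\<lambda>u. dd i (h u) s)"
    by (rule Suc.IH) (use Suc.prems in auto)
  have 2: "(\<lambda>u. dd i (h u) ?t) integrable_on A \<and>
         dd i (\<lambda>x. integral A (\<lambda>u. h u x)) ?t = integral A (\<lambda>u. dd i (h u) ?t)"
    by (rule Suc.IH) (use Suc.prems in auto)
  show ?case using 1 2
    by (auto simp: integral_diff divide_inverse intro!: integrable_on_mult_left integrable_diff)
qed auto

text \<open>\<open>isdd i f \<phi>\<close>: the function \<open>\<phi>\<close> of infinitely many variables is a continuous extension of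
  the \<open>i\<close>-th divided difference of \<open>f\<close>. Not cutting \<open>\<phi>\<close> down to \<open>\<real>\<^sup>i\<^sup>+\<^sup>1\<close> lets divided differences
  of different orders be evaluated at the same point; by continuity \<open>\<phi>\<close> depends only
  on the coordinates \<open>0, \<dots>, i\<close>.\<close>

definition isdd :: "nat \<Rightarrow> (real \<Rightarrow> complex) \<Rightarrow> ((nat \<Rightarrow> real) \<Rightarrow> complex) \<Rightarrow> bool" where
  "isdd i f \<phi> \<longleftrightarrow> continuous_on UNIV \<phi> \<and> (\<forall>s. inj_on s {..i} \<longrightarrow> \<phi> s = dd i f s)"

lemma continuous_on_substitute_coordinates:
  fixes \<phi> :: "(nat \<Rightarrow> real) \<Rightarrow> 'b::topological_space"
  assumes "continuous_on UNIV \<phi>" and "\<And>l. continuous_on A (\<lambda>p. h p l)"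
  shows "continuous_on A (\<lambda>p. \<phi> (h p))"
  by (rule continuous_on_compose2[OF assms(1)])
     (auto intro: continuous_on_coordinatewise_then_product assms(2))

lemma isdd_continuous: "isdd i f \<phi> \<Longrightarrow> continuous_on A \<phi>"
  unfolding isdd_def by (auto intro: continuous_on_subset)

text \<open>The cube with free coordinates from \<open>m\<close> on, so that functions of different numbers of
  variables can be evaluated at the same point.\<close>

definition cylinder :: "real \<Rightarrow> nat \<Rightarrow> (nat \<Rightarrow> real) set" where
  "cylinder r m = {s. \<forall>l<m. \<bar>s l\<bar> \<le> r}"

text \<open>Moving \<open>s\<close> towards a point \<open>w\<close> with distinct coordinates makes the coordinates
  distinct, and keeps the point inside any convex set containing \<open>s\<close> and \<open>w\<close>.\<close>

lemma eventually_inj_segment: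
  fixes s w :: "nat \<Rightarrow> real"
  assumes w: "inj_on w {..i}"
  shows "eventually (\<lambda>n. inj_on (\<lambda>l. (1 - 1 / real n) * s l + (1 / real n) * w l) {..i}) sequentially"
proof -
  have "eventually (\<lambda>n. (1 - 1 / real n) * s l + (1 / real n) * w l \<noteq>
          (1 - 1 / real n) * s l' + (1 / real n) * w l') sequentially"
    if "l \<in> {..i}" "l' \<in> {..i}" "l \<noteq> l'" for l l'
  proof (cases "s l = s l'")
    case True
    have "w l \<noteq> w l'" using that w by (auto dest: inj_onD)
    then show ?thesis using True by (auto intro: eventually_sequentiallyI[of 1])
  next
    case False
    have "(\<lambda>n. (1 - 1 / real n) * (s l - s l') + (1 / real n) * (w l - w l')) \<longlonglongrightarrow>
        (1 - 0) * (s l - s l') + 0 * (w l - w l')"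
      by (intro tendsto_intros lim_1_over_n)
    then have "eventually (\<lambda>n. (1 - 1 / real n) * (s l - s l') + (1 / real n) * (w l - w l') \<noteq> 0) sequentially"
      using False by (intro tendsto_imp_eventually_ne) auto
    then show ?thesis by eventually_elim (auto simp: algebra_simps)
  qed
  then have "eventually (\<lambda>n. \<forall>l\<in>{..i}. \<forall>l'\<in>{..i}. l \<noteq> l' \<longrightarrow> (1 - 1 / real n) * s l + (1 / real n) * w l \<noteq>
          (1 - 1 / real n) * s l' + (1 / real n) * w l') sequentially"
    by (intro eventually_ball_finite finite_atMost ballI) (auto simp: eventually_conj_iff)
  then show ?thesis by eventually_elim (auto simp: inj_on_def)
qed

lemma segment_tendsto:
  fixes s w :: "nat \<Rightarrow> real"
  shows "(\<lambda>n. (\<lambda>l. (1 - 1 / real n) * s l + (1 / real n) * w l)) \<longlonglongrightarrow> s"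
proof -
  have "(\<lambda>n. (1 - 1 / real n) * s l + (1 / real n) * w l) \<longlonglongrightarrow> (1 - 0) * s l + 0 * w l" for l
    by (intro tendsto_intros lim_1_over_n)
  then have "limitin (powertop_real UNIV) (\<lambda>n l. (1 - 1 / real n) * s l + (1 / real n) * w l) s sequentially"
    by (simp add: limitin_componentwise)
  then show ?thesis by (simp add: euclidean_product_topology)
qed

lemma continuous_eq_on_distinct:
  fixes \<phi> \<psi> :: "(nat \<Rightarrow> real) \<Rightarrow> complex"
  assumes \<phi>: "continuous_on B \<phi>" and \<psi>: "continuous_on B \<psi>"
    and conv: "\<And>s t u. s \<in> B \<Longrightarrow> t \<in> B \<Longrightarrow> 0 \<le> u \<Longrightarrow> u \<le> 1 \<Longrightarrow> (\<lambda>l. (1 - u) * s l + u * t l) \<in> B"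
    and w: "w \<in> B" "inj_on w {..i}"
    and eq: "\<And>s. s \<in> B \<Longrightarrow> inj_on s {..i} \<Longrightarrow> \<phi> s = \<psi> s"
    and s: "s \<in> B"
  shows "\<phi> s = \<psi> s"
proof -
  let ?s = "\<lambda>n l. (1 - 1 / real n) * s l + (1 / real n) * w l"
  have B: "eventually (\<lambda>n. ?s n \<in> B) sequentially"
    by (rule eventually_sequentiallyI[of 1]) (intro conv s w, auto)
  have 1: "(\<lambda>n. \<phi> (?s n)) \<longlonglongrightarrow> \<phi> s"
    by (rule continuous_on_tendsto_compose[OF \<phi> segment_tendsto s B])
  have 2: "(\<lambda>n. \<psi> (?s n)) \<longlonglongrightarrow> \<psi> s"
    by (rule continuous_on_tendsto_compose[OF \<psi> segment_tendsto s B])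
  have "eventually (\<lambda>n. \<phi> (?s n) = \<psi> (?s n)) sequentially"
    using B eventually_inj_segment[OF w(2), of s] by eventually_elim (rule eq)
  then have "(\<lambda>n. \<psi> (?s n)) \<longlonglongrightarrow> \<phi> s"
    using 1 by (rule Lim_transform_eventually[rotated])
  with 2 show ?thesis using LIMSEQ_unique by blast
qed

text \<open>Points with distinct coordinates are dense in each of these sets: each is convex and
  contains a point with distinct coordinates, towards which any other point can be moved.\<close>

lemma isdd_eq_on:
  fixes \<phi> \<psi> :: "(nat \<Rightarrow> real) \<Rightarrow> complex"
  assumes \<phi>: "continuous_on B \<phi>" and \<psi>: "continuous_on B \<psi>"
    and "B = UNIV \<or> B = Rn (Suc i) \<or> (0 < r \<and> (B = cylinder r (Suc i) \<or> B = cube r (Suc i)))"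
    and eq: "\<And>s. s \<in> B \<Longrightarrow> inj_on s {..i} \<Longrightarrow> \<phi> s = \<psi> s" and s: "s \<in> B"
  shows "\<phi> s = \<psi> s"
proof -
  define w where "w = (\<lambda>l. if l \<le> i then (if 0 < r then r else 1) * real l / real (Suc i) else 0)"
  have w: "inj_on w {..i}" by (auto simp: inj_on_def w_def)
  have le: "r * real l / real (Suc i) \<le> r" if "l < Suc i" "0 < r" for l
  proof -
    have "r * real l \<le> r * real (Suc i)" using that by (intro mult_left_mono) auto
    then show ?thesis by (simp add: divide_le_eq del: of_nat_Suc)
  qed
  have cv: "\<bar>(1 - u) * a + u * b\<bar> \<le> r" if "\<bar>a\<bar> \<le> r" "\<bar>b\<bar> \<le> r" "0 \<le> u" "u \<le> 1" for a b u r :: real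
  proof -
    have "\<bar>(1 - u) * a + u * b\<bar> \<le> (1 - u) * \<bar>a\<bar> + u * \<bar>b\<bar>"
      by (rule order_trans[OF abs_triangle_ineq]) (use that in \<open>simp add: abs_mult\<close>)
    also have "\<dots> \<le> (1 - u) * r + u * r" by (intro add_mono mult_left_mono) (use that in auto)
    finally show ?thesis by (simp add: algebra_simps)
  qed
  have cv': "- r \<le> (1 - u) * a + u * b \<and> (1 - u) * a + u * b \<le> r"
    if "- r \<le> a \<and> a \<le> r" "- r \<le> b \<and> b \<le> r" "0 \<le> u" "u \<le> 1" for a b u r :: real
    using cv[of a r b u] that by (auto simp: abs_le_iff)
  show ?thesis
  proof (rule continuous_eq_on_distinct[OF \<phi> \<psi> _ _ w eq s])
    have w0: "0 \<le> w l" for l by (auto simp: w_def)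
    have "0 < r \<Longrightarrow> w l \<le> r" for l using le[of l] by (auto simp: w_def)
    moreover have "0 < r \<Longrightarrow> - r \<le> w l" for l using w0[of l] by linarith
    moreover have "w l = 0" if "Suc i \<le> l" for l using that by (auto simp: w_def)
    ultimately show "w \<in> B" using assms(3) w0
      by (elim disjE conjE) (simp_all add: cylinder_def cube_def topspace_Euclidean_space abs_of_nonneg)
    fix s t and u :: real assume "s \<in> B" "t \<in> B" "0 \<le> u" "u \<le> 1"
    then show "(\<lambda>l. (1 - u) * s l + u * t l) \<in> B"
      using assms(3)
      by (elim disjE conjE) (simp_all add: cylinder_def cube_def topspace_Euclidean_space cv cv')
  qed
qed

lemma isdd_unique: "isdd i f \<phi> \<Longrightarrow> isdd i f \<psi> \<Longrightarrow> \<phi> = \<psi>"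
  unfolding isdd_def using isdd_eq_on[of UNIV \<phi> \<psi> i] by auto

lemma isdd_local:
  assumes "isdd i f \<phi>" and "\<And>l. l \<le> i \<Longrightarrow> s l = t l"
  shows "\<phi> s = \<phi> t"
proof -
  let ?T = "\<lambda>x l. if l \<le> i then x l else t l"
  have "continuous_on UNIV (\<phi> \<circ> ?T)"
    unfolding comp_def
  proof (intro continuous_on_substitute_coordinates[OF isdd_continuous[OF assms(1)]])
    show "continuous_on UNIV (\<lambda>x. if l \<le> i then x l else t l)" for l by (cases "l \<le> i") auto
  qed
  moreover have "dd i f (?T s) = dd i f s" for s by (rule dd_cong) auto
  moreover have "inj_on (?T s) {..i} \<longleftrightarrow> inj_on s {..i}" for s by (auto simp: inj_on_def)
  ultimately have "isdd i f (\<phi> \<circ> ?T)" using assms(1) unfolding isdd_def by simp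
  then have "\<phi> \<circ> ?T = \<phi>" using assms(1) by (rule isdd_unique)
  then have "\<phi> s = \<phi> (?T s)" by (simp add: fun_eq_iff)
  moreover have "?T s = t" using assms(2) by auto
  ultimately show ?thesis by simp
qed

lemma divdiff_eq:
  assumes "isdd i f \<phi>"
  shows "divdiff i f = restr (Rn (Suc i)) \<phi>"
  unfolding divdiff_def
proof (rule the_equality)
  have c: "continuous_on (Rn (Suc i)) \<phi>" using assms unfolding isdd_def by (auto intro: continuous_on_subset)
  then have c': "continuous_on (Rn (Suc i)) (restr (Rn (Suc i)) \<phi>)"
    by (rule continuous_on_eq) (auto simp: restr_def)
  then show "restr (Rn (Suc i)) \<phi> \<in> C_on (Rn (Suc i)) \<and>
      (\<forall>s\<in>Rn (Suc i). inj_on s {..i} \<longrightarrow> restr (Rn (Suc i)) \<phi> s = dd i f s)"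
    using assms unfolding isdd_def C_on_def by (auto simp: restr_def)
  fix g assume g: "g \<in> C_on (Rn (Suc i)) \<and> (\<forall>s\<in>Rn (Suc i). inj_on s {..i} \<longrightarrow> g s = dd i f s)"
  have "g s = restr (Rn (Suc i)) \<phi> s" if "s \<in> Rn (Suc i)" for s
    by (rule isdd_eq_on[OF _ c' _ _ that, where i=i])
       (use g assms in \<open>auto simp: isdd_def C_on_def restr_def\<close>)
  moreover have "g s = restr (Rn (Suc i)) \<phi> s" if "s \<notin> Rn (Suc i)" for s
    using that g by (auto simp: C_on_def restr_def)
  ultimately show "g = restr (Rn (Suc i)) \<phi>" by blast
qed

text \<open>The Hermite--Genocchi formula, unrolled once: since
  \<open>(f s\<^sub>0 - f x) / (s\<^sub>0 - x)\<close> is the mean of \<open>f'\<close> over the segment from \<open>s\<^sub>0\<close> to \<open>x\<close>, a divided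
  difference of \<open>f\<close> is a mean of divided differences of \<open>f'\<close> of one order less.\<close>

lemma Ck_imp_isdd: "f \<in> Ck (enat i) \<Longrightarrow> \<exists>\<phi>. isdd i f \<phi>"
proof (induction i arbitrary: f)
  case 0
  have "isdd 0 f (\<lambda>s. f (s 0))"
    using 0 unfolding isdd_def Ck_0
    by (auto intro: continuous_on_compose2[of UNIV f])
  then show ?case by blast
next
  case (Suc i)
  define f' where "f' = (\<lambda>x. vector_derivative f (at x))"
  have f': "\<And>x. (f has_vector_derivative f' x) (at x)" and f'C: "f' \<in> Ck (enat i)"
    unfolding f'_def by (rule Ck_SucD[OF Suc.prems])+
  obtain \<phi> where \<phi>: "isdd i f' \<phi>" using Suc.IH f'C by blast
  define \<psi> where "\<psi> = (\<lambda>s. integral (cbox 0 1)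
     (\<lambda>u. complex_of_real u ^ i * \<phi> (\<lambda>j. (1 - u) * s 0 + u * s (Suc j))))"
  have "continuous_on UNIV \<psi>"
    unfolding \<psi>_def
  proof (rule integral_continuous_on_param)
    have "continuous_on (UNIV \<times> cbox 0 1) (\<lambda>p::(nat \<Rightarrow> real) \<times> real. \<phi> (\<lambda>j. (1 - snd p) * fst p 0 + snd p * fst p (Suc j)))"
      by (intro continuous_on_substitute_coordinates[OF isdd_continuous[OF \<phi>]] continuous_intros
          continuous_on_product_then_coordinatewise[of _ fst])
    then show "continuous_on (UNIV \<times> cbox 0 1)
       (\<lambda>(s, u). complex_of_real u ^ i * \<phi> (\<lambda>j. (1 - u) * s 0 + u * s (Suc j)))"
      unfolding case_prod_beta by (intro continuous_intros)
  qed
  moreover have "\<psi> s = dd (Suc i) f s" if inj: "inj_on s {..Suc i}" for s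
  proof -
    have f'cont: "continuous_on UNIV f'" using f'C by (rule Ck_continuous)
    have int: "(\<lambda>u. f' ((1 - u) * s 0 + u * x)) integrable_on {0..1}" for x
      by (intro integrable_continuous_interval continuous_on_compose2[OF f'cont] continuous_intros) auto
    have mean: "(f (s 0) - f x) / complex_of_real (s 0 - x) = integral {0..1} (\<lambda>u. f' ((1 - u) * s 0 + u * x))"
      if "x \<noteq> s 0" for x
    proof -
      have "((\<lambda>u. (x - s 0) *\<^sub>R f' ((1 - u) * s 0 + u * x)) has_integral
          (f ((1 - 1) * s 0 + 1 * x) - f ((1 - 0) * s 0 + 0 * x))) {0..1}"
      proof (rule fundamental_theorem_of_calculus)
        fix u :: real
        have "((\<lambda>u. (1 - u) * s 0 + u * x) has_vector_derivative (x - s 0)) (at u within {0..1})"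
          by (auto intro!: derivative_eq_intros simp: algebra_simps)
        from vector_diff_chain_within[OF this has_vector_derivative_at_within[OF f']]
        show "((\<lambda>u. f ((1 - u) * s 0 + u * x)) has_vector_derivative (x - s 0) *\<^sub>R f' ((1 - u) * s 0 + u * x)) (at u within {0..1})"
          by (simp add: o_def)
      qed simp
      then have "integral {0..1} (\<lambda>u. (x - s 0) *\<^sub>R f' ((1 - u) * s 0 + u * x)) = f x - f (s 0)"
        by (rule integral_unique[THEN trans]) simp
      then have *: "complex_of_real (x - s 0) * integral {0..1} (\<lambda>u. f' ((1 - u) * s 0 + u * x)) = f x - f (s 0)"
        by (subst (asm) integral_cmul) (simp only: scaleR_conv_of_real)
      have "complex_of_real (x - s 0) \<noteq> 0" using that by simp
      then have "integral {0..1} (\<lambda>u. f' ((1 - u) * s 0 + u * x)) = (f x - f (s 0)) / complex_of_real (x - s 0)"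
        using * by (simp add: nonzero_eq_divide_eq mult.commute)
      also have "\<dots> = (f (s 0) - f x) / complex_of_real (s 0 - x)"
        using minus_divide_divide[of "f (s 0) - f x" "complex_of_real (s 0 - x)"] by simp
      finally show ?thesis by simp
    qed
    have "dd (Suc i) f s = dd i (\<lambda>x. integral {0..1} (\<lambda>u. f' ((1 - u) * s 0 + u * x))) (\<lambda>j. s (Suc j))"
      unfolding dd_Suc_first
    proof (rule dd_cong, intro conjI refl)
      fix j assume "j \<le> i"
      then have "s (Suc j) \<noteq> s 0" using inj by (auto dest: inj_onD)
      then show "(f (s 0) - f (s (Suc j))) / complex_of_real (s 0 - s (Suc j)) =
        integral {0..1} (\<lambda>u. f' ((1 - u) * s 0 + u * s (Suc j)))" by (rule mean)
    qed
    also have "\<dots> = integral {0..1} (\<lambda>u. dd i (\<lambda>x. f' ((1 - u) * s 0 + u * x)) (\<lambda>j. s (Suc j)))"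
      using dd_integral[of i "\<lambda>u x. f' ((1 - u) * s 0 + u * x)"] int by blast
    also have "\<dots> = \<psi> s"
      unfolding \<psi>_def box_real
    proof (rule integral_spike[of "{0}"])
      fix u :: real assume u: "u \<in> {0..1} - {0}"
      have "inj_on (\<lambda>j. (1 - u) * s 0 + u * s (Suc j)) {..i}"
        using inj u by (auto simp: inj_on_def)
      then have "\<phi> (\<lambda>j. (1 - u) * s 0 + u * s (Suc j)) = dd i f' (\<lambda>j. (1 - u) * s 0 + u * s (Suc j))"
        using \<phi> unfolding isdd_def by blast
      then show "complex_of_real u ^ i * \<phi> (\<lambda>j. (1 - u) * s 0 + u * s (Suc j)) =
          dd i (\<lambda>x. f' ((1 - u) * s 0 + u * x)) (\<lambda>j. s (Suc j))"
        using dd_affine[of u i f' "(1 - u) * s 0" "\<lambda>j. s (Suc j)"] u by simp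
    qed simp
    finally show ?thesis by simp
  qed
  ultimately have "isdd (Suc i) f \<psi>" unfolding isdd_def by blast
  then show ?case by blast
qed

lemma isdd_add: "isdd i f \<phi> \<Longrightarrow> isdd i g \<psi> \<Longrightarrow> isdd i (\<lambda>x. f x + g x) (\<lambda>s. \<phi> s + \<psi> s)"
  unfolding isdd_def by (auto simp: dd_add intro: continuous_intros)

lemma isdd_diff: "isdd i f \<phi> \<Longrightarrow> isdd i g \<psi> \<Longrightarrow> isdd i (\<lambda>x. f x - g x) (\<lambda>s. \<phi> s - \<psi> s)"
  unfolding isdd_def by (auto simp: dd_diff intro: continuous_intros)

lemma isdd_cmult: "isdd i f \<phi> \<Longrightarrow> isdd i (\<lambda>x. c * f x) (\<lambda>s. c * \<phi> s)"
  unfolding isdd_def by (auto simp: dd_cmult intro: continuous_intros)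

lemma isdd_sum:
  "(\<And>a. a \<in> A \<Longrightarrow> isdd i (f a) (\<phi> a)) \<Longrightarrow> isdd i (\<lambda>x. \<Sum>a\<in>A. f a x) (\<lambda>s. \<Sum>a\<in>A. \<phi> a s)"
  unfolding isdd_def by (auto simp: dd_sum intro!: continuous_intros)

lemma isdd_shift:
  assumes "isdd i f \<phi>" shows "isdd i (\<lambda>x. f (x + t)) (\<lambda>s. \<phi> (\<lambda>l. s l + t))"
proof -
  have "continuous_on UNIV (\<lambda>s. \<phi> (\<lambda>l. s l + t))"
    by (intro continuous_on_substitute_coordinates[OF isdd_continuous[OF assms]]
        continuous_on_add continuous_on_product_coordinates continuous_on_const)
  moreover have "dd i (\<lambda>x. f (x + t)) s = dd i f (\<lambda>l. s l + t)" for s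
    using dd_affine[of 1 i f t s] by (simp add: add.commute)
  ultimately show ?thesis using assms unfolding isdd_def by (simp add: inj_on_def)
qed

lemma isdd_mult:
  assumes "\<And>j. j \<le> i \<Longrightarrow> isdd j f (\<phi> j)" and "\<And>j. j \<le> i \<Longrightarrow> isdd j g (\<psi> j)"
  shows "isdd i (\<lambda>x. f x * g x) (\<lambda>s. \<Sum>j\<le>i. \<phi> j s * \<psi> (i - j) (\<lambda>l. s (l + j)))"
  unfolding isdd_def
proof (intro conjI allI impI)
  have "continuous_on UNIV (\<lambda>s. \<psi> (i - j) (\<lambda>l. s (l + j)))" for j
    by (intro continuous_on_substitute_coordinates[OF isdd_continuous[OF assms(2)]]
        continuous_on_product_coordinates) simp
  then show "continuous_on UNIV (\<lambda>s. \<Sum>j\<le>i. \<phi> j s * \<psi> (i - j) (\<lambda>l. s (l + j)))"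
    using assms(1) unfolding isdd_def by (intro continuous_intros) auto
  fix s :: "nat \<Rightarrow> real" assume s: "inj_on s {..i}"
  show "(\<Sum>j\<le>i. \<phi> j s * \<psi> (i - j) (\<lambda>l. s (l + j))) = dd i (\<lambda>x. f x * g x) s"
    unfolding dd_mult[OF s]
  proof (intro sum.cong refl arg_cong2[of _ _ _ _ "(*)"])
    fix j assume j: "j \<in> {..i}"
    have "inj_on s {..j}" using s by (rule inj_on_subset) (use j in auto)
    then show "\<phi> j s = dd j f s" using assms(1)[of j] j unfolding isdd_def by auto
    have "inj_on (\<lambda>l. s (l + j)) {..i - j}"
    proof (rule inj_onI)
      fix x y assume "x \<in> {..i - j}" "y \<in> {..i - j}" "s (x + j) = s (y + j)"
      then show "x = y" using inj_onD[OF s, of "x + j" "y + j"] j by auto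
    qed
    then show "\<psi> (i - j) (\<lambda>l. s (l + j)) = dd (i - j) g (\<lambda>l. s (l + j))"
      using assms(2)[of "i - j"] j unfolding isdd_def by auto
  qed
qed


section \<open>Explicit tensor decompositions\<close>

text \<open>An explicit witness for \<^const>\<open>varopoulos_family\<close> being at most \<open>c\<close>. The factors are normalized to
  norm at most \<open>1\<close> and the coefficients collected in \<open>a\<close>, which turns the norm of an expansion into
  an ordinary series. Stating bounds instead of a norm avoids infima altogether.\<close>

definition tensor_le :: "real \<Rightarrow> nat \<Rightarrow> ((nat \<Rightarrow> real) \<Rightarrow> complex) \<Rightarrow> real \<Rightarrow> bool" where
  "tensor_le r m \<phi> c \<longleftrightarrow> (\<exists>(a :: nat \<Rightarrow> complex) F.
     (\<forall>l<m. \<forall>n. continuous_on {-r..r} (F l n) \<and> (\<forall>t\<in>{-r..r}. cmod (F l n t) \<le> 1)) \<and>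
     summable (\<lambda>n. cmod (a n)) \<and> (\<Sum>n. cmod (a n)) \<le> c \<and>
     (\<forall>s\<in>cylinder r m. (\<lambda>n. a n * (\<Prod>l<m. F l n (s l))) sums \<phi> s))"

lemma tensor_le_mono: "tensor_le r m \<phi> c \<Longrightarrow> c \<le> d \<Longrightarrow> tensor_le r m \<phi> d"
  unfolding tensor_le_def by (elim exE conjE, intro exI conjI, assumption+) auto

lemma cylinder_prod_le_1:
  assumes "\<And>l t. l < m \<Longrightarrow> t \<in> {-r..r} \<Longrightarrow> cmod (F l t) \<le> 1" and "s \<in> cylinder r m"
  shows "cmod (\<Prod>l<m. F l (s l)) \<le> 1"
proof -
  have "(\<Prod>l<m. cmod (F l (s l))) \<le> 1"
    by (rule prod_le_1) (use assms in \<open>auto simp: cylinder_def abs_le_iff intro!: assms(1)\<close>)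
  then show ?thesis by (simp add: prod_norm)
qed

lemma tensor_le_nonneg: "tensor_le r m \<phi> c \<Longrightarrow> 0 \<le> c"
  unfolding tensor_le_def by (elim exE conjE) (rule order_trans[OF suminf_nonneg], auto)

lemma tensor_le_bound:
  assumes "tensor_le r m \<phi> c" "s \<in> cylinder r m" shows "cmod (\<phi> s) \<le> c"
proof -
  obtain a :: "nat \<Rightarrow> complex" and F where
    F: "\<And>l n t. l < m \<Longrightarrow> t \<in> {-r..r} \<Longrightarrow> cmod (F l n t) \<le> 1"
    and a: "summable (\<lambda>n. cmod (a n))" "(\<Sum>n. cmod (a n)) \<le> c"
    and s: "(\<lambda>n. a n * (\<Prod>l<m. F l n (s l))) sums \<phi> s"
    using assms unfolding tensor_le_def by blast
  have le: "cmod (a n * (\<Prod>l<m. F l n (s l))) \<le> cmod (a n)" for n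
    using mult_left_mono[OF cylinder_prod_le_1[where F="\<lambda>l. F l n", OF F assms(2)], of "cmod (a n)"]
    by (simp add: norm_mult)
  then have "cmod (\<phi> s) \<le> (\<Sum>n. cmod (a n))"
    using norm_suminf_le[OF le a(1)] s by (simp add: sums_iff)
  with a(2) show ?thesis by simp
qed

text \<open>Countable sums and products of expansions are both double series; enumerating the index pairs
  turns such a series into a single expansion.\<close>

lemma tensor_le_Sigma:
  fixes a :: "nat \<Rightarrow> nat \<Rightarrow> complex"
  assumes F: "\<And>l n k. l < m \<Longrightarrow> continuous_on {-r..r} (F l n k)"
    "\<And>l n k t. l < m \<Longrightarrow> t \<in> {-r..r} \<Longrightarrow> cmod (F l n k t) \<le> 1"
    and a: "\<And>n. summable (\<lambda>k. cmod (a n k))" "\<And>n. (\<Sum>k. cmod (a n k)) \<le> C n"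
    and C: "summable C" "suminf C \<le> c"
    and g: "\<And>s n. s \<in> cylinder r m \<Longrightarrow> (\<lambda>k. a n k * (\<Prod>l<m. F l n k (s l))) sums g s n"
      "\<And>s. s \<in> cylinder r m \<Longrightarrow> g s sums \<phi> s"
  shows "tensor_le r m \<phi> c"
proof -
  have rows: "((\<lambda>k. cmod (a n k)) has_sum (\<Sum>k. cmod (a n k))) UNIV" for n
    by (rule norm_summable_imp_has_sum) (use a in \<open>auto simp: summable_sums\<close>)
  have C0: "0 \<le> (\<Sum>k. cmod (a n k))" for n by (intro suminf_nonneg a) auto
  have Cs: "summable (\<lambda>n. \<Sum>k. cmod (a n k))"
    by (rule summable_comparison_test'[OF C(1)]) (use a(2) C0 in auto)
  have abs: "(\<lambda>p. cmod (a (fst p) (snd p))) summable_on (UNIV \<times> UNIV)"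
  proof (subst Infinite_Sum.abs_summable_on_Sigma_iff, intro conjI ballI)
    fix n show "(\<lambda>k. cmod (a (fst (n, k)) (snd (n, k)))) summable_on UNIV"
      using rows[of n] by (auto simp: summable_on_def)
    have "(\<lambda>n. \<Sum>k. cmod (a n k)) summable_on UNIV"
      using Cs C0 by (intro norm_summable_imp_summable_on) simp
    then show "(\<lambda>n. norm (infsum (\<lambda>k. cmod (a (fst (n, k)) (snd (n, k)))) UNIV)) summable_on UNIV"
      using C0 by (simp add: infsumI[OF rows])
  qed
  define T where "T = infsum (\<lambda>(n, k). cmod (a n k)) (UNIV \<times> UNIV)"
  have T: "((\<lambda>(n, k). cmod (a n k)) has_sum T) (UNIV \<times> UNIV)"
    unfolding T_def using abs by (intro has_sum_infsum) (simp add: case_prod_beta')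
  have bij: "bij_betw prod_decode UNIV (UNIV \<times> UNIV)" using bij_prod_decode by simp
  let ?a = "\<lambda>p. a (fst (prod_decode p)) (snd (prod_decode p))"
  have "((\<lambda>p. cmod (?a p)) has_sum T) UNIV"
    using T has_sum_reindex_bij_betw[OF bij, of "\<lambda>(n, k). cmod (a n k)" T] by (simp add: case_prod_beta)
  then have sumT: "(\<lambda>p. cmod (?a p)) sums T" by (rule has_sum_imp_sums)
  have "((\<lambda>n. \<Sum>k. cmod (a n k)) has_sum T) UNIV"
    by (rule has_sum_SigmaD[OF T]) (use rows in auto)
  then have "T = (\<Sum>n. \<Sum>k. cmod (a n k))" by (intro sums_unique has_sum_imp_sums)
  also have "\<dots> \<le> suminf C" by (intro suminf_le a Cs C)
  finally have Tc: "T \<le> c" using C(2) by simp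
  have "(\<lambda>p. ?a p * (\<Prod>l<m. F l (fst (prod_decode p)) (snd (prod_decode p)) (s l))) sums \<phi> s"
    if s: "s \<in> cylinder r m" for s
  proof -
    define h where "h = (\<lambda>(n, k). a n k * (\<Prod>l<m. F l n k (s l)))"
    have hle: "norm (h p) \<le> norm (cmod (a (fst p) (snd p)))" for p
      using mult_left_mono[OF cylinder_prod_le_1[where F="\<lambda>l. F l (fst p) (snd p)", OF F(2) s], of "cmod (a (fst p) (snd p))"]
      by (simp add: norm_mult h_def case_prod_beta)
    have "(\<lambda>p. norm (h p)) summable_on (UNIV \<times> UNIV)"
      by (rule Infinite_Sum.abs_summable_on_comparison_test[of "\<lambda>p. cmod (a (fst p) (snd p))"])
         (use abs hle in auto)
    then have hs: "(h has_sum infsum h (UNIV \<times> UNIV)) (UNIV \<times> UNIV)"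
      by (rule has_sum_infsum[OF Infinite_Sum.abs_summable_summable])
    have "(g s has_sum infsum h (UNIV \<times> UNIV)) UNIV"
    proof (rule has_sum_SigmaD[OF hs])
      fix n
      have "(\<lambda>k. norm (h (n, k))) summable_on UNIV"
      proof (rule Infinite_Sum.abs_summable_on_comparison_test)
        show "(\<lambda>k. norm (cmod (a n k))) summable_on UNIV"
          using rows[of n] by (auto simp: summable_on_def)
        show "norm (h (n, k)) \<le> norm (cmod (a n k))" for k using hle[of "(n, k)"] by simp
      qed
      then have "((\<lambda>k. h (n, k)) has_sum infsum (\<lambda>k. h (n, k)) UNIV) UNIV"
        by (rule has_sum_infsum[OF Infinite_Sum.abs_summable_summable])
      moreover have "infsum (\<lambda>k. h (n, k)) UNIV = g s n"
        using has_sum_imp_sums[OF calculation] g(1)[OF s, of n] unfolding h_def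
        by (auto intro: sums_unique2)
      ultimately show "((\<lambda>k. h (n, k)) has_sum g s n) UNIV" by simp
    qed
    then have "infsum h (UNIV \<times> UNIV) = \<phi> s"
      using has_sum_imp_sums g(2)[OF s] sums_unique2 by blast
    then have "((\<lambda>p. h (prod_decode p)) has_sum \<phi> s) UNIV"
      using hs has_sum_reindex_bij_betw[OF bij, of h] by simp
    then show ?thesis
      by (auto simp: h_def case_prod_beta dest: has_sum_imp_sums)
  qed
  then show ?thesis
    unfolding tensor_le_def using F sumT Tc
    by (intro exI[of _ ?a] exI[of _ "\<lambda>l p. F l (fst (prod_decode p)) (snd (prod_decode p))"])
       (auto simp: sums_iff)
qed

lemma tensor_le_sums:
  assumes "\<And>n. tensor_le r m (\<phi> n) (C n)" and "summable C" and "\<And>s. s \<in> cylinder r m \<Longrightarrow> (\<lambda>n. \<phi> n s) sums \<psi> s"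
  shows "tensor_le r m \<psi> (suminf C)"
proof -
  have "\<forall>n. \<exists>a F. (\<forall>l<m. \<forall>k. continuous_on {-r..r} (F l k) \<and> (\<forall>t\<in>{-r..r}. cmod (F l k t) \<le> 1)) \<and>
     summable (\<lambda>k. cmod (a k)) \<and> (\<Sum>k. cmod (a k)) \<le> C n \<and>
     (\<forall>s\<in>cylinder r m. (\<lambda>k. a k * (\<Prod>l<m. F l k (s l))) sums \<phi> n s)"
    using assms(1) unfolding tensor_le_def by simp
  from choice[OF this] obtain a where
    "\<forall>n. \<exists>F. (\<forall>l<m. \<forall>k. continuous_on {-r..r} (F l k) \<and> (\<forall>t\<in>{-r..r}. cmod (F l k t) \<le> 1)) \<and>
     summable (\<lambda>k. cmod (a n k)) \<and> (\<Sum>k. cmod (a n k)) \<le> C n \<and>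
     (\<forall>s\<in>cylinder r m. (\<lambda>k. a n k * (\<Prod>l<m. F l k (s l))) sums \<phi> n s)" by blast
  from choice[OF this] obtain F where
    *: "\<forall>n. (\<forall>l<m. \<forall>k. continuous_on {-r..r} (F n l k) \<and> (\<forall>t\<in>{-r..r}. cmod (F n l k t) \<le> 1)) \<and>
     summable (\<lambda>k. cmod (a n k)) \<and> (\<Sum>k. cmod (a n k)) \<le> C n \<and>
     (\<forall>s\<in>cylinder r m. (\<lambda>k. a n k * (\<Prod>l<m. F n l k (s l))) sums \<phi> n s)"
    by blast
  have F: "\<And>l n k. l < m \<Longrightarrow> continuous_on {-r..r} (F n l k)"
    "\<And>l n k t. l < m \<Longrightarrow> t \<in> {-r..r} \<Longrightarrow> cmod (F n l k t) \<le> 1"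
    using *[THEN spec, THEN conjunct1] by blast+
  have a: "\<And>n. summable (\<lambda>k. cmod (a n k))" "\<And>n. (\<Sum>k. cmod (a n k)) \<le> C n"
    and s: "\<And>s n. s \<in> cylinder r m \<Longrightarrow> (\<lambda>k. a n k * (\<Prod>l<m. F n l k (s l))) sums \<phi> n s"
    using *[THEN spec, THEN conjunct2] by blast+
  show ?thesis
    by (rule tensor_le_Sigma[where F="\<lambda>l n. F n l" and g="\<lambda>s n. \<phi> n s", OF F a assms(2) order_refl s assms(3)])
qed

lemma tensor_le_elementary:
  assumes f: "\<And>l. l < m \<Longrightarrow> continuous_on {-r..r} (f l)"
    and K: "\<And>l t. l < m \<Longrightarrow> t \<in> {-r..r} \<Longrightarrow> cmod (f l t) \<le> K l" and K0: "\<And>l. l < m \<Longrightarrow> 0 \<le> K l"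
  shows "tensor_le r m (\<lambda>s. \<Prod>l<m. f l (s l)) (\<Prod>l<m. K l)"
proof -
  define a where "a = (\<lambda>n::nat. if n = 0 then complex_of_real (\<Prod>l<m. K l) else 0)"
  have sums: "(\<lambda>n. if n = 0 then x else (0::'a::real_normed_vector)) sums x" for x
    using sums_single[of 0 "\<lambda>_. x"] by simp
  have ca: "(\<lambda>n. cmod (a n)) = (\<lambda>n. if n = 0 then \<bar>\<Prod>l<m. K l\<bar> else 0)"
    by (rule ext) (simp only: a_def if_distrib[of cmod] norm_of_real norm_zero)
  have P0: "0 \<le> (\<Prod>l<m. K l)" using K0 by (intro prod_nonneg) auto
  show ?thesis unfolding tensor_le_def
  proof (intro exI[of _ a] exI[of _ "\<lambda>l n t. f l t / complex_of_real (K l)"] conjI allI impI ballI)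
    fix l t n assume l: "l < m"
    show "continuous_on {- r..r} (\<lambda>t. f l t / complex_of_real (K l))"
      unfolding divide_inverse by (intro continuous_intros f l)
    assume "t \<in> {-r..r}"
    then show "cmod (f l t / complex_of_real (K l)) \<le> 1"
      using K[OF l] K0[OF l] by (cases "K l = 0") (auto simp: norm_divide divide_le_eq)
  next
    show "summable (\<lambda>n. cmod (a n))" unfolding ca using sums by (auto simp: sums_iff)
    show "(\<Sum>n. cmod (a n)) \<le> (\<Prod>l<m. K l)"
      unfolding ca using sums[of "\<bar>\<Prod>l<m. K l\<bar>"] P0 by (auto simp: sums_iff)
    fix s assume s: "s \<in> cylinder r m"
    have "complex_of_real (K l) * (f l (s l) / complex_of_real (K l)) = f l (s l)" if "l < m" for l
      using K[OF that, of "s l"] s that by (cases "K l = 0") (auto simp: cylinder_def abs_le_iff)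
    then have "complex_of_real (\<Prod>l<m. K l) * (\<Prod>l<m. f l (s l) / complex_of_real (K l)) = (\<Prod>l<m. f l (s l))"
      unfolding of_real_prod prod.distrib[symmetric] by (intro prod.cong) auto
    then have "(\<lambda>n. a n * (\<Prod>l<m. f l (s l) / complex_of_real (K l))) =
        (\<lambda>n. if n = 0 then (\<Prod>l<m. f l (s l)) else 0)"
      by (auto simp: a_def)
    then show "(\<lambda>n. a n * (\<Prod>l<m. f l (s l) / complex_of_real (K l))) sums (\<Prod>l<m. f l (s l))"
      using sums by simp
  qed
qed

lemma tensor_le_cmult: assumes "tensor_le r m \<phi> c" shows "tensor_le r m (\<lambda>s. z * \<phi> s) (cmod z * c)"
proof -
  obtain a :: "nat \<Rightarrow> complex" and F where
    F: "\<forall>l<m. \<forall>n. continuous_on {-r..r} (F l n) \<and> (\<forall>t\<in>{-r..r}. cmod (F l n t) \<le> 1)"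
    and a: "summable (\<lambda>n. cmod (a n))" "(\<Sum>n. cmod (a n)) \<le> c"
    and s: "\<forall>s\<in>cylinder r m. (\<lambda>n. a n * (\<Prod>l<m. F l n (s l))) sums \<phi> s"
    using assms unfolding tensor_le_def by blast
  show ?thesis unfolding tensor_le_def
    by (intro exI[of _ "\<lambda>n. z * a n"] exI[of _ F] conjI)
       (use F a s in \<open>auto simp: norm_mult suminf_mult mult.assoc
          intro!: summable_mult mult_left_mono sums_mult\<close>)
qed

lemma tensor_le_zero: "tensor_le r m (\<lambda>s. 0) 0"
  unfolding tensor_le_def by (intro exI[of _ "\<lambda>n. 0"] exI[of _ "\<lambda>l n t. 0"]) auto

lemma tensor_le_add:
  assumes "tensor_le r m \<phi> c" "tensor_le r m \<psi> d" shows "tensor_le r m (\<lambda>s. \<phi> s + \<psi> s) (c + d)"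
proof -
  have two: "(\<lambda>n. if n = 0 then x else if n = Suc 0 then y else (0::'a::real_normed_vector)) sums (x + y)" for x y
    using sums_finite[of "{0, Suc 0}" "\<lambda>n. if n = 0 then x else if n = Suc 0 then y else 0"] by simp
  have "tensor_le r m (\<lambda>s. \<phi> s + \<psi> s) (suminf (\<lambda>n. if n = 0 then c else if n = Suc 0 then d else 0))"
  proof (rule tensor_le_sums[where \<phi>="\<lambda>n. if n = 0 then \<phi> else if n = Suc 0 then \<psi> else (\<lambda>s. 0)"])
    show "summable (\<lambda>n. if n = 0 then c else if n = Suc 0 then d else 0)"
      using two[of c d] by (simp add: sums_iff)
    show "(\<lambda>n. (if n = 0 then \<phi> else if n = Suc 0 then \<psi> else (\<lambda>s. 0)) s) sums (\<phi> s + \<psi> s)" for s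
      using two[of "\<phi> s" "\<psi> s"] by (simp add: if_distrib[of "\<lambda>f. f s"] cong: if_cong)
  qed (use assms tensor_le_zero in auto)
  then show ?thesis using two[of c d] by (simp add: sums_iff)
qed

lemma tensor_le_sum:
  assumes "\<And>a. a \<in> A \<Longrightarrow> tensor_le r m (\<phi> a) (c a)" shows "tensor_le r m (\<lambda>s. \<Sum>a\<in>A. \<phi> a s) (\<Sum>a\<in>A. c a)"
  using assms by (induction A rule: infinite_finite_induct) (auto intro: tensor_le_zero tensor_le_add)

text \<open>The product of two functions sharing one variable, the shape of the terms in the Leibniz rule: the
  factors in the common variable \<open>s j\<close> are multiplied.\<close>

lemma tensor_le_shared_mult:
  assumes \<phi>: "tensor_le r (Suc j) \<phi> c" and \<psi>: "tensor_le r (Suc k) \<psi> d"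
  shows "tensor_le r (Suc (j + k)) (\<lambda>s. \<phi> s * \<psi> (\<lambda>l. s (l + j))) (c * d)"
proof -
  obtain a :: "nat \<Rightarrow> complex" and F where
    F: "\<And>l n. l < Suc j \<Longrightarrow> continuous_on {-r..r} (F l n)"
    "\<And>l n t. l < Suc j \<Longrightarrow> t \<in> {-r..r} \<Longrightarrow> cmod (F l n t) \<le> 1"
    and a: "summable (\<lambda>n. cmod (a n))" "(\<Sum>n. cmod (a n)) \<le> c"
    and \<phi>s: "\<And>s. s \<in> cylinder r (Suc j) \<Longrightarrow> (\<lambda>n. a n * (\<Prod>l<Suc j. F l n (s l))) sums \<phi> s"
    using \<phi> unfolding tensor_le_def by blast
  obtain b :: "nat \<Rightarrow> complex" and G where
    G: "\<And>l n. l < Suc k \<Longrightarrow> continuous_on {-r..r} (G l n)"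
    "\<And>l n t. l < Suc k \<Longrightarrow> t \<in> {-r..r} \<Longrightarrow> cmod (G l n t) \<le> 1"
    and b: "summable (\<lambda>n. cmod (b n))" "(\<Sum>n. cmod (b n)) \<le> d"
    and \<psi>s: "\<And>s. s \<in> cylinder r (Suc k) \<Longrightarrow> (\<lambda>n. b n * (\<Prod>l<Suc k. G l n (s l))) sums \<psi> s"
    using \<psi> unfolding tensor_le_def by blast
  define H where "H = (\<lambda>l n p t. (if l \<le> j then F l n t else 1) * (if j \<le> l then G (l - j) p t else 1))"
  have prodH: "(\<Prod>l<Suc (j + k). H l n p (s l)) =
      (\<Prod>l<Suc j. F l n (s l)) * (\<Prod>l<Suc k. G l p (s (l + j)))" for n p and s :: "nat \<Rightarrow> real"
  proof -
    have "(\<Prod>l<Suc (j + k). if l \<le> j then F l n (s l) else 1) = (\<Prod>l<Suc j. F l n (s l))"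
      by (rule prod.mono_neutral_cong_right) auto
    moreover have "(\<Prod>l<Suc (j + k). if j \<le> l then G (l - j) p (s l) else 1) =
        (\<Prod>l\<in>{j..<Suc k + j}. G (l - j) p (s l))"
      by (rule prod.mono_neutral_cong_right) auto
    moreover have "(\<Prod>l\<in>{0 + j..<Suc k + j}. G (l - j) p (s l)) = (\<Prod>l<Suc k. G l p (s (l + j)))"
      by (subst prod.shift_bounds_nat_ivl) (simp add: atLeast0LessThan)
    ultimately show ?thesis unfolding H_def prod.distrib by simp
  qed
  show ?thesis
  proof (rule tensor_le_Sigma[where F=H and a="\<lambda>n p. a n * b p" and C="\<lambda>n. cmod (a n) * d" and
        g="\<lambda>s n. a n * (\<Prod>l<Suc j. F l n (s l)) * \<psi> (\<lambda>l. s (l + j))"])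
    fix l n p assume l: "l < Suc (j + k)"
    show "continuous_on {-r..r} (H l n p)" unfolding H_def
      by (cases "l \<le> j"; cases "j \<le> l") (use l in \<open>auto intro!: continuous_intros F G\<close>)
    fix t assume t: "t \<in> {-r..r}"
    have "cmod (if l \<le> j then F l n t else 1) * cmod (if j \<le> l then G (l - j) p t else 1) \<le> 1 * 1"
      by (intro mult_mono) (use l t F(2)[of l t n] G(2)[of "l - j" t p] in auto)
    then show "cmod (H l n p t) \<le> 1" by (simp add: H_def norm_mult)
  next
    fix n
    show "summable (\<lambda>k. cmod (a n * b k))" using b by (simp add: norm_mult summable_mult)
    show "(\<Sum>k. cmod (a n * b k)) \<le> cmod (a n) * d"
      using b by (simp add: norm_mult suminf_mult mult_left_mono)
  next
    show "summable (\<lambda>n. cmod (a n) * d)" using a by (simp add: summable_mult2)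
    show "(\<Sum>n. cmod (a n) * d) \<le> c * d"
      using a tensor_le_nonneg[OF \<psi>] by (simp add: suminf_mult2[symmetric] mult_right_mono)
  next
    fix s n assume s: "s \<in> cylinder r (Suc (j + k))"
    have sj: "s \<in> cylinder r (Suc j)" and sk: "(\<lambda>l. s (l + j)) \<in> cylinder r (Suc k)"
      using s by (auto simp: cylinder_def)
    show "(\<lambda>p. a n * b p * (\<Prod>l<Suc (j + k). H l n p (s l))) sums
        (a n * (\<Prod>l<Suc j. F l n (s l)) * \<psi> (\<lambda>l. s (l + j)))"
      using sums_mult[OF \<psi>s[OF sk], of "a n * (\<Prod>l<Suc j. F l n (s l))"]
      unfolding prodH by (simp only: ac_simps)
    show "(\<lambda>n. a n * (\<Prod>l<Suc j. F l n (s l)) * \<psi> (\<lambda>l. s (l + j))) sums (\<phi> s * \<psi> (\<lambda>l. s (l + j)))"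
      by (rule sums_mult2[OF \<phi>s[OF sj]])
  qed
qed

lemma prod_ennreal_le_1:
  fixes g :: "nat \<Rightarrow> ennreal"
  shows "(\<And>l. l < m \<Longrightarrow> g l \<le> 1) \<Longrightarrow> (\<Prod>l<m. g l) \<le> 1"
proof (induction m)
  case (Suc m)
  then have "(\<Prod>l<m. g l) * g m \<le> 1 * 1" by (intro mult_mono) auto
  then show ?case by (simp add: mult.commute)
qed simp

lemma tensor_le_imp_varopoulos_le:
  assumes \<phi>: "tensor_le r (Suc m) \<phi> c"
  shows "varopoulos_family r (Suc m) (restr (cube r (Suc m)) \<phi>) \<le> ennreal c"
proof -
  obtain a :: "nat \<Rightarrow> complex" and F where
    F: "\<And>l n. l < Suc m \<Longrightarrow> continuous_on {-r..r} (F l n)"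
    "\<And>l n t. l < Suc m \<Longrightarrow> t \<in> {-r..r} \<Longrightarrow> cmod (F l n t) \<le> 1"
    and a: "summable (\<lambda>n. cmod (a n))" "(\<Sum>n. cmod (a n)) \<le> c"
    and \<phi>s: "\<And>s. s \<in> cylinder r (Suc m) \<Longrightarrow> (\<lambda>n. a n * (\<Prod>l<Suc m. F l n (s l))) sums \<phi> s"
    using \<phi> unfolding tensor_le_def by blast
  define f where "f = (\<lambda>l n t. if l = (0::nat) then a n * F l n t else F l n t)"
  have prodf: "(\<Prod>l<Suc m. f l n (s l)) = a n * (\<Prod>l<Suc m. F l n (s l))" for n and s :: "nat \<Rightarrow> real"
    unfolding prod.lessThan_Suc_shift by (simp add: f_def)
  have le: "(\<Prod>l<Suc m. SUP t\<in>{-r..r}. ennreal (cmod (f l n t))) \<le> ennreal (cmod (a n))" for n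
  proof -
    have "(SUP t\<in>{-r..r}. ennreal (cmod (f 0 n t))) \<le> ennreal (cmod (a n))"
      using F(2)[of 0] by (intro SUP_least ennreal_leI) (auto simp: f_def norm_mult mult_left_le)
    moreover have "(\<Prod>l<m. SUP t\<in>{-r..r}. ennreal (cmod (f (Suc l) n t))) \<le> 1"
      using F(2) by (intro prod_ennreal_le_1 SUP_least) (auto simp: f_def)
    ultimately have "(SUP t\<in>{-r..r}. ennreal (cmod (f 0 n t))) *
        (\<Prod>l<m. SUP t\<in>{-r..r}. ennreal (cmod (f (Suc l) n t))) \<le> ennreal (cmod (a n)) * 1"
      by (intro mult_mono) auto
    then show ?thesis unfolding prod.lessThan_Suc_shift by simp
  qed
  define S where "S = (\<Sum>n. \<Prod>l<Suc m. SUP t\<in>{-r..r}. ennreal (cmod (f l n t)))"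
  have "S \<le> (\<Sum>n. ennreal (cmod (a n)))" unfolding S_def by (intro suminf_le le) auto
  also have "\<dots> = ennreal (\<Sum>n. cmod (a n))" using a by (intro suminf_ennreal2) auto
  also have "\<dots> \<le> ennreal c" using a by (intro ennreal_leI)
  finally have S: "S \<le> ennreal c" .
  have "varopoulos_family r (Suc m) (restr (cube r (Suc m)) \<phi>) \<le> S"
    unfolding varopoulos_family_def
  proof (rule Inf_lower, rule CollectI, intro exI[of _ f] conjI allI impI ballI)
    show "continuous_on {- r..r} (f l n)" if "l < Suc m" for l n
      using F(1)[OF that] unfolding f_def by (cases "l = 0") (auto intro!: continuous_intros)
    show "S = (\<Sum>n. \<Prod>l<Suc m. SUP t\<in>{-r..r}. ennreal (cmod (f l n t)))" by (simp add: S_def)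
    show "S < \<infinity>" using S by (simp add: order_le_less_trans)
    fix s assume s: "s \<in> cube r (Suc m)"
    then have "s \<in> cylinder r (Suc m)" by (auto simp: cube_def cylinder_def abs_le_iff)
    from \<phi>s[OF this] show "(\<lambda>n. \<Prod>l<Suc m. f l n (s l)) sums restr (cube r (Suc m)) \<phi> s"
      using s unfolding prodf by (simp add: restr_def)
  qed
  with S show ?thesis by simp
qed

section \<open>Norms of divided differences\<close>

definition dd_le :: "real \<Rightarrow> nat \<Rightarrow> (real \<Rightarrow> complex) \<Rightarrow> real \<Rightarrow> bool" where
  "dd_le r i f c \<longleftrightarrow> (\<exists>\<phi>. isdd i f \<phi> \<and> tensor_le r (Suc i) \<phi> c)"

lemma dd_le_mono: "dd_le r i f c \<Longrightarrow> c \<le> d \<Longrightarrow> dd_le r i f d"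
  unfolding dd_le_def using tensor_le_mono by blast

lemma dd_le_nonneg: "dd_le r i f c \<Longrightarrow> 0 \<le> c"
  unfolding dd_le_def using tensor_le_nonneg by blast

lemma dd_le_add: "dd_le r i f c \<Longrightarrow> dd_le r i g d \<Longrightarrow> dd_le r i (\<lambda>x. f x + g x) (c + d)"
  unfolding dd_le_def using isdd_add tensor_le_add by blast

lemma dd_le_cmult: "dd_le r i f c \<Longrightarrow> dd_le r i (\<lambda>x. z * f x) (cmod z * c)"
  unfolding dd_le_def using isdd_cmult tensor_le_cmult by blast

lemma isdd_const_0: "isdd i (\<lambda>x. 0) (\<lambda>s. 0)"
  unfolding isdd_def using dd_cmult[of i 0 "\<lambda>_. 0"] by auto

lemma dd_le_zero: "dd_le r i (\<lambda>x. 0) 0"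
  unfolding dd_le_def by (intro exI[of _ "\<lambda>s. 0"] conjI isdd_const_0 tensor_le_zero)

lemma dd_le_0:
  assumes "continuous_on UNIV f" and "\<And>x. \<bar>x\<bar> \<le> r \<Longrightarrow> cmod (f x) \<le> c" and "0 \<le> c"
  shows "dd_le r 0 f c"
proof -
  have "isdd 0 f (\<lambda>s. f (s 0))" using assms(1) unfolding isdd_def
    by (auto intro: continuous_on_compose2[of UNIV f])
  moreover have "tensor_le r (Suc 0) (\<lambda>s. \<Prod>l<Suc 0. f (s l)) (\<Prod>l<Suc 0. c)"
    using assms by (intro tensor_le_elementary) (auto intro: continuous_on_subset)
  ultimately show ?thesis unfolding dd_le_def by auto
qed

lemma dd_le_mult:
  assumes "\<And>j. j \<le> i \<Longrightarrow> dd_le r j f (c j)" and "\<And>j. j \<le> i \<Longrightarrow> dd_le r j g (d j)"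
  shows "dd_le r i (\<lambda>x. f x * g x) (\<Sum>j\<le>i. c j * d (i - j))"
proof -
  obtain \<phi> where \<phi>: "\<And>j. j \<le> i \<Longrightarrow> isdd j f (\<phi> j)" "\<And>j. j \<le> i \<Longrightarrow> tensor_le r (Suc j) (\<phi> j) (c j)"
    using assms(1) unfolding dd_le_def by metis
  obtain \<psi> where \<psi>: "\<And>j. j \<le> i \<Longrightarrow> isdd j g (\<psi> j)" "\<And>j. j \<le> i \<Longrightarrow> tensor_le r (Suc j) (\<psi> j) (d j)"
    using assms(2) unfolding dd_le_def by metis
  have "tensor_le r (Suc i) (\<lambda>s. \<phi> j s * \<psi> (i - j) (\<lambda>l. s (l + j))) (c j * d (i - j))" if "j \<le> i" for j
    using tensor_le_shared_mult[OF \<phi>(2)[OF that] \<psi>(2)[of "i - j"]] that by simp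
  then have "tensor_le r (Suc i) (\<lambda>s. \<Sum>j\<le>i. \<phi> j s * \<psi> (i - j) (\<lambda>l. s (l + j))) (\<Sum>j\<le>i. c j * d (i - j))"
    by (intro tensor_le_sum) auto
  then show ?thesis using isdd_mult[of i f \<phi> g \<psi>] \<phi>(1) \<psi>(1) unfolding dd_le_def by blast
qed

text \<open>The sum is only assumed to converge pointwise to \<open>f\<close> on \<open>[-r,r]\<close>; the divided differences
  then converge at distinct nodes, and uniformly thanks to the norm bounds.\<close>

lemma dd_le_sums:
  assumes r: "0 < r" and f: "isdd i f \<phi>" and h: "\<And>n. dd_le r i (h n) (c n)" and c: "summable c"
    and s: "\<And>x. \<bar>x\<bar> \<le> r \<Longrightarrow> (\<lambda>n. h n x) sums f x"
  shows "dd_le r i f (suminf c)"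
proof -
  obtain \<eta> where \<eta>: "\<And>n. isdd i (h n) (\<eta> n)" "\<And>n. tensor_le r (Suc i) (\<eta> n) (c n)"
    using h unfolding dd_le_def by metis
  let ?B = "cylinder r (Suc i)"
  have le: "cmod (\<eta> n s) \<le> c n" if "s \<in> ?B" for n s using tensor_le_bound[OF \<eta>(2) that] .
  have "uniform_limit ?B (\<lambda>N s. \<Sum>n<N. \<eta> n s) (\<lambda>s. \<Sum>n. \<eta> n s) sequentially"
    by (rule Weierstrass_m_test[OF le c])
  then have cont: "continuous_on ?B (\<lambda>s. \<Sum>n. \<eta> n s)"
    by (rule uniform_limit_theorem[rotated])
       (auto intro!: always_eventually continuous_on_sum isdd_continuous[OF \<eta>(1)])
  have eq: "\<phi> s = (\<Sum>n. \<eta> n s)" if "s \<in> ?B" for s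
  proof (rule isdd_eq_on[OF isdd_continuous[OF f] cont _ _ that, where i=i and r=r])
    show "?B = UNIV \<or> ?B = Rn (Suc i) \<or> 0 < r \<and> (?B = cylinder r (Suc i) \<or> ?B = cube r (Suc i))"
      using r by simp
    fix s assume s': "s \<in> ?B" "inj_on s {..i}"
    have "(\<lambda>N. dd i (\<lambda>x. \<Sum>n<N. h n x) s) \<longlonglongrightarrow> dd i f s"
      by (rule dd_tendsto) (use s s'(1) in \<open>auto simp: cylinder_def sums_def\<close>)
    then have "(\<lambda>n. dd i (h n) s) sums dd i f s" by (simp add: dd_sum sums_def)
    then show "\<phi> s = (\<Sum>n. \<eta> n s)" using \<eta>(1) f s'(2) by (auto simp: isdd_def sums_iff)
  qed
  have "tensor_le r (Suc i) \<phi> (suminf c)"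
  proof (rule tensor_le_sums[OF \<eta>(2) c])
    fix s assume s: "s \<in> ?B"
    have "summable (\<lambda>n. \<eta> n s)" by (rule summable_comparison_test'[OF c le[OF s]])
    then show "(\<lambda>n. \<eta> n s) sums \<phi> s" using eq[OF s] by (simp add: summable_sums)
  qed
  then show ?thesis using f unfolding dd_le_def by blast
qed

definition smooth_le :: "real \<Rightarrow> nat \<Rightarrow> (real \<Rightarrow> complex) \<Rightarrow> real \<Rightarrow> bool" where
  "smooth_le r n f c \<longleftrightarrow> (\<exists>b. (\<forall>i\<le>n. dd_le r i f (b i)) \<and> (\<Sum>i\<le>n. b i) \<le> c)"

lemma smooth_leI: "(\<And>i. i \<le> n \<Longrightarrow> dd_le r i f (b i)) \<Longrightarrow> (\<Sum>i\<le>n. b i) \<le> c \<Longrightarrow> smooth_le r n f c"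
  unfolding smooth_le_def by blast

lemma smooth_le_imp_dd_le: assumes "smooth_le r n f c" "i \<le> n" shows "dd_le r i f c"
proof -
  obtain b where b: "\<And>i. i \<le> n \<Longrightarrow> dd_le r i f (b i)" "(\<Sum>i\<le>n. b i) \<le> c"
    using assms unfolding smooth_le_def by blast
  have "b i \<le> (\<Sum>i\<le>n. b i)"
    by (rule member_le_sum) (use assms in \<open>auto intro: dd_le_nonneg[OF b(1)]\<close>)
  then show ?thesis using dd_le_mono[OF b(1)] assms(2) b(2) by auto
qed

lemma smooth_le_mono: "smooth_le r n f c \<Longrightarrow> c \<le> d \<Longrightarrow> smooth_le r n f d"
  unfolding smooth_le_def by (meson order_trans)

lemma smooth_le_nonneg: "smooth_le r n f c \<Longrightarrow> 0 \<le> c"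
  using smooth_le_imp_dd_le[of r n f c 0] dd_le_nonneg by auto

lemma smooth_le_add: assumes "smooth_le r n f c" "smooth_le r n g d" shows "smooth_le r n (\<lambda>x. f x + g x) (c + d)"
proof -
  obtain b where b: "\<And>i. i \<le> n \<Longrightarrow> dd_le r i f (b i)" "(\<Sum>i\<le>n. b i) \<le> c"
    using assms unfolding smooth_le_def by blast
  obtain b' where b': "\<And>i. i \<le> n \<Longrightarrow> dd_le r i g (b' i)" "(\<Sum>i\<le>n. b' i) \<le> d"
    using assms unfolding smooth_le_def by blast
  show ?thesis
    by (rule smooth_leI[where b="\<lambda>i. b i + b' i"]) (use b b' in \<open>auto simp: sum.distrib intro: dd_le_add\<close>)
qed

lemma smooth_le_cmult: assumes "smooth_le r n f c" shows "smooth_le r n (\<lambda>x. z * f x) (cmod z * c)"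
proof -
  obtain b where b: "\<And>i. i \<le> n \<Longrightarrow> dd_le r i f (b i)" "(\<Sum>i\<le>n. b i) \<le> c"
    using assms unfolding smooth_le_def by blast
  show ?thesis
    by (rule smooth_leI[where b="\<lambda>i. cmod z * b i"])
       (use b in \<open>auto simp: sum_distrib_left[symmetric] intro: dd_le_cmult mult_left_mono\<close>)
qed

lemma smooth_le_diff: assumes "smooth_le r n f c" "smooth_le r n g d" shows "smooth_le r n (\<lambda>x. f x - g x) (c + d)"
  using smooth_le_add[OF assms(1) smooth_le_cmult[OF assms(2), of "-1"]] by simp

lemma smooth_le_mult: assumes "smooth_le r n f c" "smooth_le r n g d" shows "smooth_le r n (\<lambda>x. f x * g x) (c * d)"
proof -
  obtain b where b: "\<And>i. i \<le> n \<Longrightarrow> dd_le r i f (b i)" "(\<Sum>i\<le>n. b i) \<le> c"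
    using assms unfolding smooth_le_def by blast
  obtain b' where b': "\<And>i. i \<le> n \<Longrightarrow> dd_le r i g (b' i)" "(\<Sum>i\<le>n. b' i) \<le> d"
    using assms unfolding smooth_le_def by blast
  have b0: "0 \<le> b i" "0 \<le> b' i" if "i \<le> n" for i
    using b(1) b'(1) that dd_le_nonneg by blast+
  show ?thesis
  proof (rule smooth_leI[where b="\<lambda>i. \<Sum>j\<le>i. b j * b' (i - j)"])
    show "dd_le r i (\<lambda>x. f x * g x) (\<Sum>j\<le>i. b j * b' (i - j))" if "i \<le> n" for i
      by (rule dd_le_mult) (use b b' that in auto)
    have "(\<Sum>i\<le>n. \<Sum>j\<le>i. b j * b' (i - j)) = (\<Sum>(j, l)\<in>{(j, l). j + l \<le> n}. b j * b' l)"
      by (simp add: sum.triangle_reindex_eq)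
    also have "\<dots> \<le> (\<Sum>(j, l)\<in>{..n} \<times> {..n}. b j * b' l)"
      by (rule sum_mono2) (use b0 in auto)
    also have "\<dots> = (\<Sum>i\<le>n. b i) * (\<Sum>i\<le>n. b' i)"
      by (simp add: sum_product sum.cartesian_product)
    also have "\<dots> \<le> c * d"
      using b(2) b'(2) b0 by (intro mult_mono sum_nonneg smooth_le_nonneg[OF assms(1)]) auto
    finally show "(\<Sum>i\<le>n. \<Sum>j\<le>i. b j * b' (i - j)) \<le> c * d" .
  qed
qed

lemma smooth_le_sum: "(\<And>a. a \<in> A \<Longrightarrow> smooth_le r n (f a) (c a)) \<Longrightarrow> smooth_le r n (\<lambda>x. \<Sum>a\<in>A. f a x) (\<Sum>a\<in>A. c a)"
proof -
  have 0: "smooth_le r n (\<lambda>x. 0) 0"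
    by (rule smooth_leI[where b="\<lambda>_. 0"]) (auto intro: dd_le_zero)
  show "(\<And>a. a \<in> A \<Longrightarrow> smooth_le r n (f a) (c a)) \<Longrightarrow> smooth_le r n (\<lambda>x. \<Sum>a\<in>A. f a x) (\<Sum>a\<in>A. c a)"
    by (induction A rule: infinite_finite_induct) (auto intro: 0 smooth_le_add)
qed

lemma smooth_le_sums:
  assumes "0 < r" and f: "f \<in> Ck (enat n)" and h: "\<And>k. smooth_le r n (h k) (c k)" and c: "summable c"
    and s: "\<And>x. \<bar>x\<bar> \<le> r \<Longrightarrow> (\<lambda>k. h k x) sums f x"
  shows "smooth_le r n f (real (Suc n) * suminf c)"
proof (rule smooth_leI[where b="\<lambda>_. suminf c"])
  fix i assume i: "i \<le> n"
  obtain \<phi> where "isdd i f \<phi>" using Ck_imp_isdd[OF Ck_mono[OF f]] i by (metis enat_ord_simps(1))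
  then show "dd_le r i f (suminf c)"
    by (rule dd_le_sums[OF assms(1)]) (use smooth_le_imp_dd_le[OF h i] c s in auto)
qed simp

text \<open>The functions that are limits of members of \<open>A\<close>. Since the norms are submultiplicative,
  this is an algebra when \<open>A\<close> is one.\<close>

definition smooth_closure :: "real \<Rightarrow> nat \<Rightarrow> (real \<Rightarrow> complex) set \<Rightarrow> (real \<Rightarrow> complex) set" where
  "smooth_closure r n A = {f. (\<exists>c. smooth_le r n f c) \<and> (\<forall>e>0. \<exists>g\<in>A. smooth_le r n (\<lambda>x. f x - g x) e)}"

lemma smooth_closureD: "f \<in> smooth_closure r n A \<Longrightarrow> 0 < e \<Longrightarrow> \<exists>g\<in>A. smooth_le r n (\<lambda>x. f x - g x) e"
  unfolding smooth_closure_def by blast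

lemma smooth_closure_add:
  assumes A: "\<And>f g. f \<in> A \<Longrightarrow> g \<in> A \<Longrightarrow> (\<lambda>x. f x + g x) \<in> A"
    and f: "f \<in> smooth_closure r n A" and g: "g \<in> smooth_closure r n A"
  shows "(\<lambda>x. f x + g x) \<in> smooth_closure r n A"
  unfolding smooth_closure_def
proof (intro CollectI conjI allI impI)
  show "\<exists>c. smooth_le r n (\<lambda>x. f x + g x) c" using f g smooth_le_add unfolding smooth_closure_def by blast
  fix e :: real assume "0 < e"
  then obtain f' g' where "f' \<in> A" "g' \<in> A" and
    "smooth_le r n (\<lambda>x. f x - f' x) (e / 2)" "smooth_le r n (\<lambda>x. g x - g' x) (e / 2)"
    using smooth_closureD[OF f, of "e / 2"] smooth_closureD[OF g, of "e / 2"] by auto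
  then show "\<exists>h\<in>A. smooth_le r n (\<lambda>x. f x + g x - h x) e"
    using smooth_le_add[of r n "\<lambda>x. f x - f' x" "e / 2" "\<lambda>x. g x - g' x" "e / 2"]
    by (intro bexI[of _ "\<lambda>x. f' x + g' x"]) (auto simp: algebra_simps A)
qed

lemma smooth_closure_mult:
  assumes A: "\<And>f g. f \<in> A \<Longrightarrow> g \<in> A \<Longrightarrow> (\<lambda>x. f x * g x) \<in> A"
    and f: "f \<in> smooth_closure r n A" and g: "g \<in> smooth_closure r n A"
  shows "(\<lambda>x. f x * g x) \<in> smooth_closure r n A"
  unfolding smooth_closure_def
proof (intro CollectI conjI allI impI)
  obtain c d where c: "smooth_le r n f c" and d: "smooth_le r n g d" using f g unfolding smooth_closure_def by blast
  note c0 = smooth_le_nonneg[OF c] and d0 = smooth_le_nonneg[OF d]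
  show "\<exists>c. smooth_le r n (\<lambda>x. f x * g x) c" using smooth_le_mult[OF c d] by blast
  fix e :: real assume e: "0 < e"
  define \<delta> where "\<delta> = min 1 (e / (c + d + 1))"
  have \<delta>: "0 < \<delta>" "\<delta> \<le> 1" "\<delta> * (c + d + 1) \<le> e"
    using e c0 d0 by (auto simp: \<delta>_def min_def field_simps add_nonneg_pos add_pos_nonneg)
  obtain f' g' where A': "f' \<in> A" "g' \<in> A" and
    f': "smooth_le r n (\<lambda>x. f x - f' x) \<delta>" and g': "smooth_le r n (\<lambda>x. g x - g' x) \<delta>"
    using smooth_closureD[OF f \<delta>(1)] smooth_closureD[OF g \<delta>(1)] by auto
  \<comment> \<open>\<open>f g - f' g' = f (g - g') + (f - f') (g - (g - g'))\<close>\<close>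
  have "smooth_le r n (\<lambda>x. f x * (g x - g' x) + (f x - f' x) * (g x - (g x - g' x))) (c * \<delta> + \<delta> * (d + \<delta>))"
    by (intro smooth_le_add smooth_le_mult smooth_le_diff c d f' g')
  moreover have "c * \<delta> + \<delta> * (d + \<delta>) \<le> e"
  proof -
    have "\<delta> * \<delta> \<le> \<delta>" using \<delta> by (simp add: mult_left_le)
    then have "\<delta> * (c + d) + \<delta> * \<delta> \<le> \<delta> * (c + d) + \<delta>" by (rule add_left_mono)
    also have "\<dots> = \<delta> * (c + d + 1)" by (simp add: algebra_simps)
    also have "\<dots> \<le> e" by (rule \<delta>(3))
    finally show ?thesis by (simp add: algebra_simps)
  qed
  ultimately have "smooth_le r n (\<lambda>x. f x * g x - f' x * g' x) e"
    by (intro smooth_le_mono[of _ _ _ _ e]) (auto simp: algebra_simps intro: smooth_le_mono)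
  then show "\<exists>h\<in>A. smooth_le r n (\<lambda>x. f x * g x - h x) e"
    by (intro bexI[where x="\<lambda>x. f' x * g' x"] A A')
qed

lemma smooth_closure_subset_closure:
  assumes f: "f \<in> smooth_closure r n A" and A: "A \<subseteq> smooth_closure r n B"
  shows "f \<in> smooth_closure r n B"
  unfolding smooth_closure_def
proof (intro CollectI conjI allI impI)
  show "\<exists>c. smooth_le r n f c" using f unfolding smooth_closure_def by blast
  fix e :: real assume e: "0 < e"
  obtain g where g: "g \<in> A" "smooth_le r n (\<lambda>x. f x - g x) (e / 2)"
    using smooth_closureD[OF f, of "e / 2"] e by auto
  obtain h where h: "h \<in> B" "smooth_le r n (\<lambda>x. g x - h x) (e / 2)"
    using smooth_closureD[of g r n B "e / 2"] g A e by auto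
  show "\<exists>g\<in>B. smooth_le r n (\<lambda>x. f x - g x) e"
    using smooth_le_add[OF g(2) h(2)] h(1) by auto
qed

lemma smooth_closure_superset:
  assumes "f \<in> A" "smooth_le r n f c" shows "f \<in> smooth_closure r n A"
  unfolding smooth_closure_def
proof (intro CollectI conjI allI impI)
  fix e :: real assume "0 < e"
  then have "smooth_le r n (\<lambda>x. f x - f x) e"
    by (intro smooth_leI[where b="\<lambda>_. 0"]) (auto intro: dd_le_zero)
  then show "\<exists>g\<in>A. smooth_le r n (\<lambda>x. f x - g x) e" using assms(1) by blast
qed (use assms in blast)

lemma smooth_closure_sums:
  assumes r: "0 < r" and f: "f \<in> Ck (enat n)" and h: "\<And>k. smooth_le r n (h k) (c k)" and c: "summable c"
    and s: "\<And>x. \<bar>x\<bar> \<le> r \<Longrightarrow> (\<lambda>k. h k x) sums f x"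
    and hC: "\<And>k. h k \<in> Ck (enat n)" and hA: "\<And>k. h k \<in> smooth_closure r n A"
    and A: "(\<lambda>x. 0) \<in> A" "\<And>f g. f \<in> A \<Longrightarrow> g \<in> A \<Longrightarrow> (\<lambda>x. f x + g x) \<in> A"
  shows "f \<in> smooth_closure r n A"
proof -
  have 0: "(\<lambda>x. 0) \<in> smooth_closure r n A"
    by (rule smooth_closure_superset[OF A(1)]) (auto intro: smooth_leI[where b="\<lambda>_. 0"] dd_le_zero)
  have part: "(\<lambda>x. \<Sum>k<N. h k x) \<in> smooth_closure r n A" for N
    by (induction N) (auto intro: 0 smooth_closure_add hA A)
  have "f \<in> smooth_closure r n (smooth_closure r n A)"
    unfolding smooth_closure_def[of r n "smooth_closure r n A"]
  proof (intro CollectI conjI allI impI)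
    show "\<exists>c. smooth_le r n f c" using smooth_le_sums[OF r f h c s] by blast
    fix e :: real assume "0 < e"
    then have "0 < e / real (Suc n)" by simp
    from suminf_exist_split[OF this c]
    obtain N where N: "norm (\<Sum>k. c (k + N)) < e / real (Suc n)" by blast
    have "smooth_le r n (\<lambda>x. f x - (\<Sum>k<N. h k x)) (real (Suc n) * (\<Sum>k. c (k + N)))"
    proof (rule smooth_le_sums[OF r, where h="\<lambda>k. h (k + N)"])
      show "(\<lambda>x. f x - (\<Sum>k<N. h k x)) \<in> Ck (enat n)" by (intro Ck_diff f Ck_sum hC)
      show "summable (\<lambda>k. c (k + N))" using c by simp
      show "(\<lambda>k. h (k + N) x) sums (f x - (\<Sum>k<N. h k x))" if "\<bar>x\<bar> \<le> r" for x
        using s[OF that] by (rule sums_split_initial_segment)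
    qed (rule h)
    moreover have "real (Suc n) * (\<Sum>k. c (k + N)) \<le> e"
    proof -
      have "(\<Sum>k. c (k + N)) \<le> e / real (Suc n)" using N by simp
      then show ?thesis by (simp add: le_divide_eq mult.commute del: of_nat_Suc)
    qed
    ultimately have "smooth_le r n (\<lambda>x. f x - (\<Sum>k<N. h k x)) e" by (rule smooth_le_mono)
    then show "\<exists>g\<in>smooth_closure r n A. smooth_le r n (\<lambda>x. f x - g x) e"
      by (intro bexI[where x="\<lambda>x. \<Sum>k<N. h k x"] part)
  qed
  then show ?thesis by (rule smooth_closure_subset_closure) simp
qed


section \<open>Polynomials, power series and exponentials\<close>

lemma dd_const: "dd i (\<lambda>x. c) s = (if i = 0 then c else 0)"
  by (induction i arbitrary: s) auto

lemma dd_of_real: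
  "inj_on s {..i} \<Longrightarrow> dd i complex_of_real s = (if i = 0 then complex_of_real (s 0) else if i = 1 then 1 else 0)"
proof (induction i arbitrary: s)
  case (Suc i)
  have ne: "s i \<noteq> s (Suc i)" using Suc.prems by (auto dest: inj_onD)
  have "inj_on s {..i}" using Suc.prems by (rule inj_on_subset) auto
  with Suc.IH[OF this] Suc.IH[OF inj_on_drop_node[OF Suc.prems]] ne show ?case
    by (cases "i = 0") (auto simp: fun_upd_def)
qed simp

lemma isdd_const: "isdd i (\<lambda>x. c) (\<lambda>s. if i = 0 then c else 0)"
  unfolding isdd_def by (auto simp: dd_const)

lemma isdd_of_real:
  "isdd i complex_of_real (\<lambda>s. if i = 0 then complex_of_real (s 0) else if i = 1 then 1 else 0)"
  unfolding isdd_def by (cases "i = 0") (auto simp: dd_of_real intro!: continuous_intros)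

lemma tensor_le_const: assumes "0 < m" shows "tensor_le r m (\<lambda>s. z) (cmod z)"
  using tensor_le_cmult[OF tensor_le_elementary[of m r "\<lambda>l t. 1" "\<lambda>l. 1"], of z] by simp

lemma dd_le_const: "dd_le r i (\<lambda>x. c) (if i = 0 then cmod c else 0)"
  using isdd_const[of i c] tensor_le_const[of "Suc i" r c] tensor_le_zero[of r "Suc i"]
  unfolding dd_le_def by (cases "i = 0") auto

lemma dd_le_of_real:
  assumes "0 \<le> r"
  shows "dd_le r i complex_of_real (if i = 0 then r else if i = 1 then 1 else 0)"
proof (cases "i = 0")
  case True
  then show ?thesis using dd_le_0[of complex_of_real r r] assms by (simp add: continuous_on_of_real_id)
next
  case False
  then show ?thesis using isdd_of_real[of i] tensor_le_const[of "Suc i" r 1] tensor_le_zero[of r "Suc i"]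
    unfolding dd_le_def by (cases "i = 1") auto
qed

text \<open>By the Leibniz rule for \<open>x \<cdot> x\<^sup>n\<close>, where only the orders \<open>0\<close> and \<open>1\<close> of the factor \<open>x\<close> contribute.
  The divided difference vanishes for \<open>i > n\<close>; otherwise the exact value
  \<open>n choose i\<close> times \<open>r\<^sup>n\<^sup>-\<^sup>i\<close> is bounded by a term of \<open>(r + 1)\<^sup>n\<close>.\<close>

lemma dd_le_power:
  assumes r: "0 \<le> r"
  shows "dd_le r i (\<lambda>x. complex_of_real x ^ n) (if n < i then 0 else (r + 1) ^ n)"
proof (induction n arbitrary: i)
  case 0
  show ?case using dd_le_const[of r i 1] by auto
next
  case (Suc n)
  define c :: "nat \<Rightarrow> real" where "c = (\<lambda>i. if i = 0 then r else if i = 1 then 1 else 0)"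
  define d :: "nat \<Rightarrow> real" where "d = (\<lambda>i. if n < i then 0 else (r + 1) ^ n)"
  have B: "dd_le r i (\<lambda>x. complex_of_real x * complex_of_real x ^ n) (\<Sum>j\<le>i. c j * d (i - j))"
    by (rule dd_le_mult) (use dd_le_of_real[OF r] Suc.IH in \<open>auto simp: c_def d_def\<close>)
  have "(\<Sum>j\<le>i. c j * d (i - j)) \<le> (if Suc n < i then 0 else (r + 1) ^ Suc n)"
  proof (cases i)
    case 0
    then show ?thesis using r by (simp add: c_def d_def mult_right_mono)
  next
    case (Suc k)
    have "(\<Sum>j\<le>k. c (Suc j) * d (k - j)) = (\<Sum>j\<le>k. if j = 0 then d k else 0)"
      by (intro sum.cong) (auto simp: c_def)
    then have "(\<Sum>j\<le>i. c j * d (i - j)) = r * d (Suc k) + d k"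
      unfolding Suc sum.atMost_Suc_shift by (simp add: c_def)
    then show ?thesis using r by (auto simp: Suc d_def algebra_simps)
  qed
  then show ?case using dd_le_mono[OF B] by simp
qed

lemma smooth_le_power: assumes "0 \<le> r" shows "smooth_le r n (\<lambda>x. complex_of_real x ^ k) (real (Suc n) * (r + 1) ^ k)"
proof (rule smooth_leI[where b="\<lambda>_. (r + 1) ^ k"])
  show "dd_le r i (\<lambda>x. complex_of_real x ^ k) ((r + 1) ^ k)" for i
    by (rule dd_le_mono[OF dd_le_power]) (use assms in auto)
qed simp

lemma polys_add: "f \<in> polys \<Longrightarrow> g \<in> polys \<Longrightarrow> (\<lambda>x. f x + g x) \<in> polys"
  unfolding polys_def by (auto simp: poly_add[symmetric] simp del: poly_add)

lemma polys_mult: "f \<in> polys \<Longrightarrow> g \<in> polys \<Longrightarrow> (\<lambda>x. f x * g x) \<in> polys"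
  unfolding polys_def by (auto simp: poly_mult[symmetric] simp del: poly_mult)

lemma polys_const: "(\<lambda>x. c) \<in> polys"
  unfolding polys_def by (auto intro!: exI[of _ "[:c:]"])

lemma polys_of_real: "complex_of_real \<in> polys"
  unfolding polys_def by (auto intro!: exI[of _ "[:0, 1:]"])

lemma polys_induct [consumes 1, case_names const var add mult]:
  assumes "f \<in> polys" and c: "\<And>c. P (\<lambda>x. c)" and v: "P complex_of_real"
    and a: "\<And>f g. f \<in> polys \<Longrightarrow> g \<in> polys \<Longrightarrow> P f \<Longrightarrow> P g \<Longrightarrow> P (\<lambda>x. f x + g x)"
    and m: "\<And>f g. f \<in> polys \<Longrightarrow> g \<in> polys \<Longrightarrow> P f \<Longrightarrow> P g \<Longrightarrow> P (\<lambda>x. f x * g x)"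
  shows "P f"
proof -
  obtain p where f: "f = (\<lambda>x. poly p (complex_of_real x))" using assms(1) unfolding polys_def by auto
  have "P (\<lambda>x. poly p (complex_of_real x))"
  proof (induction p)
    case 0 show ?case using c[of 0] by simp
  next
    case (pCons b p)
    have p: "(\<lambda>x. poly p (complex_of_real x)) \<in> polys" unfolding polys_def by auto
    show ?case
      using a[OF polys_const polys_mult[OF polys_of_real p] c m[OF polys_of_real p v pCons.IH]] by simp
  qed
  then show ?thesis by (simp add: f)
qed

lemma polys_subset_Ck: "polys \<subseteq> Ck k"
proof
  fix f assume "f \<in> polys"
  then have "f \<in> Ck (enat n)" for n
    by (induction rule: polys_induct) (auto intro: Ck_const Ck_of_real Ck_add Ck_mult)
  then show "f \<in> Ck k" using Ck_iff_finite by blast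
qed

lemma polys_smooth_le: "f \<in> polys \<Longrightarrow> 0 \<le> r \<Longrightarrow> \<exists>c. smooth_le r n f c"
proof (induction rule: polys_induct)
  case (const c)
  have "smooth_le r n (\<lambda>x. c * complex_of_real x ^ 0) (cmod c * (real (Suc n) * (r + 1) ^ 0))"
    by (intro smooth_le_cmult smooth_le_power const)
  then show ?case by auto
next
  case var
  then show ?case using smooth_le_power[of r n 1] by auto
qed (blast intro: smooth_le_add smooth_le_mult)+

lemma smooth_closure_power_series:
  assumes r: "0 < r" and f: "f \<in> Ck (enat n)"
    and a: "summable (\<lambda>k. cmod (a k) * (r + 1) ^ k)"
    and s: "\<And>x. \<bar>x\<bar> \<le> r \<Longrightarrow> (\<lambda>k. a k * complex_of_real x ^ k) sums f x"
  shows "f \<in> smooth_closure r n polys"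
    and "smooth_le r n f (real (Suc n) ^ 2 * (\<Sum>k. cmod (a k) * (r + 1) ^ k))"
proof -
  have h: "smooth_le r n (\<lambda>x. a k * complex_of_real x ^ k) (real (Suc n) * (cmod (a k) * (r + 1) ^ k))" for k
    using smooth_le_cmult[OF smooth_le_power[of r n k], of "a k"] r by (simp add: mult.left_commute)
  have c: "summable (\<lambda>k. real (Suc n) * (cmod (a k) * (r + 1) ^ k))" using a by (rule summable_mult)
  have p: "(\<lambda>x. a k * complex_of_real x ^ k) \<in> polys" for k
    unfolding polys_def by (intro CollectI exI[of _ "monom (a k) k"]) (simp add: poly_monom)
  show "f \<in> smooth_closure r n polys"
    by (rule smooth_closure_sums[OF r f h c s])
       (use p polys_subset_Ck smooth_closure_superset[OF p h] polys_const[of 0] polys_add in auto)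
  show "smooth_le r n f (real (Suc n) ^ 2 * (\<Sum>k. cmod (a k) * (r + 1) ^ k))"
    using smooth_le_sums[OF r f h c s] suminf_mult[OF a, of "real (Suc n)"] by (simp add: power2_eq_square mult.assoc)
qed

definition expi :: "real \<Rightarrow> real \<Rightarrow> complex" where
  "expi \<xi> x = exp (\<i> * complex_of_real (x * \<xi>))"

lemma cmod_expi [simp]: "cmod (expi \<xi> x) = 1"
  by (simp add: expi_def)

lemma expi_add: "expi (\<xi> + \<eta>) x = expi \<xi> x * expi \<eta> x"
  by (simp add: expi_def exp_add[symmetric] algebra_simps)

lemma expi_0 [simp]: "expi 0 x = 1"
  by (simp add: expi_def)

lemma expi_has_vector_derivative:
  "((\<lambda>x. expi \<xi> x) has_vector_derivative (\<i> * complex_of_real \<xi> * expi \<xi> x)) (at x)"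
proof -
  have "((\<lambda>z. exp (\<i> * (z * complex_of_real \<xi>))) has_field_derivative
      (\<i> * complex_of_real \<xi> * expi \<xi> x)) (at (complex_of_real x))"
    by (auto intro!: derivative_eq_intros simp: expi_def)
  from has_vector_derivative_real_field[OF this] show ?thesis
    by (simp add: expi_def[abs_def] o_def)
qed

lemma Ck_expi: "expi \<xi> \<in> Ck (enat n)"
proof (induction n)
  case 0
  show ?case unfolding Ck_0
    by (auto intro!: continuous_at_imp_continuous_on has_vector_derivative_continuous expi_has_vector_derivative)
next
  case (Suc n)
  show ?case by (rule Ck_SucI[OF expi_has_vector_derivative]) (intro Ck_cmult Suc.IH)
qed

lemma expi_sums: "(\<lambda>k. (\<i> * complex_of_real \<xi>) ^ k / fact k * complex_of_real x ^ k) sums expi \<xi> x"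
proof -
  have "(\<lambda>k. (\<i> * complex_of_real (x * \<xi>)) ^ k /\<^sub>R fact k) sums expi \<xi> x"
    unfolding expi_def by (rule exp_converges)
  then show ?thesis
    by (simp add: scaleR_conv_of_real power_mult_distrib field_simps)
qed

lemma exp_real_sums: "(\<lambda>k. (x::real) ^ k / fact k) sums exp x"
  using exp_converges[of x] by (simp add: divide_inverse mult.commute)

text \<open>Comparing power series gives the right power of the frequency only for bounded
  frequencies. The identity \<open>expi \<xi> = (expi (\<xi>/2))\<^sup>2\<close> transports the bound to all frequencies without
  loss, because \<open>z\<^sup>i / i!\<close> is the sequence of coefficients of an exponential.\<close>

lemma dd_le_expi:
  assumes r: "0 < r"
  obtains C where "1 \<le> C" and "\<And>i \<xi>. i \<le> n \<Longrightarrow> dd_le r i (expi \<xi>) ((C * \<bar>\<xi>\<bar>) ^ i / fact i)"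
proof
  define K where "K = exp (r + 1)"
  \<comment> \<open>The factor \<open>fact n\<close> absorbs the division by \<open>fact i\<close> in the claimed bound.\<close>
  define C where "C = K * fact n"
  have K: "1 \<le> K" using r by (simp add: K_def)
  have n1: "(1::real) \<le> fact n" by (rule fact_ge_1)
  show C: "1 \<le> C" unfolding C_def using mult_mono[OF K n1] K by simp
  have small: "dd_le r i (expi \<xi>) ((C * \<bar>\<xi>\<bar>) ^ i / fact i)" if i: "i \<le> n" and \<xi>: "\<bar>\<xi>\<bar> \<le> 1" for i \<xi>
  proof (cases "i = 0")
    case True
    then show ?thesis using dd_le_0[of "expi \<xi>" r 1] Ck_continuous[OF Ck_expi] by simp
  next
    case False
    define c where "c = (\<lambda>k. \<bar>\<xi>\<bar> ^ k / fact k * (if k < i then 0 else (r + 1) ^ k))"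
    have cle: "c k \<le> \<bar>\<xi>\<bar> ^ i * ((r + 1) ^ k / fact k)" for k
    proof (cases "k < i")
      case False
      then have "\<bar>\<xi>\<bar> ^ k \<le> \<bar>\<xi>\<bar> ^ i" using \<xi> by (intro power_decreasing) auto
      then have "\<bar>\<xi>\<bar> ^ k * ((r + 1) ^ k / fact k) \<le> \<bar>\<xi>\<bar> ^ i * ((r + 1) ^ k / fact k)"
        using r by (intro mult_right_mono) auto
      then show ?thesis using False by (simp add: c_def)
    qed (use r in \<open>auto simp: c_def\<close>)
    have c0: "0 \<le> c k" for k using r by (auto simp: c_def)
    have s: "summable (\<lambda>k. \<bar>\<xi>\<bar> ^ i * ((r + 1) ^ k / fact k))"
      "(\<Sum>k. \<bar>\<xi>\<bar> ^ i * ((r + 1) ^ k / fact k)) = \<bar>\<xi>\<bar> ^ i * K"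
      using sums_mult[OF exp_real_sums[of "r + 1"], of "\<bar>\<xi>\<bar> ^ i"] by (auto simp: sums_iff K_def)
    have cs: "summable c" by (rule summable_comparison_test'[OF s(1)]) (use cle c0 in auto)
    obtain \<phi> where \<phi>: "isdd i (expi \<xi>) \<phi>" using Ck_imp_isdd[OF Ck_expi] by blast
    have "dd_le r i (expi \<xi>) (suminf c)"
    proof (rule dd_le_sums[OF r \<phi> _ cs expi_sums])
      fix k
      show "dd_le r i (\<lambda>x. (\<i> * complex_of_real \<xi>) ^ k / fact k * complex_of_real x ^ k) (c k)"
        using dd_le_cmult[OF dd_le_power[of r i k], of "(\<i> * complex_of_real \<xi>) ^ k / fact k"] r
        by (simp add: c_def norm_divide norm_power norm_mult)
    qed
    moreover have "suminf c \<le> (C * \<bar>\<xi>\<bar>) ^ i / fact i"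
    proof -
      have "suminf c \<le> \<bar>\<xi>\<bar> ^ i * K" using suminf_le[OF cle cs s(1)] s(2) by simp
      also have "\<dots> \<le> \<bar>\<xi>\<bar> ^ i * (C / fact i)"
      proof (intro mult_left_mono)
        have "K * fact i \<le> K * (fact n :: real)" using K by (intro mult_left_mono fact_mono i) auto
        then show "K \<le> C / fact i" by (simp add: C_def field_simps)
      qed simp
      also have "\<dots> \<le> \<bar>\<xi>\<bar> ^ i * (C ^ i / fact i)"
        using C False by (intro mult_left_mono divide_right_mono self_le_power) auto
      finally show ?thesis by (simp add: power_mult_distrib mult.commute)
    qed
    ultimately show ?thesis by (rule dd_le_mono)
  qed
  have "\<forall>i\<le>n. dd_le r i (expi \<xi>) ((C * \<bar>\<xi>\<bar>) ^ i / fact i)" if "\<bar>\<xi>\<bar> \<le> 2 ^ m" for m \<xi>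
    using that
  proof (induction m arbitrary: \<xi>)
    case 0 then show ?case using small by simp
  next
    case (Suc m)
    define y where "y = C * \<bar>\<xi> / 2\<bar>"
    have half: "\<forall>i\<le>n. dd_le r i (expi (\<xi> / 2)) (y ^ i / fact i)"
      using Suc.IH[of "\<xi> / 2"] Suc.prems by (simp add: y_def)
    show ?case
    proof (intro allI impI)
      fix i assume i: "i \<le> n"
      have "dd_le r i (\<lambda>x. expi (\<xi> / 2) x * expi (\<xi> / 2) x) (\<Sum>j\<le>i. y ^ j / fact j * (y ^ (i - j) / fact (i - j)))"
        by (rule dd_le_mult) (use half i in auto)
      moreover have "(\<lambda>x. expi (\<xi> / 2) x * expi (\<xi> / 2) x) = expi \<xi>"
        by (simp add: expi_add[symmetric])
      moreover have "(\<Sum>j\<le>i. y ^ j / fact j * (y ^ (i - j) / fact (i - j))) = (y + y) ^ i / fact i"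
        unfolding binomial_ring sum_divide_distrib
        by (intro sum.cong) (auto simp: binomial_fact)
      moreover have "y + y = C * \<bar>\<xi>\<bar>" by (simp add: y_def)
      ultimately show "dd_le r i (expi \<xi>) ((C * \<bar>\<xi>\<bar>) ^ i / fact i)" by simp
    qed
  qed
  moreover have "\<exists>m. \<bar>\<xi>\<bar> \<le> 2 ^ m" for \<xi> :: real
    using real_arch_pow[of 2 "\<bar>\<xi>\<bar>"] by (auto intro: less_imp_le)
  ultimately show "\<And>i \<xi>. i \<le> n \<Longrightarrow> dd_le r i (expi \<xi>) ((C * \<bar>\<xi>\<bar>) ^ i / fact i)" by blast
qed

lemma expi_smooth_closure: assumes r: "0 < r" shows "expi \<xi> \<in> smooth_closure r n polys"
proof (rule smooth_closure_power_series(1)[OF r Ck_expi _ expi_sums])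
  have "summable (\<lambda>k. (\<bar>\<xi>\<bar> * (r + 1)) ^ k / fact k)"
    using exp_real_sums by (simp add: sums_iff)
  then show "summable (\<lambda>k. cmod ((\<i> * complex_of_real \<xi>) ^ k / fact k) * (r + 1) ^ k)"
    by (simp add: norm_divide norm_power norm_mult power_mult_distrib)
qed

section \<open>Trigonometric polynomials\<close>

definition trig :: "real set \<Rightarrow> (real \<Rightarrow> complex) set" where
  "trig G = {\<lambda>x. \<Sum>\<xi>\<in>F. c \<xi> * expi \<xi> x | F c. finite F \<and> F \<subseteq> G}"

lemma trig_add: assumes "f \<in> trig G" "g \<in> trig G" shows "(\<lambda>x. f x + g x) \<in> trig G"
proof -
  obtain F c where f: "f = (\<lambda>x. \<Sum>\<xi>\<in>F. c \<xi> * expi \<xi> x)" "finite F" "F \<subseteq> G"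
    using assms(1) unfolding trig_def by blast
  obtain H d where g: "g = (\<lambda>x. \<Sum>\<xi>\<in>H. d \<xi> * expi \<xi> x)" "finite H" "H \<subseteq> G"
    using assms(2) unfolding trig_def by blast
  let ?c = "\<lambda>\<xi>. (if \<xi> \<in> F then c \<xi> else 0) + (if \<xi> \<in> H then d \<xi> else 0)"
  have "(\<Sum>\<xi>\<in>F. c \<xi> * expi \<xi> x) = (\<Sum>\<xi>\<in>F \<union> H. (if \<xi> \<in> F then c \<xi> else 0) * expi \<xi> x)" for x
    by (rule sum.mono_neutral_cong_left) (use f g in auto)
  moreover have "(\<Sum>\<xi>\<in>H. d \<xi> * expi \<xi> x) = (\<Sum>\<xi>\<in>F \<union> H. (if \<xi> \<in> H then d \<xi> else 0) * expi \<xi> x)" for x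
    by (rule sum.mono_neutral_cong_left) (use f g in auto)
  ultimately have "(\<lambda>x. f x + g x) = (\<lambda>x. \<Sum>\<xi>\<in>F \<union> H. ?c \<xi> * expi \<xi> x)"
    by (simp add: f g sum.distrib distrib_right)
  then show ?thesis unfolding trig_def using f g by (auto intro!: exI[of _ "F \<union> H"] exI[of _ ?c])
qed

lemma trig_expi: "\<xi> \<in> G \<Longrightarrow> (\<lambda>x. z * expi \<xi> x) \<in> trig G"
  unfolding trig_def by (auto intro!: exI[of _ "{\<xi>}"] exI[of _ "\<lambda>_. z"])

lemma trig_0: "(\<lambda>x. 0) \<in> trig G"
  unfolding trig_def by (auto intro!: exI[of _ "{}"])

lemma trig_sum: "(\<And>a. a \<in> A \<Longrightarrow> f a \<in> trig G) \<Longrightarrow> (\<lambda>x. \<Sum>a\<in>A. f a x) \<in> trig G"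
  by (induction A rule: infinite_finite_induct) (auto intro: trig_0 trig_add)

lemma trig_mult:
  assumes "f \<in> trig G" "g \<in> trig H" and GH: "\<And>\<xi> \<eta>. \<xi> \<in> G \<Longrightarrow> \<eta> \<in> H \<Longrightarrow> \<xi> + \<eta> \<in> L"
  shows "(\<lambda>x. f x * g x) \<in> trig L"
proof -
  obtain F c where f: "f = (\<lambda>x. \<Sum>\<xi>\<in>F. c \<xi> * expi \<xi> x)" "finite F" "F \<subseteq> G"
    using assms(1) unfolding trig_def by blast
  obtain F' d where g: "g = (\<lambda>x. \<Sum>\<xi>\<in>F'. d \<xi> * expi \<xi> x)" "finite F'" "F' \<subseteq> H"
    using assms(2) unfolding trig_def by blast
  have "(\<lambda>x. f x * g x) = (\<lambda>x. \<Sum>\<xi>\<in>F. \<Sum>\<eta>\<in>F'. (c \<xi> * d \<eta>) * expi (\<xi> + \<eta>) x)"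
    by (simp add: f g sum_product expi_add mult_ac)
  moreover have "(\<lambda>x. \<Sum>\<xi>\<in>F. \<Sum>\<eta>\<in>F'. (c \<xi> * d \<eta>) * expi (\<xi> + \<eta>) x) \<in> trig L"
    by (intro trig_sum trig_expi GH) (use f g in auto)
  ultimately show ?thesis by simp
qed

lemma trig_cmult: assumes "f \<in> trig G" shows "(\<lambda>x. z * f x) \<in> trig G"
  using trig_mult[OF trig_expi[of 0 "{0}" z] assms, of G] by simp

text \<open>Polynomials are limits of trigonometric polynomials since \<open>(e\<^bsup>ihx\<^esup> - 1) / (ih)\<close> tends to \<open>x\<close>
  with all its derivatives.\<close>

lemma polys_subset_smooth_closure_trig:
  assumes r: "0 < r" shows "polys \<subseteq> smooth_closure r n (trig UNIV)"
proof
  have c: "(\<lambda>x. z) \<in> smooth_closure r n (trig UNIV)" for z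
    using polys_smooth_le[OF polys_const, of r n z] r smooth_closure_superset[of "\<lambda>x. z" "trig UNIV"] trig_expi[of 0 UNIV z]
    by auto
  have v: "complex_of_real \<in> smooth_closure r n (trig UNIV)"
    unfolding smooth_closure_def
  proof (intro CollectI conjI allI impI)
    show "\<exists>c. smooth_le r n complex_of_real c" using polys_smooth_le[OF polys_of_real] r by auto
    fix e :: real assume e: "0 < e"
    define K where "K = real (Suc n) ^ 2 * exp (r + 1)"
    have K: "0 < K" by (simp add: K_def)
    define h where "h = min 1 (e / K)"
    have h: "0 < h" "h \<le> 1" "h * K \<le> e" using e K by (auto simp: h_def min_def field_simps)
    define g where "g = (\<lambda>x. 1 / (\<i> * complex_of_real h) * expi h x + - 1 / (\<i> * complex_of_real h))"
    define a where "a = (\<lambda>k. if k < 2 then 0 else - ((\<i> * complex_of_real h) ^ (k - 1) / fact k))"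
    have g: "g \<in> trig UNIV"
      unfolding g_def using trig_add[OF trig_expi[of h UNIV "1 / (\<i> * complex_of_real h)"]
          trig_expi[of 0 UNIV "- 1 / (\<i> * complex_of_real h)"]] by simp
    have ak: "cmod (a k) * (r + 1) ^ k \<le> h * ((r + 1) ^ k / fact k)" for k
    proof (cases "k < 2")
      case False
      have "h ^ (k - 1) \<le> h ^ 1" by (rule power_decreasing) (use h False in auto)
      then have "h ^ (k - 1) * ((r + 1) ^ k / fact k) \<le> h * ((r + 1) ^ k / fact k)"
        using r by (intro mult_right_mono) auto
      then show ?thesis using False h by (simp add: a_def norm_divide norm_power norm_mult)
    qed (use h r in \<open>auto simp: a_def\<close>)
    have hs: "summable (\<lambda>k. h * ((r + 1) ^ k / fact k))" "(\<Sum>k. h * ((r + 1) ^ k / fact k)) = h * exp (r + 1)"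
      using sums_mult[OF exp_real_sums[of "r + 1"], of h] by (auto simp: sums_iff)
    have as: "summable (\<lambda>k. cmod (a k) * (r + 1) ^ k)"
      by (rule summable_comparison_test'[OF hs(1)]) (use ak r in auto)
    have sums: "(\<lambda>k. a k * complex_of_real x ^ k) sums (complex_of_real x - g x)" for x
    proof -
      let ?b = "\<lambda>k. (\<i> * complex_of_real h) ^ k / fact k * complex_of_real x ^ k"
      have "(\<lambda>k. if k < 2 then ?b k else 0) sums (\<Sum>k<2. ?b k)"
        using sums_If_finite_set[of "{..<2::nat}" ?b] by simp
      then have "(\<lambda>k. (- 1 / (\<i> * complex_of_real h)) * (?b k - (if k < 2 then ?b k else 0))) sums
          ((- 1 / (\<i> * complex_of_real h)) * (expi h x - (\<Sum>k<2. ?b k)))"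
        by (intro sums_mult sums_diff expi_sums)
      moreover have "(- 1 / (\<i> * complex_of_real h)) * (?b k - (if k < 2 then ?b k else 0)) = a k * complex_of_real x ^ k" for k
        using h by (cases k) (auto simp: a_def field_simps)
      moreover have "(- 1 / (\<i> * complex_of_real h)) * (expi h x - (\<Sum>k<2. ?b k)) = complex_of_real x - g x"
        using h by (simp add: g_def numeral_2_eq_2 field_simps)
      ultimately show ?thesis by simp
    qed
    have "smooth_le r n (\<lambda>x. complex_of_real x - g x) (real (Suc n) ^ 2 * (\<Sum>k. cmod (a k) * (r + 1) ^ k))"
    proof (rule smooth_closure_power_series(2)[OF r _ as sums])
      show "(\<lambda>x. complex_of_real x - g x) \<in> Ck (enat n)"
        unfolding g_def by (intro Ck_diff Ck_of_real Ck_add Ck_cmult Ck_expi Ck_const)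
    qed
    moreover have "real (Suc n) ^ 2 * (\<Sum>k. cmod (a k) * (r + 1) ^ k) \<le> real (Suc n) ^ 2 * (h * exp (r + 1))"
      using suminf_le[OF ak as hs(1)] hs(2) by (intro mult_left_mono) auto
    moreover have "real (Suc n) ^ 2 * (h * exp (r + 1)) \<le> e" using h(3) by (simp add: K_def mult_ac)
    ultimately have "smooth_le r n (\<lambda>x. complex_of_real x - g x) e" by (meson smooth_le_mono order_trans)
    with g show "\<exists>g\<in>trig UNIV. smooth_le r n (\<lambda>x. complex_of_real x - g x) e" by blast
  qed
  fix f assume "f \<in> polys"
  then show "f \<in> smooth_closure r n (trig UNIV)"
    by (induction rule: polys_induct) (auto intro!: c v smooth_closure_add smooth_closure_mult trig_add trig_mult)
qed


section \<open>Smooth functions are limits of polynomials, with a loss of one derivative\<close>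

definition half_integers :: "real set" where
  "half_integers = {of_int m + 1 / 2 | m. True}"

lemma half_integers_ge: "\<xi> \<in> half_integers \<Longrightarrow> 1 / 2 \<le> \<bar>\<xi>\<bar>"
proof -
  assume "\<xi> \<in> half_integers"
  then obtain m where m: "\<xi> = of_int m + 1 / 2" unfolding half_integers_def by blast
  have "0 \<le> m \<or> m \<le> -1" by linarith
  then have "0 \<le> real_of_int m \<or> real_of_int m \<le> -1"
    by (metis of_int_0_le_iff of_int_le_iff of_int_minus of_int_1)
  then show ?thesis unfolding m by (auto simp: abs_if)
qed

lemma expi_cis: "expi \<xi> x = cis (x * \<xi>)"
  by (simp add: expi_def cis_conv_exp)

lemma real_polynomial_cis_trig:
  "real_polynomial_function p \<Longrightarrow> (\<lambda>t. complex_of_real (p (cis t))) \<in> trig \<int>"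
proof (induction p rule: real_polynomial_function.induct)
  case (linear f)
  interpret bounded_linear f by fact
  have 1: "f (cis t) = cos t * f 1 + sin t * f \<i>" for t
  proof -
    have "cis t = cos t *\<^sub>R 1 + sin t *\<^sub>R \<i>" by (simp add: complex_eq_iff)
    then show ?thesis by (simp add: add scaleR)
  qed
  have 2: "complex_of_real (cos t) = 1 / 2 * expi 1 t + 1 / 2 * expi (-1) t" for t
    by (simp add: expi_cis complex_eq_iff)
  have 3: "complex_of_real (sin t) = (- \<i> / 2) * expi 1 t + (\<i> / 2) * expi (-1) t" for t
    by (simp add: expi_cis complex_eq_iff)
  have "(\<lambda>t. complex_of_real (f (cis t))) =
     (\<lambda>t. (complex_of_real (f 1) / 2 - \<i> * f \<i> / 2) * expi 1 t + (complex_of_real (f 1) / 2 + \<i> * f \<i> / 2) * expi (-1) t)"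
    unfolding 1 of_real_add of_real_mult 2 3 by (simp add: algebra_simps)
  then show ?case by (simp only:) (intro trig_add trig_expi, auto)
next
  case (const c)
  show ?case using trig_expi[of 0 \<int> "complex_of_real c"] by simp
next
  case (add f g) then show ?case by (simp add: trig_add)
next
  case (mult f g) then show ?case by (simp add: trig_mult)
qed

text \<open>Extending \<open>g\<close> from an arc to the whole circle and applying the Stone--Weierstrass theorem there.
  The half-integer frequencies make \<open>G\<close> antiperiodic and keep the frequency \<open>0\<close>, which
  cannot be integrated within trigonometric polynomials, away.\<close>

lemma half_integer_trig_approx:
  assumes g: "continuous_on {-1..1} g"
  obtains G where "\<And>t. \<bar>t\<bar> \<le> 1 \<Longrightarrow> G t = g t"
    and "\<And>e. 0 < e \<Longrightarrow> \<exists>T\<in>trig half_integers. \<forall>t. cmod (G t - T t) < e"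
proof -
  define K where "K = cis ` {-1..1}"
  have K: "compact K" unfolding K_def
    by (intro compact_continuous_image continuous_intros compact_Icc)
  \<comment> \<open>On this arc \<open>arcsin (Im z)\<close> is the argument of \<open>z\<close>.\<close>
  define k where "k = (\<lambda>z. expi (-1/2) (arcsin (Im z)) * g (arcsin (Im z)))"
  have arcsin: "arcsin (sin t) = t" if "\<bar>t\<bar> \<le> 1" for t
    using that pi_gt3 by (intro arcsin_sin) (auto simp: abs_le_iff)
  have c: "continuous_on K (\<lambda>z. arcsin (Im z))"
    by (intro continuous_intros) (auto simp: K_def)
  moreover have "(\<lambda>z. arcsin (Im z)) ` K \<subseteq> {-1..1}"
    by (auto simp: K_def arcsin abs_le_iff)
  ultimately have "continuous_on K k" unfolding k_def
    by (intro continuous_on_mult continuous_on_compose2[OF g] c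
        continuous_on_compose2[OF Ck_continuous[OF Ck_expi]]) auto
  then obtain h where h: "continuous_on UNIV h" "\<And>z. z \<in> K \<Longrightarrow> h z = k z"
    using Dugundji[of UNIV UNIV K k] K by (auto simp: compact_imp_closed)
  define G where "G = (\<lambda>t. expi (1/2) t * h (cis t))"
  show ?thesis
  proof
    fix t :: real assume t: "\<bar>t\<bar> \<le> 1"
    then have "cis t \<in> K" unfolding K_def by (intro imageI) auto
    then show "G t = g t"
      using arcsin[OF t] expi_add[of "1/2" "-1/2" t] by (simp add: G_def h k_def mult.assoc[symmetric])
  next
    fix e :: real assume e: "0 < e"
    obtain p where p: "polynomial_function p" "\<And>z. z \<in> sphere 0 1 \<Longrightarrow> cmod (h z - p z) < e"
      using Stone_Weierstrass_polynomial_function[of "sphere (0::complex) 1" h e]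
        continuous_on_subset[OF h(1)] e by auto
    have "(\<lambda>t. complex_of_real (Re (p (cis t))) + \<i> * complex_of_real (Im (p (cis t)))) \<in> trig \<int>"
      using p(1) real_polynomial_cis_trig[of "Re \<circ> p"] real_polynomial_cis_trig[of "Im \<circ> p"]
      by (intro trig_add trig_cmult) (auto simp: polynomial_function_def bounded_linear_Re bounded_linear_Im)
    then have pt: "(\<lambda>t. p (cis t)) \<in> trig \<int>" by (simp add: complex_eq[symmetric])
    have hi: "\<xi> + \<eta> \<in> half_integers" if "\<xi> \<in> {1 / 2}" "\<eta> \<in> \<int>" for \<xi> \<eta>
    proof -
      obtain m where "\<eta> = of_int m" using \<open>\<eta> \<in> \<int>\<close> by (auto elim: Ints_cases)
      moreover have "\<xi> = 1 / 2" using \<open>\<xi> \<in> {1 / 2}\<close> by blast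
      ultimately show ?thesis unfolding half_integers_def by (intro CollectI exI[of _ m]) simp
    qed
    have "(\<lambda>t. (1 * expi (1/2) t) * p (cis t)) \<in> trig half_integers"
      by (rule trig_mult[OF trig_expi[of "1 / 2" "{1 / 2}"] pt hi]) simp_all
    moreover have "cmod (G t - 1 * expi (1/2) t * p (cis t)) < e" for t
    proof -
      have "G t - 1 * expi (1/2) t * p (cis t) = expi (1/2) t * (h (cis t) - p (cis t))"
        by (simp add: G_def algebra_simps)
      then show ?thesis using p(2)[of "cis t"] by (simp add: norm_mult)
    qed
    ultimately show "\<exists>T\<in>trig half_integers. \<forall>t. cmod (G t - T t) < e"
      by (intro bexI[where x="\<lambda>t. 1 * expi (1/2) t * p (cis t)"] allI)
  qed
qed

lemma expi_integral:
  assumes "k \<in> \<int>"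
  shows "((\<lambda>t. expi k t) has_integral (if k = 0 then 2 * pi else 0)) {-pi..pi}"
proof (cases "k = 0")
  case True
  then show ?thesis using has_integral_const_real[of "1::complex" "-pi" pi] by (simp add: scaleR_conv_of_real)
next
  case False
  let ?c = "1 / (\<i> * complex_of_real k)"
  have "((\<lambda>t. expi k t) has_integral (?c * expi k pi - ?c * expi k (-pi))) {-pi..pi}"
  proof (rule fundamental_theorem_of_calculus)
    fix t
    have "((\<lambda>t. ?c * expi k t) has_vector_derivative ?c * (\<i> * complex_of_real k * expi k t)) (at t within {-pi..pi})"
      by (rule has_vector_derivative_mult_right[OF has_vector_derivative_at_within[OF expi_has_vector_derivative]])
    moreover have "?c * (\<i> * complex_of_real k) = 1" using False by simp
    ultimately show "((\<lambda>t. ?c * expi k t) has_vector_derivative expi k t) (at t within {-pi..pi})"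
      by (simp only: mult.assoc[symmetric] mult_1_left)
  qed simp
  moreover have "expi k pi = expi k (-pi)"
  proof -
    obtain m where "k = of_int m" using assms by (auto elim: Ints_cases)
    then have "sin (pi * k) = 0" by (auto simp: sin_zero_iff_int2)
    then show ?thesis by (simp add: expi_cis complex_eq_iff)
  qed
  ultimately show ?thesis using False by simp
qed

text \<open>Differences of half-integers are integers, so these exponentials are orthogonal on
  \<open>[-\<pi>, \<pi>]\<close>.\<close>

lemma bessel_inequality:
  assumes F: "finite F" "F \<subseteq> half_integers" and M: "\<And>t. cmod (\<Sum>\<xi>\<in>F. c \<xi> * expi \<xi> t) \<le> M"
  shows "(\<Sum>\<xi>\<in>F. (cmod (c \<xi>))\<^sup>2) \<le> M\<^sup>2"
proof -
  let ?T = "\<lambda>t. \<Sum>\<xi>\<in>F. c \<xi> * expi \<xi> t"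
  have cnj: "cnj (expi \<xi> t) = expi (- \<xi>) t" for \<xi> t
    by (simp add: expi_cis complex_eq_iff)
  have prod: "?T t * cnj (?T t) = (\<Sum>\<xi>\<in>F. \<Sum>\<eta>\<in>F. (c \<xi> * cnj (c \<eta>)) * expi (\<xi> - \<eta>) t)" for t
    using expi_add[of _ "- _" t] by (simp add: cnj_sum sum_product cnj mult_ac diff_conv_add_uminus del: add_uminus_conv_diff)
  have int: "\<xi> - \<eta> \<in> \<int>" if "\<xi> \<in> F" "\<eta> \<in> F" for \<xi> \<eta>
  proof -
    have "\<xi> \<in> half_integers" "\<eta> \<in> half_integers" using that F by auto
    then obtain m m' where "\<xi> = of_int m + 1 / 2" "\<eta> = of_int m' + 1 / 2"
      unfolding half_integers_def by auto
    then have "\<xi> - \<eta> = of_int (m - m')" by simp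
    then show ?thesis by (metis Ints_of_int)
  qed
  have "((\<lambda>t. ?T t * cnj (?T t)) has_integral
      (\<Sum>\<xi>\<in>F. \<Sum>\<eta>\<in>F. (c \<xi> * cnj (c \<eta>)) * (if \<xi> - \<eta> = 0 then 2 * pi else 0))) {-pi..pi}"
    unfolding prod by (intro has_integral_sum F has_integral_mult_right expi_integral int)
  moreover have "(\<Sum>\<eta>\<in>F. (c \<xi> * cnj (c \<eta>)) * complex_of_real (if \<xi> - \<eta> = 0 then 2 * pi else 0))
      = complex_of_real (2 * pi * (cmod (c \<xi>))\<^sup>2)" if "\<xi> \<in> F" for \<xi>
  proof -
    have "(\<Sum>\<eta>\<in>F. (c \<xi> * cnj (c \<eta>)) * complex_of_real (if \<xi> - \<eta> = 0 then 2 * pi else 0))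
      = (\<Sum>\<eta>\<in>F. if \<eta> = \<xi> then c \<xi> * cnj (c \<xi>) * complex_of_real (2 * pi) else 0)"
      by (intro sum.cong) auto
    also have "\<dots> = c \<xi> * cnj (c \<xi>) * complex_of_real (2 * pi)" using that F(1) by simp
    also have "\<dots> = complex_of_real (2 * pi * (cmod (c \<xi>))\<^sup>2)"
      by (simp only: complex_norm_square[symmetric] of_real_mult of_real_power mult_ac)
    finally show ?thesis .
  qed
  ultimately have I: "((\<lambda>t. ?T t * cnj (?T t)) has_integral
      complex_of_real (2 * pi * (\<Sum>\<xi>\<in>F. (cmod (c \<xi>))\<^sup>2))) (cbox (-pi) pi)"
    by (simp add: sum_distrib_left)
  have "norm (complex_of_real (2 * pi * (\<Sum>\<xi>\<in>F. (cmod (c \<xi>))\<^sup>2))) \<le> M\<^sup>2 * measure lborel (cbox (-pi) pi)"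
  proof (rule has_integral_bound[OF _ I])
    show "cmod (?T t * cnj (?T t)) \<le> M\<^sup>2" for t
      using M[of t] unfolding norm_mult complex_mod_cnj power2_eq_square
      by (intro mult_mono) (auto intro: order_trans[OF norm_ge_zero])
  qed simp
  moreover have "norm (complex_of_real (2 * pi * (\<Sum>\<xi>\<in>F. (cmod (c \<xi>))\<^sup>2))) = 2 * pi * (\<Sum>\<xi>\<in>F. (cmod (c \<xi>))\<^sup>2)"
    unfolding norm_of_real by (rule abs_of_nonneg) (simp add: sum_nonneg)
  ultimately show ?thesis by simp
qed

lemma half_integers_inverse_squares:
  obtains Q where "\<And>F. finite F \<Longrightarrow> F \<subseteq> half_integers \<Longrightarrow> (\<Sum>\<xi>\<in>F. 1 / \<xi>\<^sup>2) \<le> Q"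
proof
  define q where "q = (\<lambda>n::nat. 1 / (real n + 1 / 2)\<^sup>2)"
  have q: "summable q"
  proof (rule summable_comparison_test')
    have "summable (\<lambda>n. inverse (real n ^ 2))" by (rule inverse_power_summable) simp
    then have "summable (\<lambda>n. inverse (real (Suc n) ^ 2))" by (subst summable_Suc_iff)
    then show "summable (\<lambda>n. 4 * inverse (real (Suc n) ^ 2))" by (rule summable_mult)
    fix n :: nat
    have "(real (Suc n))\<^sup>2 \<le> (2 * (real n + 1 / 2))\<^sup>2" by (rule power_mono) auto
    then have le: "(real (Suc n))\<^sup>2 \<le> 4 * (real n + 1 / 2)\<^sup>2" unfolding power_mult_distrib by simp
    have pos: "0 < (real (Suc n))\<^sup>2" "0 < (real n + 1 / 2)\<^sup>2" by simp_all
    have "1 / y \<le> 4 * inverse x" if "x \<le> 4 * y" "0 < x" "0 < y" for x y :: real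
      using that by (simp add: field_simps)
    from this[OF le pos] show "norm (q n) \<le> 4 * inverse (real (Suc n) ^ 2)"
      unfolding q_def real_norm_def by (subst abs_of_nonneg) simp_all
  qed
  have half: "(\<Sum>\<xi>\<in>F. 1 / \<xi>\<^sup>2) \<le> suminf q"
    if F: "finite F" and s: "\<And>\<xi>. \<xi> \<in> F \<Longrightarrow> \<exists>n. \<bar>\<xi>\<bar> = real n + 1 / 2" and inj: "inj_on abs F" for F
  proof -
    define f where "f = (\<lambda>\<xi>::real. nat \<lfloor>\<bar>\<xi>\<bar>\<rfloor>)"
    have f: "\<bar>\<xi>\<bar> = real (f \<xi>) + 1 / 2" if \<xi>: "\<xi> \<in> F" for \<xi>
    proof -
      obtain n where n: "\<bar>\<xi>\<bar> = real n + 1 / 2" using s[OF \<xi>] by blast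
      have "\<lfloor>real n + 1 / 2\<rfloor> = int n" by linarith
      then show ?thesis by (simp add: f_def n)
    qed
    have "inj_on f F"
    proof (rule inj_onI)
      fix x y assume "x \<in> F" "y \<in> F" "f x = f y"
      then have "\<bar>x\<bar> = \<bar>y\<bar>" using f[of x] f[of y] by simp
      then show "x = y" by (rule inj_onD[OF inj _ \<open>x \<in> F\<close> \<open>y \<in> F\<close>])
    qed
    have "(\<Sum>\<xi>\<in>F. 1 / \<xi>\<^sup>2) = (\<Sum>\<xi>\<in>F. q (f \<xi>))"
    proof (intro sum.cong refl)
      fix \<xi> assume "\<xi> \<in> F"
      then show "1 / \<xi>\<^sup>2 = q (f \<xi>)" using f[of \<xi>] by (metis power2_abs q_def)
    qed
    also have "\<dots> = (\<Sum>n\<in>f ` F. q n)" using \<open>inj_on f F\<close> by (simp add: sum.reindex)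
    also have "\<dots> \<le> suminf q" by (rule sum_le_suminf[OF q]) (use F in \<open>auto simp: q_def\<close>)
    finally show ?thesis .
  qed
  fix F assume F: "finite F" "F \<subseteq> half_integers"
  define P where "P = {\<xi>\<in>F. 0 \<le> \<xi>}"
  define N where "N = {\<xi>\<in>F. \<xi> < 0}"
  have "(\<Sum>\<xi>\<in>F. 1 / \<xi>\<^sup>2) = (\<Sum>\<xi>\<in>P. 1 / \<xi>\<^sup>2) + (\<Sum>\<xi>\<in>N. 1 / \<xi>\<^sup>2)"
    using F(1) by (subst sum.union_disjoint[symmetric]) (auto simp: P_def N_def intro!: sum.cong)
  also have "\<dots> \<le> suminf q + suminf q"
  proof (intro add_mono half)
    show "finite P" "finite N" using F by (auto simp: P_def N_def)
    show "inj_on abs P" "inj_on abs N" by (auto simp: inj_on_def P_def N_def)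
    show "\<exists>n. \<bar>\<xi>\<bar> = real n + 1 / 2" if "\<xi> \<in> P" for \<xi>
    proof -
      have "\<xi> \<in> half_integers" "0 \<le> \<xi>" using that F by (auto simp: P_def)
      then obtain m where m: "\<xi> = of_int m + 1 / 2" "0 \<le> \<xi>" unfolding half_integers_def by auto
      then have "0 \<le> m" by linarith
      then show ?thesis using m by (intro exI[of _ "nat m"]) auto
    qed
    show "\<exists>n. \<bar>\<xi>\<bar> = real n + 1 / 2" if "\<xi> \<in> N" for \<xi>
    proof -
      have "\<xi> \<in> half_integers" "\<xi> < 0" using that F by (auto simp: N_def)
      then obtain m where m: "\<xi> = of_int m + 1 / 2" "\<xi> < 0" unfolding half_integers_def by auto
      then have "m \<le> - 1" by linarith
      then show ?thesis using m by (intro exI[of _ "nat (- m - 1)"]) auto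
    qed
  qed
  finally show "(\<Sum>\<xi>\<in>F. 1 / \<xi>\<^sup>2) \<le> suminf q + suminf q" .
qed

text \<open>Cauchy--Schwarz in the form \<open>2ab \<le> a\<^sup>2 + b\<^sup>2\<close>, balanced by \<open>M\<close>.\<close>

lemma half_integer_coefficients:
  obtains Q where "0 < Q" and "\<And>F c M. finite F \<Longrightarrow> F \<subseteq> half_integers \<Longrightarrow> 0 < M \<Longrightarrow>
    (\<And>t. cmod (\<Sum>\<xi>\<in>F. c \<xi> * expi \<xi> t) \<le> M) \<Longrightarrow> (\<Sum>\<xi>\<in>F. cmod (c \<xi>) / \<bar>\<xi>\<bar>) \<le> Q * M"
proof -
  obtain Q where Q: "\<And>F. finite F \<Longrightarrow> F \<subseteq> half_integers \<Longrightarrow> (\<Sum>\<xi>\<in>F. 1 / \<xi>\<^sup>2) \<le> Q"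
    using half_integers_inverse_squares by blast
  have Q0: "0 \<le> Q" using Q[of "{}"] by simp
  show thesis
  proof
    show "0 < 1 + Q" using Q0 by simp
    fix F c and M :: real assume F: "finite F" "F \<subseteq> half_integers" and M: "0 < M"
      and T: "\<And>t. cmod (\<Sum>\<xi>\<in>F. c \<xi> * expi \<xi> t) \<le> M"
    have "(\<Sum>\<xi>\<in>F. cmod (c \<xi>) / \<bar>\<xi>\<bar>) \<le> (\<Sum>\<xi>\<in>F. (1 / M) * (cmod (c \<xi>))\<^sup>2 + M * (1 / \<xi>\<^sup>2))"
    proof (rule sum_mono)
      fix \<xi>
      let ?a = "cmod (c \<xi>)" and ?b = "M * (1 / \<bar>\<xi>\<bar>)"
      have "?a * ?b \<le> ?a\<^sup>2 + ?b\<^sup>2"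
      proof -
        have "0 \<le> ?a * ?b" using M by simp
        moreover have "2 * (?a * ?b) \<le> ?a\<^sup>2 + ?b\<^sup>2"
          using sum_squares_bound[of ?a ?b] by (simp only: mult.assoc)
        moreover have "x \<le> y" if "0 \<le> x" "2 * x \<le> y" for x y :: real using that by linarith
        ultimately show ?thesis by blast
      qed
      then have "(1 / M) * (?a * ?b) \<le> (1 / M) * (?a\<^sup>2 + ?b\<^sup>2)"
        using M by (intro mult_left_mono) auto
      then show "?a / \<bar>\<xi>\<bar> \<le> (1 / M) * ?a\<^sup>2 + M * (1 / \<xi>\<^sup>2)"
        using M by (simp add: distrib_left power_mult_distrib power_divide power2_eq_square)
    qed
    also have "\<dots> = (1 / M) * (\<Sum>\<xi>\<in>F. (cmod (c \<xi>))\<^sup>2) + M * (\<Sum>\<xi>\<in>F. 1 / \<xi>\<^sup>2)"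
      by (simp only: sum.distrib sum_distrib_left)
    also have "\<dots> \<le> (1 / M) * M\<^sup>2 + M * Q"
      using M by (intro add_mono mult_left_mono bessel_inequality Q F T) auto
    also have "\<dots> = (1 + Q) * M" using M by (simp add: power2_eq_square algebra_simps)
    finally show "(\<Sum>\<xi>\<in>F. cmod (c \<xi>) / \<bar>\<xi>\<bar>) \<le> (1 + Q) * M" .
  qed
qed

text \<open>\<open>antider n u v\<close>: the function \<open>u\<close> is the \<open>n\<close>-fold integral of \<open>v\<close> from \<open>0\<close>.\<close>

fun antider :: "nat \<Rightarrow> (real \<Rightarrow> complex) \<Rightarrow> (real \<Rightarrow> complex) \<Rightarrow> bool" where
  "antider 0 u v \<longleftrightarrow> u = v"
| "antider (Suc n) u v \<longleftrightarrow>
     (\<exists>w. (\<forall>x. (u has_vector_derivative w x) (at x)) \<and> u 0 = 0 \<and> antider n w v)"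

lemma antider_lincomb:
  "antider n u v \<Longrightarrow> antider n u' v' \<Longrightarrow> antider n (\<lambda>x. a * u x + b * u' x) (\<lambda>x. a * v x + b * v' x)"
proof (induction n arbitrary: u u')
  case (Suc n)
  obtain w w' where w: "\<And>x. (u has_vector_derivative w x) (at x)" "u 0 = 0" "antider n w v"
    and w': "\<And>x. (u' has_vector_derivative w' x) (at x)" "u' 0 = 0" "antider n w' v'"
    using Suc.prems by auto
  have "((\<lambda>x. a * u x + b * u' x) has_vector_derivative a * w x + b * w' x) (at x)" for x
    by (intro has_vector_derivative_add has_vector_derivative_mult_right w w')
  then show ?case using Suc.IH[OF w(3) w'(3)] w(2) w'(2)
    by (auto intro!: exI[of _ "\<lambda>x. a * w x + b * w' x"])
qed auto

lemma antider_zero: "antider n (\<lambda>x. 0) (\<lambda>x. 0)"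
  by (induction n) (auto intro!: exI[of _ "\<lambda>x. 0"])

lemma antider_sum:
  "(\<And>a. a \<in> A \<Longrightarrow> antider n (u a) (v a)) \<Longrightarrow> antider n (\<lambda>x. \<Sum>a\<in>A. c a * u a x) (\<lambda>x. \<Sum>a\<in>A. c a * v a x)"
proof (induction A rule: infinite_finite_induct)
  case (insert a A)
  then have "antider n (\<lambda>x. c a * u a x + 1 * (\<Sum>a\<in>A. c a * u a x)) (\<lambda>x. c a * v a x + 1 * (\<Sum>a\<in>A. c a * v a x))"
    by (intro antider_lincomb) auto
  with insert show ?case by simp
qed (auto intro: antider_zero)

lemma antider_bound:
  assumes "antider n u v" and "0 \<le> r" and "\<And>x. \<bar>x\<bar> \<le> r \<Longrightarrow> cmod (v x) \<le> M" and "\<bar>x\<bar> \<le> r"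
  shows "cmod (u x) \<le> r ^ n * M"
  using assms(1,4)
proof (induction n arbitrary: u x)
  case 0 then show ?case using assms(3) by simp
next
  case (Suc n)
  obtain w where w: "\<And>x. (u has_vector_derivative w x) (at x)" "u 0 = 0" "antider n w v"
    using Suc.prems by auto
  have "norm (u x - u 0) \<le> (r ^ n * M) * norm (x - 0)"
  proof (rule differentiable_bound[where S="{-r..r}" and f'="\<lambda>x h. h *\<^sub>R w x"])
    show "(u has_derivative (\<lambda>h. h *\<^sub>R w x)) (at x within {-r..r})" for x
      using w(1)[of x] unfolding has_vector_derivative_def by (rule has_derivative_at_withinI)
    fix x assume "x \<in> {-r..r}"
    then have le: "cmod (w x) \<le> r ^ n * M" by (intro Suc.IH w) auto
    show "onorm (\<lambda>h. h *\<^sub>R w x) \<le> r ^ n * M"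
    proof (rule onorm_le)
      fix h show "norm (h *\<^sub>R w x) \<le> r ^ n * M * norm h"
        using mult_right_mono[OF le, of "norm h"] by (simp add: mult.commute)
    qed
  qed (use Suc.prems assms(2) in auto)
  also have "\<dots> \<le> (r ^ n * M) * r"
  proof (rule mult_left_mono)
    have "0 \<le> M" using assms(2) order_trans[OF norm_ge_zero assms(3)[of 0]] by simp
    then show "0 \<le> r ^ n * M" using assms(2) by simp
  qed (use Suc.prems in simp)
  finally show ?case using w(2) by (simp add: mult_ac)
qed

lemma polys_antiderivative:
  assumes "P \<in> polys"
  shows "\<exists>Q\<in>polys. (\<forall>x. (Q has_vector_derivative P x) (at x)) \<and> Q 0 = 0"
proof -
  obtain p where P: "P = (\<lambda>x. poly p (complex_of_real x))" using assms unfolding polys_def by blast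
  define q where "q = (\<Sum>i\<le>degree p. monom (coeff p i / of_nat (Suc i)) (Suc i))"
  have q: "poly q z = (\<Sum>i\<le>degree p. coeff p i / of_nat (Suc i) * z ^ Suc i)" for z
    by (simp add: q_def poly_sum poly_monom)
  have "((\<lambda>z. poly q z) has_field_derivative poly p z) (at z)" for z
    unfolding q poly_altdef[of p]
  proof (intro DERIV_sum)
    fix i
    have "((\<lambda>z. z ^ Suc i) has_field_derivative (1 + of_nat i) * (1 * z ^ i)) (at z)"
      by (rule DERIV_power_Suc[OF DERIV_ident])
    from DERIV_cmult[OF this, of "coeff p i / of_nat (Suc i)"]
    show "((\<lambda>z. coeff p i / of_nat (Suc i) * z ^ Suc i) has_field_derivative coeff p i * z ^ i) (at z)"
      by (auto elim!: DERIV_cong simp: field_simps simp del: of_nat_Suc) (simp add: of_nat_Suc field_simps)?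
  qed
  from has_vector_derivative_real_field[OF this]
  have "((\<lambda>x. poly q (complex_of_real x)) has_vector_derivative P x) (at x)" for x
    by (simp add: P o_def)
  moreover have "poly q (complex_of_real 0) = 0" by (simp add: q)
  ultimately show ?thesis unfolding polys_def by (intro bexI[of _ "\<lambda>x. poly q (complex_of_real x)"]) auto
qed

lemma Ck_antider_mod_polys:
  "f \<in> Ck (enat n) \<Longrightarrow> \<exists>P\<in>polys. antider n (\<lambda>x. f x - P x) (vderiv n f)"
proof (induction n arbitrary: f)
  case 0
  show ?case by (intro bexI[of _ "\<lambda>x. 0"]) (auto intro: polys_const)
next
  case (Suc n)
  define f' where "f' = (\<lambda>x. vector_derivative f (at x))"
  have f': "\<And>x. (f has_vector_derivative f' x) (at x)" "f' \<in> Ck (enat n)"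
    unfolding f'_def by (rule Ck_SucD[OF Suc.prems])+
  obtain P where P: "P \<in> polys" "antider n (\<lambda>x. f' x - P x) (vderiv n f')" using Suc.IH[OF f'(2)] by blast
  obtain Q where Q: "Q \<in> polys" "\<And>x. (Q has_vector_derivative P x) (at x)" "Q 0 = 0"
    using polys_antiderivative[OF P(1)] by blast
  have "((\<lambda>x. f x - (f 0 + Q x)) has_vector_derivative f' x - (0 + P x)) (at x)" for x
    by (intro has_vector_derivative_diff has_vector_derivative_add has_vector_derivative_const f' Q)
  then have "antider (Suc n) (\<lambda>x. f x - (f 0 + Q x)) (vderiv (Suc n) f)"
    using P(2) Q(3) unfolding vderiv_Suc f'_def[symmetric]
    by (auto intro!: exI[of _ "\<lambda>x. f' x - P x"])
  then show ?case by (intro bexI[where x="\<lambda>x. f 0 + Q x"] polys_add polys_const Q(1))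
qed

text \<open>For \<open>\<omega> \<noteq> 0\<close>, the \<open>n\<close>-fold integral of \<open>expi \<omega>\<close> from \<open>0\<close>, that is, \<open>(i\<omega>)\<^sup>-\<^sup>n\<close> times the remainder of
  the exponential series after \<open>n\<close> terms.\<close>

fun iexp :: "nat \<Rightarrow> real \<Rightarrow> real \<Rightarrow> complex" where
  "iexp 0 \<omega> x = expi \<omega> x"
| "iexp (Suc n) \<omega> x = (iexp n \<omega> x - complex_of_real x ^ n / fact n) / (\<i> * complex_of_real \<omega>)"

lemma iexp_has_vector_derivative:
  assumes "\<omega> \<noteq> 0"
  shows "(iexp (Suc n) \<omega> has_vector_derivative iexp n \<omega> x) (at x)"
proof (induction n)
  case 0
  have "((\<lambda>x. (expi \<omega> x - 1) / (\<i> * complex_of_real \<omega>)) has_vector_derivative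
      (\<i> * complex_of_real \<omega> * expi \<omega> x - 0) / (\<i> * complex_of_real \<omega>)) (at x)"
    by (intro has_vector_derivative_divide has_vector_derivative_diff expi_has_vector_derivative
        has_vector_derivative_const)
  then show ?case using assms by (simp add: fun_eq_iff[symmetric])
next
  case (Suc n)
  have "((\<lambda>z. z ^ Suc n / fact (Suc n)) has_field_derivative z ^ n / fact n) (at z)" for z :: complex
  proof (rule DERIV_cong[OF DERIV_cdivide[OF DERIV_power_Suc[OF DERIV_ident]]])
    have "(1 + of_nat n) * (1 * z ^ n) / fact (Suc n) = (of_nat (Suc n) * z ^ n) / (of_nat (Suc n) * fact n)"
      by simp
    also have "\<dots> = z ^ n / fact n" by (rule nonzero_mult_divide_mult_cancel_left) (rule of_nat_neq_0)
    finally show "(1 + of_nat n) * (1 * z ^ n) / fact (Suc n) = z ^ n / fact n" .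
  qed
  from has_vector_derivative_real_field[OF this]
  have p: "((\<lambda>x. complex_of_real x ^ Suc n / fact (Suc n)) has_vector_derivative complex_of_real x ^ n / fact n) (at x)"
    by (simp add: o_def)
  have "iexp (Suc (Suc n)) \<omega> = (\<lambda>x. (iexp (Suc n) \<omega> x - complex_of_real x ^ Suc n / fact (Suc n)) / (\<i> * complex_of_real \<omega>))"
    by (rule ext) (rule iexp.simps(2))
  moreover have "((\<lambda>x. (iexp (Suc n) \<omega> x - complex_of_real x ^ Suc n / fact (Suc n)) / (\<i> * complex_of_real \<omega>))
      has_vector_derivative (iexp n \<omega> x - complex_of_real x ^ n / fact n) / (\<i> * complex_of_real \<omega>)) (at x)"
    by (intro has_vector_derivative_divide has_vector_derivative_diff Suc.IH p)
  ultimately show ?case by simp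
qed

lemma iexp_0: "iexp (Suc n) \<omega> 0 = 0"
  by (induction n) (auto simp: expi_cis)

lemma antider_iexp: "\<omega> \<noteq> 0 \<Longrightarrow> antider n (iexp n \<omega>) (expi \<omega>)"
proof (induction n)
  case 0 then show ?case by (simp add: fun_eq_iff)
next
  case (Suc n)
  then show ?case using iexp_has_vector_derivative[OF Suc.prems, of n] iexp_0[of n]
    by (auto simp del: iexp.simps)
qed

lemma iexp_Ck: "iexp n \<omega> \<in> Ck (enat m)"
proof (induction n)
  case 0
  have "iexp 0 \<omega> = expi \<omega>" by (simp add: fun_eq_iff)
  then show ?case by (simp add: Ck_expi)
next
  case (Suc n)
  have "iexp (Suc n) \<omega> = (\<lambda>x. 1 / (\<i> * complex_of_real \<omega>) * (iexp n \<omega> x - 1 / fact n * complex_of_real x ^ n))"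
    by (simp add: fun_eq_iff)
  then show ?case by (simp only:) (intro Ck_cmult Ck_diff Suc.IH Ck_power)
qed

lemma iexp_smooth_closure: assumes r: "0 < r" shows "iexp n \<omega> \<in> smooth_closure r p polys"
proof (induction n)
  case 0
  have "iexp 0 \<omega> = expi \<omega>" by (simp add: fun_eq_iff)
  then show ?case by (simp add: expi_smooth_closure r)
next
  case (Suc n)
  have "(\<lambda>x. (- 1 / fact n) * complex_of_real x ^ n) \<in> polys"
    unfolding polys_def by (intro CollectI exI[of _ "monom (- 1 / fact n) n"]) (simp add: poly_monom)
  then have 1: "(\<lambda>x. (- 1 / fact n) * complex_of_real x ^ n) \<in> smooth_closure r p polys"
    using polys_smooth_le r smooth_closure_superset by (meson less_imp_le)
  have 2: "(\<lambda>x. 1 / (\<i> * complex_of_real \<omega>)) \<in> smooth_closure r p polys"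
    using polys_smooth_le[OF polys_const] r smooth_closure_superset[OF polys_const] by (meson less_imp_le)
  have "iexp (Suc n) \<omega> = (\<lambda>x. 1 / (\<i> * complex_of_real \<omega>) * (iexp n \<omega> x + (- 1 / fact n) * complex_of_real x ^ n))"
    by (simp add: fun_eq_iff)
  then show ?case by (simp only:) (intro smooth_closure_mult smooth_closure_add polys_add polys_mult Suc.IH 1 2)
qed

text \<open>Each integration divides the exponential by \<open>i\<omega>\<close> and subtracts a fixed monomial divided by \<open>i\<omega>\<close>. Starting
  from order \<open>\<bar>\<omega>\<bar>\<^sup>p\<close>, the monomials are dominated until the \<open>(p + 1)\<close>-st step.\<close>

lemma iexp_smooth_le:
  assumes r: "0 < r" and \<omega>0: "0 < \<omega>0"
  shows "j \<le> p \<Longrightarrow> \<exists>K. \<forall>\<omega>. \<omega>0 \<le> \<bar>\<omega>\<bar> \<longrightarrow> smooth_le r p (iexp j \<omega>) (K * \<bar>\<omega>\<bar> ^ (p - j))"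
    and "\<exists>K. \<forall>\<omega>. \<omega>0 \<le> \<bar>\<omega>\<bar> \<longrightarrow> smooth_le r p (iexp (Suc p) \<omega>) (K / \<bar>\<omega>\<bar>)"
proof -
  have step: "smooth_le r p (iexp (Suc j) \<omega>) ((c + real (Suc p) * (r + 1) ^ j / fact j) / \<bar>\<omega>\<bar>)"
    if "smooth_le r p (iexp j \<omega>) c" for j \<omega> c
  proof -
    have "iexp (Suc j) \<omega> = (\<lambda>x. 1 / (\<i> * complex_of_real \<omega>) * (iexp j \<omega> x - 1 / fact j * complex_of_real x ^ j))"
      by (simp add: fun_eq_iff)
    moreover have "smooth_le r p (\<lambda>x. 1 / (\<i> * complex_of_real \<omega>) * (iexp j \<omega> x - 1 / fact j * complex_of_real x ^ j))
        (cmod (1 / (\<i> * complex_of_real \<omega>)) * (c + cmod (1 / fact j) * (real (Suc p) * (r + 1) ^ j)))"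
      using r by (intro smooth_le_cmult smooth_le_diff that smooth_le_power) auto
    ultimately show ?thesis by (simp add: norm_divide norm_mult)
  qed
  show low: "\<exists>K. \<forall>\<omega>. \<omega>0 \<le> \<bar>\<omega>\<bar> \<longrightarrow> smooth_le r p (iexp j \<omega>) (K * \<bar>\<omega>\<bar> ^ (p - j))" if "j \<le> p" for j
    using that
  proof (induction j)
    case 0
    obtain C where C: "1 \<le> C" "\<And>i \<xi>. i \<le> p \<Longrightarrow> dd_le r i (expi \<xi>) ((C * \<bar>\<xi>\<bar>) ^ i / fact i)"
      using dd_le_expi[OF r] by blast
    define K where "K = (\<Sum>i\<le>p. C ^ i / (fact i * \<omega>0 ^ (p - i)))"
    have "smooth_le r p (iexp 0 \<omega>) (K * \<bar>\<omega>\<bar> ^ (p - 0))" if \<omega>: "\<omega>0 \<le> \<bar>\<omega>\<bar>" for \<omega>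
    proof -
      have "(\<Sum>i\<le>p. (C * \<bar>\<omega>\<bar>) ^ i / fact i) \<le> (\<Sum>i\<le>p. C ^ i / (fact i * \<omega>0 ^ (p - i)) * \<bar>\<omega>\<bar> ^ p)"
      proof (rule sum_mono)
        fix i assume i: "i \<in> {..p}"
        have "\<omega>0 ^ (p - i) \<le> \<bar>\<omega>\<bar> ^ (p - i)" using \<omega> \<omega>0 by (intro power_mono) auto
        then have "1 \<le> \<bar>\<omega>\<bar> ^ (p - i) / \<omega>0 ^ (p - i)" using \<omega>0 by simp
        then have "(C * \<bar>\<omega>\<bar>) ^ i / fact i * 1 \<le> (C * \<bar>\<omega>\<bar>) ^ i / fact i * (\<bar>\<omega>\<bar> ^ (p - i) / \<omega>0 ^ (p - i))"
          using C(1) by (intro mult_left_mono) auto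
        also have "\<dots> = C ^ i / (fact i * \<omega>0 ^ (p - i)) * (\<bar>\<omega>\<bar> ^ i * \<bar>\<omega>\<bar> ^ (p - i))"
          by (simp add: power_mult_distrib)
        also have "\<bar>\<omega>\<bar> ^ i * \<bar>\<omega>\<bar> ^ (p - i) = \<bar>\<omega>\<bar> ^ p" using i by (simp flip: power_add)
        finally show "(C * \<bar>\<omega>\<bar>) ^ i / fact i \<le> C ^ i / (fact i * \<omega>0 ^ (p - i)) * \<bar>\<omega>\<bar> ^ p" by simp
      qed
      then have "(\<Sum>i\<le>p. (C * \<bar>\<omega>\<bar>) ^ i / fact i) \<le> K * \<bar>\<omega>\<bar> ^ (p - 0)"
        by (simp add: K_def sum_distrib_right)
      then have "smooth_le r p (expi \<omega>) (K * \<bar>\<omega>\<bar> ^ (p - 0))" by (rule smooth_leI[rotated]) (rule C(2))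
      moreover have "iexp 0 \<omega> = expi \<omega>" by (simp add: fun_eq_iff)
      ultimately show ?thesis by simp
    qed
    then show ?case by blast
  next
    case (Suc j)
    then obtain K where K: "\<And>\<omega>. \<omega>0 \<le> \<bar>\<omega>\<bar> \<Longrightarrow> smooth_le r p (iexp j \<omega>) (K * \<bar>\<omega>\<bar> ^ (p - j))" by auto
    define D where "D = real (Suc p) * (r + 1) ^ j / fact j"
    have "smooth_le r p (iexp (Suc j) \<omega>) ((K + D / \<omega>0 ^ (p - j)) * \<bar>\<omega>\<bar> ^ (p - Suc j))" if \<omega>: "\<omega>0 \<le> \<bar>\<omega>\<bar>" for \<omega>
    proof (rule smooth_le_mono[OF step[OF K[OF \<omega>]]])
      have \<omega>pos: "0 < \<bar>\<omega>\<bar>" using \<omega> \<omega>0 by simp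
      have pj: "p - j = Suc (p - Suc j)" using Suc.prems by simp
      have "0 \<le> D" using r by (simp add: D_def)
      have "\<omega>0 ^ (p - j) \<le> \<bar>\<omega>\<bar> ^ (p - j)" using \<omega> \<omega>0 by (intro power_mono) auto
      then have "1 \<le> \<bar>\<omega>\<bar> ^ (p - j) / \<omega>0 ^ (p - j)" using \<omega>0 by simp
      then have "D * 1 \<le> D * (\<bar>\<omega>\<bar> ^ (p - j) / \<omega>0 ^ (p - j))"
        using \<open>0 \<le> D\<close> by (intro mult_left_mono) auto
      then have "(K * \<bar>\<omega>\<bar> ^ (p - j) + D) / \<bar>\<omega>\<bar> \<le> (K * \<bar>\<omega>\<bar> ^ (p - j) + D * (\<bar>\<omega>\<bar> ^ (p - j) / \<omega>0 ^ (p - j))) / \<bar>\<omega>\<bar>"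
        using \<omega>pos by (intro divide_right_mono) auto
      also have "\<dots> = (K + D / \<omega>0 ^ (p - j)) * \<bar>\<omega>\<bar> ^ (p - Suc j)"
      proof -
        have "(K * \<bar>\<omega>\<bar> ^ (p - j) + D * (\<bar>\<omega>\<bar> ^ (p - j) / \<omega>0 ^ (p - j))) / \<bar>\<omega>\<bar> = (K + D / \<omega>0 ^ (p - j)) * (\<bar>\<omega>\<bar> ^ (p - j) / \<bar>\<omega>\<bar>)"
          by (simp add: algebra_simps add_divide_distrib)
        also have "\<bar>\<omega>\<bar> ^ (p - j) / \<bar>\<omega>\<bar> = \<bar>\<omega>\<bar> ^ (p - Suc j)" using \<omega>pos by (simp add: pj del: abs_power_minus)
        finally show ?thesis .
      qed
      finally show "(K * \<bar>\<omega>\<bar> ^ (p - j) + real (Suc p) * (r + 1) ^ j / fact j) / \<bar>\<omega>\<bar>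
          \<le> (K + D / \<omega>0 ^ (p - j)) * \<bar>\<omega>\<bar> ^ (p - Suc j)" by (simp add: D_def)
    qed
    then show ?case by blast
  qed
  obtain K where K: "\<And>\<omega>. \<omega>0 \<le> \<bar>\<omega>\<bar> \<Longrightarrow> smooth_le r p (iexp p \<omega>) (K * \<bar>\<omega>\<bar> ^ (p - p))" using low[of p] by auto
  have "smooth_le r p (iexp (Suc p) \<omega>) ((K + real (Suc p) * (r + 1) ^ p / fact p) / \<bar>\<omega>\<bar>)" if "\<omega>0 \<le> \<bar>\<omega>\<bar>" for \<omega>
    using step[OF K[OF that]] by simp
  then show "\<exists>K. \<forall>\<omega>. \<omega>0 \<le> \<bar>\<omega>\<bar> \<longrightarrow> smooth_le r p (iexp (Suc p) \<omega>) (K / \<bar>\<omega>\<bar>)" by blast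
qed

text \<open>The \<open>(p + 1)\<close>-fold integral of a trigonometric polynomial is controlled, in the norms up to order
  \<open>p\<close>, by \<open>\<Sum> \<bar>c\<^sub>\<xi>\<bar> / \<bar>\<xi>\<bar>\<close>, hence by the supremum. The frequencies are rescaled by \<open>1 / r\<close>, so that \<open>[-r, r]\<close>
  corresponds to the arc \<open>[-1, 1]\<close>.\<close>

lemma trig_antider:
  assumes r: "0 < r"
  obtains K where "0 < K" and "\<And>T M. T \<in> trig half_integers \<Longrightarrow> 0 < M \<Longrightarrow> (\<And>t. cmod (T t) \<le> M) \<Longrightarrow>
    \<exists>J. antider (Suc p) J (\<lambda>x. T (x / r)) \<and> smooth_le r p J (K * M) \<and> J \<in> smooth_closure r p polys \<and> J \<in> Ck (enat p)"
proof -
  obtain Q where Q: "0 < Q" "\<And>F c M. finite F \<Longrightarrow> F \<subseteq> half_integers \<Longrightarrow> 0 < M \<Longrightarrow>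
    (\<And>t. cmod (\<Sum>\<xi>\<in>F. c \<xi> * expi \<xi> t) \<le> M) \<Longrightarrow> (\<Sum>\<xi>\<in>F. cmod (c \<xi>) / \<bar>\<xi>\<bar>) \<le> Q * M"
    using half_integer_coefficients by blast
  obtain K where K: "\<And>\<omega>. 1 / (2 * r) \<le> \<bar>\<omega>\<bar> \<Longrightarrow> smooth_le r p (iexp (Suc p) \<omega>) (K / \<bar>\<omega>\<bar>)"
    using iexp_smooth_le(2)[OF r, of "1 / (2 * r)" p] r by auto
  define L where "L = \<bar>K\<bar> + 1"
  show thesis
  proof
    show "0 < L * r * Q" using r Q by (auto simp: L_def)
    fix T M assume T: "T \<in> trig half_integers" and M: "0 < (M::real)" and TM: "\<And>t. cmod (T t) \<le> M"
    obtain F c where F: "T = (\<lambda>x. \<Sum>\<xi>\<in>F. c \<xi> * expi \<xi> x)" "finite F" "F \<subseteq> half_integers"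
      using T unfolding trig_def by blast
    define J where "J = (\<lambda>x. \<Sum>\<xi>\<in>F. c \<xi> * iexp (Suc p) (\<xi> / r) x)"
    have \<xi>: "1 / 2 \<le> \<bar>\<xi>\<bar>" if "\<xi> \<in> F" for \<xi> using half_integers_ge F(3) that by blast
    have resc: "expi (\<xi> / r) x = expi \<xi> (x / r)" for \<xi> x by (simp add: expi_def)
    have "antider (Suc p) J (\<lambda>x. \<Sum>\<xi>\<in>F. c \<xi> * expi (\<xi> / r) x)"
      unfolding J_def by (rule antider_sum, rule antider_iexp) (use \<xi> r in fastforce)
    then have "antider (Suc p) J (\<lambda>x. T (x / r))" by (simp add: F(1) resc del: antider.simps)
    moreover have "smooth_le r p J (L * r * Q * M)"
    proof -
      have "smooth_le r p (iexp (Suc p) (\<xi> / r)) (L * r / \<bar>\<xi>\<bar>)" if "\<xi> \<in> F" for \<xi>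
      proof (rule smooth_le_mono[OF K])
        show "1 / (2 * r) \<le> \<bar>\<xi> / r\<bar>" using \<xi>[OF that] r by (simp add: field_simps)
        have "K * (r / \<bar>\<xi>\<bar>) \<le> L * (r / \<bar>\<xi>\<bar>)" using r by (intro mult_right_mono) (auto simp: L_def)
        then show "K / \<bar>\<xi> / r\<bar> \<le> L * r / \<bar>\<xi>\<bar>" using r by simp
      qed
      then have "smooth_le r p J (\<Sum>\<xi>\<in>F. cmod (c \<xi>) * (L * r / \<bar>\<xi>\<bar>))"
        unfolding J_def by (intro smooth_le_sum smooth_le_cmult)
      moreover have "(\<Sum>\<xi>\<in>F. cmod (c \<xi>) * (L * r / \<bar>\<xi>\<bar>)) = L * r * (\<Sum>\<xi>\<in>F. cmod (c \<xi>) / \<bar>\<xi>\<bar>)"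
        by (simp add: sum_distrib_left mult_ac)
      moreover have "L * r * (\<Sum>\<xi>\<in>F. cmod (c \<xi>) / \<bar>\<xi>\<bar>) \<le> L * r * (Q * M)"
        using r TM by (intro mult_left_mono Q F M) (auto simp: L_def F(1))
      ultimately show ?thesis by (metis smooth_le_mono mult.assoc)
    qed
    moreover have "J \<in> smooth_closure r p polys"
    proof -
      have z: "(\<lambda>x. z) \<in> smooth_closure r p polys" for z
        using polys_smooth_le[OF polys_const] r smooth_closure_superset[OF polys_const] by (meson less_imp_le)
      show ?thesis unfolding J_def
        by (induction F rule: infinite_finite_induct)
           (auto simp del: iexp.simps intro!: z smooth_closure_add smooth_closure_mult iexp_smooth_closure r polys_add polys_mult)
    qed
    moreover have "J \<in> Ck (enat p)" unfolding J_def by (intro Ck_sum Ck_cmult iexp_Ck)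
    ultimately show "\<exists>J. antider (Suc p) J (\<lambda>x. T (x / r)) \<and> smooth_le r p J (L * r * Q * M) \<and>
        J \<in> smooth_closure r p polys \<and> J \<in> Ck (enat p)" by blast
  qed
qed

text \<open>Approximate the derivative of order \<open>p + 1\<close> on \<open>[-r, r]\<close> by trigonometric polynomials
  \<open>T j\<close> with error \<open>2\<^sup>-\<^sup>j\<close>. The integrals of \<open>T (j + 1) - T j\<close> form a summable series,
  whose sum is \<open>f\<close> up to a polynomial.\<close>

lemma Ck_Suc_smooth_closure:
  assumes r: "0 < r" and f: "f \<in> Ck (enat (Suc p))"
  shows "f \<in> smooth_closure r p polys"
proof -
  define v where "v = vderiv (Suc p) f"
  obtain P where P: "P \<in> polys" "antider (Suc p) (\<lambda>x. f x - P x) v"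
    using Ck_antider_mod_polys[OF f] unfolding v_def by blast
  have v: "continuous_on UNIV v" using f unfolding Ck_def v_def by simp
  have "continuous_on {-1..1} (\<lambda>t. v (r * t))"
    by (rule continuous_on_compose2[OF v]) (auto intro: continuous_intros)
  then obtain G where G: "\<And>t. \<bar>t\<bar> \<le> 1 \<Longrightarrow> G t = v (r * t)"
    "\<And>e. 0 < e \<Longrightarrow> \<exists>T\<in>trig half_integers. \<forall>t. cmod (G t - T t) < e"
    by (rule half_integer_trig_approx) blast
  have "\<forall>j. \<exists>T. T \<in> trig half_integers \<and> (\<forall>t. cmod (G t - T t) < (1/2) ^ j)" using G(2) by (simp add: Bex_def)
  from choice[OF this] obtain T where T: "\<And>j. T j \<in> trig half_integers"
    "\<And>j t. cmod (G t - T j t) < (1/2) ^ j" by blast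
  obtain K where K: "0 < K" "\<And>T M. T \<in> trig half_integers \<Longrightarrow> 0 < M \<Longrightarrow> (\<And>t. cmod (T t) \<le> M) \<Longrightarrow>
    \<exists>J. antider (Suc p) J (\<lambda>x. T (x / r)) \<and> smooth_le r p J (K * M) \<and> J \<in> smooth_closure r p polys \<and> J \<in> Ck (enat p)"
    using trig_antider[OF r] by blast
  obtain M0 where M0: "0 < M0" "\<And>t. cmod (T 0 t) \<le> M0"
  proof -
    obtain F c where F: "T 0 = (\<lambda>x. \<Sum>\<xi>\<in>F. c \<xi> * expi \<xi> x)" using T(1)[of 0] unfolding trig_def by blast
    have "cmod (T 0 t) \<le> (\<Sum>\<xi>\<in>F. cmod (c \<xi>)) + 1" for t
      using norm_sum[of "\<lambda>\<xi>. c \<xi> * expi \<xi> t" F] by (simp add: F norm_mult)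
    moreover have "0 \<le> (\<Sum>\<xi>\<in>F. cmod (c \<xi>))" by (simp add: sum_nonneg)
    ultimately show ?thesis by (intro that[of "(\<Sum>\<xi>\<in>F. cmod (c \<xi>)) + 1"]) auto
  qed
  define S where "S = (\<lambda>j. case j of 0 \<Rightarrow> T 0 | Suc j \<Rightarrow> (\<lambda>t. T (Suc j) t + (-1) * T j t))"
  define M where "M = (\<lambda>j. case j of 0 \<Rightarrow> M0 | Suc j \<Rightarrow> 2 * (1/2::real) ^ j)"
  have S: "S j \<in> trig half_integers" for j
    using T(1) trig_add[OF T(1) trig_cmult[OF T(1), of "-1"]] by (cases j) (simp_all add: S_def)
  have M: "0 < M j" for j by (cases j) (auto simp: M_def M0)
  have SM: "cmod (S j t) \<le> M j" for j t
  proof (cases j)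
    case (Suc i)
    have "T (Suc i) t - T i t = (G t - T i t) - (G t - T (Suc i) t)" by simp
    then have "cmod (T (Suc i) t - T i t) \<le> cmod (G t - T i t) + cmod (G t - T (Suc i) t)"
      by (metis norm_triangle_ineq4)
    moreover have "(1/2::real) ^ Suc i \<le> (1/2) ^ i" by (intro power_decreasing) auto
    ultimately have "cmod (T (Suc i) t - T i t) \<le> 2 * (1/2) ^ i"
      using T(2)[of t i] T(2)[of t "Suc i"] by linarith
    then show ?thesis by (simp add: S_def M_def Suc)
  qed (use M0 in \<open>simp add: S_def M_def\<close>)
  have "\<forall>j. \<exists>J. antider (Suc p) J (\<lambda>x. S j (x / r)) \<and> smooth_le r p J (K * M j) \<and> J \<in> smooth_closure r p polys \<and> J \<in> Ck (enat p)"
    using K(2)[OF S M SM] by blast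
  from choice[OF this] obtain J where J: "\<And>j. antider (Suc p) (J j) (\<lambda>x. S j (x / r))"
    "\<And>j. smooth_le r p (J j) (K * M j)" "\<And>j. J j \<in> smooth_closure r p polys" "\<And>j. J j \<in> Ck (enat p)" by blast
  have Sp: "(\<Sum>j<Suc N. S j t) = T N t" for N t
    by (induction N) (auto simp: S_def)
  have Msum: "summable (\<lambda>j. K * M j)"
  proof -
    have "summable (\<lambda>j. M (Suc j))" by (simp add: M_def summable_mult summable_geometric)
    then have "summable M" by (subst (asm) summable_Suc_iff)
    then show ?thesis by (rule summable_mult)
  qed
  have sums: "(\<lambda>j. J j x) sums (f x - P x)" if x: "\<bar>x\<bar> \<le> r" for x
  proof -
    have bound: "cmod ((f x - P x) - (\<Sum>j<Suc N. J j x)) \<le> r ^ Suc p * (1/2) ^ N" for N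
    proof -
      have "antider (Suc p) (\<lambda>x. \<Sum>j<Suc N. 1 * J j x) (\<lambda>x. \<Sum>j<Suc N. 1 * S j (x / r))"
        by (rule antider_sum) (rule J)
      from antider_lincomb[OF P(2) this, of 1 "-1"]
      have A: "antider (Suc p) (\<lambda>x. (f x - P x) - (\<Sum>j<Suc N. J j x)) (\<lambda>x. v x - T N (x / r))"
        by (simp add: Sp del: antider.simps sum.lessThan_Suc)
      show ?thesis
      proof (rule antider_bound[OF A _ _ x])
        fix y assume "\<bar>y\<bar> \<le> r"
        then have "G (y / r) = v y" using G(1)[of "y / r"] r by simp
        then show "cmod (v y - T N (y / r)) \<le> (1/2) ^ N" using T(2)[of "y / r" N] by simp
      qed (use r in simp)
    qed
    have "(\<lambda>N. (f x - P x) - (\<Sum>j<Suc N. J j x)) \<longlonglongrightarrow> 0"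
    proof (rule Lim_null_comparison)
      show "eventually (\<lambda>N. norm ((f x - P x) - (\<Sum>j<Suc N. J j x)) \<le> r ^ Suc p * (1/2) ^ N) sequentially"
        using bound by simp
      have "(\<lambda>N. r ^ Suc p * (1/2) ^ N) \<longlonglongrightarrow> r ^ Suc p * 0"
        by (intro tendsto_mult tendsto_const LIMSEQ_realpow_zero) auto
      then show "(\<lambda>N. r ^ Suc p * (1/2) ^ N) \<longlonglongrightarrow> 0" by simp
    qed
    then have "(\<lambda>N. (f x - P x) - ((f x - P x) - (\<Sum>j<Suc N. J j x))) \<longlonglongrightarrow> (f x - P x) - 0"
      by (intro tendsto_diff tendsto_const)
    then have "(\<lambda>N. \<Sum>j<Suc N. J j x) \<longlonglongrightarrow> f x - P x" by (simp del: sum.lessThan_Suc)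
    then show ?thesis unfolding sums_def by (rule filterlim_sequentially_Suc[THEN iffD1])
  qed
  have "f \<in> Ck (enat p)" using f by (rule Ck_mono) simp
  then have "(\<lambda>x. f x - P x) \<in> Ck (enat p)"
    using P(1) polys_subset_Ck by (intro Ck_diff) auto
  then have "(\<lambda>x. f x - P x) \<in> smooth_closure r p polys"
    by (rule smooth_closure_sums[OF r _ J(2) Msum sums J(4) J(3) polys_const polys_add])
  moreover have "P \<in> smooth_closure r p polys"
    using polys_smooth_le[OF P(1)] r smooth_closure_superset[OF P(1)] by (meson less_imp_le)
  ultimately have "(\<lambda>x. (f x - P x) + P x) \<in> smooth_closure r p polys"
    by (intro smooth_closure_add polys_add)
  then show ?thesis by simp
qed


section \<open>Multivariate polynomials\<close>

definition mpoly_fun :: "nat \<Rightarrow> ((nat \<Rightarrow> real) \<Rightarrow> complex) set" where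
  "mpoly_fun m = {\<lambda>s. \<Sum>e\<in>E. c e * (\<Prod>i<m. complex_of_real (s i) ^ e i) | E c. finite (E :: (nat \<Rightarrow> nat) set)}"

lemma mpolys_eq: "mpolys m = restr (Rn m) ` mpoly_fun m"
  unfolding mpolys_def mpoly_fun_def by auto

lemma mpoly_fun_monomial: "(\<lambda>s. z * (\<Prod>i<m. complex_of_real (s i) ^ e i)) \<in> mpoly_fun m"
  unfolding mpoly_fun_def by (auto intro!: exI[of _ "{e}"] exI[of _ "\<lambda>_. z"])

lemma mpoly_fun_0: "(\<lambda>s. 0) \<in> mpoly_fun m"
  unfolding mpoly_fun_def by (auto intro!: exI[of _ "{}"])

lemma mpoly_fun_add: assumes "\<phi> \<in> mpoly_fun m" "\<psi> \<in> mpoly_fun m" shows "(\<lambda>s. \<phi> s + \<psi> s) \<in> mpoly_fun m"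
proof -
  obtain E c where f: "\<phi> = (\<lambda>s. \<Sum>e\<in>E. c e * (\<Prod>i<m. complex_of_real (s i) ^ e i))" "finite E"
    using assms(1) unfolding mpoly_fun_def by blast
  obtain H d where g: "\<psi> = (\<lambda>s. \<Sum>e\<in>H. d e * (\<Prod>i<m. complex_of_real (s i) ^ e i))" "finite H"
    using assms(2) unfolding mpoly_fun_def by blast
  let ?c = "\<lambda>e. (if e \<in> E then c e else 0) + (if e \<in> H then d e else 0)"
  let ?m = "\<lambda>e s. \<Prod>i<m. complex_of_real (s i) ^ e i"
  have "(\<Sum>e\<in>E. c e * ?m e s) = (\<Sum>e\<in>E \<union> H. (if e \<in> E then c e else 0) * ?m e s)" for s
    by (rule sum.mono_neutral_cong_left) (use f g in auto)
  moreover have "(\<Sum>e\<in>H. d e * ?m e s) = (\<Sum>e\<in>E \<union> H. (if e \<in> H then d e else 0) * ?m e s)" for s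
    by (rule sum.mono_neutral_cong_left) (use f g in auto)
  ultimately have "(\<lambda>s. \<phi> s + \<psi> s) = (\<lambda>s. \<Sum>e\<in>E \<union> H. ?c e * ?m e s)"
    by (simp add: f g sum.distrib distrib_right)
  then show ?thesis unfolding mpoly_fun_def using f g by (auto intro!: exI[of _ "E \<union> H"] exI[of _ ?c])
qed

lemma mpoly_fun_sum: "(\<And>a. a \<in> A \<Longrightarrow> \<phi> a \<in> mpoly_fun m) \<Longrightarrow> (\<lambda>s. \<Sum>a\<in>A. \<phi> a s) \<in> mpoly_fun m"
  by (induction A rule: infinite_finite_induct) (auto intro: mpoly_fun_0 mpoly_fun_add)

lemma mpoly_fun_mult: assumes "\<phi> \<in> mpoly_fun m" "\<psi> \<in> mpoly_fun m" shows "(\<lambda>s. \<phi> s * \<psi> s) \<in> mpoly_fun m"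
proof -
  obtain E c where f: "\<phi> = (\<lambda>s. \<Sum>e\<in>E. c e * (\<Prod>i<m. complex_of_real (s i) ^ e i))" "finite E"
    using assms(1) unfolding mpoly_fun_def by blast
  obtain H d where g: "\<psi> = (\<lambda>s. \<Sum>e\<in>H. d e * (\<Prod>i<m. complex_of_real (s i) ^ e i))" "finite H"
    using assms(2) unfolding mpoly_fun_def by blast
  have "(\<lambda>s. \<phi> s * \<psi> s) = (\<lambda>s. \<Sum>e\<in>E. \<Sum>e'\<in>H. (c e * d e') * (\<Prod>i<m. complex_of_real (s i) ^ (e i + e' i)))"
    by (simp add: f g sum_product power_add prod.distrib mult_ac)
  also have "\<dots> \<in> mpoly_fun m" by (intro mpoly_fun_sum mpoly_fun_monomial)
  finally show ?thesis .
qed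

lemma mpoly_fun_const: "(\<lambda>s. c) \<in> mpoly_fun m"
  using mpoly_fun_monomial[where z=c and e="\<lambda>_. 0"] by simp

lemma mpoly_fun_coordinate: assumes "l < m" shows "(\<lambda>s. complex_of_real (s l)) \<in> mpoly_fun m"
proof -
  have "(\<Prod>i<m. complex_of_real (s i) ^ (if i = l then 1 else 0)) = complex_of_real (s l)" for s :: "nat \<Rightarrow> real"
  proof -
    have "(\<Prod>i<m. complex_of_real (s i) ^ (if i = l then 1 else 0)) = (\<Prod>i<m. if i = l then complex_of_real (s i) else 1)"
      by (intro prod.cong) auto
    then show ?thesis using assms by simp
  qed
  then show ?thesis using mpoly_fun_monomial[where z=1 and m=m and e="\<lambda>i. if i = l then 1 else 0"] by simp
qed

lemma mpoly_fun_power: "\<phi> \<in> mpoly_fun m \<Longrightarrow> (\<lambda>s. \<phi> s ^ n) \<in> mpoly_fun m"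
  by (induction n) (auto intro: mpoly_fun_const mpoly_fun_mult)

lemma mpoly_fun_prod: "(\<And>a. a \<in> A \<Longrightarrow> \<phi> a \<in> mpoly_fun m) \<Longrightarrow> (\<lambda>s. \<Prod>a\<in>A. \<phi> a s) \<in> mpoly_fun m"
  by (induction A rule: infinite_finite_induct) (auto intro: mpoly_fun_const mpoly_fun_mult)

lemma mpoly_fun_rename:
  assumes "\<phi> \<in> mpoly_fun m" and "\<And>l. l < m \<Longrightarrow> p l < M"
  shows "(\<lambda>s. \<phi> (\<lambda>l. s (p l))) \<in> mpoly_fun M"
proof -
  obtain E c where f: "\<phi> = (\<lambda>s. \<Sum>e\<in>E. c e * (\<Prod>i<m. complex_of_real (s i) ^ e i))" "finite E"
    using assms(1) unfolding mpoly_fun_def by blast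
  show ?thesis unfolding f
    by (intro mpoly_fun_sum mpoly_fun_mult mpoly_fun_const mpoly_fun_prod mpoly_fun_power mpoly_fun_coordinate) (use assms(2) in auto)
qed

lemma mpoly_fun_continuous: assumes "\<phi> \<in> mpoly_fun m" shows "continuous_on A \<phi>"
proof -
  obtain E c where f: "\<phi> = (\<lambda>s. \<Sum>e\<in>E. c e * (\<Prod>i<m. complex_of_real (s i) ^ e i))"
    using assms unfolding mpoly_fun_def by blast
  show ?thesis unfolding f
    by (intro continuous_on_sum continuous_on_mult continuous_on_const continuous_on_prod
        continuous_on_power continuous_on_of_real
        continuous_on_subset[OF continuous_on_product_coordinates]) auto
qed

lemma mpoly_fun_local: "\<phi> \<in> mpoly_fun m \<Longrightarrow> (\<And>l. l < m \<Longrightarrow> s l = t l) \<Longrightarrow> \<phi> s = \<phi> t"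
  unfolding mpoly_fun_def by auto

text \<open>By the Leibniz rule and induction over the construction of the polynomial.\<close>

lemma polys_isdd_mpoly_fun: "f \<in> polys \<Longrightarrow> \<exists>\<phi>\<in>mpoly_fun (Suc i). isdd i f \<phi>"
proof (induction arbitrary: i rule: polys_induct)
  case (const c)
  have "(\<lambda>s. if i = 0 then c else 0) \<in> mpoly_fun (Suc i)" by (rule mpoly_fun_const)
  with isdd_const[of i c] show ?case by (rule rev_bexI[rotated])
next
  case var
  have "(\<lambda>s. if i = 0 then complex_of_real (s 0) else if i = 1 then 1 else 0) \<in> mpoly_fun (Suc i)"
    by (cases "i = 0"; cases "i = 1") (auto intro: mpoly_fun_coordinate mpoly_fun_const)
  then show ?case using isdd_of_real[of i] by blast
next
  case (add f g)
  then obtain \<phi> \<psi> where "\<phi> \<in> mpoly_fun (Suc i)" "isdd i f \<phi>" "\<psi> \<in> mpoly_fun (Suc i)" "isdd i g \<psi>" by blast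
  then show ?case by (intro bexI[where x="\<lambda>s. \<phi> s + \<psi> s"] isdd_add mpoly_fun_add)
next
  case (mult f g)
  have "\<forall>i. \<exists>\<phi>. \<phi> \<in> mpoly_fun (Suc i) \<and> isdd i f \<phi>" using mult.IH(1) by blast
  from choice[OF this] obtain \<phi> where \<phi>: "\<And>j. \<phi> j \<in> mpoly_fun (Suc j)" "\<And>j. isdd j f (\<phi> j)" by blast
  have "\<forall>i. \<exists>\<phi>. \<phi> \<in> mpoly_fun (Suc i) \<and> isdd i g \<phi>" using mult.IH(2) by blast
  from choice[OF this] obtain \<psi> where \<psi>: "\<And>j. \<psi> j \<in> mpoly_fun (Suc j)" "\<And>j. isdd j g (\<psi> j)" by blast
  have "(\<lambda>s. \<Sum>j\<le>i. \<phi> j s * \<psi> (i - j) (\<lambda>l. s (l + j))) \<in> mpoly_fun (Suc i)"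
  proof (intro mpoly_fun_sum mpoly_fun_mult)
    fix j assume j: "j \<in> {..i}"
    show "\<phi> j \<in> mpoly_fun (Suc i)" using mpoly_fun_rename[OF \<phi>(1)[of j], of "\<lambda>l. l" "Suc i"] j by simp
    show "(\<lambda>s. \<psi> (i - j) (\<lambda>l. s (l + j))) \<in> mpoly_fun (Suc i)"
      by (rule mpoly_fun_rename[OF \<psi>(1)]) (use j in auto)
  qed
  then show ?case using isdd_mult[of i f \<phi> g \<psi>] \<phi>(2) \<psi>(2) by blast
qed

lemma prod_diff_telescope:
  fixes x y :: "nat \<Rightarrow> 'a::comm_ring_1"
  shows "(\<Prod>i<m. x i) - (\<Prod>i<m. y i) = (\<Sum>j<m. \<Prod>i<m. if i < j then y i else if i = j then x i - y i else x i)"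
proof (induction m)
  case (Suc m)
  have last: "(\<Prod>i<m. if i < m then y i else if i = m then x i - y i else x i) = (\<Prod>i<m. y i)"
    by (intro prod.cong) auto
  have "(\<Prod>i<Suc m. x i) - (\<Prod>i<Suc m. y i) = ((\<Prod>i<m. x i) - (\<Prod>i<m. y i)) * x m + (\<Prod>i<m. y i) * (x m - y m)"
    by (simp add: algebra_simps)
  then show ?case by (simp add: Suc.IH sum_distrib_right last)
qed simp

lemma power_shift_lipschitz:
  assumes r: "0 \<le> r"
  shows "\<exists>D\<ge>0. \<forall>t h. \<bar>t\<bar> \<le> r \<longrightarrow> 0 \<le> h \<longrightarrow> h \<le> 1 \<longrightarrow>
     cmod (complex_of_real (t + h) ^ n - complex_of_real t ^ n) \<le> D * h"
proof (induction n)
  case 0 show ?case by (intro exI[of _ 0]) auto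
next
  case (Suc n)
  then obtain D where D: "0 \<le> D" "\<And>t h. \<bar>t\<bar> \<le> r \<Longrightarrow> 0 \<le> h \<Longrightarrow> h \<le> 1 \<Longrightarrow>
     cmod (complex_of_real (t + h) ^ n - complex_of_real t ^ n) \<le> D * h" by blast
  have "cmod (complex_of_real (t + h) ^ Suc n - complex_of_real t ^ Suc n) \<le> ((r + 1) * D + r ^ n) * h"
    if t: "\<bar>t\<bar> \<le> r" and h: "0 \<le> h" "h \<le> 1" for t h
  proof -
    have "complex_of_real (t + h) ^ Suc n - complex_of_real t ^ Suc n =
       complex_of_real (t + h) * (complex_of_real (t + h) ^ n - complex_of_real t ^ n) + complex_of_real h * complex_of_real t ^ n"
      by (simp add: algebra_simps)
    also have "cmod \<dots> \<le> cmod (complex_of_real (t + h)) * cmod (complex_of_real (t + h) ^ n - complex_of_real t ^ n)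
        + cmod (complex_of_real h) * cmod (complex_of_real t) ^ n"
      by (rule order_trans[OF norm_triangle_ineq]) (simp add: norm_mult norm_power)
    also have "\<dots> \<le> (r + 1) * (D * h) + h * r ^ n"
    proof (intro add_mono mult_mono)
      show "cmod (complex_of_real (t + h)) \<le> r + 1"
        unfolding norm_of_real using t h by (simp add: abs_le_iff)
      show "cmod (complex_of_real t) ^ n \<le> r ^ n" using t by (intro power_mono) auto
    qed (use t h r D in auto)
    finally show ?thesis by (simp add: algebra_simps)
  qed
  moreover have "0 \<le> (r + 1) * D + r ^ n" using r D by simp
  ultimately show ?case by blast
qed

text \<open>Multivariate polynomials are translated continuously in the tensor norms: the difference of two
  elementary tensors telescopes into elementary tensors with one small factor.\<close>

lemma mpoly_fun_shift_tensor_le: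
  assumes r: "0 < r" and "\<phi> \<in> mpoly_fun m"
  shows "\<exists>K\<ge>0. \<forall>h. 0 \<le> h \<longrightarrow> h \<le> 1 \<longrightarrow> tensor_le r m (\<lambda>s. \<phi> (\<lambda>l. s l + h) - \<phi> s) (K * h)"
proof -
  have mono: "\<exists>K\<ge>0. \<forall>h. 0 \<le> h \<longrightarrow> h \<le> 1 \<longrightarrow>
     tensor_le r m (\<lambda>s. (\<Prod>i<m. complex_of_real (s i + h) ^ e i) - (\<Prod>i<m. complex_of_real (s i) ^ e i)) (K * h)"
    for e :: "nat \<Rightarrow> nat"
  proof -
    have "\<forall>n. \<exists>D. D \<ge> 0 \<and> (\<forall>t h. \<bar>t\<bar> \<le> r \<longrightarrow> 0 \<le> h \<longrightarrow> h \<le> 1 \<longrightarrow>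
       cmod (complex_of_real (t + h) ^ n - complex_of_real t ^ n) \<le> D * h)"
      using power_shift_lipschitz r by (meson less_imp_le)
    from choice[OF this] obtain D where D: "\<And>n. 0 \<le> D n" "\<And>n t h. \<bar>t\<bar> \<le> r \<Longrightarrow> 0 \<le> h \<Longrightarrow> h \<le> 1 \<Longrightarrow>
       cmod (complex_of_real (t + h) ^ n - complex_of_real t ^ n) \<le> D n * h" by blast
    define K where "K = (\<Sum>j<m. \<Prod>i<m. if i = j then D (e i) else (r + 1) ^ e i)"
    have "tensor_le r m (\<lambda>s. (\<Prod>i<m. complex_of_real (s i + h) ^ e i) - (\<Prod>i<m. complex_of_real (s i) ^ e i)) (K * h)"
      if h: "0 \<le> h" "h \<le> 1" for h
    proof -
      define f where "f = (\<lambda>j i t. if i < j then complex_of_real t ^ e i else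
         if i = j then complex_of_real (t + h) ^ e i - complex_of_real t ^ e i else complex_of_real (t + h) ^ e i)"
      have B: "tensor_le r m (\<lambda>s. \<Prod>i<m. f j i (s i)) (\<Prod>i<m. if i = j then D (e i) * h else (r + 1) ^ e i)" for j
      proof (rule tensor_le_elementary)
        fix i
        have "i < j \<or> i = j \<or> j < i" by auto
        then show "continuous_on {-r..r} (f j i)" unfolding f_def by (auto intro!: continuous_intros)
        fix t assume t: "t \<in> {-r..r}"
        have "cmod (complex_of_real t ^ e i) \<le> (r + 1) ^ e i" "cmod (complex_of_real (t + h) ^ e i) \<le> (r + 1) ^ e i"
          unfolding norm_power norm_of_real using t h by (auto intro!: power_mono simp: abs_le_iff)
        then show "cmod (f j i t) \<le> (if i = j then D (e i) * h else (r + 1) ^ e i)"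
          using D(2)[of t h "e i"] t h unfolding f_def by (auto simp: abs_le_iff)
      qed (use D h r in auto)
      have "(\<Prod>i<m. if i = j then D (e i) * h else (r + 1) ^ e i) =
          (\<Prod>i<m. if i = j then D (e i) else (r + 1) ^ e i) * h" if "j < m" for j
      proof -
        have "(\<Prod>i<m. if i = j then D (e i) * h else (r + 1) ^ e i) =
          (\<Prod>i<m. (if i = j then D (e i) else (r + 1) ^ e i) * (if i = j then h else 1))"
          by (intro prod.cong) auto
        then show ?thesis using that by (simp add: prod.distrib)
      qed
      then have "(\<Sum>j<m. \<Prod>i<m. if i = j then D (e i) * h else (r + 1) ^ e i) = K * h"
        by (simp add: K_def sum_distrib_right)
      moreover have "tensor_le r m (\<lambda>s. \<Sum>j<m. \<Prod>i<m. f j i (s i)) (\<Sum>j<m. \<Prod>i<m. if i = j then D (e i) * h else (r + 1) ^ e i)"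
        by (rule tensor_le_sum) (rule B)
      ultimately show ?thesis by (simp add: prod_diff_telescope f_def del: of_real_add)
    qed
    moreover have "0 \<le> K" unfolding K_def using D r by (intro sum_nonneg prod_nonneg) auto
    ultimately show ?thesis by blast
  qed
  obtain E c where f: "\<phi> = (\<lambda>s. \<Sum>e\<in>E. c e * (\<Prod>i<m. complex_of_real (s i) ^ e i))" "finite E"
    using assms(2) unfolding mpoly_fun_def by blast
  have "\<forall>e. \<exists>K. K \<ge> 0 \<and> (\<forall>h. 0 \<le> h \<longrightarrow> h \<le> 1 \<longrightarrow>
     tensor_le r m (\<lambda>s. (\<Prod>i<m. complex_of_real (s i + h) ^ e i) - (\<Prod>i<m. complex_of_real (s i) ^ e i)) (K * h))"
    using mono by blast
  from choice[OF this] obtain K where K: "\<And>e. 0 \<le> K e" "\<And>e h. 0 \<le> h \<Longrightarrow> h \<le> 1 \<Longrightarrow>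
     tensor_le r m (\<lambda>s. (\<Prod>i<m. complex_of_real (s i + h) ^ e i) - (\<Prod>i<m. complex_of_real (s i) ^ e i)) (K e * h)"
    by blast
  have "tensor_le r m (\<lambda>s. \<phi> (\<lambda>l. s l + h) - \<phi> s) ((\<Sum>e\<in>E. cmod (c e) * K e) * h)" if "0 \<le> h" "h \<le> 1" for h
  proof -
    have "tensor_le r m (\<lambda>s. \<Sum>e\<in>E. c e * ((\<Prod>i<m. complex_of_real (s i + h) ^ e i) - (\<Prod>i<m. complex_of_real (s i) ^ e i)))
      (\<Sum>e\<in>E. cmod (c e) * (K e * h))"
      by (intro tensor_le_sum tensor_le_cmult K that)
    then show ?thesis by (simp add: f sum_subtractf right_diff_distrib sum_distrib_right mult.assoc)
  qed
  moreover have "0 \<le> (\<Sum>e\<in>E. cmod (c e) * K e)" using K by (intro sum_nonneg) auto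
  ultimately show ?thesis by blast
qed

lemma mpoly_fun_tensor_le: assumes "0 < r" "\<phi> \<in> mpoly_fun m" shows "\<exists>c. tensor_le r m \<phi> c"
proof -
  obtain E c where f: "\<phi> = (\<lambda>s. \<Sum>e\<in>E. c e * (\<Prod>i<m. complex_of_real (s i) ^ e i))"
    using assms(2) unfolding mpoly_fun_def by blast
  have "tensor_le r m (\<lambda>s. \<Prod>i<m. complex_of_real (s i) ^ e i) (\<Prod>i<m. r ^ e i)" for e
    by (rule tensor_le_elementary)
       (use assms(1) in \<open>auto intro!: continuous_intros power_mono simp: norm_power abs_le_iff\<close>)
  then have "tensor_le r m \<phi> (\<Sum>e\<in>E. cmod (c e) * (\<Prod>i<m. r ^ e i))"
    unfolding f by (intro tensor_le_sum tensor_le_cmult)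
  then show ?thesis by blast
qed

section \<open>Riemann sums\<close>

lemma antiderivative_exists:
  fixes f :: "real \<Rightarrow> complex"
  assumes "continuous_on UNIV f"
  obtains F where "\<And>x. (F has_vector_derivative f x) (at x)"
proof -
  have "isCont f x" for x using assms by (simp add: continuous_on_eq_continuous_at)
  then have "\<exists>F. \<forall>x. (-\<infinity> :: ereal) < ereal x \<longrightarrow> ereal x < \<infinity> \<longrightarrow> (F has_vector_derivative f x) (at x)"
    by (intro einterval_antiderivative) auto
  then show thesis using that by auto
qed

text \<open>The integral of \<open>f\<close> is expressed by an antiderivative because its differentiability, which
  makes averages smoother than \<open>f\<close>, is then part of the data.\<close>

lemma riemann_sums_tendsto:
  fixes f F :: "real \<Rightarrow> complex"
  assumes f: "continuous_on UNIV f" and F: "\<And>x. (F has_vector_derivative f x) (at x)" and \<epsilon>: "0 < \<epsilon>"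
  shows "(\<lambda>n. 1 / complex_of_real (real (Suc n)) * (\<Sum>j<Suc n. f (x + \<epsilon> * real j / real (Suc n))))
     \<longlonglongrightarrow> 1 / complex_of_real \<epsilon> * (F (x + \<epsilon>) - F x)"
proof (rule LIMSEQ_I)
  fix e :: real assume e: "0 < e"
  have "uniformly_continuous_on {x..x + \<epsilon>} f"
    by (intro compact_uniformly_continuous continuous_on_subset[OF f]) auto
  then obtain d where d: "0 < d" "\<And>a b. a \<in> {x..x + \<epsilon>} \<Longrightarrow> b \<in> {x..x + \<epsilon>} \<Longrightarrow> dist b a < d \<Longrightarrow> dist (f b) (f a) < e / 2"
    using e unfolding uniformly_continuous_on_def by (metis half_gt_zero)
  obtain N where N: "\<epsilon> / d < real N" using reals_Archimedean2 by blast
  show "\<exists>no. \<forall>n\<ge>no. norm (1 / complex_of_real (real (Suc n)) * (\<Sum>j<Suc n. f (x + \<epsilon> * real j / real (Suc n)))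
      - 1 / complex_of_real \<epsilon> * (F (x + \<epsilon>) - F x)) < e"
  proof (intro exI[of _ N] allI impI)
    fix n assume n: "N \<le> n"
    define k where "k = real (Suc n)"
    have k: "0 < k" by (simp add: k_def)
    have \<epsilon>k: "\<epsilon> / k < d"
    proof -
      have "\<epsilon> / d < k" using N n by (simp add: k_def)
      then show ?thesis using d(1) k by (simp add: field_simps)
    qed
    define t where "t = (\<lambda>j. x + \<epsilon> * real j / k)"
    have ts: "t (Suc j) = t j + \<epsilon> / k" for j by (simp add: t_def add_divide_distrib distrib_left)
    have piece: "cmod (F (t (Suc j)) - F (t j) - complex_of_real (\<epsilon> / k) * f (t j)) \<le> e / 2 * (\<epsilon> / k)" if j: "j < Suc n" for j
    proof -
      have tj: "x \<le> t j" "t (Suc j) \<le> x + \<epsilon>"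
      proof -
        show "x \<le> t j" using \<epsilon> k by (simp add: t_def)
        have "\<epsilon> * real (Suc j) \<le> \<epsilon> * k" using j \<epsilon> by (intro mult_left_mono) (auto simp: k_def)
        then show "t (Suc j) \<le> x + \<epsilon>" using k by (simp add: t_def divide_le_eq del: of_nat_Suc)
      qed
      let ?S = "{t j..t (Suc j)}"
      have "norm ((F (t (Suc j)) - t (Suc j) *\<^sub>R f (t j)) - (F (t j) - t j *\<^sub>R f (t j))) \<le> e / 2 * norm (t (Suc j) - t j)"
      proof (rule differentiable_bound[where S="?S" and f'="\<lambda>y h. h *\<^sub>R (f y - f (t j))"])
        fix y assume y: "y \<in> ?S"
        have "((\<lambda>y. F y - y *\<^sub>R f (t j)) has_vector_derivative f y - (1 *\<^sub>R f (t j))) (at y within ?S)"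
          by (intro has_vector_derivative_diff has_vector_derivative_at_within[OF F])
             (auto intro!: derivative_eq_intros)
        then show "((\<lambda>y. F y - y *\<^sub>R f (t j)) has_derivative (\<lambda>h. h *\<^sub>R (f y - f (t j)))) (at y within ?S)"
          by (simp add: has_vector_derivative_def)
        have le: "norm (f y - f (t j)) \<le> e / 2"
          using d(2)[of "t j" y] y tj ts[of j] \<epsilon>k by (auto simp: dist_norm)
        show "onorm (\<lambda>h. h *\<^sub>R (f y - f (t j))) \<le> e / 2"
        proof (rule onorm_le)
          fix h show "norm (h *\<^sub>R (f y - f (t j))) \<le> e / 2 * norm h"
            using mult_right_mono[OF le, of "norm h"] by (simp add: mult.commute)
        qed
      qed (use ts[of j] \<epsilon> k in auto)
      moreover have "(F (t (Suc j)) - t (Suc j) *\<^sub>R f (t j)) - (F (t j) - t j *\<^sub>R f (t j)) =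
          F (t (Suc j)) - F (t j) - complex_of_real (\<epsilon> / k) * f (t j)"
        unfolding ts by (simp add: scaleR_conv_of_real algebra_simps)
      moreover have "norm (t (Suc j) - t j) = \<epsilon> / k" using ts[of j] \<epsilon> k by simp
      ultimately show ?thesis by (simp only:)
    qed
    have "(\<Sum>j<Suc n. F (t (Suc j)) - F (t j)) = F (t (Suc n)) - F (t 0)"
      by (rule sum_lessThan_telescope)
    also have "\<dots> = F (x + \<epsilon>) - F x" using k by (simp add: t_def k_def del: of_nat_Suc)
    finally have tel: "F (x + \<epsilon>) - F x = (\<Sum>j<Suc n. F (t (Suc j)) - F (t j))" by simp
    have "cmod (F (x + \<epsilon>) - F x - complex_of_real (\<epsilon> / k) * (\<Sum>j<Suc n. f (t j))) =
        cmod (\<Sum>j<Suc n. F (t (Suc j)) - F (t j) - complex_of_real (\<epsilon> / k) * f (t j))"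
      unfolding tel by (simp only: sum_subtractf sum_distrib_left)
    also have "\<dots> \<le> (\<Sum>j<Suc n. e / 2 * (\<epsilon> / k))"
      by (rule sum_norm_le) (use piece in auto)
    also have "\<dots> = k * (e / 2 * (\<epsilon> / k))" by (simp only: sum_constant card_lessThan k_def)
    also have "\<dots> = e / 2 * \<epsilon>" using k by simp
    finally have 1: "cmod (F (x + \<epsilon>) - F x - complex_of_real (\<epsilon> / k) * (\<Sum>j<Suc n. f (t j))) \<le> e / 2 * \<epsilon>" .
    have "1 / complex_of_real k * (\<Sum>j<Suc n. f (t j)) - 1 / complex_of_real \<epsilon> * (F (x + \<epsilon>) - F x) =
       - (1 / complex_of_real \<epsilon>) * (F (x + \<epsilon>) - F x - complex_of_real (\<epsilon> / k) * (\<Sum>j<Suc n. f (t j)))"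
      using \<epsilon> by (simp add: right_diff_distrib del: sum.lessThan_Suc)
    then have "cmod (1 / complex_of_real k * (\<Sum>j<Suc n. f (t j)) - 1 / complex_of_real \<epsilon> * (F (x + \<epsilon>) - F x)) =
       (1 / \<epsilon>) * cmod (F (x + \<epsilon>) - F x - complex_of_real (\<epsilon> / k) * (\<Sum>j<Suc n. f (t j)))"
      using \<epsilon> by (simp add: norm_mult norm_divide del: sum.lessThan_Suc)
    also have "\<dots> \<le> (1 / \<epsilon>) * (e / 2 * \<epsilon>)" using 1 \<epsilon> by (intro mult_left_mono) auto
    also have "\<dots> < e" using e \<epsilon> by simp
    finally show "norm (1 / complex_of_real (real (Suc n)) * (\<Sum>j<Suc n. f (x + \<epsilon> * real j / real (Suc n)))
      - 1 / complex_of_real \<epsilon> * (F (x + \<epsilon>) - F x)) < e" by (simp only: t_def k_def)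
  qed
qed


section \<open>The norms of the family\<close>

lemma cube_subset_cylinder: "cube r m \<subseteq> cylinder r m"
  by (auto simp: cube_def cylinder_def abs_le_iff)

lemma cube_mono: "s \<le> r \<Longrightarrow> cube s m \<subseteq> cube r m"
  by (auto simp: cube_def)

lemma cube_subset_Rn: "cube r m \<subseteq> Rn m"
  by (auto simp: cube_def)

lemma restr_in_C_on: "continuous_on K \<phi> \<Longrightarrow> restr K \<phi> \<in> C_on K"
  unfolding C_on_def by (auto simp: restr_def elim!: continuous_on_eq)

locale admissible_family =
  fixes \<alpha> :: family
  assumes norm: "norm_family \<alpha>"
    and uniform_le: "family_le uniform_family \<alpha>"
    and le_varopoulos: "family_le \<alpha> varopoulos_family"
    and increasing: "increasing_family \<alpha>"
    and complete: "complete_family \<alpha>"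
    and translation: "translation_invariant_family \<alpha>"
begin

definition cube_norm :: "real \<Rightarrow> nat \<Rightarrow> ((nat \<Rightarrow> real) \<Rightarrow> complex) \<Rightarrow> ennreal" where
  "cube_norm r m \<phi> = \<alpha> r m (restr (cube r m) \<phi>)"

lemma cube_norm_cong: "(\<And>x. x \<in> cube r m \<Longrightarrow> \<phi> x = \<psi> x) \<Longrightarrow> cube_norm r m \<phi> = cube_norm r m \<psi>"
  unfolding cube_norm_def by (rule arg_cong[where f="\<alpha> r m"]) (auto simp: restr_def)

context
  fixes r :: real and m :: nat
  assumes r: "0 < r" and m: "1 \<le> m"
begin

lemma cube_norm_add:
  assumes "continuous_on (cube r m) \<phi>" "continuous_on (cube r m) \<psi>"
  shows "cube_norm r m (\<lambda>s. \<phi> s + \<psi> s) \<le> cube_norm r m \<phi> + cube_norm r m \<psi>"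
proof -
  have "restr (cube r m) (\<lambda>s. \<phi> s + \<psi> s) = (\<lambda>s. restr (cube r m) \<phi> s + restr (cube r m) \<psi> s)"
    by (auto simp: restr_def)
  then show ?thesis
    using norm restr_in_C_on[OF assms(1)] restr_in_C_on[OF assms(2)] r m
    unfolding cube_norm_def norm_family_def ext_norm_def by simp
qed

lemma cube_norm_cmult:
  assumes "continuous_on (cube r m) \<phi>"
  shows "cube_norm r m (\<lambda>s. c * \<phi> s) = ennreal (cmod c) * cube_norm r m \<phi>"
proof -
  have "restr (cube r m) (\<lambda>s. c * \<phi> s) = (\<lambda>s. c * restr (cube r m) \<phi> s)"
    by (auto simp: restr_def)
  then show ?thesis
    using norm restr_in_C_on[OF assms(1)] r m
    unfolding cube_norm_def norm_family_def ext_norm_def by simp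
qed

lemma cube_norm_zero: "cube_norm r m (\<lambda>s. 0) = 0"
  using cube_norm_cmult[of "\<lambda>s. 0" 0] by simp

lemma cube_norm_diff_commute:
  assumes "continuous_on (cube r m) \<phi>" "continuous_on (cube r m) \<psi>"
  shows "cube_norm r m (\<lambda>s. \<phi> s - \<psi> s) = cube_norm r m (\<lambda>s. \<psi> s - \<phi> s)"
  using cube_norm_cmult[of "\<lambda>s. \<psi> s - \<phi> s" "-1"] assms by (simp add: continuous_on_diff)

lemma cube_norm_diff_triangle:
  assumes "continuous_on (cube r m) \<phi>" "continuous_on (cube r m) \<psi>" "continuous_on (cube r m) \<eta>"
  shows "cube_norm r m (\<lambda>s. \<phi> s - \<eta> s) \<le> cube_norm r m (\<lambda>s. \<phi> s - \<psi> s) + cube_norm r m (\<lambda>s. \<psi> s - \<eta> s)"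
  using cube_norm_add[of "\<lambda>s. \<phi> s - \<psi> s" "\<lambda>s. \<psi> s - \<eta> s"] assms by (simp add: continuous_on_diff)

lemma cube_norm_sum:
  assumes "\<And>j. j < (n::nat) \<Longrightarrow> continuous_on (cube r m) (\<phi> j)" "\<And>j. j < n \<Longrightarrow> cube_norm r m (\<phi> j) \<le> e"
  shows "cube_norm r m (\<lambda>s. \<Sum>j<n. \<phi> j s) \<le> of_nat n * e"
  using assms
proof (induction n)
  case 0 then show ?case by (simp add: cube_norm_zero)
next
  case (Suc n)
  have "cube_norm r m (\<lambda>s. (\<Sum>j<n. \<phi> j s) + \<phi> n s) \<le> cube_norm r m (\<lambda>s. \<Sum>j<n. \<phi> j s) + cube_norm r m (\<phi> n)"
    by (rule cube_norm_add) (use Suc.prems in \<open>auto intro!: continuous_on_sum\<close>)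
  also have "\<dots> \<le> of_nat n * e + e"
    by (intro add_mono Suc.IH) (use Suc.prems in auto)
  finally show ?case by (simp add: distrib_right add.commute)
qed

lemma cube_norm_average:
  assumes "0 < (n::nat)"
    and "\<And>j. j < n \<Longrightarrow> continuous_on (cube r m) (\<phi> j)" "\<And>j. j < n \<Longrightarrow> cube_norm r m (\<phi> j) \<le> ennreal e" and e: "0 \<le> e"
  shows "cube_norm r m (\<lambda>s. 1 / complex_of_real (real n) * (\<Sum>j<n. \<phi> j s)) \<le> ennreal e"
proof -
  have "cube_norm r m (\<lambda>s. 1 / complex_of_real (real n) * (\<Sum>j<n. \<phi> j s)) =
      ennreal (1 / real n) * cube_norm r m (\<lambda>s. \<Sum>j<n. \<phi> j s)"
    by (subst cube_norm_cmult) (use assms in \<open>auto intro!: continuous_on_sum simp: norm_divide\<close>)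
  also have "\<dots> \<le> ennreal (1 / real n) * (of_nat n * ennreal e)"
    by (intro mult_left_mono cube_norm_sum assms) auto
  also have "\<dots> = ennreal e"
    using assms(1) e by (simp add: ennreal_of_nat_eq_real_of_nat ennreal_mult[symmetric])
  finally show ?thesis .
qed

lemma cmod_le_cube_norm:
  assumes "continuous_on (cube r m) \<phi>" "x \<in> cube r m"
  shows "ennreal (cmod (\<phi> x)) \<le> cube_norm r m \<phi>"
proof -
  have "ennreal (cmod (\<phi> x)) = ennreal (cmod (restr (cube r m) \<phi> x))" using assms(2) by (simp add: restr_def)
  also have "\<dots> \<le> uniform_family r m (restr (cube r m) \<phi>)"
    unfolding uniform_family_def using assms(2) by (intro SUP_upper)
  also have "\<dots> \<le> cube_norm r m \<phi>"
    using uniform_le restr_in_C_on[OF assms(1)] r m unfolding cube_norm_def family_le_def by blast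
  finally show ?thesis .
qed

lemma cube_norm_mono_cube:
  assumes "r \<le> R" "continuous_on (cube R m) \<phi>" shows "cube_norm r m \<phi> \<le> cube_norm R m \<phi>"
proof -
  have "restr (cube r m) (restr (cube R m) \<phi>) = restr (cube r m) \<phi>"
    using cube_mono[OF assms(1), of m] by (auto simp: restr_def fun_eq_iff)
  then show ?thesis
    using increasing restr_in_C_on[OF assms(2)] r m assms(1) unfolding cube_norm_def increasing_family_def by fastforce
qed

lemma cube_norm_shift:
  assumes t: "0 \<le> t" and \<phi>: "continuous_on (cube (r + t) m) \<phi>"
    and local: "\<And>s s'. (\<And>l. l < m \<Longrightarrow> s l = s' l) \<Longrightarrow> \<phi> s = \<phi> s'"
  shows "cube_norm r m (\<lambda>s. \<phi> (\<lambda>l. s l + t)) \<le> cube_norm (r + t) m \<phi>"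
proof -
  define \<mu> where "\<mu> = (\<lambda>i. if i < m then t else 0)"
  have \<mu>: "\<mu> \<in> Rn m" by (auto simp: \<mu>_def topspace_Euclidean_space)
  have "(\<lambda>i. \<bar>\<mu> i\<bar>) ` {..<m} = {t}" using m t by (auto simp: \<mu>_def intro!: image_eqI[of _ _ 0])
  then have max: "max_abs m \<mu> = t" by (simp add: max_abs_def)
  have "restr (cube r m) (\<lambda>s. restr (cube (r + t) m) \<phi> (\<lambda>i. s i + \<mu> i)) = restr (cube r m) (\<lambda>s. \<phi> (\<lambda>l. s l + t))"
  proof (rule ext)
    fix s
    show "restr (cube r m) (\<lambda>s. restr (cube (r + t) m) \<phi> (\<lambda>i. s i + \<mu> i)) s = restr (cube r m) (\<lambda>s. \<phi> (\<lambda>l. s l + t)) s"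
    proof (cases "s \<in> cube r m")
      case True
      then have "(\<lambda>i. s i + \<mu> i) \<in> cube (r + t) m"
        using t by (force simp: cube_def \<mu>_def topspace_Euclidean_space)
      moreover have "\<phi> (\<lambda>i. s i + \<mu> i) = \<phi> (\<lambda>l. s l + t)" by (rule local) (simp add: \<mu>_def)
      ultimately show ?thesis by (simp add: restr_def)
    qed (simp add: restr_def)
  qed
  moreover have "\<alpha> r m (restr (cube r m) (\<lambda>s. restr (cube (r + t) m) \<phi> (\<lambda>i. s i + \<mu> i))) \<le> \<alpha> (r + t) m (restr (cube (r + t) m) \<phi>)"
    using translation[unfolded translation_invariant_family_def, rule_format, of r m \<mu> "restr (cube (r + t) m) \<phi>"]
      \<mu> restr_in_C_on[OF \<phi>] r m unfolding max by blast
  ultimately show ?thesis by (simp add: cube_norm_def)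
qed

lemma cube_norm_complete:
  assumes \<phi>: "\<And>n. continuous_on (cube r m) (\<phi> n)" "\<And>n. cube_norm r m (\<phi> n) < \<infinity>"
    and cauchy: "\<And>e. 0 < e \<Longrightarrow> \<exists>M. \<forall>p\<ge>M. \<forall>q\<ge>M. cube_norm r m (\<lambda>s. \<phi> p s - \<phi> q s) < ennreal e"
  obtains l where "continuous_on (cube r m) l" "(\<lambda>n. cube_norm r m (\<lambda>s. \<phi> n s - l s)) \<longlonglongrightarrow> 0"
proof -
  let ?\<sigma> = "\<lambda>n. restr (cube r m) (\<phi> n)"
  have diff: "(\<lambda>x. ?\<sigma> p x - ?\<sigma> q x) = restr (cube r m) (\<lambda>s. \<phi> p s - \<phi> q s)" for p q
    by (auto simp: restr_def)
  have e: "\<exists>M. \<forall>p\<ge>M. \<forall>q\<ge>M. \<alpha> r m (\<lambda>x. ?\<sigma> p x - ?\<sigma> q x) < ennreal e" if "e > 0" for e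
    using cauchy[OF that] unfolding diff cube_norm_def .
  have fin: "\<forall>n. ?\<sigma> n \<in> C_on (cube r m) \<and> \<alpha> r m (?\<sigma> n) < \<infinity>"
    using restr_in_C_on[OF \<phi>(1)] \<phi>(2) unfolding cube_norm_def by simp
  have "ext_complete (C_on (cube r m)) (\<alpha> r m)"
    using complete r m unfolding complete_family_def by simp
  from this[unfolded ext_complete_def, THEN spec, of ?\<sigma>]
  obtain l where l: "l \<in> C_on (cube r m)" "(\<lambda>n. \<alpha> r m (\<lambda>x. ?\<sigma> n x - l x)) \<longlonglongrightarrow> 0"
    using fin e by auto
  have "(\<lambda>x. ?\<sigma> n x - l x) = restr (cube r m) (\<lambda>s. \<phi> n s - l s)" for n
    using l(1) by (auto simp: restr_def C_on_def)
  then show thesis using that[of l] l by (simp add: C_on_def cube_norm_def)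
qed

end

lemma cube_norm_le_tensor_le:
  assumes "0 < r" "continuous_on (cube r (Suc i)) \<phi>" "tensor_le r (Suc i) \<phi> c"
  shows "cube_norm r (Suc i) \<phi> \<le> ennreal c"
proof -
  have "cube_norm r (Suc i) \<phi> \<le> varopoulos_family r (Suc i) (restr (cube r (Suc i)) \<phi>)"
    using le_varopoulos restr_in_C_on[OF assms(2)] assms(1) unfolding cube_norm_def family_le_def by simp
  also have "\<dots> \<le> ennreal c" by (rule tensor_le_imp_varopoulos_le[OF assms(3)])
  finally show ?thesis .
qed

lemma cube_norm_le_smooth_le:
  assumes "0 < r" "smooth_le r n f c" "i \<le> n" "isdd i f \<phi>"
  shows "cube_norm r (Suc i) \<phi> \<le> ennreal c"
proof -
  obtain \<psi> where "isdd i f \<psi>" "tensor_le r (Suc i) \<psi> c"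
    using smooth_le_imp_dd_le[OF assms(2,3)] unfolding dd_le_def by blast
  with isdd_unique[OF assms(4)] have "tensor_le r (Suc i) \<phi> c" by blast
  then show ?thesis using cube_norm_le_tensor_le assms(1) isdd_continuous[OF assms(4)] by blast
qed

text \<open>Completeness identifies limits: a Cauchy sequence of divided differences of functions
  converging pointwise to \<open>g\<close> converges to the divided difference of \<open>g\<close>, because the norm dominates
  the supremum.\<close>

lemma cube_norm_isdd_limit:
  assumes r: "0 < r" and \<phi>: "\<And>n. isdd i (f n) (\<phi> n)" "\<And>n. cube_norm r (Suc i) (\<phi> n) < \<infinity>"
    and cauchy: "\<And>e. 0 < e \<Longrightarrow> \<exists>M. \<forall>p\<ge>M. \<forall>q\<ge>M. cube_norm r (Suc i) (\<lambda>s. \<phi> p s - \<phi> q s) < ennreal e"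
    and g: "isdd i g \<psi>" and lim: "\<And>x. \<bar>x\<bar> \<le> r \<Longrightarrow> (\<lambda>n. f n x) \<longlonglongrightarrow> g x"
  shows "(\<lambda>n. cube_norm r (Suc i) (\<lambda>s. \<phi> n s - \<psi> s)) \<longlonglongrightarrow> 0"
proof -
  have m: "1 \<le> Suc i" by simp
  obtain l where l: "continuous_on (cube r (Suc i)) l" "(\<lambda>n. cube_norm r (Suc i) (\<lambda>s. \<phi> n s - l s)) \<longlonglongrightarrow> 0"
    using cube_norm_complete[OF r m isdd_continuous[OF \<phi>(1)] \<phi>(2) cauchy] by blast
  have "l s = \<psi> s" if s: "s \<in> cube r (Suc i)" for s
  proof (rule isdd_eq_on[OF l(1) isdd_continuous[OF g] _ _ s, where i=i and r=r])
    fix s assume s: "s \<in> cube r (Suc i)" "inj_on s {..i}"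
    have "(\<lambda>n. \<phi> n s - l s) \<longlonglongrightarrow> 0"
    proof (rule tendsto_norm_zero_cancel, rule tendsto_ennrealD)
      show "((\<lambda>n. ennreal (norm (\<phi> n s - l s))) \<longlongrightarrow> ennreal 0) sequentially"
      proof (rule tendsto_sandwich[OF _ _ tendsto_const])
        show "\<forall>\<^sub>F n in sequentially. ennreal (norm (\<phi> n s - l s)) \<le> cube_norm r (Suc i) (\<lambda>s. \<phi> n s - l s)"
          by (intro always_eventually allI cmod_le_cube_norm[OF r m] continuous_on_diff isdd_continuous[OF \<phi>(1)] l s)
      qed (use l(2) in auto)
    qed auto
    then have "(\<lambda>n. \<phi> n s) \<longlonglongrightarrow> l s" by (rule LIM_zero_cancel)
    moreover have "\<phi> n s = dd i (f n) s" for n using \<phi>(1)[of n] s unfolding isdd_def by blast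
    ultimately have 1: "(\<lambda>n. dd i (f n) s) \<longlonglongrightarrow> l s" by simp
    have "(\<lambda>n. dd i (f n) s) \<longlonglongrightarrow> dd i g s"
      by (rule dd_tendsto, rule lim) (use s(1) cube_subset_cylinder[of r "Suc i"] in \<open>auto simp: cylinder_def\<close>)
    with 1 have "l s = dd i g s" by (rule LIMSEQ_unique)
    then show "l s = \<psi> s" using g s unfolding isdd_def by simp
  qed (use r in auto)
  then have "cube_norm r (Suc i) (\<lambda>s. \<phi> n s - l s) = cube_norm r (Suc i) (\<lambda>s. \<phi> n s - \<psi> s)" for n
    by (intro cube_norm_cong) simp
  then show ?thesis using l(2) by simp
qed

section \<open>Translation and averaging\<close>

text \<open>Membership in the closure of the polynomials, for functions not cut off outside of \<open>\<real>\<^sup>m\<close>.\<close>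

definition approximable :: "nat \<Rightarrow> ((nat \<Rightarrow> real) \<Rightarrow> complex) \<Rightarrow> bool" where
  "approximable m \<phi> \<longleftrightarrow> (\<forall>r>0. \<forall>e>0. \<exists>Q\<in>mpoly_fun m. cube_norm r m (\<lambda>s. \<phi> s - Q s) \<le> ennreal e)"

lemma cube_norm_shift_isdd:
  assumes "0 < r" "0 \<le> t" "isdd i f \<phi>"
  shows "cube_norm r (Suc i) (\<lambda>s. \<phi> (\<lambda>l. s l + t)) \<le> cube_norm (r + t) (Suc i) \<phi>"
  using assms by (intro cube_norm_shift isdd_continuous) (auto intro: isdd_local)

lemma cube_norm_mpoly_fun_finite: assumes "0 < r" "Q \<in> mpoly_fun (Suc i)" shows "cube_norm r (Suc i) Q < \<infinity>"
proof -
  obtain c where "tensor_le r (Suc i) Q c" using mpoly_fun_tensor_le[OF assms] by blast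
  then have "cube_norm r (Suc i) Q \<le> ennreal c" by (intro cube_norm_le_tensor_le assms mpoly_fun_continuous[OF assms(2)])
  then show ?thesis by (simp add: order_le_less_trans)
qed

lemma approximable_finite:
  assumes "0 < r" "approximable (Suc i) \<phi>" "\<And>A. continuous_on A \<phi>"
  shows "cube_norm r (Suc i) \<phi> < \<infinity>"
proof -
  obtain Q where Q: "Q \<in> mpoly_fun (Suc i)" "cube_norm r (Suc i) (\<lambda>s. \<phi> s - Q s) \<le> ennreal 1"
    using assms(1,2) unfolding approximable_def by (metis zero_less_one)
  have "cube_norm r (Suc i) (\<lambda>s. (\<phi> s - Q s) + Q s) \<le> cube_norm r (Suc i) (\<lambda>s. \<phi> s - Q s) + cube_norm r (Suc i) Q"
    using assms(1) by (intro cube_norm_add continuous_on_diff assms mpoly_fun_continuous[OF Q(1)]) auto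
  also have "\<dots> < \<infinity>" using Q(2) cube_norm_mpoly_fun_finite[OF assms(1) Q(1)] by (simp add: order_le_less_trans)
  finally show ?thesis by simp
qed

lemma shift_continuous:
  assumes r: "0 < r" and \<phi>: "isdd i f \<phi>" "approximable (Suc i) \<phi>" and e: "0 < e"
  obtains \<delta> where "0 < \<delta>" "\<delta> \<le> 1" "\<And>h. 0 \<le> h \<Longrightarrow> h \<le> \<delta> \<Longrightarrow> cube_norm r (Suc i) (\<lambda>s. \<phi> (\<lambda>l. s l + h) - \<phi> s) \<le> ennreal e"
proof -
  have m: "1 \<le> Suc i" by simp
  obtain Q where Q: "Q \<in> mpoly_fun (Suc i)" "cube_norm (r + 1) (Suc i) (\<lambda>s. \<phi> s - Q s) \<le> ennreal (e / 3)"
    using \<phi>(2) r e unfolding approximable_def by (metis add_pos_pos divide_pos_pos zero_less_numeral zero_less_one)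
  obtain K where K: "0 \<le> K" "\<And>h. 0 \<le> h \<Longrightarrow> h \<le> 1 \<Longrightarrow> tensor_le r (Suc i) (\<lambda>s. Q (\<lambda>l. s l + h) - Q s) (K * h)"
    using mpoly_fun_shift_tensor_le[OF r Q(1)] by blast
  define \<delta> where "\<delta> = min 1 (e / (3 * (K + 1)))"
  have \<delta>: "0 < \<delta>" "\<delta> \<le> 1" using e K(1) by (auto simp: \<delta>_def)
  have K\<delta>: "K * h \<le> e / 3" if "0 \<le> h" "h \<le> \<delta>" for h
  proof -
    have "K * h \<le> (K + 1) * (e / (3 * (K + 1)))" using that K(1) e by (intro mult_mono) (auto simp: \<delta>_def)
    also have "\<dots> = e / 3"
    proof -
      have "0 < K + 1" using K(1) by simp
      then show ?thesis by (simp add: field_simps)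
    qed
    finally show ?thesis .
  qed
  have sc: "continuous_on A (\<lambda>s. \<phi> (\<lambda>l. s l + h))" for A h
    using isdd_continuous[OF isdd_shift[OF \<phi>(1)]] .
  have sQ: "continuous_on A (\<lambda>s. Q (\<lambda>l. s l + h))" for A h
    by (intro continuous_on_substitute_coordinates[OF mpoly_fun_continuous[OF Q(1)]] continuous_on_add
        continuous_on_subset[OF continuous_on_product_coordinates] continuous_on_const) simp
  note cs = sc sQ isdd_continuous[OF \<phi>(1)] mpoly_fun_continuous[OF Q(1)]
  show thesis
  proof (rule that[OF \<delta>])
    fix h assume h: "0 \<le> h" "h \<le> \<delta>"
    have "cube_norm r (Suc i) (\<lambda>s. \<phi> (\<lambda>l. s l + h) - \<phi> s) \<le>
        cube_norm r (Suc i) (\<lambda>s. \<phi> (\<lambda>l. s l + h) - Q (\<lambda>l. s l + h)) + cube_norm r (Suc i) (\<lambda>s. Q (\<lambda>l. s l + h) - \<phi> s)"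
      by (rule cube_norm_diff_triangle[OF r m]) (rule cs)+
    also have "cube_norm r (Suc i) (\<lambda>s. Q (\<lambda>l. s l + h) - \<phi> s) \<le> cube_norm r (Suc i) (\<lambda>s. Q (\<lambda>l. s l + h) - Q s) + cube_norm r (Suc i) (\<lambda>s. Q s - \<phi> s)"
      by (rule cube_norm_diff_triangle[OF r m]) (rule cs)+
    also have "cube_norm r (Suc i) (\<lambda>s. \<phi> (\<lambda>l. s l + h) - Q (\<lambda>l. s l + h)) \<le> cube_norm (r + h) (Suc i) (\<lambda>s. \<phi> s - Q s)"
      by (rule cube_norm_shift[OF r m h(1), of "\<lambda>s. \<phi> s - Q s"])
         (auto intro!: continuous_on_diff cs arg_cong2[where f="(-)"] isdd_local[OF \<phi>(1)] mpoly_fun_local[OF Q(1)])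
    also have "\<dots> \<le> cube_norm (r + 1) (Suc i) (\<lambda>s. \<phi> s - Q s)"
      using r h \<delta> by (intro cube_norm_mono_cube continuous_on_diff cs) auto
    also have "\<dots> \<le> ennreal (e / 3)" by (rule Q(2))
    also have "cube_norm r (Suc i) (\<lambda>s. Q (\<lambda>l. s l + h) - Q s) \<le> ennreal (e / 3)"
    proof -
      have "cube_norm r (Suc i) (\<lambda>s. Q (\<lambda>l. s l + h) - Q s) \<le> ennreal (K * h)"
        using h \<delta> by (intro cube_norm_le_tensor_le r continuous_on_diff cs K) auto
      also have "\<dots> \<le> ennreal (e / 3)" by (intro ennreal_leI K\<delta> h)
      finally show ?thesis .
    qed
    also have "cube_norm r (Suc i) (\<lambda>s. Q s - \<phi> s) = cube_norm r (Suc i) (\<lambda>s. \<phi> s - Q s)"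
      by (rule cube_norm_diff_commute[OF r m]) (rule cs)+
    also have "\<dots> \<le> cube_norm (r + 1) (Suc i) (\<lambda>s. \<phi> s - Q s)"
      using r by (intro cube_norm_mono_cube continuous_on_diff cs) auto
    also have "\<dots> \<le> ennreal (e / 3)" by (rule Q(2))
    finally show "cube_norm r (Suc i) (\<lambda>s. \<phi> (\<lambda>l. s l + h) - \<phi> s) \<le> ennreal e"
      using e by (simp add: ennreal_plus[symmetric] del: ennreal_plus) (simp add: add_mono order_trans)?
  qed
qed

text \<open>The difference quotient of an antiderivative of \<open>f\<close> is the average of the translates of \<open>f\<close> by
  \<open>[0,\<epsilon>]\<close>. Its divided difference is the corresponding average of \<open>\<phi>\<close>: the Riemann sums are Cauchy
  in the complete norm because translation is continuous.\<close>

lemma average_close: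
  assumes r: "0 < r" and \<phi>: "isdd i f \<phi>" "approximable (Suc i) \<phi>" and f: "continuous_on UNIV f" and e: "0 < e"
    and F: "\<And>x. (F has_vector_derivative f x) (at x)"
  obtains \<delta> where "0 < \<delta>" and
    "\<And>\<epsilon> \<psi>. 0 < \<epsilon> \<Longrightarrow> \<epsilon> \<le> \<delta> \<Longrightarrow> isdd i (\<lambda>x. 1 / complex_of_real \<epsilon> * (F (x + \<epsilon>) - F x)) \<psi> \<Longrightarrow>
       cube_norm r (Suc i) (\<lambda>s. \<phi> s - \<psi> s) \<le> ennreal e"
proof -
  have m: "1 \<le> Suc i" by simp
  have r1: "0 < r + 1" using r by simp
  have sc: "continuous_on A (\<lambda>s. \<phi> (\<lambda>l. s l + h))" for A h
    using isdd_continuous[OF isdd_shift[OF \<phi>(1)]] .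
  note cs = sc isdd_continuous[OF \<phi>(1)]
  obtain \<delta> where \<delta>: "0 < \<delta>" "\<delta> \<le> 1"
    "\<And>h. 0 \<le> h \<Longrightarrow> h \<le> \<delta> \<Longrightarrow> cube_norm (r + 1) (Suc i) (\<lambda>s. \<phi> (\<lambda>l. s l + h) - \<phi> s) \<le> ennreal (e / 2)"
    using shift_continuous[OF r1 \<phi>, of "e / 2"] e by auto
  show thesis
  proof (rule that[OF \<delta>(1)])
    fix \<epsilon> \<psi> assume \<epsilon>: "0 < \<epsilon>" "\<epsilon> \<le> \<delta>"
      and \<psi>: "isdd i (\<lambda>x. 1 / complex_of_real \<epsilon> * (F (x + \<epsilon>) - F x)) \<psi>"
    define R where "R = (\<lambda>n s. 1 / complex_of_real (real n) * (\<Sum>j<n. \<phi> (\<lambda>l. s l + \<epsilon> * real j / real n)))"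
    have R: "isdd i (\<lambda>x. 1 / complex_of_real (real n) * (\<Sum>j<n. f (x + \<epsilon> * real j / real n))) (R n)" for n
      unfolding R_def by (intro isdd_cmult isdd_sum isdd_shift \<phi>)
    have tbound: "0 \<le> \<epsilon> * real j / real n" "\<epsilon> * real j / real n \<le> \<epsilon>" if "j < n" for j n
      using that \<epsilon> by (auto simp: divide_le_eq mult_left_mono)
    have shift_le: "cube_norm r (Suc i) (\<lambda>s. \<phi> (\<lambda>l. s l + t) - \<phi> (\<lambda>l. s l + (t + h))) \<le> ennreal d"
      if t: "0 \<le> t" "t \<le> 1" and h: "cube_norm (r + 1) (Suc i) (\<lambda>s. \<phi> (\<lambda>l. s l + h) - \<phi> s) \<le> ennreal d" for t h d
    proof -
      have "cube_norm r (Suc i) (\<lambda>s. \<phi> (\<lambda>l. s l + t) - \<phi> (\<lambda>l. s l + (t + h))) = cube_norm r (Suc i) (\<lambda>s. \<phi> (\<lambda>l. s l + t + h) - \<phi> (\<lambda>l. s l + t))"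
        using cube_norm_diff_commute[OF r m cs(1)[of _ t] cs(1)[of _ "t + h"]] by (simp add: add.assoc)
      also have "\<dots> \<le> cube_norm (r + t) (Suc i) (\<lambda>s. \<phi> (\<lambda>l. s l + h) - \<phi> s)"
        using cube_norm_shift_isdd[OF r t(1) isdd_diff[OF isdd_shift[OF \<phi>(1), of h] \<phi>(1)]] .
      also have "\<dots> \<le> cube_norm (r + 1) (Suc i) (\<lambda>s. \<phi> (\<lambda>l. s l + h) - \<phi> s)"
        using r t by (intro cube_norm_mono_cube continuous_on_diff cs) auto
      finally show ?thesis using h by simp
    qed
    have fin: "cube_norm r (Suc i) (R n) < \<infinity>" if n: "0 < n" for n
    proof -
      have "cube_norm r (Suc i) (\<lambda>s. \<phi> (\<lambda>l. s l + \<epsilon> * real j / real n)) \<le> cube_norm (r + 1) (Suc i) \<phi>" if j: "j < n" for j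
      proof -
        have "cube_norm r (Suc i) (\<lambda>s. \<phi> (\<lambda>l. s l + \<epsilon> * real j / real n)) \<le> cube_norm (r + \<epsilon> * real j / real n) (Suc i) \<phi>"
          by (rule cube_norm_shift_isdd[OF r _ \<phi>(1)]) (use tbound j in auto)
        also have "\<dots> \<le> cube_norm (r + 1) (Suc i) \<phi>"
        proof (rule cube_norm_mono_cube[OF _ m _ cs(2)])
          show "0 < r + \<epsilon> * real j / real n" by (rule add_pos_nonneg[OF r tbound(1)[OF j]])
          show "r + \<epsilon> * real j / real n \<le> r + 1" using tbound(2)[OF j] \<epsilon> \<delta> by linarith
        qed
        finally show ?thesis .
      qed
      moreover obtain c where "cube_norm (r + 1) (Suc i) \<phi> = ennreal c" "0 \<le> c"
        using approximable_finite[OF r1 \<phi>(2) cs(2)] by (cases "cube_norm (r + 1) (Suc i) \<phi>") auto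
      ultimately have "cube_norm r (Suc i) (R n) \<le> ennreal c"
        unfolding R_def using n by (intro cube_norm_average r m cs) auto
      then show ?thesis by (simp add: order_le_less_trans)
    qed
    \<comment> \<open>Any two Riemann sums are compared through their common refinement.\<close>
    have refine: "cube_norm r (Suc i) (\<lambda>s. R n s - R (n * k) s) \<le> ennreal d"
      if n: "0 < n" and k: "0 < k" and d: "0 \<le> d"
        and small: "\<And>h. 0 \<le> h \<Longrightarrow> h \<le> \<epsilon> / real n \<Longrightarrow> cube_norm (r + 1) (Suc i) (\<lambda>s. \<phi> (\<lambda>l. s l + h) - \<phi> s) \<le> ennreal d"
      for n k :: nat and d
    proof -
      have "R n s - R (n * k) s = 1 / complex_of_real (real n) * (\<Sum>j<n. 1 / complex_of_real (real k) *
          (\<Sum>q<k. \<phi> (\<lambda>l. s l + \<epsilon> * real j / real n) - \<phi> (\<lambda>l. s l + (\<epsilon> * real j / real n + \<epsilon> * real q / (real n * real k)))))" for s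
      proof -
        have "(\<Sum>p<n * k. \<phi> (\<lambda>l. s l + \<epsilon> * real p / real (n * k))) =
            (\<Sum>j<n. \<Sum>p\<in>{j * k..<j * k + k}. \<phi> (\<lambda>l. s l + \<epsilon> * real p / real (n * k)))"
          by (rule sum.nat_group[symmetric])
        also have "\<dots> = (\<Sum>j<n. \<Sum>q<k. \<phi> (\<lambda>l. s l + (\<epsilon> * real j / real n + \<epsilon> * real q / (real n * real k))))"
        proof (rule sum.cong[OF refl])
          fix j
          have "\<epsilon> * real (q + j * k) / real (n * k) = \<epsilon> * real j / real n + \<epsilon> * real q / (real n * real k)" for q
            using n k by (simp add: field_simps)
          then show "(\<Sum>p\<in>{j * k..<j * k + k}. \<phi> (\<lambda>l. s l + \<epsilon> * real p / real (n * k))) =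
            (\<Sum>q<k. \<phi> (\<lambda>l. s l + (\<epsilon> * real j / real n + \<epsilon> * real q / (real n * real k))))"
            using sum.shift_bounds_nat_ivl[of "\<lambda>p. \<phi> (\<lambda>l. s l + \<epsilon> * real p / real (n * k))" 0 "j * k" k]
            by (simp add: add.commute atLeast0LessThan)
        qed
        finally have E: "(\<Sum>p<n * k. \<phi> (\<lambda>l. s l + \<epsilon> * real p / real (n * k))) =
            (\<Sum>j<n. \<Sum>q<k. \<phi> (\<lambda>l. s l + (\<epsilon> * real j / real n + \<epsilon> * real q / (real n * real k))))" .
        have nk: "1 / complex_of_real (real (n * k)) = 1 / complex_of_real (real n) * (1 / complex_of_real (real k))"
          by simp
        have "R (n * k) s = 1 / complex_of_real (real n) * (\<Sum>j<n. 1 / complex_of_real (real k) *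
            (\<Sum>q<k. \<phi> (\<lambda>l. s l + (\<epsilon> * real j / real n + \<epsilon> * real q / (real n * real k)))))"
          unfolding R_def E nk by (simp only: sum_distrib_left[symmetric] mult.assoc)
        moreover have "R n s = 1 / complex_of_real (real n) * (\<Sum>j<n. 1 / complex_of_real (real k) *
            (\<Sum>q<k. \<phi> (\<lambda>l. s l + \<epsilon> * real j / real n)))"
          using k by (simp add: R_def)
        ultimately show ?thesis by (simp only: sum_subtractf right_diff_distrib)
      qed
      moreover have "cube_norm r (Suc i) (\<lambda>s. 1 / complex_of_real (real n) * (\<Sum>j<n. 1 / complex_of_real (real k) *
          (\<Sum>q<k. \<phi> (\<lambda>l. s l + \<epsilon> * real j / real n) - \<phi> (\<lambda>l. s l + (\<epsilon> * real j / real n + \<epsilon> * real q / (real n * real k)))))) \<le> ennreal d"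
      proof (rule cube_norm_average[OF r m n _ _ d])
        fix j assume j: "j < n"
        show "cube_norm r (Suc i) (\<lambda>s. 1 / complex_of_real (real k) * (\<Sum>q<k. \<phi> (\<lambda>l. s l + \<epsilon> * real j / real n) -
            \<phi> (\<lambda>l. s l + (\<epsilon> * real j / real n + \<epsilon> * real q / (real n * real k))))) \<le> ennreal d"
        proof (rule cube_norm_average[OF r m k _ _ d])
          fix q assume q: "q < k"
          have "\<epsilon> * real q / (real n * real k) \<le> \<epsilon> / real n"
            using divide_right_mono[OF tbound(2)[OF q], of "real n"] by (simp add: mult.commute)
          then have h: "cube_norm (r + 1) (Suc i) (\<lambda>s. \<phi> (\<lambda>l. s l + \<epsilon> * real q / (real n * real k)) - \<phi> s) \<le> ennreal d"
            using \<epsilon> by (intro small) auto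
          show "cube_norm r (Suc i) (\<lambda>s. \<phi> (\<lambda>l. s l + \<epsilon> * real j / real n) -
              \<phi> (\<lambda>l. s l + (\<epsilon> * real j / real n + \<epsilon> * real q / (real n * real k)))) \<le> ennreal d"
            by (rule shift_le[OF _ _ h]) (use tbound[OF j] \<epsilon> \<delta> in auto)
        qed (intro continuous_on_diff cs)
      qed (intro continuous_on_mult continuous_on_const continuous_on_sum continuous_on_diff cs)
      ultimately show ?thesis by simp
    qed
    have cauchy: "\<exists>M. \<forall>p\<ge>M. \<forall>q\<ge>M. cube_norm r (Suc i) (\<lambda>s. R (Suc p) s - R (Suc q) s) < ennreal d" if d: "0 < d" for d
    proof -
      obtain \<eta> where \<eta>: "0 < \<eta>"
        "\<And>h. 0 \<le> h \<Longrightarrow> h \<le> \<eta> \<Longrightarrow> cube_norm (r + 1) (Suc i) (\<lambda>s. \<phi> (\<lambda>l. s l + h) - \<phi> s) \<le> ennreal (d / 3)"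
        using shift_continuous[OF r1 \<phi>, of "d / 3"] d by auto
      obtain M where M: "\<epsilon> / \<eta> < real M" using reals_Archimedean2 by blast
      have "cube_norm r (Suc i) (\<lambda>s. R (Suc p) s - R (Suc q) s) < ennreal d" if p: "M \<le> p" and q: "M \<le> q" for p q
      proof -
        have small: "\<epsilon> / real (Suc n) \<le> \<eta>" if "M \<le> n" for n
        proof -
          have "\<epsilon> / \<eta> \<le> real (Suc n)" using M that by simp
          then show ?thesis using \<eta>(1) by (simp add: divide_le_eq mult.commute del: of_nat_Suc)
        qed
        have "cube_norm r (Suc i) (\<lambda>s. R (Suc p) s - R (Suc q) s) \<le>
            cube_norm r (Suc i) (\<lambda>s. R (Suc p) s - R (Suc p * Suc q) s) + cube_norm r (Suc i) (\<lambda>s. R (Suc p * Suc q) s - R (Suc q) s)"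
          by (intro cube_norm_diff_triangle r m isdd_continuous[OF R])
        also have "cube_norm r (Suc i) (\<lambda>s. R (Suc p) s - R (Suc p * Suc q) s) \<le> ennreal (d / 3)"
          using d \<eta>(2) small[OF p] by (intro refine) auto
        also have "cube_norm r (Suc i) (\<lambda>s. R (Suc p * Suc q) s - R (Suc q) s) = cube_norm r (Suc i) (\<lambda>s. R (Suc q) s - R (Suc q * Suc p) s)"
          by (subst cube_norm_diff_commute[OF r m]) (auto intro: isdd_continuous[OF R] simp: mult.commute)
        also have "\<dots> \<le> ennreal (d / 3)"
          using d \<eta>(2) small[OF q] by (intro refine) auto
        also have "ennreal (d / 3) + ennreal (d / 3) < ennreal d"
          using d by (simp add: ennreal_plus[symmetric] ennreal_less_iff del: ennreal_plus)
        finally show ?thesis by (simp add: add_mono)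
      qed
      then show ?thesis by blast
    qed
    have "(\<lambda>n. cube_norm r (Suc i) (\<lambda>s. R (Suc n) s - \<psi> s)) \<longlonglongrightarrow> 0"
      by (rule cube_norm_isdd_limit[OF r R fin[OF zero_less_Suc] cauchy \<psi>]) (assumption, rule riemann_sums_tendsto[OF f F \<epsilon>(1)])
    then have "\<forall>\<^sub>F n in sequentially. cube_norm r (Suc i) (\<lambda>s. R (Suc n) s - \<psi> s) < ennreal (e / 2)"
      by (rule order_tendstoD) (use e in auto)
    then obtain n where n: "cube_norm r (Suc i) (\<lambda>s. R (Suc n) s - \<psi> s) < ennreal (e / 2)"
      using eventually_happens'[OF sequentially_bot] by blast
    have "cube_norm r (Suc i) (\<lambda>s. \<phi> s - R (Suc n) s) \<le> ennreal (e / 2)"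
    proof -
      have "cube_norm r (Suc i) (\<lambda>s. 1 / complex_of_real (real (Suc n)) * (\<Sum>j<Suc n. \<phi> s - \<phi> (\<lambda>l. s l + \<epsilon> * real j / real (Suc n)))) \<le> ennreal (e / 2)"
      proof (intro cube_norm_average[OF r m] continuous_on_diff cs)
        fix j assume j: "j < Suc n"
        have "cube_norm (r + 1) (Suc i) (\<lambda>s. \<phi> (\<lambda>l. s l + \<epsilon> * real j / real (Suc n)) - \<phi> s) \<le> ennreal (e / 2)"
          using tbound[OF j] \<epsilon> by (intro \<delta>(3)) auto
        then show "cube_norm r (Suc i) (\<lambda>s. \<phi> s - \<phi> (\<lambda>l. s l + \<epsilon> * real j / real (Suc n))) \<le> ennreal (e / 2)"
          using shift_le[of 0 "\<epsilon> * real j / real (Suc n)" "e / 2"] by simp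
      qed (use e in auto)
      moreover have "1 / complex_of_real (real (Suc n)) * (\<Sum>j<Suc n. \<phi> s - \<phi> (\<lambda>l. s l + \<epsilon> * real j / real (Suc n))) = \<phi> s - R (Suc n) s" for s
        unfolding R_def sum_subtractf right_diff_distrib by (simp del: sum.lessThan_Suc of_nat_Suc)
      ultimately show ?thesis by (simp only:)
    qed
    have "cube_norm r (Suc i) (\<lambda>s. \<phi> s - \<psi> s) \<le> cube_norm r (Suc i) (\<lambda>s. \<phi> s - R (Suc n) s) + cube_norm r (Suc i) (\<lambda>s. R (Suc n) s - \<psi> s)"
      by (intro cube_norm_diff_triangle r m isdd_continuous[OF R] isdd_continuous[OF \<psi>] cs)
    also have "\<dots> \<le> ennreal (e / 2) + ennreal (e / 2)"
      by (intro add_mono) (use n in \<open>auto intro: less_imp_le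
        \<open>cube_norm r (Suc i) (\<lambda>s. \<phi> s - R (Suc n) s) \<le> ennreal (e / 2)\<close>\<close>)
    also have "\<dots> = ennreal e" using e by (simp add: ennreal_plus[symmetric] del: ennreal_plus)
    finally show "cube_norm r (Suc i) (\<lambda>s. \<phi> s - \<psi> s) \<le> ennreal e" .
  qed
qed

lemma smooth_closure_imp_cube_norm:
  assumes r: "0 < r" and f: "f \<in> smooth_closure r n polys" and e: "0 < e"
  obtains P where "P \<in> polys" and
    "\<And>i \<phi> \<psi>. i \<le> n \<Longrightarrow> isdd i f \<phi> \<Longrightarrow> isdd i P \<psi> \<Longrightarrow> cube_norm r (Suc i) (\<lambda>s. \<phi> s - \<psi> s) \<le> ennreal e"
proof -
  obtain P where P: "P \<in> polys" "smooth_le r n (\<lambda>x. f x - P x) e" using smooth_closureD[OF f e] by blast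
  show thesis by (rule that[OF P(1)]) (rule cube_norm_le_smooth_le[OF r P(2)], auto intro: isdd_diff)
qed

lemma smooth_closure_approximable:
  assumes "\<And>r. 0 < r \<Longrightarrow> f \<in> smooth_closure r n polys" "i \<le> n" "isdd i f \<phi>"
  shows "approximable (Suc i) \<phi>"
  unfolding approximable_def
proof (intro allI impI)
  fix r e :: real assume "0 < r" "0 < e"
  then obtain P where P: "P \<in> polys"
    "\<And>i \<phi> \<psi>. i \<le> n \<Longrightarrow> isdd i f \<phi> \<Longrightarrow> isdd i P \<psi> \<Longrightarrow> cube_norm r (Suc i) (\<lambda>s. \<phi> s - \<psi> s) \<le> ennreal e"
    using smooth_closure_imp_cube_norm[OF _ assms(1)] by blast
  then show "\<exists>Q\<in>mpoly_fun (Suc i). cube_norm r (Suc i) (\<lambda>s. \<phi> s - Q s) \<le> ennreal e"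
    using polys_isdd_mpoly_fun[OF P(1), of i] assms(2,3) by blast
qed

text \<open>Divided differences of order less than the order of differentiability: here the loss of one
  derivative is harmless.\<close>

lemma lower_order_approximable:
  assumes "f \<in> Ck (enat n)" "i < n" "isdd i f \<phi>"
  shows "approximable (Suc i) \<phi>"
proof -
  obtain p where p: "n = Suc p" using assms(2) by (cases n) auto
  show ?thesis
    by (rule smooth_closure_approximable[where n=p, OF Ck_Suc_smooth_closure _ assms(3)]) (use assms p in auto)
qed

text \<open>Averaging over \<open>[0,\<epsilon>]\<close> makes \<open>f\<close> once more differentiable, which compensates for the derivative
  lost in the approximation of smooth functions.\<close>

lemma simultaneous_polynomial_approximation:
  assumes f: "f \<in> Ck (enat n)" and top: "isdd n f \<phi>n" "approximable (Suc n) \<phi>n" and r: "0 < r" and e: "0 < e"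
  obtains P where "P \<in> polys" and
    "\<And>i \<phi> \<psi>. i \<le> n \<Longrightarrow> isdd i f \<phi> \<Longrightarrow> isdd i P \<psi> \<Longrightarrow> cube_norm r (Suc i) (\<lambda>s. \<phi> s - \<psi> s) \<le> ennreal e"
proof -
  have cont: "continuous_on UNIV f" by (rule Ck_continuous[OF f])
  obtain F where F: "\<And>x. (F has_vector_derivative f x) (at x)" using antiderivative_exists[OF cont] by blast
  have "\<exists>\<delta>>0. \<forall>\<epsilon> \<phi> \<psi>. 0 < \<epsilon> \<longrightarrow> \<epsilon> \<le> \<delta> \<longrightarrow> isdd i f \<phi> \<longrightarrow>
      isdd i (\<lambda>x. 1 / complex_of_real \<epsilon> * (F (x + \<epsilon>) - F x)) \<psi> \<longrightarrow> cube_norm r (Suc i) (\<lambda>s. \<phi> s - \<psi> s) \<le> ennreal (e / 2)"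
    if i: "i \<le> n" for i
  proof -
    obtain \<phi> where \<phi>: "isdd i f \<phi>" using Ck_imp_isdd[OF Ck_mono[OF f]] i by (metis enat_ord_simps(1))
    have "approximable (Suc i) \<phi>"
    proof (cases "i = n")
      case True then show ?thesis using \<phi> top isdd_unique by blast
    next
      case False then show ?thesis using lower_order_approximable[OF f _ \<phi>] i by simp
    qed
    from average_close[OF r \<phi> this cont, of "e / 2" F] F e obtain \<delta> where "0 < \<delta>"
      "\<And>\<epsilon> \<psi>. 0 < \<epsilon> \<Longrightarrow> \<epsilon> \<le> \<delta> \<Longrightarrow> isdd i (\<lambda>x. 1 / complex_of_real \<epsilon> * (F (x + \<epsilon>) - F x)) \<psi> \<Longrightarrow>
       cube_norm r (Suc i) (\<lambda>s. \<phi> s - \<psi> s) \<le> ennreal (e / 2)" by auto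
    then show ?thesis using \<phi> isdd_unique by blast
  qed
  then have "\<forall>i\<in>{..n}. \<exists>\<delta>. \<delta>>0 \<and> (\<forall>\<epsilon> \<phi> \<psi>. 0 < \<epsilon> \<longrightarrow> \<epsilon> \<le> \<delta> \<longrightarrow> isdd i f \<phi> \<longrightarrow>
      isdd i (\<lambda>x. 1 / complex_of_real \<epsilon> * (F (x + \<epsilon>) - F x)) \<psi> \<longrightarrow> cube_norm r (Suc i) (\<lambda>s. \<phi> s - \<psi> s) \<le> ennreal (e / 2))"
    by simp
  from bchoice[OF this] obtain \<delta> where *: "\<forall>i\<in>{..n}. \<delta> i > 0 \<and> (\<forall>\<epsilon> \<phi> \<psi>. 0 < \<epsilon> \<longrightarrow> \<epsilon> \<le> \<delta> i \<longrightarrow> isdd i f \<phi> \<longrightarrow>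
      isdd i (\<lambda>x. 1 / complex_of_real \<epsilon> * (F (x + \<epsilon>) - F x)) \<psi> \<longrightarrow> cube_norm r (Suc i) (\<lambda>s. \<phi> s - \<psi> s) \<le> ennreal (e / 2))"
    by blast
  have \<delta>: "\<And>i. i \<le> n \<Longrightarrow> 0 < \<delta> i"
    "\<And>i \<epsilon> \<phi> \<psi>. i \<le> n \<Longrightarrow> 0 < \<epsilon> \<Longrightarrow> \<epsilon> \<le> \<delta> i \<Longrightarrow> isdd i f \<phi> \<Longrightarrow>
      isdd i (\<lambda>x. 1 / complex_of_real \<epsilon> * (F (x + \<epsilon>) - F x)) \<psi> \<Longrightarrow> cube_norm r (Suc i) (\<lambda>s. \<phi> s - \<psi> s) \<le> ennreal (e / 2)"
    using * by blast+
  define \<epsilon> where "\<epsilon> = Min (\<delta> ` {..n})"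
  have \<epsilon>: "0 < \<epsilon>" "\<And>i. i \<le> n \<Longrightarrow> \<epsilon> \<le> \<delta> i" using \<delta>(1) by (auto simp: \<epsilon>_def)
  define g where "g = (\<lambda>x. 1 / complex_of_real \<epsilon> * (F (x + \<epsilon>) - F x))"
  have FC: "F \<in> Ck (enat (Suc n))" by (rule Ck_SucI[OF F f])
  have g: "g \<in> Ck (enat (Suc n))" unfolding g_def by (intro Ck_cmult Ck_diff Ck_shift FC)
  have "0 < e / 2" using e by simp
  from smooth_closure_imp_cube_norm[OF r Ck_Suc_smooth_closure[OF r g] this] obtain P where P: "P \<in> polys"
    "\<And>i \<phi> \<psi>. i \<le> n \<Longrightarrow> isdd i g \<phi> \<Longrightarrow> isdd i P \<psi> \<Longrightarrow> cube_norm r (Suc i) (\<lambda>s. \<phi> s - \<psi> s) \<le> ennreal (e / 2)" by blast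
  show thesis
  proof (rule that[OF P(1)])
    fix i \<phi> \<psi> assume i: "i \<le> n" and \<phi>: "isdd i f \<phi>" and \<psi>: "isdd i P \<psi>"
    obtain \<eta> where \<eta>: "isdd i g \<eta>" using Ck_imp_isdd[OF Ck_mono[OF g]] i by (metis enat_ord_simps(1) le_SucI)
    have "cube_norm r (Suc i) (\<lambda>s. \<phi> s - \<psi> s) \<le> cube_norm r (Suc i) (\<lambda>s. \<phi> s - \<eta> s) + cube_norm r (Suc i) (\<lambda>s. \<eta> s - \<psi> s)"
      using r by (intro cube_norm_diff_triangle isdd_continuous[OF \<phi>] isdd_continuous[OF \<psi>] isdd_continuous[OF \<eta>]) auto
    also have "\<dots> \<le> ennreal (e / 2) + ennreal (e / 2)"
      by (intro add_mono P(2)[OF i \<eta> \<psi>] \<delta>(2)[OF i \<epsilon>(1) \<epsilon>(2)[OF i] \<phi>] \<eta>[unfolded g_def])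
    also have "\<dots> = ennreal e" using e by (simp add: ennreal_plus[symmetric] del: ennreal_plus)
    finally show "cube_norm r (Suc i) (\<lambda>s. \<phi> s - \<psi> s) \<le> ennreal e" .
  qed
qed

end


section \<open>Closures in the topologies of the function spaces\<close>

text \<open>The generating sets are balls with arbitrary centres; the triangle inequality makes the balls
  around \<open>f\<close> a subbase of neighbourhoods of \<open>f\<close>.\<close>

lemma in_closure_of_seminorm_topology_iff:
  assumes ne: "P \<noteq> {}"
    and zero: "\<And>p f. p \<in> P \<Longrightarrow> f \<in> V \<Longrightarrow> p (\<lambda>x. f x - f x) = 0"
    and triangle: "\<And>p f g h. p \<in> P \<Longrightarrow> f \<in> V \<Longrightarrow> g \<in> V \<Longrightarrow> h \<in> V \<Longrightarrow>
      p (\<lambda>x. f x - h x) \<le> p (\<lambda>x. f x - g x) + p (\<lambda>x. g x - h x)"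
  shows "f \<in> seminorm_topology V P closure_of S \<longleftrightarrow> f \<in> V \<and>
    (\<forall>F e. finite F \<longrightarrow> F \<subseteq> P \<longrightarrow> 0 < e \<longrightarrow> (\<exists>g\<in>S \<inter> V. \<forall>p\<in>F. p (\<lambda>x. g x - f x) < ennreal e))"
proof -
  define G where "G = {{g \<in> V. p (\<lambda>x. g x - f x) < ennreal e} | f p e. f \<in> V \<and> p \<in> P \<and> e > (0::real)}"
  let ?T = "seminorm_topology V P"
  have T: "?T = topology_generated_by G" by (simp add: seminorm_topology_def G_def)
  have V: "topspace ?T = V"
  proof -
    obtain p where p: "p \<in> P" using ne by blast
    have "f \<in> {g \<in> V. p (\<lambda>x. g x - f x) < ennreal 1}" if "f \<in> V" for f
      using zero[OF p that] that by simp
    moreover have "{g \<in> V. p (\<lambda>x. g x - f x) < ennreal 1} \<in> G" if "f \<in> V" for f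
      unfolding G_def using that p zero_less_one by blast
    ultimately have "V \<subseteq> \<Union>G" by blast
    moreover have "\<Union>G \<subseteq> V" unfolding G_def by auto
    ultimately show ?thesis unfolding T topology_generated_by_topspace by auto
  qed
  have nbhd: "\<exists>F e. finite F \<and> F \<subseteq> P \<and> 0 < e \<and> {g \<in> V. \<forall>p\<in>F. p (\<lambda>x. g x - f x) < ennreal e} \<subseteq> U"
    if "generate_topology_on G U" "f \<in> U" "f \<in> V" for U f
    using that
  proof (induction arbitrary: f rule: generate_topology_on.induct)
    case Empty then show ?case by simp
  next
    case (Int a b)
    have fab: "f \<in> a" "f \<in> b" using Int.prems by auto
    from Int.IH(1)[OF fab(1) Int.prems(2)] obtain F e where 1: "finite F" "F \<subseteq> P" "0 < e"
      "{g \<in> V. \<forall>p\<in>F. p (\<lambda>x. g x - f x) < ennreal e} \<subseteq> a" by auto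
    from Int.IH(2)[OF fab(2) Int.prems(2)] obtain F' e' where 2: "finite F'" "F' \<subseteq> P" "0 < e'"
      "{g \<in> V. \<forall>p\<in>F'. p (\<lambda>x. g x - f x) < ennreal e'} \<subseteq> b" by auto
    have "{g \<in> V. \<forall>p\<in>F \<union> F'. p (\<lambda>x. g x - f x) < ennreal (min e e')} \<subseteq> a \<inter> b"
    proof
      fix g assume g: "g \<in> {g \<in> V. \<forall>p\<in>F \<union> F'. p (\<lambda>x. g x - f x) < ennreal (min e e')}"
      have "p (\<lambda>x. g x - f x) < ennreal e" if "p \<in> F" for p
        using g that order_less_le_trans[OF _ ennreal_leI[of "min e e'" e]] by simp
      then have "g \<in> a" using g 1(4) by blast
      have "p (\<lambda>x. g x - f x) < ennreal e'" if "p \<in> F'" for p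
        using g that order_less_le_trans[OF _ ennreal_leI[of "min e e'" e']] by simp
      then have "g \<in> b" using g 2(4) by blast
      with \<open>g \<in> a\<close> show "g \<in> a \<inter> b" by blast
    qed
    then show ?case using 1 2 by (intro exI[of _ "F \<union> F'"] exI[of _ "min e e'"]) auto
  next
    case (UN K)
    then obtain k where k: "k \<in> K" "f \<in> k" by blast
    from UN.IH[OF k UN.prems(2)] obtain F e where "finite F" "F \<subseteq> P" "0 < e"
      "{g \<in> V. \<forall>p\<in>F. p (\<lambda>x. g x - f x) < ennreal e} \<subseteq> k" by auto
    then show ?case using k(1) by (intro exI[of _ F] exI[of _ e]) auto
  next
    case (Basis s)
    then obtain h p e where s: "s = {g \<in> V. p (\<lambda>x. g x - h x) < ennreal e}" "h \<in> V" "p \<in> P" "0 < e"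
      unfolding G_def by blast
    have "p (\<lambda>x. f x - h x) < ennreal e" using Basis s by simp
    then obtain a where a: "p (\<lambda>x. f x - h x) = ennreal a" "0 \<le> a" "a < e"
      by (cases "p (\<lambda>x. f x - h x)") (auto simp: ennreal_less_iff)
    have "{g \<in> V. \<forall>q\<in>{p}. q (\<lambda>x. g x - f x) < ennreal (e - a)} \<subseteq> s"
    proof
      fix g assume g: "g \<in> {g \<in> V. \<forall>q\<in>{p}. q (\<lambda>x. g x - f x) < ennreal (e - a)}"
      then obtain b where b: "p (\<lambda>x. g x - f x) = ennreal b" "0 \<le> b" "b < e - a"
        by (cases "p (\<lambda>x. g x - f x)") (auto simp: ennreal_less_iff)
      have "p (\<lambda>x. g x - h x) \<le> ennreal b + ennreal a"
        using triangle[OF s(3), of g f h] g Basis(3) s(2) a(1) b(1) by auto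
      also have "\<dots> < ennreal e" using a b by (simp add: ennreal_plus[symmetric] ennreal_less_iff del: ennreal_plus)
      finally show "g \<in> s" using g s(1) by simp
    qed
    then show ?case using s(3) a(3) by (intro exI[of _ "{p}"] exI[of _ "e - a"]) auto
  qed
  show ?thesis
  proof (intro iffI conjI allI impI)
    assume f: "f \<in> ?T closure_of S"
    then show fV: "f \<in> V" by (metis V in_closure_of)
    fix F and e :: real assume F: "finite F" "F \<subseteq> P" and e: "0 < e"
    have "openin ?T {g \<in> V. \<forall>p\<in>F. p (\<lambda>x. g x - f x) < ennreal e}"
      using F
    proof (induction F)
      case empty show ?case using openin_topspace[of ?T] by (simp add: V)
    next
      case (insert p F)
      have "openin ?T {g \<in> V. p (\<lambda>x. g x - f x) < ennreal e}"
        unfolding T by (rule topology_generated_by_Basis) (use fV insert.prems e in \<open>auto simp: G_def\<close>)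
      moreover have "{g \<in> V. \<forall>q\<in>insert p F. q (\<lambda>x. g x - f x) < ennreal e} =
          {g \<in> V. p (\<lambda>x. g x - f x) < ennreal e} \<inter> {g \<in> V. \<forall>q\<in>F. q (\<lambda>x. g x - f x) < ennreal e}" by auto
      ultimately show ?case using insert by (simp add: openin_Int)
    qed
    moreover have "f \<in> {g \<in> V. \<forall>p\<in>F. p (\<lambda>x. g x - f x) < ennreal e}"
    proof (intro CollectI conjI fV ballI)
      fix p assume "p \<in> F"
      then show "p (\<lambda>x. f x - f x) < ennreal e" using zero[OF subsetD[OF F(2)] fV, of p] e by (simp only: ennreal_less_zero_iff)
    qed
    ultimately have "\<exists>y. y \<in> S \<and> y \<in> {g \<in> V. \<forall>p\<in>F. p (\<lambda>x. g x - f x) < ennreal e}"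
      using f[unfolded in_closure_of, THEN conjunct2, rule_format,
          of "{g \<in> V. \<forall>p\<in>F. p (\<lambda>x. g x - f x) < ennreal e}"] by (simp only: simp_thms)
    then show "\<exists>g\<in>S \<inter> V. \<forall>p\<in>F. p (\<lambda>x. g x - f x) < ennreal e" by blast
  next
    assume *: "f \<in> V \<and> (\<forall>F e. finite F \<longrightarrow> F \<subseteq> P \<longrightarrow> 0 < e \<longrightarrow>
      (\<exists>g\<in>S \<inter> V. \<forall>p\<in>F. p (\<lambda>x. g x - f x) < ennreal e))"
    show "f \<in> ?T closure_of S"
      unfolding in_closure_of
    proof (intro conjI allI impI)
      show "f \<in> topspace ?T" using * V by simp
      fix U assume U: "f \<in> U \<and> openin ?T U"
      then have "generate_topology_on G U" unfolding T openin_topology_generated_by_iff by blast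
      from nbhd[OF this conjunct1[OF U] conjunct1[OF *]] obtain F e where F: "finite F" "F \<subseteq> P" "0 < e"
        "{g \<in> V. \<forall>p\<in>F. p (\<lambda>x. g x - f x) < ennreal e} \<subseteq> U" by auto
      from conjunct2[OF *, rule_format, OF F(1,2,3)]
      obtain g where g: "g \<in> S \<inter> V" "\<And>p. p \<in> F \<Longrightarrow> p (\<lambda>x. g x - f x) < ennreal e" by auto
      have "g \<in> U" by (rule subsetD[OF F(4)]) (use g in simp)
      then show "\<exists>y. y \<in> S \<and> y \<in> U" using g(1) by (intro exI[of _ g]) simp
    qed
  qed
qed

lemma enat_less_plus_1_iff: "enat i < k + 1 \<longleftrightarrow> enat i \<le> k"
  by (cases k) (auto simp: one_enat_def)

lemma Ck_imp_isdd_enat: "f \<in> Ck k \<Longrightarrow> enat i \<le> k \<Longrightarrow> \<exists>\<phi>. isdd i f \<phi>"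
  using Ck_imp_isdd Ck_mono by blast

context admissible_family
begin

lemma C_on_Rn_continuous: "\<phi> \<in> C_on (Rn m) \<Longrightarrow> continuous_on (cube r m) \<phi>"
  unfolding C_on_def using cube_subset_Rn by (auto intro: continuous_on_subset)

lemma calC_top_eq: "calC_top \<alpha> m = seminorm_topology (calC \<alpha> m) {cube_norm r m | r. r > 0}"
  unfolding calC_top_def cube_norm_def[abs_def] ..

lemma cube_norm_restr_Rn: "cube_norm r m (restr (Rn m) \<phi>) = cube_norm r m \<phi>"
  by (rule cube_norm_cong) (use cube_subset_Rn in \<open>auto simp: restr_def\<close>)

lemma cube_norm_restr_Rn_diff: "cube_norm r m (\<lambda>s. restr (Rn m) \<phi> s - restr (Rn m) \<psi> s) = cube_norm r m (\<lambda>s. \<phi> s - \<psi> s)"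
  by (rule cube_norm_cong) (use cube_subset_Rn in \<open>auto simp: restr_def\<close>)

lemma calC_iff: "\<phi> \<in> calC \<alpha> m \<longleftrightarrow> \<phi> \<in> C_on (Rn m) \<and> (\<forall>r>0. cube_norm r m \<phi> < \<infinity>)"
  unfolding calC_def cube_norm_def by simp

lemma in_C_alpha_iff:
  assumes m: "1 \<le> m"
  shows "\<phi> \<in> C_alpha \<alpha> m \<longleftrightarrow> \<phi> \<in> calC \<alpha> m \<and>
    (\<forall>F e. finite F \<longrightarrow> F \<subseteq> {cube_norm r m | r. r > 0} \<longrightarrow> 0 < e \<longrightarrow>
      (\<exists>g\<in>mpolys m \<inter> calC \<alpha> m. \<forall>p\<in>F. p (\<lambda>x. g x - \<phi> x) < ennreal e))"
  unfolding C_alpha_def calC_top_eq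
proof (rule in_closure_of_seminorm_topology_iff)
  show "{cube_norm r m |r. 0 < r} \<noteq> {}" using zero_less_one by blast
  show "p (\<lambda>x. f x - f x) = 0" if "p \<in> {cube_norm r m |r. 0 < r}" for p and f :: "(nat \<Rightarrow> real) \<Rightarrow> complex"
    using that cube_norm_zero[OF _ m] by auto
  show "p (\<lambda>x. f x - h x) \<le> p (\<lambda>x. f x - g x) + p (\<lambda>x. g x - h x)"
    if "p \<in> {cube_norm r m |r. 0 < r}" "f \<in> calC \<alpha> m" "g \<in> calC \<alpha> m" "h \<in> calC \<alpha> m" for p f g h
    using that cube_norm_diff_triangle[OF _ m] C_on_Rn_continuous unfolding calC_iff by auto
qed

lemma divdiff_in_C_alpha_iff:
  assumes \<phi>: "isdd i f \<phi>"
  shows "divdiff i f \<in> C_alpha \<alpha> (i + 1) \<longleftrightarrow> approximable (Suc i) \<phi>"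
proof -
  have m: "1 \<le> Suc i" by simp
  note dd = divdiff_eq[OF \<phi>]
  have inC: "restr (Rn (Suc i)) \<psi> \<in> C_on (Rn (Suc i))" if "continuous_on (Rn (Suc i)) \<psi>" for \<psi>
    by (rule restr_in_C_on[OF that])
  show ?thesis
  proof
    assume L: "divdiff i f \<in> C_alpha \<alpha> (i + 1)"
    show "approximable (Suc i) \<phi>" unfolding approximable_def
    proof (intro allI impI)
      fix r e :: real assume r: "0 < r" and e: "0 < e"
      have "{cube_norm r (Suc i)} \<subseteq> {cube_norm r (Suc i) | r. r > 0}" using r by blast
      from L[unfolded Suc_eq_plus1[symmetric] in_C_alpha_iff[OF m] dd, THEN conjunct2, rule_format, OF _ this e]
      obtain g where g: "g \<in> mpolys (Suc i)" "cube_norm r (Suc i) (\<lambda>x. g x - restr (Rn (Suc i)) \<phi> x) < ennreal e"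
        by auto
      obtain Q where Q: "Q \<in> mpoly_fun (Suc i)" "g = restr (Rn (Suc i)) Q" using g(1) unfolding mpolys_eq by blast
      have "cube_norm r (Suc i) (\<lambda>s. \<phi> s - Q s) \<le> ennreal e"
        using g(2) cube_norm_diff_commute[OF r m isdd_continuous[OF \<phi>] mpoly_fun_continuous[OF Q(1)]]
        by (simp add: Q(2) cube_norm_restr_Rn_diff less_imp_le)
      with Q(1) show "\<exists>Q\<in>mpoly_fun (Suc i). cube_norm r (Suc i) (\<lambda>s. \<phi> s - Q s) \<le> ennreal e" by blast
    qed
  next
    assume R: "approximable (Suc i) \<phi>"
    show "divdiff i f \<in> C_alpha \<alpha> (i + 1)"
      unfolding Suc_eq_plus1[symmetric] in_C_alpha_iff[OF m] dd
    proof (intro conjI allI impI)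
      show "restr (Rn (Suc i)) \<phi> \<in> calC \<alpha> (Suc i)"
        unfolding calC_iff cube_norm_restr_Rn
        using inC[OF isdd_continuous[OF \<phi>]] approximable_finite[OF _ R isdd_continuous[OF \<phi>]] by blast
      fix F and e :: real assume F: "finite F" "F \<subseteq> {cube_norm r (Suc i) | r. r > 0}" and e: "0 < e"
      obtain r0 where r0: "0 < r0" "\<And>p. p \<in> F \<Longrightarrow> \<exists>r. 0 < r \<and> r \<le> r0 \<and> p = cube_norm r (Suc i)"
      proof -
        have "\<exists>r0>0. \<forall>p\<in>F. \<exists>r. 0 < r \<and> r \<le> r0 \<and> p = cube_norm r (Suc i)"
          using F
        proof (induction F)
          case empty show ?case by (auto intro: exI[of _ 1])
        next
          case (insert p F)
          then obtain r0 r where *: "0 < r0" "\<And>q. q \<in> F \<Longrightarrow> \<exists>r. 0 < r \<and> r \<le> r0 \<and> q = cube_norm r (Suc i)"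
            "0 < r" "p = cube_norm r (Suc i)"
            by auto
          have "\<exists>r'. 0 < r' \<and> r' \<le> max r0 r \<and> q = cube_norm r' (Suc i)" if q: "q \<in> insert p F" for q
          proof (cases "q = p")
            case True then show ?thesis using * by (intro exI[of _ r]) auto
          next
            case False
            then obtain r' where "0 < r'" "r' \<le> r0" "q = cube_norm r' (Suc i)" using *(2) q by auto
            then show ?thesis by (intro exI[of _ r']) auto
          qed
          then show ?case using *(1) by (intro exI[of _ "max r0 r"]) auto
        qed
        then show thesis using that by blast
      qed
      have "0 < e / 2" using e by simp
      from R[unfolded approximable_def, rule_format, OF r0(1) this]
      obtain Q where Q: "Q \<in> mpoly_fun (Suc i)" "cube_norm r0 (Suc i) (\<lambda>s. \<phi> s - Q s) \<le> ennreal (e / 2)" by blast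
      have "restr (Rn (Suc i)) Q \<in> calC \<alpha> (Suc i)"
        unfolding calC_iff cube_norm_restr_Rn using inC[OF mpoly_fun_continuous[OF Q(1)]] cube_norm_mpoly_fun_finite[OF _ Q(1)] by simp
      moreover have "restr (Rn (Suc i)) Q \<in> mpolys (Suc i)" unfolding mpolys_eq by (rule imageI[OF Q(1)])
      moreover have "p (\<lambda>x. restr (Rn (Suc i)) Q x - restr (Rn (Suc i)) \<phi> x) < ennreal e" if p: "p \<in> F" for p
      proof -
        obtain r where r: "0 < r" "r \<le> r0" "p = cube_norm r (Suc i)" using r0(2)[OF p] by blast
        have "p (\<lambda>x. restr (Rn (Suc i)) Q x - restr (Rn (Suc i)) \<phi> x) = cube_norm r (Suc i) (\<lambda>s. \<phi> s - Q s)"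
          unfolding r(3) cube_norm_restr_Rn_diff
          by (rule cube_norm_diff_commute[OF r(1) m mpoly_fun_continuous[OF Q(1)] isdd_continuous[OF \<phi>]])
        also have "\<dots> \<le> cube_norm r0 (Suc i) (\<lambda>s. \<phi> s - Q s)"
          by (intro cube_norm_mono_cube r m continuous_on_diff isdd_continuous[OF \<phi>] mpoly_fun_continuous[OF Q(1)])
        also have "\<dots> \<le> ennreal (e / 2)" by (rule Q(2))
        also have "\<dots> < ennreal e" using e by (simp add: ennreal_less_iff)
        finally show ?thesis .
      qed
      ultimately show "\<exists>g\<in>mpolys (Suc i) \<inter> calC \<alpha> (Suc i). \<forall>p\<in>F. p (\<lambda>x. g x - restr (Rn (Suc i)) \<phi> x) < ennreal e"
        by (intro bexI[of _ "restr (Rn (Suc i)) Q"] ballI IntI)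
    qed
  qed
qed

lemma divdiff_in_calC_iff:
  assumes \<phi>: "isdd i f \<phi>"
  shows "divdiff i f \<in> calC \<alpha> (i + 1) \<longleftrightarrow> (\<forall>r>0. cube_norm r (Suc i) \<phi> < \<infinity>)"
  using restr_in_C_on[OF isdd_continuous[OF \<phi>]]
  by (simp add: divdiff_eq[OF \<phi>] calC_iff cube_norm_restr_Rn)

definition close :: "nat \<Rightarrow> real \<Rightarrow> real \<Rightarrow> (real \<Rightarrow> complex) \<Rightarrow> (real \<Rightarrow> complex) \<Rightarrow> bool" where
  "close n r e f g \<longleftrightarrow> (\<forall>i\<le>n. \<forall>\<phi> \<psi>. isdd i f \<phi> \<longrightarrow> isdd i g \<psi> \<longrightarrow> cube_norm r (Suc i) (\<lambda>s. \<phi> s - \<psi> s) \<le> ennreal e)"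

lemma in_closure_of_calCk_top_iff:
  "f \<in> calCk_top \<alpha> k closure_of S \<longleftrightarrow> f \<in> calCk \<alpha> k \<and>
    (\<forall>n r e. enat n \<le> k \<longrightarrow> 0 < r \<longrightarrow> 0 < e \<longrightarrow> (\<exists>g\<in>S \<inter> calCk \<alpha> k. close n r e f g))"
proof -
  define p where "p = (\<lambda>r i f. cube_norm r (Suc i) (divdiff i f))"
  define P where "P = {p r i | r i. r > 0 \<and> enat i \<le> k}"
  have top: "calCk_top \<alpha> k = seminorm_topology (calCk \<alpha> k) P"
    unfolding calCk_top_def P_def p_def cube_norm_def enat_less_plus_1_iff by simp
  have p: "p r i (\<lambda>x. f x - g x) = cube_norm r (Suc i) (\<lambda>s. \<phi> s - \<psi> s)" if "isdd i f \<phi>" "isdd i g \<psi>" for r i f g \<phi> \<psi>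
    unfolding p_def divdiff_eq[OF isdd_diff[OF that]] by (rule cube_norm_restr_Rn)
  have V: "\<exists>\<phi>. isdd i f \<phi>" if "f \<in> calCk \<alpha> k" "enat i \<le> k" for f i
    using that Ck_imp_isdd_enat unfolding calCk_def by blast
  have eq1: "f \<in> seminorm_topology (calCk \<alpha> k) P closure_of S \<longleftrightarrow> f \<in> calCk \<alpha> k \<and>
    (\<forall>F e. finite F \<longrightarrow> F \<subseteq> P \<longrightarrow> 0 < e \<longrightarrow> (\<exists>g\<in>S \<inter> calCk \<alpha> k. \<forall>p\<in>F. p (\<lambda>x. g x - f x) < ennreal e))"
  proof (rule in_closure_of_seminorm_topology_iff)
    have "p 1 0 \<in> P" unfolding P_def
      by (intro CollectI exI[of _ 1] exI[of _ 0]) (simp add: zero_enat_def[symmetric])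
    then show "P \<noteq> {}" by blast
    show "q (\<lambda>x. f x - f x) = 0" if qP: "q \<in> P" and f: "f \<in> calCk \<alpha> k" for q f
    proof -
      obtain r i where q: "q = p r i" "0 < r" "enat i \<le> k" using qP unfolding P_def by blast
      obtain \<phi> where \<phi>: "isdd i f \<phi>" using V[OF f q(3)] by blast
      show ?thesis unfolding q(1) p[OF \<phi> \<phi>] by (simp add: cube_norm_zero[OF q(2)])
    qed
    show "q (\<lambda>x. f x - h x) \<le> q (\<lambda>x. f x - g x) + q (\<lambda>x. g x - h x)"
      if qP: "q \<in> P" and fgh: "f \<in> calCk \<alpha> k" "g \<in> calCk \<alpha> k" "h \<in> calCk \<alpha> k" for q f g h
    proof -
      obtain r i where q: "q = p r i" "0 < r" "enat i \<le> k" using qP unfolding P_def by blast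
      obtain \<phi> \<psi> \<eta> where i: "isdd i f \<phi>" "isdd i g \<psi>" "isdd i h \<eta>"
        using V[OF fgh(1) q(3)] V[OF fgh(2) q(3)] V[OF fgh(3) q(3)] by blast
      show ?thesis unfolding q(1) p[OF i(1) i(2)] p[OF i(1) i(3)] p[OF i(2) i(3)]
        by (intro cube_norm_diff_triangle q isdd_continuous[OF i(1)] isdd_continuous[OF i(2)] isdd_continuous[OF i(3)]) simp
    qed
  qed
  have eq2: "(\<forall>F e. finite F \<longrightarrow> F \<subseteq> P \<longrightarrow> 0 < e \<longrightarrow> (\<exists>g\<in>S \<inter> calCk \<alpha> k. \<forall>p\<in>F. p (\<lambda>x. g x - f x) < ennreal e))
     \<longleftrightarrow> (\<forall>n r e. enat n \<le> k \<longrightarrow> 0 < r \<longrightarrow> 0 < e \<longrightarrow> (\<exists>g\<in>S \<inter> calCk \<alpha> k. close n r e f g))"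
    (is "?L \<longleftrightarrow> ?R") if f: "f \<in> calCk \<alpha> k"
  proof
    assume L: ?L
    show ?R
    proof (intro allI impI)
      fix n and r e :: real assume n: "enat n \<le> k" and r: "0 < r" and e: "0 < e"
      have "p r i \<in> P" if "i \<le> n" for i
        unfolding P_def using r n that by (intro CollectI exI[of _ r] exI[of _ i]) (simp add: order_trans[of _ "enat n"])
      then have "finite (p r ` {..n})" "p r ` {..n} \<subseteq> P" by auto
      from L[rule_format, OF this e] obtain g where g: "g \<in> S \<inter> calCk \<alpha> k"
        "\<And>i. i \<le> n \<Longrightarrow> p r i (\<lambda>x. g x - f x) < ennreal e" by auto
      have "close n r e f g" unfolding close_def
      proof (intro allI impI)
        fix i \<phi> \<psi> assume i: "i \<le> n" and \<phi>: "isdd i f \<phi>" and \<psi>: "isdd i g \<psi>"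
        have "cube_norm r (Suc i) (\<lambda>s. \<phi> s - \<psi> s) = p r i (\<lambda>x. g x - f x)"
          unfolding p[OF \<psi> \<phi>] by (intro cube_norm_diff_commute r isdd_continuous[OF \<phi>] isdd_continuous[OF \<psi>]) simp
        then show "cube_norm r (Suc i) (\<lambda>s. \<phi> s - \<psi> s) \<le> ennreal e" using g(2)[OF i] by simp
      qed
      then show "\<exists>g\<in>S \<inter> calCk \<alpha> k. close n r e f g" using g(1) by blast
    qed
  next
    assume R: ?R
    show ?L
    proof (intro allI impI)
      fix F and e :: real assume F: "finite F" "F \<subseteq> P" and e: "0 < e"
      have "\<exists>n r0. enat n \<le> k \<and> 0 < r0 \<and> (\<forall>q\<in>F. \<exists>r i. 0 < r \<and> r \<le> r0 \<and> i \<le> n \<and> q = p r i)"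
        using F
      proof (induction F)
        case empty
        show ?case by (intro exI[of _ 0] exI[of _ 1]) (auto simp: zero_enat_def[symmetric])
      next
        case (insert q F)
        then obtain n r0 where n: "enat n \<le> k" "0 < r0" "\<And>q. q \<in> F \<Longrightarrow> \<exists>r i. 0 < r \<and> r \<le> r0 \<and> i \<le> n \<and> q = p r i"
          by auto
        obtain r i where q: "q = p r i" "0 < r" "enat i \<le> k" using insert.prems unfolding P_def by blast
        have "enat (max n i) \<le> k" using n(1) q(3) by (simp add: max_def)
        moreover have "\<exists>r' i'. 0 < r' \<and> r' \<le> max r0 r \<and> i' \<le> max n i \<and> q' = p r' i'" if q': "q' \<in> insert q F" for q'
        proof (cases "q' = q")
          case True then show ?thesis using q by (intro exI[of _ r] exI[of _ i]) auto
        next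
          case False
          then obtain r' i' where "0 < r'" "r' \<le> r0" "i' \<le> n" "q' = p r' i'" using n(3) q' by blast
          then show ?thesis by (intro exI[of _ r'] exI[of _ i']) auto
        qed
        ultimately show ?case using n(2) by (intro exI[of _ "max n i"] exI[of _ "max r0 r"]) auto
      qed
      then obtain n r0 where n: "enat n \<le> k" "0 < r0" "\<And>q. q \<in> F \<Longrightarrow> \<exists>r i. 0 < r \<and> r \<le> r0 \<and> i \<le> n \<and> q = p r i"
        by blast
      have "0 < e / 2" using e by simp
      then obtain g where g: "g \<in> S \<inter> calCk \<alpha> k" "close n r0 (e / 2) f g" using R n by blast
      have "q (\<lambda>x. g x - f x) < ennreal e" if "q \<in> F" for q
      proof -
        obtain r i where q: "0 < r" "r \<le> r0" "i \<le> n" "q = p r i" using n(3)[OF \<open>q \<in> F\<close>] by blast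
        have ik: "enat i \<le> k" using q(3) n(1) by (meson enat_ord_simps(1) order_trans)
        obtain \<phi> \<psi> where i: "isdd i f \<phi>" "isdd i g \<psi>" using V[OF f ik] V[OF _ ik, of g] g(1) by blast
        note c = isdd_continuous[OF i(1)] isdd_continuous[OF i(2)]
        have "q (\<lambda>x. g x - f x) = cube_norm r (Suc i) (\<lambda>s. \<phi> s - \<psi> s)"
          unfolding q(4) p[OF i(2) i(1)] by (intro cube_norm_diff_commute q c) simp
        also have "\<dots> \<le> cube_norm r0 (Suc i) (\<lambda>s. \<phi> s - \<psi> s)" by (intro cube_norm_mono_cube q continuous_on_diff c) simp
        also have "\<dots> \<le> ennreal (e / 2)" using g(2) i q(3) unfolding close_def by blast
        also have "\<dots> < ennreal e" using e by (simp add: ennreal_less_iff)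
        finally show ?thesis .
      qed
      then show "\<exists>g\<in>S \<inter> calCk \<alpha> k. \<forall>p\<in>F. p (\<lambda>x. g x - f x) < ennreal e"
        using g(1) by (intro bexI[of _ g] ballI)
    qed
  qed
  show ?thesis unfolding top eq1 by (rule conj_cong[OF refl eq2])
qed

lemma in_boldCk_iff:
  "f \<in> boldCk \<alpha> k \<longleftrightarrow> f \<in> Ck k \<and> (\<forall>i \<phi>. enat i \<le> k \<longrightarrow> isdd i f \<phi> \<longrightarrow> approximable (Suc i) \<phi>)"
proof -
  have "divdiff i f \<in> C_alpha \<alpha> (i + 1) \<longleftrightarrow> (\<forall>\<phi>. isdd i f \<phi> \<longrightarrow> approximable (Suc i) \<phi>)"
    if f: "f \<in> Ck k" and i: "enat i \<le> k" for i
    using Ck_imp_isdd_enat[OF f i] divdiff_in_C_alpha_iff by auto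
  then show ?thesis unfolding boldCk_def enat_less_plus_1_iff by auto
qed

lemma in_calCk_iff:
  "f \<in> calCk \<alpha> k \<longleftrightarrow> f \<in> Ck k \<and> (\<forall>i \<phi>. enat i \<le> k \<longrightarrow> isdd i f \<phi> \<longrightarrow> (\<forall>r>0. cube_norm r (Suc i) \<phi> < \<infinity>))"
proof -
  have "divdiff i f \<in> calC \<alpha> (i + 1) \<longleftrightarrow> (\<forall>\<phi>. isdd i f \<phi> \<longrightarrow> (\<forall>r>0. cube_norm r (Suc i) \<phi> < \<infinity>))"
    if f: "f \<in> Ck k" and i: "enat i \<le> k" for i
    using Ck_imp_isdd_enat[OF f i] divdiff_in_calC_iff by auto
  then show ?thesis unfolding calCk_def enat_less_plus_1_iff by auto
qed

lemma boldCk_subset_calCk: "boldCk \<alpha> k \<subseteq> calCk \<alpha> k"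
proof
  fix f assume "f \<in> boldCk \<alpha> k"
  then show "f \<in> calCk \<alpha> k" unfolding in_boldCk_iff in_calCk_iff
    using approximable_finite isdd_continuous by blast
qed

text \<open>The norms in different numbers of variables are unrelated, so the condition of order \<open>n\<close> cannot be
  transferred to lower orders by an estimate; the lower orders hold by differentiability.\<close>

lemma boldCk_finite_order: "boldCk \<alpha> (enat n) = {f \<in> Ck (enat n). divdiff n f \<in> C_alpha \<alpha> (n + 1)}"
proof (intro set_eqI iffI)
  fix f assume "f \<in> boldCk \<alpha> (enat n)"
  then show "f \<in> {f \<in> Ck (enat n). divdiff n f \<in> C_alpha \<alpha> (n + 1)}"
    unfolding boldCk_def enat_less_plus_1_iff by simp
next
  fix f assume f: "f \<in> {f \<in> Ck (enat n). divdiff n f \<in> C_alpha \<alpha> (n + 1)}"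
  have "approximable (Suc i) \<phi>" if "i \<le> n" "isdd i f \<phi>" for i \<phi>
  proof (cases "i = n")
    case True then show ?thesis using f divdiff_in_C_alpha_iff that by simp
  next
    case False then show ?thesis using lower_order_approximable[of f n i \<phi>] f that by simp
  qed
  then show "f \<in> boldCk \<alpha> (enat n)" using f unfolding in_boldCk_iff by simp
qed

lemma polys_subset_boldCk: "polys \<subseteq> boldCk \<alpha> k"
proof
  fix P assume P: "P \<in> polys"
  have cl: "P \<in> smooth_closure r n polys" if "0 < r" for r n
    using polys_smooth_le[OF P, of r n] that smooth_closure_superset[OF P] by auto
  have "approximable (Suc i) \<phi>" if "isdd i P \<phi>" for i \<phi>
    by (rule smooth_closure_approximable[OF cl order_refl that])
  then show "P \<in> boldCk \<alpha> k" using P polys_subset_Ck unfolding in_boldCk_iff by blast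
qed

lemma boldCk_eq_Ck_alpha: "boldCk \<alpha> k = Ck_alpha \<alpha> k"
proof (intro set_eqI iffI)
  fix f assume f: "f \<in> boldCk \<alpha> k"
  have "\<exists>g\<in>polys \<inter> calCk \<alpha> k. close n r e f g" if n: "enat n \<le> k" and re: "0 < r" "0 < e" for n r e
  proof -
    have fn: "f \<in> Ck (enat n)" using f n Ck_mono unfolding in_boldCk_iff by blast
    obtain \<phi> where \<phi>: "isdd n f \<phi>" using Ck_imp_isdd[OF fn] by blast
    have "approximable (Suc n) \<phi>" using f n \<phi> unfolding in_boldCk_iff by blast
    from simultaneous_polynomial_approximation[OF fn \<phi> this re]
    obtain P where P0: "P \<in> polys" and "\<And>i \<phi> \<psi>. i \<le> n \<Longrightarrow> isdd i f \<phi> \<Longrightarrow> isdd i P \<psi> \<Longrightarrow>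
      cube_norm r (Suc i) (\<lambda>s. \<phi> s - \<psi> s) \<le> ennreal e" by auto
    then have P: "P \<in> polys" "close n r e f P" unfolding close_def by simp_all
    have "P \<in> calCk \<alpha> k" using P(1) polys_subset_boldCk boldCk_subset_calCk by blast
    then show ?thesis using P by (intro bexI[of _ P] IntI)
  qed
  then show "f \<in> Ck_alpha \<alpha> k"
    unfolding Ck_alpha_def in_closure_of_calCk_top_iff using f boldCk_subset_calCk by blast
next
  fix f assume "f \<in> Ck_alpha \<alpha> k"
  then have f: "f \<in> calCk \<alpha> k" "\<And>n r e. enat n \<le> k \<Longrightarrow> 0 < r \<Longrightarrow> 0 < e \<Longrightarrow> \<exists>g\<in>polys. close n r e f g"
    unfolding Ck_alpha_def in_closure_of_calCk_top_iff by blast+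
  have "approximable (Suc i) \<phi>" if i: "enat i \<le> k" and \<phi>: "isdd i f \<phi>" for i \<phi>
    unfolding approximable_def
  proof (intro allI impI)
    fix r e :: real assume "0 < r" "0 < e"
    then obtain P where P: "P \<in> polys" "close i r e f P" using f(2)[OF i] by blast
    obtain Q where "Q \<in> mpoly_fun (Suc i)" "isdd i P Q" using polys_isdd_mpoly_fun[OF P(1)] by blast
    then show "\<exists>Q\<in>mpoly_fun (Suc i). cube_norm r (Suc i) (\<lambda>s. \<phi> s - Q s) \<le> ennreal e"
      using P(2) \<phi> unfolding close_def by blast
  qed
  then show "f \<in> boldCk \<alpha> k" using f(1) unfolding in_boldCk_iff in_calCk_iff by blast
qed

lemma boldCk_top_closure_of_polys: "boldCk_top \<alpha> k closure_of polys = boldCk \<alpha> k"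
proof -
  have "boldCk \<alpha> k \<inter> polys = polys" using polys_subset_boldCk by blast
  then show ?thesis
    unfolding boldCk_top_def closure_of_subtopology using boldCk_eq_Ck_alpha[of k]
    by (simp add: Ck_alpha_def)
qed

text \<open>A subset of the bold space is dense as soon as it approximates the polynomials.\<close>

lemma boldCk_top_closure_ofI:
  assumes S: "S \<subseteq> boldCk \<alpha> k" and T: "T \<subseteq> S"
    and approx: "\<And>r n. 0 < r \<Longrightarrow> polys \<subseteq> smooth_closure r n T"
  shows "boldCk_top \<alpha> k closure_of S = boldCk \<alpha> k"
proof -
  have "P \<in> calCk_top \<alpha> k closure_of S" if P: "P \<in> polys" for P
    unfolding in_closure_of_calCk_top_iff
  proof (intro conjI allI impI)
    show "P \<in> calCk \<alpha> k" using P polys_subset_boldCk boldCk_subset_calCk by blast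
    fix n and r e :: real assume "enat n \<le> k" and r: "0 < r" and e: "0 < e"
    have "P \<in> smooth_closure r n T" using P approx[OF r] by blast
    then obtain g where g: "g \<in> T" "smooth_le r n (\<lambda>x. P x - g x) e" using smooth_closureD e by blast
    have "close n r e P g" unfolding close_def
      using cube_norm_le_smooth_le[OF r g(2)] isdd_diff by blast
    then show "\<exists>g\<in>S \<inter> calCk \<alpha> k. close n r e P g" using g(1) S T boldCk_subset_calCk by blast
  qed
  then have "calCk_top \<alpha> k closure_of polys \<subseteq> calCk_top \<alpha> k closure_of S"
    by (metis closure_of_closure_of closure_of_mono subsetI)
  then have "boldCk \<alpha> k \<subseteq> calCk_top \<alpha> k closure_of S"
    unfolding boldCk_eq_Ck_alpha Ck_alpha_def .
  then show ?thesis unfolding boldCk_top_def closure_of_subtopology using S by (auto simp: inf_absorb2)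
qed

lemma calCk_eq_Ck_alpha:
  assumes "\<forall>m\<ge>1. calC \<alpha> m = C_alpha \<alpha> m"
  shows "calCk \<alpha> k = Ck_alpha \<alpha> k"
proof -
  have "calCk \<alpha> k = boldCk \<alpha> k" unfolding calCk_def boldCk_def using assms by simp
  then show ?thesis using boldCk_eq_Ck_alpha by simp
qed

end


section \<open>Fourier integrals\<close>

lemma expi_lipschitz: "cmod (expi \<xi> x - expi \<xi> y) \<le> \<bar>\<xi>\<bar> * \<bar>x - y\<bar>"
proof -
  have "norm (expi \<xi> x - expi \<xi> y) \<le> \<bar>\<xi>\<bar> * norm (x - y)"
  proof (rule differentiable_bound[where S=UNIV and f'="\<lambda>x h. h *\<^sub>R (\<i> * complex_of_real \<xi> * expi \<xi> x)"])
    show "(expi \<xi> has_derivative (\<lambda>h. h *\<^sub>R (\<i> * complex_of_real \<xi> * expi \<xi> x))) (at x within UNIV)" for x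
      using expi_has_vector_derivative[of \<xi> x] unfolding has_vector_derivative_def by simp
    show "onorm (\<lambda>h. h *\<^sub>R (\<i> * complex_of_real \<xi> * expi \<xi> x)) \<le> \<bar>\<xi>\<bar>" for x
      by (intro onorm_le) (simp add: norm_mult mult.commute)
  qed auto
  then show ?thesis by simp
qed

lemma expi_measurable [measurable]:
  assumes [measurable]: "\<theta> \<in> borel_measurable M"
  shows "(\<lambda>\<xi>. expi (\<theta> \<xi>) x) \<in> borel_measurable M"
proof -
  have "continuous_on UNIV (\<lambda>t. expi t x)" unfolding expi_def by (intro continuous_intros)
  then have "(\<lambda>t. expi t x) \<in> borel_measurable borel" by (rule borel_measurable_continuous_onI)
  then show ?thesis by measurable
qed

definition fourier :: "'a measure \<Rightarrow> ('a \<Rightarrow> complex) \<Rightarrow> ('a \<Rightarrow> real) \<Rightarrow> real \<Rightarrow> complex" where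
  "fourier M w \<theta> x = (LINT \<xi>|M. w \<xi> * expi (\<theta> \<xi>) x)"

lemma fourier_integrable:
  assumes w: "integrable M w" and [measurable]: "\<theta> \<in> borel_measurable M"
  shows "integrable M (\<lambda>\<xi>. w \<xi> * expi (\<theta> \<xi>) x)"
proof -
  have [measurable]: "w \<in> borel_measurable M" using w by simp
  show ?thesis by (rule Bochner_Integration.integrable_bound[OF w]) (auto simp: norm_mult)
qed

lemma fourier_continuous:
  assumes w: "integrable M w" and \<theta>: "\<theta> \<in> borel_measurable M"
  shows "continuous_on UNIV (fourier M w \<theta>)"
  unfolding continuous_on_sequentially comp_def
proof (intro allI ballI impI, elim conjE)
  fix X :: "nat \<Rightarrow> real" and x assume X: "X \<longlonglongrightarrow> x"
  have [measurable]: "w \<in> borel_measurable M" using w by simp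
  note [measurable] = \<theta>
  show "(\<lambda>n. fourier M w \<theta> (X n)) \<longlonglongrightarrow> fourier M w \<theta> x"
    unfolding fourier_def
  proof (rule integral_dominated_convergence[where w="\<lambda>\<xi>. cmod (w \<xi>)"])
    have "(\<lambda>n. expi (\<theta> \<xi>) (X n)) \<longlonglongrightarrow> expi (\<theta> \<xi>) x" for \<xi>
      by (rule continuous_on_tendsto_compose[OF Ck_continuous[OF Ck_expi] X]) auto
    then show "AE \<xi> in M. (\<lambda>n. w \<xi> * expi (\<theta> \<xi>) (X n)) \<longlonglongrightarrow> w \<xi> * expi (\<theta> \<xi>) x"
      by (intro AE_I2 tendsto_mult tendsto_const)
  qed (use w in \<open>auto simp: norm_mult\<close>)
qed

lemma fourier_has_vector_derivative:
  assumes w: "integrable M w" and \<theta>: "\<theta> \<in> borel_measurable M"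
    and w': "integrable M (\<lambda>\<xi>. \<i> * complex_of_real (\<theta> \<xi>) * w \<xi>)"
  shows "(fourier M w \<theta> has_vector_derivative fourier M (\<lambda>\<xi>. \<i> * complex_of_real (\<theta> \<xi>) * w \<xi>) \<theta> x) (at x)"
proof -
  have [measurable]: "w \<in> borel_measurable M" using w by simp
  note [measurable] = \<theta>
  let ?w' = "\<lambda>\<xi>. \<i> * complex_of_real (\<theta> \<xi>) * w \<xi>"
  define D where "D = fourier M ?w' \<theta> x"
  show ?thesis
    unfolding has_vector_derivative_def has_derivative_iff_norm D_def[symmetric] tendsto_at_iff_sequentially
  proof (intro conjI allI impI bounded_linear_scaleR_left)
    fix X assume X: "\<forall>n. X n \<in> UNIV - {x}" and lim: "X \<longlonglongrightarrow> x"
    define h where "h = (\<lambda>n \<xi>. w \<xi> * ((expi (\<theta> \<xi>) (X n) - expi (\<theta> \<xi>) x) / complex_of_real (X n - x) - \<i> * complex_of_real (\<theta> \<xi>) * expi (\<theta> \<xi>) x))"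
    have Xne: "X n - x \<noteq> 0" for n using X by auto
    have "(\<lambda>n. LINT \<xi>|M. h n \<xi>) \<longlonglongrightarrow> (LINT \<xi>|M. 0)"
    proof (rule integral_dominated_convergence[where w="\<lambda>\<xi>. 2 * cmod (?w' \<xi>)"])
      show "integrable M (\<lambda>\<xi>. 2 * cmod (?w' \<xi>))" using w' by simp
      show "AE \<xi> in M. (\<lambda>n. h n \<xi>) \<longlonglongrightarrow> 0"
      proof (rule AE_I2)
        fix \<xi>
        have "((\<lambda>y. norm ((expi (\<theta> \<xi>) y - expi (\<theta> \<xi>) x) - (y - x) *\<^sub>R (\<i> * complex_of_real (\<theta> \<xi>) * expi (\<theta> \<xi>) x)) / norm (y - x)) \<longlongrightarrow> 0) (at x)"
          using expi_has_vector_derivative[of "\<theta> \<xi>" x] unfolding has_vector_derivative_def has_derivative_iff_norm by blast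
        then have "(\<lambda>n. norm ((expi (\<theta> \<xi>) (X n) - expi (\<theta> \<xi>) x) - (X n - x) *\<^sub>R (\<i> * complex_of_real (\<theta> \<xi>) * expi (\<theta> \<xi>) x)) / norm (X n - x)) \<longlonglongrightarrow> 0"
          using X lim unfolding tendsto_at_iff_sequentially comp_def by blast
        moreover have "norm ((expi (\<theta> \<xi>) (X n) - expi (\<theta> \<xi>) x) - (X n - x) *\<^sub>R (\<i> * complex_of_real (\<theta> \<xi>) * expi (\<theta> \<xi>) x)) / norm (X n - x) =
            norm ((expi (\<theta> \<xi>) (X n) - expi (\<theta> \<xi>) x) / complex_of_real (X n - x) - \<i> * complex_of_real (\<theta> \<xi>) * expi (\<theta> \<xi>) x)" for n
        proof -
          have "norm (X n - x) = norm (complex_of_real (X n - x))" by (simp only: norm_of_real real_norm_def)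
          then show ?thesis using Xne[of n]
            by (simp only: norm_divide[symmetric] scaleR_conv_of_real diff_divide_distrib) simp
        qed
        ultimately have "(\<lambda>n. norm ((expi (\<theta> \<xi>) (X n) - expi (\<theta> \<xi>) x) / complex_of_real (X n - x) - \<i> * complex_of_real (\<theta> \<xi>) * expi (\<theta> \<xi>) x)) \<longlonglongrightarrow> 0"
          by (simp only:)
        then have "(\<lambda>n. (expi (\<theta> \<xi>) (X n) - expi (\<theta> \<xi>) x) / complex_of_real (X n - x) - \<i> * complex_of_real (\<theta> \<xi>) * expi (\<theta> \<xi>) x) \<longlonglongrightarrow> 0"
          by (rule tendsto_norm_zero_cancel)
        then show "(\<lambda>n. h n \<xi>) \<longlonglongrightarrow> 0" unfolding h_def by (rule tendsto_mult_right_zero)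
      qed
      show "AE \<xi> in M. norm (h n \<xi>) \<le> 2 * cmod (?w' \<xi>)" for n
      proof (rule AE_I2)
        fix \<xi>
        have "cmod ((expi (\<theta> \<xi>) (X n) - expi (\<theta> \<xi>) x) / complex_of_real (X n - x)) \<le> \<bar>\<theta> \<xi>\<bar>"
          using expi_lipschitz[of "\<theta> \<xi>" "X n" x] Xne[of n]
          unfolding norm_divide norm_of_real by (simp add: divide_le_eq)
        then have "cmod ((expi (\<theta> \<xi>) (X n) - expi (\<theta> \<xi>) x) / complex_of_real (X n - x) - \<i> * complex_of_real (\<theta> \<xi>) * expi (\<theta> \<xi>) x) \<le> \<bar>\<theta> \<xi>\<bar> + \<bar>\<theta> \<xi>\<bar>"
          by (intro order_trans[OF norm_triangle_ineq4] add_mono) (simp_all add: norm_mult)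
        from mult_left_mono[OF this norm_ge_zero[of "w \<xi>"]]
        show "norm (h n \<xi>) \<le> 2 * cmod (?w' \<xi>)"
          unfolding h_def norm_mult by (simp add: algebra_simps)
      qed
    qed (auto simp: h_def)
    then have "(\<lambda>n. norm (LINT \<xi>|M. h n \<xi>)) \<longlonglongrightarrow> 0" by (intro tendsto_norm_zero) simp
    moreover have "norm (LINT \<xi>|M. h n \<xi>) = norm ((fourier M w \<theta> (X n) - fourier M w \<theta> x) - (X n - x) *\<^sub>R D) / norm (X n - x)" for n
    proof -
      have i: "integrable M (\<lambda>\<xi>. w \<xi> * expi (\<theta> \<xi>) (X n))" "integrable M (\<lambda>\<xi>. w \<xi> * expi (\<theta> \<xi>) x)"
        "integrable M (\<lambda>\<xi>. ?w' \<xi> * expi (\<theta> \<xi>) x)"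
        by (rule fourier_integrable[OF w \<theta>] fourier_integrable[OF w' \<theta>])+
      have "h n = (\<lambda>\<xi>. 1 / complex_of_real (X n - x) * (w \<xi> * expi (\<theta> \<xi>) (X n) - w \<xi> * expi (\<theta> \<xi>) x) - ?w' \<xi> * expi (\<theta> \<xi>) x)"
        by (simp add: h_def fun_eq_iff algebra_simps diff_divide_distrib)
      then have "(LINT \<xi>|M. h n \<xi>) = 1 / complex_of_real (X n - x) * (fourier M w \<theta> (X n) - fourier M w \<theta> x) - D"
        unfolding D_def fourier_def using i
        by (simp only: Bochner_Integration.integral_diff Bochner_Integration.integrable_diff integrable_mult_right integral_mult_right_zero)
      also have "\<dots> = ((fourier M w \<theta> (X n) - fourier M w \<theta> x) - (X n - x) *\<^sub>R D) / complex_of_real (X n - x)"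
        using Xne[of n] by (simp add: scaleR_conv_of_real diff_divide_distrib)
      finally show ?thesis by (simp only: norm_divide norm_of_real real_norm_def)
    qed
    ultimately show "((\<lambda>y. norm ((fourier M w \<theta> y - fourier M w \<theta> x) - (y - x) *\<^sub>R D) / norm (y - x)) \<circ> X) \<longlonglongrightarrow> 0"
      by (simp only: comp_def)
  qed
qed

lemma fourier_Ck:
  assumes \<theta>: "\<theta> \<in> borel_measurable M"
    and "\<And>j. j \<le> n \<Longrightarrow> integrable M (\<lambda>\<xi>. complex_of_real (\<theta> \<xi>) ^ j * w \<xi>)"
  shows "fourier M w \<theta> \<in> Ck (enat n)"
  using assms(2)
proof (induction n arbitrary: w)
  case 0
  show ?case unfolding Ck_0 using fourier_continuous[OF _ \<theta>] 0[of 0] by simp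
next
  case (Suc n)
  let ?w' = "\<lambda>\<xi>. \<i> * complex_of_real (\<theta> \<xi>) * w \<xi>"
  have int: "integrable M (\<lambda>\<xi>. complex_of_real (\<theta> \<xi>) ^ j * ?w' \<xi>)" if "j \<le> n" for j
    using integrable_mult_right[OF Suc.prems[of "Suc j"], of \<i>] that by (simp add: mult_ac)
  show ?case
    by (rule Ck_SucI[OF fourier_has_vector_derivative[OF _ \<theta>] Suc.IH[OF int]])
       (use Suc.prems[of 0] int[of 0] in auto)
qed

lemma (in finite_measure) integrable_indicator_real_complex:
  assumes "A \<in> sets M"
  shows "integrable M (indicator A :: _ \<Rightarrow> real)" and "integrable M (indicator A :: _ \<Rightarrow> complex)"
proof -
  show 1: "integrable M (indicator A :: _ \<Rightarrow> real)"
    using assms by (intro integrable_real_indicator) (auto simp: emeasure_finite less_top[symmetric])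
  have "integrable M (\<lambda>\<xi>. complex_of_real (indicator A \<xi>))" using 1 by (rule integrable_of_real)
  then show "integrable M (indicator A :: _ \<Rightarrow> complex)" by (simp add: of_real_indicator)
qed

text \<open>On a set of bounded frequencies the Fourier integral is an entire power series.\<close>

lemma fourier_bounded_frequencies:
  assumes M: "finite_measure M" and \<theta>: "\<theta> \<in> borel_measurable M" and A: "A \<in> sets M"
    and bound: "\<And>\<xi>. \<xi> \<in> A \<Longrightarrow> \<bar>\<theta> \<xi>\<bar> \<le> 1" and r: "0 < r"
  shows "fourier M (indicator A) \<theta> \<in> smooth_closure r n polys"
    and "smooth_le r n (fourier M (indicator A) \<theta>) (real (Suc n) ^ 2 * (measure M A * exp (r + 1)))"
proof -
  interpret finite_measure M by fact
  note [measurable] = \<theta> A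
  have le1: "\<bar>\<theta> \<xi>\<bar> ^ k * indicator A \<xi> \<le> indicator A \<xi>" for k \<xi>
    using bound[of \<xi>] by (auto simp: power_le_one split: split_indicator)
  have indA: "integrable M (indicator A :: _ \<Rightarrow> complex)" "integrable M (indicator A :: _ \<Rightarrow> real)"
    by (rule integrable_indicator_real_complex[OF A])+
  have int: "integrable M (\<lambda>\<xi>. c * complex_of_real (\<theta> \<xi>) ^ k * indicator A \<xi>)" for k c
  proof (rule Bochner_Integration.integrable_bound[OF integrable_mult_right[OF indA(2), of "cmod c"]])
    show "AE \<xi> in M. norm (c * complex_of_real (\<theta> \<xi>) ^ k * indicator A \<xi>) \<le> norm (cmod c * indicator A \<xi> :: real)"
    proof (rule AE_I2)
      fix \<xi>
      have "norm (c * complex_of_real (\<theta> \<xi>) ^ k * indicator A \<xi>) = cmod c * (\<bar>\<theta> \<xi>\<bar> ^ k * indicator A \<xi>)"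
        by (simp add: norm_mult norm_power split: split_indicator)
      also have "\<dots> \<le> cmod c * indicator A \<xi>" by (rule mult_left_mono[OF le1]) simp
      finally show "norm (c * complex_of_real (\<theta> \<xi>) ^ k * indicator A \<xi>) \<le> norm (cmod c * indicator A \<xi> :: real)"
        by simp
    qed
  qed measurable
  define a where "a = (\<lambda>k. LINT \<xi>|M. \<i> ^ k / fact k * complex_of_real (\<theta> \<xi>) ^ k * indicator A \<xi>)"
  have nle: "norm (\<i> ^ k / fact k * complex_of_real (\<theta> \<xi>) ^ k * indicator A \<xi>) \<le> 1 / fact k * indicator A \<xi>" for k \<xi>
  proof -
    have "norm (\<i> ^ k / fact k * complex_of_real (\<theta> \<xi>) ^ k * indicator A \<xi>) = 1 / fact k * (\<bar>\<theta> \<xi>\<bar> ^ k * indicator A \<xi>)"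
      by (simp add: norm_mult norm_power norm_divide split: split_indicator)
    also have "\<dots> \<le> 1 / fact k * indicator A \<xi>" by (rule mult_left_mono[OF le1]) simp
    finally show ?thesis .
  qed
  have ale: "cmod (a k) \<le> measure M A / fact k" for k
  proof -
    have "cmod (a k) \<le> (LINT \<xi>|M. norm (\<i> ^ k / fact k * complex_of_real (\<theta> \<xi>) ^ k * indicator A \<xi>))"
      unfolding a_def by (rule integral_norm_bound)
    also have "\<dots> \<le> (LINT \<xi>|M. 1 / fact k * indicator A \<xi>)"
      by (rule integral_mono) (use int nle indA in auto)
    also have "\<dots> = measure M A / fact k" using A by (simp add: sets.Int_space_eq2)
    finally show ?thesis .
  qed
  have le: "cmod (a k) * (r + 1) ^ k \<le> measure M A * ((r + 1) ^ k / fact k)" for k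
    using mult_right_mono[OF ale[of k], of "(r + 1) ^ k"] r by simp
  have es: "summable (\<lambda>k. measure M A * ((r + 1) ^ k / fact k))"
    "(\<Sum>k. measure M A * ((r + 1) ^ k / fact k)) = measure M A * exp (r + 1)"
    using sums_mult[OF exp_real_sums[of "r + 1"], of "measure M A"] by (auto simp: sums_iff)
  have as: "summable (\<lambda>k. cmod (a k) * (r + 1) ^ k)"
    by (rule summable_comparison_test'[OF es(1)]) (use le r in auto)
  have sums: "(\<lambda>k. a k * complex_of_real x ^ k) sums fourier M (indicator A) \<theta> x" for x
  proof -
    let ?f = "\<lambda>k \<xi>. (\<i> ^ k / fact k * complex_of_real (\<theta> \<xi>) ^ k * indicator A \<xi>) * complex_of_real x ^ k"
    have fs: "(\<lambda>k. ?f k \<xi>) sums (indicator A \<xi> * expi (\<theta> \<xi>) x)" for \<xi>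
      using sums_mult[OF expi_sums[of "\<theta> \<xi>" x], of "indicator A \<xi>"] by (simp add: power_mult_distrib mult_ac)
    have nf: "norm (?f k \<xi>) \<le> (\<bar>x\<bar> ^ k / fact k) * indicator A \<xi>" for k \<xi>
    proof -
      have "norm (?f k \<xi>) = norm (\<i> ^ k / fact k * complex_of_real (\<theta> \<xi>) ^ k * indicator A \<xi>) * \<bar>x\<bar> ^ k"
        unfolding norm_mult[of _ "complex_of_real x ^ k"] norm_power[of "complex_of_real x"] norm_of_real ..
      also have "\<dots> \<le> (1 / fact k * indicator A \<xi>) * \<bar>x\<bar> ^ k" by (rule mult_right_mono[OF nle]) simp
      finally show ?thesis by (simp add: mult.commute)
    qed
    have ex: "summable (\<lambda>k. \<bar>x\<bar> ^ k / fact k)" using exp_real_sums[of "\<bar>x\<bar>"] by (simp add: sums_iff)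
    have "(\<lambda>k. LINT \<xi>|M. ?f k \<xi>) sums (LINT \<xi>|M. (\<Sum>k. ?f k \<xi>))"
    proof (rule sums_integral)
      show "integrable M (?f k)" for k by (intro integrable_mult_left int)
      show "AE \<xi> in M. summable (\<lambda>k. norm (?f k \<xi>))"
      proof (rule AE_I2)
        fix \<xi> show "summable (\<lambda>k. norm (?f k \<xi>))"
          by (rule summable_comparison_test'[OF summable_mult2[OF ex, of "indicator A \<xi>"]]) (use nf in auto)
      qed
      have "(LINT \<xi>|M. norm (?f k \<xi>)) \<le> (\<bar>x\<bar> ^ k / fact k) * measure M A" for k
      proof -
        have "(LINT \<xi>|M. norm (?f k \<xi>)) \<le> (LINT \<xi>|M. (\<bar>x\<bar> ^ k / fact k) * indicator A \<xi>)"
          by (rule integral_mono) (use int nf indA in auto)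
        then show ?thesis using A by (simp add: sets.Int_space_eq2)
      qed
      then show "summable (\<lambda>k. LINT \<xi>|M. norm (?f k \<xi>))"
        by (intro summable_comparison_test'[OF summable_mult2[OF ex, of "measure M A"]]) auto
    qed
    moreover have "(\<Sum>k. ?f k \<xi>) = indicator A \<xi> * expi (\<theta> \<xi>) x" for \<xi> using fs by (simp add: sums_iff)
    moreover have "(LINT \<xi>|M. ?f k \<xi>) = a k * complex_of_real x ^ k" for k unfolding a_def by simp
    ultimately show ?thesis unfolding fourier_def by (simp only:)
  qed
  have C: "fourier M (indicator A) \<theta> \<in> Ck (enat n)"
    by (rule fourier_Ck[OF \<theta>]) (use int[of 1] in simp)
  show "fourier M (indicator A) \<theta> \<in> smooth_closure r n polys"
    by (rule smooth_closure_power_series(1)[OF r C as sums])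
  show "smooth_le r n (fourier M (indicator A) \<theta>) (real (Suc n) ^ 2 * (measure M A * exp (r + 1)))"
    by (rule smooth_le_mono[OF smooth_closure_power_series(2)[OF r C as sums]])
       (use suminf_le[OF le as es(1)] es(2) in \<open>auto intro!: mult_left_mono\<close>)
qed

text \<open>Cutting the frequency axis into the cells \<open>\<lfloor>\<xi>\<rfloor> = z\<close> and writing \<open>e\<^bsup>ix\<xi>\<^esup> = e\<^bsup>ixz\<^esup> e\<^bsup>ix(\<xi>-z)\<^esup>\<close>: the
  second factor has bounded frequencies, and the norm of the first is of order \<open>\<bar>z\<bar>\<^sup>n\<close>. Hence the
  cells are summable when the \<open>n\<close>-th moment is finite.\<close>

lemma fourier_smooth_closure:
  assumes M: "finite_measure M" and sets: "sets M = sets (borel :: real measure)"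
    and moment: "(\<integral>\<^sup>+ \<xi>. ennreal (\<bar>\<xi>\<bar> ^ n) \<partial>M) < \<infinity>"
  shows "fourier M (\<lambda>_. 1) (\<lambda>\<xi>. \<xi>) \<in> Ck (enat n)"
    and "0 < r \<Longrightarrow> fourier M (\<lambda>_. 1) (\<lambda>\<xi>. \<xi>) \<in> smooth_closure r n polys"
proof -
  interpret finite_measure M by fact
  have meas: "f \<in> borel_measurable M" if "f \<in> borel_measurable borel" for f :: "real \<Rightarrow> 'b::topological_space"
    using that measurable_cong_sets[OF sets refl] by blast
  have m\<theta> [measurable]: "(\<lambda>\<xi>. \<xi> - c) \<in> borel_measurable M" "(\<lambda>\<xi>. \<xi>) \<in> borel_measurable M" for c :: real
    by (rule meas, simp)+
  have space: "space M = UNIV" using sets_eq_imp_space_eq[OF sets] by simp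
  have im: "integrable M (\<lambda>\<xi>. \<bar>\<xi>\<bar> ^ n)"
    by (rule integrableI_bounded) (use moment in \<open>auto intro!: meas simp: \<close>)
  have hi: "integrable M (\<lambda>\<xi>. (2 + \<bar>\<xi>\<bar>) ^ n)"
  proof (rule Bochner_Integration.integrable_bound)
    show "integrable M (\<lambda>\<xi>. 4 ^ n * (1 + \<bar>\<xi>\<bar> ^ n))" using im by simp
    show "AE \<xi> in M. norm ((2 + \<bar>\<xi>\<bar>) ^ n) \<le> norm (4 ^ n * (1 + \<bar>\<xi>\<bar> ^ n))"
    proof (rule AE_I2)
      fix \<xi> :: real
      have "(2 + \<bar>\<xi>\<bar>) ^ n \<le> (4 * max 1 \<bar>\<xi>\<bar>) ^ n" by (rule power_mono) auto
      also have "\<dots> = 4 ^ n * max 1 \<bar>\<xi>\<bar> ^ n" by (simp add: power_mult_distrib)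
      also have "\<dots> \<le> 4 ^ n * (1 + \<bar>\<xi>\<bar> ^ n)" by (intro mult_left_mono) (auto simp: max_def)
      finally show "norm ((2 + \<bar>\<xi>\<bar>) ^ n) \<le> norm (4 ^ n * (1 + \<bar>\<xi>\<bar> ^ n))" by simp
    qed
  qed (auto intro!: meas)
  have pw: "integrable M (\<lambda>\<xi>. complex_of_real \<xi> ^ j * w \<xi>)"
    if j: "j \<le> n" and w: "w \<in> borel_measurable M" "\<And>\<xi>. cmod (w \<xi>) \<le> 1" for j and w :: "real \<Rightarrow> complex"
  proof (rule Bochner_Integration.integrable_bound[OF hi])
    note [measurable] = w(1)
    show "(\<lambda>\<xi>. complex_of_real \<xi> ^ j * w \<xi>) \<in> borel_measurable M" by measurable
    show "AE \<xi> in M. norm (complex_of_real \<xi> ^ j * w \<xi>) \<le> norm ((2 + \<bar>\<xi>\<bar>) ^ n)"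
    proof (rule AE_I2)
      fix \<xi>
      have "\<bar>\<xi>\<bar> ^ j * cmod (w \<xi>) \<le> \<bar>\<xi>\<bar> ^ j * 1" by (intro mult_left_mono w) auto
      also have "\<dots> \<le> (2 + \<bar>\<xi>\<bar>) ^ j" by (simp add: power_mono)
      also have "\<dots> \<le> (2 + \<bar>\<xi>\<bar>) ^ n" by (intro power_increasing j) auto
      finally show "norm (complex_of_real \<xi> ^ j * w \<xi>) \<le> norm ((2 + \<bar>\<xi>\<bar>) ^ n)"
        by (simp add: norm_mult norm_power)
    qed
  qed
  show C: "fourier M (\<lambda>_. 1) (\<lambda>\<xi>. \<xi>) \<in> Ck (enat n)"
    by (rule fourier_Ck) (use pw[of _ "\<lambda>_. 1"] in auto)
  assume r: "0 < r"
  define z where "z = (\<lambda>k. real_of_int (int_decode k))"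
  define A where "A = (\<lambda>k. {\<xi>::real. \<lfloor>\<xi>\<rfloor> = int_decode k})"
  have A: "A k \<in> sets M" for k
  proof -
    have "A k = {z k..<z k + 1}" by (auto simp: A_def z_def floor_eq_iff)
    then show ?thesis by (simp add: sets)
  qed
  have disj: "disjoint_family A" using injD[OF inj_int_decode] by (auto simp: disjoint_family_on_def A_def)
  have UA: "(\<Union>k. A k) = UNIV"
  proof -
    have "\<xi> \<in> A (int_encode \<lfloor>\<xi>\<rfloor>)" for \<xi> by (simp add: A_def)
    then show ?thesis by blast
  qed
  have A1: "\<bar>\<xi> - z k\<bar> \<le> 1" if "\<xi> \<in> A k" for \<xi> k
    using that by (auto simp: A_def z_def floor_eq_iff abs_le_iff)
  define g where "g = (\<lambda>k. fourier M (indicator (A k)) (\<lambda>\<xi>. \<xi> - z k))"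
  define h where "h = (\<lambda>k. fourier M (indicator (A k)) (\<lambda>\<xi>. \<xi>))"
  have h_eq: "h k = (\<lambda>x. expi (z k) x * g k x)" for k
  proof (rule ext)
    fix x
    have "expi (z k) x * g k x = (LINT \<xi>|M. expi (z k) x * (indicator (A k) \<xi> * expi (\<xi> - z k) x))"
      unfolding g_def fourier_def by simp
    also have "\<dots> = h k x"
      unfolding h_def fourier_def
    proof (rule Bochner_Integration.integral_cong[OF refl])
      fix \<xi>
      have "expi \<xi> x = expi (z k) x * expi (\<xi> - z k) x" using expi_add[of "z k" "\<xi> - z k" x] by simp
      then show "expi (z k) x * (indicator (A k) \<xi> * expi (\<xi> - z k) x) = indicator (A k) \<xi> * expi \<xi> x"
        by (simp only: mult.left_commute)
    qed
    finally show "h k x = expi (z k) x * g k x" by simp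
  qed
  obtain C0 where C0: "1 \<le> C0" "\<And>i \<xi>. i \<le> n \<Longrightarrow> dd_le r i (expi \<xi>) ((C0 * \<bar>\<xi>\<bar>) ^ i / fact i)"
    using dd_le_expi[OF r] by blast
  define D where "D = (\<Sum>i\<le>n. C0 ^ i / fact i)"
  have nbE: "smooth_le r n (expi \<xi>) (D * (1 + \<bar>\<xi>\<bar>) ^ n)" for \<xi>
  proof (rule smooth_leI[OF C0(2)])
    have "(C0 * \<bar>\<xi>\<bar>) ^ i / fact i \<le> C0 ^ i / fact i * (1 + \<bar>\<xi>\<bar>) ^ n" if "i \<le> n" for i
    proof -
      have "\<bar>\<xi>\<bar> ^ i \<le> (1 + \<bar>\<xi>\<bar>) ^ i" by (rule power_mono) auto
      also have "\<dots> \<le> (1 + \<bar>\<xi>\<bar>) ^ n" by (rule power_increasing[OF that]) auto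
      finally have "C0 ^ i / fact i * \<bar>\<xi>\<bar> ^ i \<le> C0 ^ i / fact i * (1 + \<bar>\<xi>\<bar>) ^ n"
        using C0(1) by (intro mult_left_mono) auto
      then show ?thesis by (simp add: power_mult_distrib)
    qed
    then show "(\<Sum>i\<le>n. (C0 * \<bar>\<xi>\<bar>) ^ i / fact i) \<le> D * (1 + \<bar>\<xi>\<bar>) ^ n"
      unfolding D_def sum_distrib_right by (intro sum_mono) auto
  qed
  have D0: "0 \<le> D" unfolding D_def using C0(1) by (intro sum_nonneg) auto
  define E where "E = real (Suc n) ^ 2 * exp (r + 1)"
  have E0: "0 \<le> E" by (simp add: E_def)
  have g: "g k \<in> smooth_closure r n polys" "smooth_le r n (g k) (E * measure M (A k))" for k
    using fourier_bounded_frequencies[OF M m\<theta>(1) A A1 r, of k] unfolding g_def E_def by (simp_all add: mult_ac)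
  define c where "c = (\<lambda>k. D * E * (LINT \<xi>|M. indicator (A k) \<xi> * (2 + \<bar>\<xi>\<bar>) ^ n))"
  have hiA: "integrable M (\<lambda>\<xi>. indicator (A k) \<xi> * (2 + \<bar>\<xi>\<bar>) ^ n)" for k
    using integrable_mult_indicator[OF A hi] by (simp add: mult.commute)
  have hnb: "smooth_le r n (h k) (c k)" for k
  proof -
    have "smooth_le r n (h k) (D * (1 + \<bar>z k\<bar>) ^ n * (E * measure M (A k)))"
      unfolding h_eq by (rule smooth_le_mult[OF nbE g(2)])
    moreover have "(1 + \<bar>z k\<bar>) ^ n * measure M (A k) \<le> (LINT \<xi>|M. indicator (A k) \<xi> * (2 + \<bar>\<xi>\<bar>) ^ n)"
    proof -
      have "(1 + \<bar>z k\<bar>) ^ n * measure M (A k) = (LINT \<xi>|M. (1 + \<bar>z k\<bar>) ^ n * indicator (A k) \<xi>)"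
        using A by (simp add: space)
      also have "\<dots> \<le> (LINT \<xi>|M. indicator (A k) \<xi> * (2 + \<bar>\<xi>\<bar>) ^ n)"
      proof (rule integral_mono[OF _ hiA])
        show "integrable M (\<lambda>\<xi>. (1 + \<bar>z k\<bar>) ^ n * indicator (A k) \<xi>)"
          using A by (intro integrable_mult_right integrable_real_indicator) (auto simp: less_top[symmetric] emeasure_finite)
        fix \<xi>
        have "\<xi> \<in> A k \<Longrightarrow> (1 + \<bar>z k\<bar>) ^ n \<le> (2 + \<bar>\<xi>\<bar>) ^ n"
          using A1[of \<xi> k] by (intro power_mono) linarith+
        then show "(1 + \<bar>z k\<bar>) ^ n * indicator (A k) \<xi> \<le> indicator (A k) \<xi> * (2 + \<bar>\<xi>\<bar>) ^ n"
          by (auto split: split_indicator)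
      qed
      finally show ?thesis .
    qed
    then have "D * E * ((1 + \<bar>z k\<bar>) ^ n * measure M (A k)) \<le> c k"
      unfolding c_def using D0 E0 by (intro mult_left_mono) auto
    ultimately show ?thesis by (elim smooth_le_mono) (simp add: mult_ac)
  qed
  have csum: "summable c"
  proof -
    have "summable (\<lambda>k. LINT \<xi>|M. indicator (A k) \<xi> * (2 + \<bar>\<xi>\<bar>) ^ n)"
    proof (rule summableI_nonneg_bounded)
      show "0 \<le> (LINT \<xi>|M. indicator (A k) \<xi> * (2 + \<bar>\<xi>\<bar>) ^ n)" for k
        by (intro Bochner_Integration.integral_nonneg) auto
      fix K
      have "(\<Sum>k<K. LINT \<xi>|M. indicator (A k) \<xi> * (2 + \<bar>\<xi>\<bar>) ^ n) = (LINT \<xi>|M. (\<Sum>k<K. indicator (A k) \<xi> * (2 + \<bar>\<xi>\<bar>) ^ n))"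
        by (rule Bochner_Integration.integral_sum[symmetric]) (rule hiA)
      also have "\<dots> \<le> (LINT \<xi>|M. (2 + \<bar>\<xi>\<bar>) ^ n)"
      proof (rule integral_mono[OF Bochner_Integration.integrable_sum[OF hiA] hi])
        fix \<xi>
        have "(\<Sum>k<K. indicator (A k) \<xi>) = (indicator (\<Union>k<K. A k) \<xi> :: real)"
          by (rule indicator_UN_disjoint[symmetric]) (use disj in \<open>auto simp: disjoint_family_on_def\<close>)
        then have "(\<Sum>k<K. indicator (A k) \<xi> * (2 + \<bar>\<xi>\<bar>) ^ n) = indicator (\<Union>k<K. A k) \<xi> * (2 + \<bar>\<xi>\<bar>) ^ n"
          by (simp add: sum_distrib_right[symmetric])
        also have "\<dots> \<le> (2 + \<bar>\<xi>\<bar>) ^ n" by (auto split: split_indicator)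
        finally show "(\<Sum>k<K. indicator (A k) \<xi> * (2 + \<bar>\<xi>\<bar>) ^ n) \<le> (2 + \<bar>\<xi>\<bar>) ^ n" .
      qed
      finally show "(\<Sum>k<K. LINT \<xi>|M. indicator (A k) \<xi> * (2 + \<bar>\<xi>\<bar>) ^ n) \<le> (LINT \<xi>|M. (2 + \<bar>\<xi>\<bar>) ^ n)" .
    qed
    then show ?thesis unfolding c_def by (rule summable_mult)
  qed
  have hC: "h k \<in> Ck (enat n)" for k
    unfolding h_def by (rule fourier_Ck) (use pw[of _ "indicator (A k)"] A in \<open>auto split: split_indicator\<close>)
  have hA: "h k \<in> smooth_closure r n polys" for k
    unfolding h_eq by (intro smooth_closure_mult polys_mult expi_smooth_closure r g(1))
  have sums: "(\<lambda>k. h k x) sums fourier M (\<lambda>_. 1) (\<lambda>\<xi>. \<xi>) x" for x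
  proof -
    have ind: "(\<lambda>k. indicator (A k) \<xi> :: real) sums 1" for \<xi>
      using indicator_sums[of A \<xi>] disj UA by (simp add: disjoint_family_on_def)
    have nrm: "norm (indicator (A k) \<xi> * expi \<xi> x) = indicator (A k) \<xi>" for k \<xi>
      by (simp add: norm_mult split: split_indicator)
    have indi: "integrable M (indicator (A k) :: real \<Rightarrow> real)" "integrable M (indicator (A k) :: real \<Rightarrow> complex)" for k
      by (rule integrable_indicator_real_complex[OF A])+
    have "(\<lambda>k. LINT \<xi>|M. indicator (A k) \<xi> * expi \<xi> x) sums (LINT \<xi>|M. (\<Sum>k. indicator (A k) \<xi> * expi \<xi> x))"
    proof (rule sums_integral)
      show "integrable M (\<lambda>\<xi>. indicator (A k) \<xi> * expi \<xi> x)" for k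
        by (rule fourier_integrable[OF indi(2) m\<theta>(2)])
      show "AE \<xi> in M. summable (\<lambda>k. norm (indicator (A k) \<xi> * expi \<xi> x))"
        unfolding nrm using ind by (auto simp: sums_iff)
      have "(\<lambda>k. measure M (A k)) sums measure M (\<Union>k. A k)"
        by (rule finite_measure_UNION) (use A disj in auto)
      moreover have "(LINT \<xi>|M. norm (indicator (A k) \<xi> * expi \<xi> x)) = measure M (A k)" for k
        unfolding nrm using A by (simp add: space)
      ultimately show "summable (\<lambda>k. LINT \<xi>|M. norm (indicator (A k) \<xi> * expi \<xi> x))"
        by (simp add: sums_iff)
    qed
    moreover have "(\<Sum>k. indicator (A k) \<xi> * expi \<xi> x) = 1 * expi \<xi> x" for \<xi>
    proof -
      have "(\<lambda>k. complex_of_real (indicator (A k) \<xi>) * expi \<xi> x) sums (complex_of_real 1 * expi \<xi> x)"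
        by (intro sums_mult2 sums_of_real ind)
      then show ?thesis by (simp add: sums_iff of_real_indicator)
    qed
    ultimately show ?thesis unfolding h_def fourier_def by (simp only:)
  qed
  show "fourier M (\<lambda>_. 1) (\<lambda>\<xi>. \<xi>) \<in> smooth_closure r n polys"
    by (rule smooth_closure_sums[OF r C hnb csum sums hC hA polys_const polys_add])
qed


section \<open>Complex measures\<close>

context
  fixes \<mu> :: "real set \<Rightarrow> complex"
  assumes \<mu>: "complex_borel_measure \<mu>"
begin

lemma complex_measure_sums:
  assumes "\<And>n. A n \<in> sets borel" "disjoint_family A"
  shows "(\<lambda>n. \<mu> (A n)) sums \<mu> (\<Union>n. A n)"
  using \<mu> assms unfolding complex_borel_measure_def by blast

lemma complex_measure_empty: "\<mu> {} = 0"
proof -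
  have "(\<lambda>n::nat. \<mu> {}) sums \<mu> (\<Union>n::nat. {})"
    by (rule complex_measure_sums) (auto simp: disjoint_family_on_def)
  then have "(\<lambda>n::nat. \<mu> {}) \<longlonglongrightarrow> 0" by (intro summable_LIMSEQ_zero) (simp add: sums_iff)
  then show ?thesis by (simp add: LIMSEQ_const_iff)
qed

lemma complex_measure_Un:
  assumes "B \<in> sets borel" "C \<in> sets borel" "B \<inter> C = {}"
  shows "\<mu> (B \<union> C) = \<mu> B + \<mu> C"
proof -
  define A where "A = (\<lambda>n::nat. if n = 0 then B else if n = 1 then C else {})"
  have "(\<lambda>n. \<mu> (A n)) sums \<mu> (\<Union>n. A n)"
    by (rule complex_measure_sums) (use assms in \<open>auto simp: A_def disjoint_family_on_def\<close>)
  moreover have "(\<Union>n. A n) = B \<union> C" by (auto simp: A_def split: if_splits)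
  moreover have "(\<lambda>n. \<mu> (A n)) sums (\<Sum>n\<in>{0, 1}. \<mu> (A n))"
    by (rule sums_finite) (auto simp: A_def complex_measure_empty)
  ultimately have "\<mu> (B \<union> C) = (\<Sum>n\<in>{0, 1}. \<mu> (A n))" by (metis sums_unique2)
  then show ?thesis by (simp add: A_def)
qed

lemma complex_measure_Diff:
  assumes "B \<in> sets borel" "E \<in> sets borel" "B \<subseteq> E"
  shows "\<mu> (E - B) = \<mu> E - \<mu> B"
proof -
  have "B \<union> (E - B) = E" using assms(3) by blast
  then show ?thesis using complex_measure_Un[of B "E - B"] assms by simp
qed

text \<open>If \<open>\<mu>\<close> is unbounded on the subsets of \<open>E\<close>, then \<open>E\<close> splits into a part of measure at least \<open>1\<close> and
  a part on which \<open>\<mu>\<close> is still unbounded. Iterating contradicts countable additivity.\<close>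

lemma complex_measure_bounded: "\<exists>K. \<forall>B\<in>sets borel. cmod (\<mu> B) \<le> K"
proof (rule ccontr)
  assume unb: "\<not> (\<exists>K. \<forall>B\<in>sets borel. cmod (\<mu> B) \<le> K)"
  define bad where "bad = (\<lambda>E. E \<in> sets borel \<and> (\<forall>K. \<exists>B\<in>sets borel. B \<subseteq> E \<and> K < cmod (\<mu> B)))"
  have step: "\<exists>E'. bad E' \<and> E' \<subseteq> E \<and> 1 \<le> cmod (\<mu> (E - E'))" if E: "bad E" for E
  proof -
    have Eb: "E \<in> sets borel" using E by (simp add: bad_def)
    obtain B where B: "B \<in> sets borel" "B \<subseteq> E" "cmod (\<mu> E) + 1 < cmod (\<mu> B)" using E unfolding bad_def by blast
    have "cmod (\<mu> B) - cmod (\<mu> E) \<le> cmod (\<mu> B - \<mu> E)" by (rule norm_triangle_ineq2)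
    also have "\<dots> = cmod (\<mu> (E - B))" using complex_measure_Diff[OF B(1) Eb B(2)] by (simp add: norm_minus_commute)
    finally have 1: "1 \<le> cmod (\<mu> (E - B))" using B(3) by simp
    show ?thesis
    proof (cases "bad B")
      case True then show ?thesis using 1 B(2) by blast
    next
      case False
      then obtain K where K: "\<And>C. C \<in> sets borel \<Longrightarrow> C \<subseteq> B \<Longrightarrow> cmod (\<mu> C) \<le> K"
        using B(1) unfolding bad_def by (meson not_le_imp_less)
      have "bad (E - B)" unfolding bad_def
      proof (intro conjI allI)
        show "E - B \<in> sets borel" using Eb B(1) by blast
        fix L
        obtain C where C: "C \<in> sets borel" "C \<subseteq> E" "K + L < cmod (\<mu> C)" using E unfolding bad_def by blast
        have "\<mu> C = \<mu> (C \<inter> B) + \<mu> (C - B)"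
        proof -
          have "(C \<inter> B) \<union> (C - B) = C" by blast
          then show ?thesis using complex_measure_Un[of "C \<inter> B" "C - B"] C(1) B(1) by (auto simp: Int_Diff)
        qed
        then have "cmod (\<mu> C) \<le> cmod (\<mu> (C \<inter> B)) + cmod (\<mu> (C - B))" by (simp add: norm_triangle_ineq)
        also have "cmod (\<mu> (C \<inter> B)) \<le> K" using C(1) B(1) by (intro K) auto
        finally have "L < cmod (\<mu> (C - B))" using C(3) by simp
        then show "\<exists>C\<in>sets borel. C \<subseteq> E - B \<and> L < cmod (\<mu> C)"
          using C B(1) by (intro bexI[of _ "C - B"]) auto
      qed
      moreover have "E - (E - B) = B" using B(2) by blast
      moreover have "1 \<le> cmod (\<mu> B)" using B(3) norm_ge_zero[of "\<mu> E"] by linarith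
      ultimately show ?thesis by (intro exI[of _ "E - B"]) auto
    qed
  qed
  have "bad UNIV" unfolding bad_def using unb by (simp add: not_le) 
  then have "\<exists>E. \<forall>n. bad (E n) \<and> (E (Suc n) \<subseteq> E n \<and> 1 \<le> cmod (\<mu> (E n - E (Suc n))))"
    by (intro dependent_nat_choice) (use step in auto)
  then obtain E where E: "\<And>n. bad (E n)" "\<And>n. E (Suc n) \<subseteq> E n" "\<And>n. 1 \<le> cmod (\<mu> (E n - E (Suc n)))" by blast
  define A where "A = (\<lambda>n. E n - E (Suc n))"
  have mono: "m \<le> n \<Longrightarrow> E n \<subseteq> E m" for m n by (rule lift_Suc_antimono_le[of E, OF E(2)])
  have "A m \<inter> A n = {}" if "m < n" for m n using mono[of "Suc m" n] that by (auto simp: A_def)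
  then have "disjoint_family A" unfolding disjoint_family_on_def by (metis Int_commute linorder_neqE_nat)
  then have "(\<lambda>n. \<mu> (A n)) sums \<mu> (\<Union>n. A n)"
    by (intro complex_measure_sums) (use E(1) in \<open>auto simp: A_def bad_def\<close>)
  then have "(\<lambda>n. \<mu> (A n)) \<longlonglongrightarrow> 0" by (intro summable_LIMSEQ_zero) (simp add: sums_iff)
  then have "(\<lambda>n. cmod (\<mu> (A n))) \<longlonglongrightarrow> 0" by (rule tendsto_norm_zero)
  then have "\<forall>\<^sub>F n in sequentially. cmod (\<mu> (A n)) < 1" by (rule order_tendstoD) simp
  then obtain n where "cmod (\<mu> (A n)) < 1" using eventually_happens'[OF sequentially_bot] by blast
  then show False using E(3)[of n] by (simp add: A_def)
qed

end

text \<open>Countable Borel partitions, with empty parts allowed.\<close>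

definition partitions :: "real set \<Rightarrow> (nat \<Rightarrow> real set) set" where
  "partitions E = {A. range A \<subseteq> sets borel \<and> disjoint_family A \<and> (\<Union>n. A n) = E}"

definition variation :: "(real set \<Rightarrow> complex) \<Rightarrow> real set \<Rightarrow> ennreal" where
  "variation \<mu> E = (SUP A\<in>partitions E. \<Sum>n. ennreal (cmod (\<mu> (A n))))"

lemma total_variation_eq: "total_variation \<mu> = measure_of UNIV (sets borel) (variation \<mu>)"
  unfolding total_variation_def variation_def partitions_def by (simp add: image_Collect)

lemma two_set_partition:
  assumes "B \<in> sets borel" "E \<in> sets borel" "B \<subseteq> E"
  shows "(\<lambda>n::nat. if n = 0 then B else if n = 1 then E - B else {}) \<in> partitions E"
  using assms unfolding partitions_def by (auto simp: disjoint_family_on_def split: if_splits)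

lemma le_variation:
  assumes "B \<in> sets borel" "E \<in> sets borel" "B \<subseteq> E"
  shows "ennreal (cmod (\<mu> B)) \<le> variation \<mu> E"
proof -
  let ?A = "\<lambda>n::nat. if n = 0 then B else if n = 1 then E - B else {}"
  have "ennreal (cmod (\<mu> B)) = (\<Sum>n\<in>{0}. ennreal (cmod (\<mu> (?A n))))" by simp
  also have "\<dots> \<le> (\<Sum>n. ennreal (cmod (\<mu> (?A n))))" by (rule sum_le_suminf) auto
  also have "\<dots> \<le> variation \<mu> E" unfolding variation_def by (rule SUP_upper[OF two_set_partition[OF assms]])
  finally show ?thesis .
qed

lemma ennreal_norm_le_suminf:
  fixes f :: "nat \<Rightarrow> complex"
  assumes "f sums s" shows "ennreal (norm s) \<le> (\<Sum>n. ennreal (norm (f n)))"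
proof (rule LIMSEQ_le_const2)
  show "(\<lambda>N. ennreal (norm (\<Sum>n<N. f n))) \<longlonglongrightarrow> ennreal (norm s)"
    using assms unfolding sums_def by (intro tendsto_ennrealI tendsto_norm)
  have "ennreal (norm (\<Sum>n<N. f n)) \<le> (\<Sum>n. ennreal (norm (f n)))" for N
  proof -
    have "ennreal (norm (\<Sum>n<N. f n)) \<le> ennreal (\<Sum>n<N. norm (f n))" by (intro ennreal_leI norm_sum)
    also have "\<dots> = (\<Sum>n<N. ennreal (norm (f n)))" by (simp add: sum_ennreal)
    also have "\<dots> \<le> (\<Sum>n. ennreal (norm (f n)))" by (rule sum_le_suminf) auto
    finally show ?thesis .
  qed
  then show "\<exists>M. \<forall>N\<ge>M. ennreal (norm (\<Sum>n<N. f n)) \<le> (\<Sum>n. ennreal (norm (f n)))" by blast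
qed

lemma suminf_ennreal_swap:
  fixes f :: "nat \<Rightarrow> nat \<Rightarrow> ennreal" shows "(\<Sum>i. \<Sum>j. f i j) = (\<Sum>j. \<Sum>i. f i j)"
proof -
  have "(\<Sum>i. \<Sum>j. f i j) = (\<integral>\<^sup>+ i. (\<Sum>j. f i j) \<partial>count_space UNIV)" by (simp add: nn_integral_count_space_nat)
  also have "\<dots> = (\<Sum>j. \<integral>\<^sup>+ i. f i j \<partial>count_space UNIV)" by (rule nn_integral_suminf) simp
  finally show ?thesis by (simp add: nn_integral_count_space_nat)
qed

lemma variation_suminf:
  assumes \<mu>: "complex_borel_measure \<mu>" and E: "\<And>n. E n \<in> sets borel" "disjoint_family E"
  shows "(\<Sum>n. variation \<mu> (E n)) = variation \<mu> (\<Union>n. E n)"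
proof (rule antisym)
  let ?S = "\<lambda>A. \<Sum>n. ennreal (cmod (\<mu> (A n)))"
  have ne: "?S ` partitions (E n) \<noteq> {}" for n using two_set_partition[of "{}" "E n"] E(1) by blast
  have "\<forall>n. \<exists>f. incseq f \<and> range f \<subseteq> ?S ` partitions (E n) \<and> Sup (?S ` partitions (E n)) = (SUP p. f p)"
    by (intro allI ennreal_Sup_countable_SUP ne)
  from choice[OF this] obtain f where f: "\<And>n. incseq (f n)" "\<And>n. range (f n) \<subseteq> ?S ` partitions (E n)"
    "\<And>n. Sup (?S ` partitions (E n)) = (SUP p. f n p)" by blast
  have "(\<Sum>n. variation \<mu> (E n)) = (\<Sum>n. SUP p. f n p)" unfolding variation_def f(3) ..
  also have "\<dots> = (SUP p. \<Sum>n. f n p)" by (rule ennreal_suminf_SUP_eq) (rule f(1))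
  also have "\<dots> \<le> variation \<mu> (\<Union>n. E n)"
  proof (rule SUP_least)
    fix p
    have "\<forall>n. \<exists>A. A \<in> partitions (E n) \<and> f n p = ?S A" using f(2) by blast
    from choice[OF this] obtain A where A: "\<And>n. A n \<in> partitions (E n)" "\<And>n. f n p = ?S (A n)" by blast
    have A1: "A n j \<in> sets borel" for n j using A(1)[of n] unfolding partitions_def by blast
    have A2: "A n i \<inter> A n j = {}" if "i \<noteq> j" for n i j
      using A(1)[of n] that unfolding partitions_def disjoint_family_on_def by blast
    have A3: "(\<Union>j. A n j) = E n" for n using A(1)[of n] unfolding partitions_def by blast
    define B where "B = (\<lambda>i. case prod_decode i of (n, j) \<Rightarrow> A n j)"
    have "B \<in> partitions (\<Union>n. E n)"
      unfolding partitions_def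
    proof (intro CollectI conjI)
      show "range B \<subseteq> sets borel" using A1 by (auto simp: B_def split: prod.split)
      show "disjoint_family B" unfolding disjoint_family_on_def
      proof (intro ballI impI)
        fix i j :: nat assume ij: "i \<noteq> j"
        obtain n k m l where d: "prod_decode i = (n, k)" "prod_decode j = (m, l)" by (metis surj_pair)
        have "(n, k) \<noteq> (m, l)" using ij d by (metis prod_decode_inverse)
        show "B i \<inter> B j = {}"
        proof (cases "n = m")
          case True
          then show ?thesis using \<open>(n, k) \<noteq> (m, l)\<close> A2[of k l n] by (simp add: B_def d)
        next
          case False
          then have "E n \<inter> E m = {}" using E(2) by (auto simp: disjoint_family_on_def)
          moreover have "A n k \<subseteq> E n" "A m l \<subseteq> E m" using A3[of n] A3[of m] by blast+
          ultimately show ?thesis by (auto simp: B_def d)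
        qed
      qed
      have "(\<Union>i. B i) = (\<Union>n. \<Union>j. A n j)"
      proof (intro equalityI subsetI)
        fix x assume "x \<in> (\<Union>i. B i)" then show "x \<in> (\<Union>n. \<Union>j. A n j)" by (auto simp: B_def case_prod_beta)
      next
        fix x assume "x \<in> (\<Union>n. \<Union>j. A n j)"
        then obtain n j where "x \<in> A n j" by blast
        then have "x \<in> B (prod_encode (n, j))" by (simp add: B_def)
        then show "x \<in> (\<Union>i. B i)" by blast
      qed
      then show "(\<Union>i. B i) = (\<Union>n. E n)" using A3 by simp
    qed
    then have "?S B \<le> variation \<mu> (\<Union>n. E n)" unfolding variation_def by (rule SUP_upper)
    moreover have "(\<Sum>i. (\<lambda>(n, j). ennreal (cmod (\<mu> (A n j)))) (prod_decode i)) = (\<Sum>n. f n p)"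
      by (rule suminf_ennreal_2dimen) (simp add: A(2))
    moreover have "?S B = (\<Sum>i. (\<lambda>(n, j). ennreal (cmod (\<mu> (A n j)))) (prod_decode i))"
      by (simp add: B_def case_prod_beta)
    ultimately show "(\<Sum>n. f n p) \<le> variation \<mu> (\<Union>n. E n)" by simp
  qed
  finally show "(\<Sum>n. variation \<mu> (E n)) \<le> variation \<mu> (\<Union>n. E n)" .
  show "variation \<mu> (\<Union>n. E n) \<le> (\<Sum>n. variation \<mu> (E n))"
    unfolding variation_def[of \<mu> "\<Union>n. E n"]
  proof (rule SUP_least)
    fix A assume "A \<in> partitions (\<Union>n. E n)"
    then have A: "\<And>j. A j \<in> sets borel" "disjoint_family A" "(\<Union>j. A j) = (\<Union>n. E n)" unfolding partitions_def by auto
    have "ennreal (cmod (\<mu> (A j))) \<le> (\<Sum>n. ennreal (cmod (\<mu> (A j \<inter> E n))))" for j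
    proof (rule ennreal_norm_le_suminf)
      have "(\<lambda>n. \<mu> (A j \<inter> E n)) sums \<mu> (\<Union>n. A j \<inter> E n)"
        using A(1) E by (intro complex_measure_sums[OF \<mu>])
          (auto intro: disjoint_family_on_bisimulation[OF E(2)])
      moreover have "(\<Union>n. A j \<inter> E n) = A j" using A(3) by blast
      ultimately show "(\<lambda>n. \<mu> (A j \<inter> E n)) sums \<mu> (A j)" by simp
    qed
    then have "?S A \<le> (\<Sum>j. \<Sum>n. ennreal (cmod (\<mu> (A j \<inter> E n))))" by (intro suminf_le) auto
    also have "\<dots> = (\<Sum>n. \<Sum>j. ennreal (cmod (\<mu> (A j \<inter> E n))))" by (rule suminf_ennreal_swap)
    also have "\<dots> \<le> (\<Sum>n. variation \<mu> (E n))"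
    proof (intro suminf_le)
      fix n
      have "(\<lambda>j. A j \<inter> E n) \<in> partitions (E n)"
        unfolding partitions_def using A E(1) by (auto simp: disjoint_family_on_def)
      then show "(\<Sum>j. ennreal (cmod (\<mu> (A j \<inter> E n)))) \<le> variation \<mu> (E n)"
        unfolding variation_def by (rule SUP_upper2) simp
    qed auto
    finally show "?S A \<le> (\<Sum>n. variation \<mu> (E n))" .
  qed
qed

lemma sigma_sets_borel: "sigma_sets UNIV (sets borel) = sets (borel :: real measure)"
  using sets.sigma_sets_eq[of "borel :: real measure"] by simp

lemma emeasure_total_variation:
  assumes \<mu>: "complex_borel_measure \<mu>" and E: "E \<in> sets borel"
  shows "emeasure (total_variation \<mu>) E = variation \<mu> E"
proof -
  have "variation \<mu> {} = 0"
  proof -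
    have 0: "(\<Sum>n. ennreal (cmod (\<mu> (A n)))) \<le> 0" if "A \<in> partitions {}" for A
    proof -
      have "A = (\<lambda>n. {})" using that unfolding partitions_def by auto
      then show ?thesis using complex_measure_empty[OF \<mu>] by simp
    qed
    have "variation \<mu> {} \<le> 0" unfolding variation_def by (rule SUP_least) (rule 0)
    then show ?thesis by simp
  qed
  then have "measure_space UNIV (sets borel) (variation \<mu>)"
    unfolding measure_space_def positive_def countably_additive_def
    using variation_suminf[OF \<mu>] sets.sigma_algebra_axioms[of "borel :: real measure"] by auto
  then show ?thesis
    unfolding total_variation_eq emeasure_measure_of_conv sigma_sets_borel using E by simp
qed

lemma sets_total_variation: "sets (total_variation \<mu>) = sets borel"
  unfolding total_variation_eq by (simp add: sets_measure_of_conv sigma_sets_borel)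

lemma sets_jordan_pos: "sets (jordan_pos \<nu>) = sets borel"
  unfolding jordan_pos_def by (simp add: sets_measure_of_conv sigma_sets_borel)

lemma emeasure_jordan_pos_le: "emeasure (jordan_pos \<nu>) E \<le> (SUP B\<in>{B \<in> sets borel. B \<subseteq> E}. ennreal (\<nu> B))"
  unfolding jordan_pos_def emeasure_measure_of_conv by auto

text \<open>If the supremum defining \<^const>\<open>jordan_pos\<close> is not countably additive, then \<^const>\<open>measure_of\<close> returns
  the null measure. Upper bounds hold in either case, since the supremum is taken over values that
  the variation of \<open>\<mu>\<close> dominates.\<close>

lemma jordan_pos_dominated:
  assumes \<mu>: "complex_borel_measure \<mu>" and \<nu>: "\<And>B. \<nu> B \<le> cmod (\<mu> B)"
  shows "finite_measure (jordan_pos \<nu>)"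
    and "(\<integral>\<^sup>+ \<xi>. g \<xi> \<partial>jordan_pos \<nu>) \<le> (\<integral>\<^sup>+ \<xi>. g \<xi> \<partial>total_variation \<mu>)"
proof -
  obtain K where K: "\<And>B. B \<in> sets borel \<Longrightarrow> cmod (\<mu> B) \<le> K" using complex_measure_bounded[OF \<mu>] by blast
  have "emeasure (jordan_pos \<nu>) E \<le> ennreal K" for E
    by (rule order_trans[OF emeasure_jordan_pos_le], rule SUP_least, rule ennreal_leI)
       (use \<nu> K in \<open>auto intro: order_trans\<close>)
  then show "finite_measure (jordan_pos \<nu>)"
    by (intro finite_measureI) (metis ennreal_less_top order_le_less_trans order_less_irrefl infinity_ennreal_def)
  have "emeasure (jordan_pos \<nu>) E \<le> emeasure (total_variation \<mu>) E" if E: "E \<in> sets borel" for E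
  proof -
    have "emeasure (jordan_pos \<nu>) E \<le> variation \<mu> E"
    proof (rule order_trans[OF emeasure_jordan_pos_le], rule SUP_least)
      fix B assume "B \<in> {B \<in> sets borel. B \<subseteq> E}"
      then have "ennreal (cmod (\<mu> B)) \<le> variation \<mu> E" using le_variation[of B E \<mu>] E by simp
      then show "ennreal (\<nu> B) \<le> variation \<mu> E" by (rule order_trans[OF ennreal_leI[OF \<nu>]])
    qed
    then show ?thesis using emeasure_total_variation[OF \<mu> E] by simp
  qed
  then have "jordan_pos \<nu> \<le> total_variation \<mu>"
    by (subst le_measure) (auto simp: sets_jordan_pos sets_total_variation)
  then show "(\<integral>\<^sup>+ \<xi>. g \<xi> \<partial>jordan_pos \<nu>) \<le> (\<integral>\<^sup>+ \<xi>. g \<xi> \<partial>total_variation \<mu>)"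
    by (rule nn_integral_mono_measure[rotated]) (simp add: sets_jordan_pos sets_total_variation)
qed

lemma wiener_fin_smooth_closure:
  assumes "f \<in> wiener_fin n"
  shows "f \<in> Ck (enat n)" and "0 < r \<Longrightarrow> f \<in> smooth_closure r n polys"
proof -
  obtain \<mu> where \<mu>: "complex_borel_measure \<mu>"
    and moment: "(\<integral>\<^sup>+ \<xi>. ennreal (\<bar>\<xi>\<bar> ^ n) \<partial>total_variation \<mu>) < \<infinity>"
    and f: "\<And>x. f x = complex_integral \<mu> (\<lambda>\<xi>. exp (\<i> * complex_of_real (x * \<xi>)))"
    using assms unfolding wiener_fin_def by blast
  define F where "F = (\<lambda>\<nu>. fourier (jordan_pos \<nu>) (\<lambda>_. 1) (\<lambda>\<xi>. \<xi>))"
  have F: "F \<nu> \<in> Ck (enat n)" "0 < r \<Longrightarrow> F \<nu> \<in> smooth_closure r n polys" if \<nu>: "\<And>B. \<nu> B \<le> cmod (\<mu> B)" for \<nu> r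
  proof -
    have "(\<integral>\<^sup>+ \<xi>. ennreal (\<bar>\<xi>\<bar> ^ n) \<partial>jordan_pos \<nu>) < \<infinity>"
      using jordan_pos_dominated(2)[OF \<mu> \<nu>] moment by (rule order_le_less_trans)
    from fourier_smooth_closure[OF jordan_pos_dominated(1)[OF \<mu> \<nu>] sets_jordan_pos this]
    show "F \<nu> \<in> Ck (enat n)" "0 < r \<Longrightarrow> F \<nu> \<in> smooth_closure r n polys" unfolding F_def by blast+
  qed
  have b: "Re (\<mu> B) \<le> cmod (\<mu> B)" "- Re (\<mu> B) \<le> cmod (\<mu> B)" "Im (\<mu> B) \<le> cmod (\<mu> B)" "- Im (\<mu> B) \<le> cmod (\<mu> B)" for B
    using abs_Re_le_cmod[of "\<mu> B"] abs_Im_le_cmod[of "\<mu> B"] by (auto simp: abs_le_iff)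
  have f_eq: "f = (\<lambda>x. (F (\<lambda>E. Re (\<mu> E)) x + (-1) * F (\<lambda>E. - Re (\<mu> E)) x) +
      \<i> * (F (\<lambda>E. Im (\<mu> E)) x + (-1) * F (\<lambda>E. - Im (\<mu> E)) x))"
    unfolding f complex_integral_def signed_integral_def F_def fourier_def expi_def by simp
  show "f \<in> Ck (enat n)"
    unfolding f_eq by (intro Ck_add Ck_cmult F b)
  assume r: "0 < r"
  have c: "(\<lambda>x. z) \<in> smooth_closure r n polys" for z
    using polys_smooth_le[OF polys_const, of r n z] r smooth_closure_superset[OF polys_const] by auto
  show "f \<in> smooth_closure r n polys"
    unfolding f_eq by (intro smooth_closure_add smooth_closure_mult polys_add polys_mult c F b r)
qed

section \<open>Trigonometric polynomials as Fourier transforms of discrete measures\<close>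

definition atoms :: "real set \<Rightarrow> (real \<Rightarrow> real) \<Rightarrow> real measure" where
  "atoms F w = distr (point_measure F w) borel (\<lambda>\<xi>. \<xi>)"

lemma emeasure_atoms:
  assumes "finite F" "\<And>\<xi>. 0 \<le> w \<xi>" "E \<in> sets borel"
  shows "emeasure (atoms F w) E = ennreal (\<Sum>\<xi>\<in>F. w \<xi> * indicator E \<xi>)"
proof -
  have "emeasure (atoms F w) E = emeasure (point_measure F w) (E \<inter> F)"
    unfolding atoms_def using assms(3) by (subst emeasure_distr) (auto simp: space_point_measure)
  also have "\<dots> = (\<Sum>\<xi>\<in>E \<inter> F. ennreal (w \<xi>))" using assms(1) by (intro emeasure_point_measure_finite) auto
  also have "\<dots> = ennreal (\<Sum>\<xi>\<in>E \<inter> F. w \<xi>)" using assms(2) by (intro sum_ennreal) auto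
  also have "(\<Sum>\<xi>\<in>E \<inter> F. w \<xi>) = (\<Sum>\<xi>\<in>F. w \<xi> * indicator E \<xi>)"
    using assms(1) by (intro sum.mono_neutral_cong_left) (auto split: split_indicator)
  finally show ?thesis .
qed

lemma sets_atoms: "sets (atoms F w) = sets borel"
  by (simp add: atoms_def)

lemma integral_atoms:
  fixes g :: "real \<Rightarrow> complex"
  assumes "finite F" "\<And>\<xi>. 0 \<le> w \<xi>" "g \<in> borel_measurable borel"
  shows "(LINT \<xi>|atoms F w. g \<xi>) = (\<Sum>\<xi>\<in>F. w \<xi> *\<^sub>R g \<xi>)"
  unfolding atoms_def using assms by (subst integral_distr) (auto simp: lebesgue_integral_point_measure_finite)

text \<open>The supremum is attained at the atoms of nonnegative weight.\<close>

lemma jordan_pos_atoms: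
  assumes F: "finite F"
  shows "jordan_pos (\<lambda>E. \<Sum>\<xi>\<in>F. b \<xi> * indicator E \<xi>) = atoms F (\<lambda>\<xi>. max 0 (b \<xi>))"
proof -
  have "(SUP B\<in>{B \<in> sets borel. B \<subseteq> E}. ennreal (\<Sum>\<xi>\<in>F. b \<xi> * indicator B \<xi>)) = emeasure (atoms F (\<lambda>\<xi>. max 0 (b \<xi>))) E"
    if E: "E \<in> sets borel" for E
    unfolding emeasure_atoms[where w="\<lambda>\<xi>. max 0 (b \<xi>)", OF F max.cobounded1 E]
  proof (rule antisym)
    show "(SUP B\<in>{B \<in> sets borel. B \<subseteq> E}. ennreal (\<Sum>\<xi>\<in>F. b \<xi> * indicator B \<xi>)) \<le> ennreal (\<Sum>\<xi>\<in>F. max 0 (b \<xi>) * indicator E \<xi>)"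
      by (intro SUP_least ennreal_leI sum_mono) (auto split: split_indicator)
    let ?B = "{\<xi>\<in>F. 0 \<le> b \<xi>} \<inter> E"
    have "?B \<in> {B \<in> sets borel. B \<subseteq> E}" using F E by (auto intro!: sets.Int borel_closed finite_imp_closed)
    moreover have "(\<Sum>\<xi>\<in>F. b \<xi> * indicator ?B \<xi>) = (\<Sum>\<xi>\<in>F. max 0 (b \<xi>) * indicator E \<xi>)"
      by (intro sum.cong) (auto split: split_indicator)
    ultimately show "ennreal (\<Sum>\<xi>\<in>F. max 0 (b \<xi>) * indicator E \<xi>) \<le> (SUP B\<in>{B \<in> sets borel. B \<subseteq> E}. ennreal (\<Sum>\<xi>\<in>F. b \<xi> * indicator B \<xi>))"
      by (intro SUP_upper2[of ?B]) auto
  qed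
  then have "jordan_pos (\<lambda>E. \<Sum>\<xi>\<in>F. b \<xi> * indicator E \<xi>) = measure_of UNIV (sets borel) (emeasure (atoms F (\<lambda>\<xi>. max 0 (b \<xi>))))"
    unfolding jordan_pos_def by (intro measure_of_eq) (auto simp: sigma_sets_borel)
  also have "\<dots> = atoms F (\<lambda>\<xi>. max 0 (b \<xi>))"
    using measure_of_of_measure[of "atoms F (\<lambda>\<xi>. max 0 (b \<xi>))"] by (simp add: atoms_def)
  finally show ?thesis .
qed

lemma signed_integral_atoms:
  assumes F: "finite F" and g: "g \<in> borel_measurable borel"
  shows "signed_integral (\<lambda>E. \<Sum>\<xi>\<in>F. b \<xi> * indicator E \<xi>) g = (\<Sum>\<xi>\<in>F. b \<xi> *\<^sub>R g \<xi>)"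
proof -
  have neg: "(\<lambda>E. - (\<Sum>\<xi>\<in>F. b \<xi> * indicator E \<xi>)) = (\<lambda>E. \<Sum>\<xi>\<in>F. (- b \<xi>) * indicator E \<xi>)"
    by (simp add: sum_negf)
  have "signed_integral (\<lambda>E. \<Sum>\<xi>\<in>F. b \<xi> * indicator E \<xi>) g =
      (\<Sum>\<xi>\<in>F. max 0 (b \<xi>) *\<^sub>R g \<xi>) - (\<Sum>\<xi>\<in>F. max 0 (- b \<xi>) *\<^sub>R g \<xi>)"
    unfolding signed_integral_def neg jordan_pos_atoms[OF F] by (simp add: integral_atoms[OF F _ g])
  also have "\<dots> = (\<Sum>\<xi>\<in>F. (max 0 (b \<xi>) - max 0 (- b \<xi>)) *\<^sub>R g \<xi>)"
    by (simp add: scaleR_diff_left sum_subtractf)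
  also have "\<dots> = (\<Sum>\<xi>\<in>F. b \<xi> *\<^sub>R g \<xi>)" by (intro sum.cong) (auto simp: max_def)
  finally show ?thesis .
qed

lemma trig_subset_wiener_fin: "trig UNIV \<subseteq> wiener_fin n"
proof
  fix f assume "f \<in> trig UNIV"
  then obtain F c where f: "f = (\<lambda>x. \<Sum>\<xi>\<in>F. c \<xi> * expi \<xi> x)" and F: "finite F" unfolding trig_def by blast
  define \<mu> where "\<mu> = (\<lambda>E. \<Sum>\<xi>\<in>F. c \<xi> * complex_of_real (indicator E \<xi>))"
  have ind: "(\<lambda>n. complex_of_real (indicator (A n) \<xi>)) sums complex_of_real (indicator (\<Union>n. A n) \<xi>)"
    if "disjoint_family A" for A :: "nat \<Rightarrow> real set" and \<xi>
    by (intro sums_of_real indicator_sums) (use that in \<open>auto simp: disjoint_family_on_def\<close>)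
  have \<mu>: "complex_borel_measure \<mu>"
    unfolding complex_borel_measure_def \<mu>_def by (intro allI impI sums_sum sums_mult ind) blast
  have mle: "emeasure (total_variation \<mu>) E \<le> emeasure (atoms F (\<lambda>\<xi>. cmod (c \<xi>))) E" if E: "E \<in> sets borel" for E
    unfolding emeasure_total_variation[OF \<mu> E] variation_def
  proof (rule SUP_least)
    fix A assume "A \<in> partitions E"
    then have A: "disjoint_family A" "(\<Union>n. A n) = E" unfolding partitions_def by auto
    have s: "(\<lambda>n. \<Sum>\<xi>\<in>F. cmod (c \<xi>) * indicator (A n) \<xi>) sums (\<Sum>\<xi>\<in>F. cmod (c \<xi>) * indicator E \<xi>)"
      unfolding A(2)[symmetric] by (intro sums_sum sums_mult indicator_sums) (use A(1) in \<open>auto simp: disjoint_family_on_def\<close>)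
    have "cmod (\<mu> (A n)) \<le> (\<Sum>\<xi>\<in>F. cmod (c \<xi>) * indicator (A n) \<xi>)" for n
      unfolding \<mu>_def by (rule order_trans[OF norm_sum]) (auto simp: norm_mult intro!: sum_mono)
    then have "(\<Sum>n. ennreal (cmod (\<mu> (A n)))) \<le> (\<Sum>n. ennreal (\<Sum>\<xi>\<in>F. cmod (c \<xi>) * indicator (A n) \<xi>))"
      by (intro suminf_le ennreal_leI) auto
    also have "\<dots> = ennreal (\<Sum>\<xi>\<in>F. cmod (c \<xi>) * indicator E \<xi>)"
      by (rule suminf_ennreal_eq[OF _ s]) (auto intro!: sum_nonneg)
    finally show "(\<Sum>n. ennreal (cmod (\<mu> (A n)))) \<le> emeasure (atoms F (\<lambda>\<xi>. cmod (c \<xi>))) E"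
      using emeasure_atoms[OF F _ E, of "\<lambda>\<xi>. cmod (c \<xi>)"] by simp
  qed
  have "total_variation \<mu> \<le> atoms F (\<lambda>\<xi>. cmod (c \<xi>))"
    by (subst le_measure) (use mle in \<open>auto simp: sets_total_variation sets_atoms\<close>)
  then have "(\<integral>\<^sup>+ \<xi>. ennreal (\<bar>\<xi>\<bar> ^ n) \<partial>total_variation \<mu>) \<le> (\<integral>\<^sup>+ \<xi>. ennreal (\<bar>\<xi>\<bar> ^ n) \<partial>atoms F (\<lambda>\<xi>. cmod (c \<xi>)))"
    by (rule nn_integral_mono_measure[rotated]) (simp add: sets_total_variation sets_atoms)
  also have "\<dots> = (\<Sum>\<xi>\<in>F. ennreal (cmod (c \<xi>)) * ennreal (\<bar>\<xi>\<bar> ^ n))"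
    unfolding atoms_def by (subst nn_integral_distr) (auto simp: F nn_integral_point_measure_finite)
  also have "\<dots> < \<infinity>" using F by (simp add: ennreal_mult[symmetric] sum_ennreal)
  finally have moment: "(\<integral>\<^sup>+ \<xi>. ennreal (\<bar>\<xi>\<bar> ^ n) \<partial>total_variation \<mu>) < \<infinity>" .
  have "f x = complex_integral \<mu> (\<lambda>\<xi>. exp (\<i> * complex_of_real (x * \<xi>)))" for x
  proof -
    let ?g = "\<lambda>\<xi>. exp (\<i> * complex_of_real (x * \<xi>))"
    have g: "?g \<in> borel_measurable borel"
      by (intro borel_measurable_continuous_onI continuous_intros)
    have "(\<lambda>E. Re (\<mu> E)) = (\<lambda>E. \<Sum>\<xi>\<in>F. Re (c \<xi>) * indicator E \<xi>)"
      "(\<lambda>E. Im (\<mu> E)) = (\<lambda>E. \<Sum>\<xi>\<in>F. Im (c \<xi>) * indicator E \<xi>)" by (simp_all add: \<mu>_def)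
    then have "complex_integral \<mu> ?g = (\<Sum>\<xi>\<in>F. Re (c \<xi>) *\<^sub>R ?g \<xi>) + \<i> * (\<Sum>\<xi>\<in>F. Im (c \<xi>) *\<^sub>R ?g \<xi>)"
      unfolding complex_integral_def by (simp only: signed_integral_atoms[OF F g])
    also have "\<dots> = (\<Sum>\<xi>\<in>F. (complex_of_real (Re (c \<xi>)) + \<i> * complex_of_real (Im (c \<xi>))) * ?g \<xi>)"
      by (simp only: sum_distrib_left sum.distrib[symmetric] scaleR_conv_of_real distrib_right mult.assoc)
    also have "\<dots> = (\<Sum>\<xi>\<in>F. c \<xi> * expi \<xi> x)" by (simp only: complex_eq[symmetric] expi_def)
    finally show ?thesis by (simp add: f)
  qed
  then show "f \<in> wiener_fin n" unfolding wiener_fin_def using \<mu> moment by blast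
qed

lemma trig_subset_wiener: "trig UNIV \<subseteq> wiener k"
  unfolding wiener_def using trig_subset_wiener_fin by (cases k) auto

section \<open>Density of the polynomials and of the Wiener space\<close>

lemma (in admissible_family) wiener_subset_boldCk: "wiener k \<subseteq> boldCk \<alpha> k"
proof
  fix f assume f: "f \<in> wiener k"
  \<comment> \<open>\<open>wiener \<infinity>\<close> is an intersection over positive orders only, whence the detour for order \<open>0\<close>.\<close>
  have W: "\<exists>m\<ge>n. f \<in> wiener_fin m" if n: "enat n \<le> k" for n
  proof (cases k)
    case (enat m) then show ?thesis using f n by (auto simp: wiener_def)
  next
    case infinity then show ?thesis using f by (intro exI[of _ "max 1 n"]) (auto simp: wiener_def)
  qed
  show "f \<in> boldCk \<alpha> k" unfolding in_boldCk_iff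
  proof (intro conjI allI impI)
    show "f \<in> Ck k" unfolding Ck_iff_finite[of f k]
    proof (intro allI impI)
      fix n assume "enat n \<le> k"
      then obtain m where "n \<le> m" "f \<in> wiener_fin m" using W by blast
      then show "f \<in> Ck (enat n)" using wiener_fin_smooth_closure(1) Ck_mono enat_ord_simps(1) by blast
    qed
    fix i \<phi> assume "enat i \<le> k" and \<phi>: "isdd i f \<phi>"
    then obtain m where m: "i \<le> m" "f \<in> wiener_fin m" using W by blast
    show "approximable (Suc i) \<phi>"
      by (rule smooth_closure_approximable[OF wiener_fin_smooth_closure(2)[OF m(2)] m(1) \<phi>])
  qed
qed

theorem theorem4p4:
  fixes \<alpha> :: "real \<Rightarrow> nat \<Rightarrow> ((nat \<Rightarrow> real) \<Rightarrow> complex) \<Rightarrow> ennreal" and k :: enat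
  assumes "norm_family \<alpha>"
    and "family_le uniform_family \<alpha>"
    and "family_le \<alpha> varopoulos_family"
    and "increasing_family \<alpha>"
    and "complete_family \<alpha>"
    and "translation_invariant_family \<alpha>"
  shows "(boldCk \<alpha> k = Ck_alpha \<alpha> k \<and>
          polys \<subseteq> boldCk \<alpha> k \<and> boldCk_top \<alpha> k closure_of polys = boldCk \<alpha> k \<and>
          (\<forall>n. k = enat n \<longrightarrow> Ck_alpha \<alpha> k = {f \<in> Ck k. divdiff n f \<in> C_alpha \<alpha> (n + 1)}) \<and>
          ((\<forall>m\<ge>1. calC \<alpha> m = C_alpha \<alpha> m) \<longrightarrow>
             calCk \<alpha> k = Ck_alpha \<alpha> k \<and>
             polys \<subseteq> calCk \<alpha> k \<and> calCk_top \<alpha> k closure_of polys = calCk \<alpha> k)) \<and>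
         (wiener k \<subseteq> boldCk \<alpha> k \<and> boldCk_top \<alpha> k closure_of wiener k = boldCk \<alpha> k)"
proof -
  interpret admissible_family \<alpha> by standard (fact assms)+
  have W: "boldCk_top \<alpha> k closure_of wiener k = boldCk \<alpha> k"
    by (rule boldCk_top_closure_ofI[OF wiener_subset_boldCk trig_subset_wiener polys_subset_smooth_closure_trig])
  have "\<forall>n. k = enat n \<longrightarrow> Ck_alpha \<alpha> k = {f \<in> Ck k. divdiff n f \<in> C_alpha \<alpha> (n + 1)}"
    using boldCk_eq_Ck_alpha boldCk_finite_order by auto
  moreover have "calCk \<alpha> k = Ck_alpha \<alpha> k \<and> polys \<subseteq> calCk \<alpha> k \<and> calCk_top \<alpha> k closure_of polys = calCk \<alpha> k"
    if "\<forall>m\<ge>1. calC \<alpha> m = C_alpha \<alpha> m"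
    using calCk_eq_Ck_alpha[OF that, of k] polys_subset_boldCk[of k] boldCk_subset_calCk[of k]
    by (auto simp: Ck_alpha_def)
  ultimately show ?thesis
    using boldCk_eq_Ck_alpha[of k] polys_subset_boldCk[of k] boldCk_top_closure_of_polys[of k]
      wiener_subset_boldCk[of k] W by blast
qed

end
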